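(* Let $C$ be a smooth curve of genus $1$, let $\mathcal{E}$ be a rank-2 vector bundle on $C$ given by a non-split extension $0\to\mathcal{O}_C\to\mathcal{E}\to\mathcal{O}_C\to0$, and let $m\ge2$. Let $S=\mathbb{P}(\mathcal{E})\subset\mathbb{P}^{2m+1}$ be embedded as a linearly normal surface scroll over $C$, with hyperplane bundle $L$. Then, for $x\in S$, one has $x\in\Phi_m(S)$ if and only if the line bundle $L\otimes\mathcal{O}_S(-mf_x)$ is not spanned at $x$, where $f_x$ is the fibre of $S$ through $x$.
   Context: We work over $\mathbb{C}$. Let $\pi:S=\mathbb{P}(\mathcal{E})\to C$ be the ruling projection and $C_0$ the tautological section. Being a linearly normal scroll in $\mathbb{P}^{2m+1}$ means that $S$ is embedded by the complete linear system $|L|$, where $L=\mathcal{O}_S(C_0+\pi^*\delta)$ for a divisor $\delta$ on $C$ of degree $m+1\ge3$ (so that fibres of $\pi$ are lines, $h^0(L)=2m+2$ and $S$ has degree $2m+2$). For $x\in S$ let $j_{k,x}:H^0(S,L)\to(J_kL)_x$ be the map sending a section to its $k$-th jet at $x$ ($J_kL$ the $k$-th jet bundle). The $k$-th osculating space $\mathrm{Osc}^k_x(S)=\mathbb{P}(\mathrm{Im}\,j_{k,x})$ is a linear subspace of $\mathbb{P}^{2m+1}=\mathbb{P}(H^0(S,L))$ (the set of codimension-one subspaces) of dimension $\mathrm{rk}(j_{k,x})-1\le 2k$. The $m$-th inflectional locus $\Phi_m(S)$ is the set of $x\in S$ with $\dim\mathrm{Osc}^m_x(S)<2m$. A line bundle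 is spanned at $x$ if it has a global section not vanishing at $x$. *)

theory Defs
  imports "HOL-Analysis.Analysis"
begin

section \<open>Varieties over the complex numbers as spaces with functions\<close>

text \<open>
  As in Serre's FAC, a (reduced) variety is a set of closed points with its Zariski topology and a
  sheaf of complex-valued regular functions. Functions are total in HOL: membership in
  \<open>reg X U\<close> depends only on the values on \<open>U\<close> and is meaningful only for open \<open>U\<close>.
\<close>

record 'a fspace =
  zar :: "'a topology"
  reg :: "'a set \<Rightarrow> ('a \<Rightarrow> complex) set"

abbreviation pts :: "'a fspace \<Rightarrow> 'a set" where
  "pts X \<equiv> topspace (zar X)"

definition space_with_functions :: "'a fspace \<Rightarrow> bool" where
  "space_with_functions X \<longleftrightarrow>
     (\<forall>U f g. f \<in> reg X U \<and> (\<forall>x\<in>U. g x = f x) \<longrightarrow> g \<in> reg X U) \<and>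
     (\<forall>U c. openin (zar X) U \<longrightarrow> (\<lambda>_. c) \<in> reg X U) \<and>
     (\<forall>U f g. openin (zar X) U \<and> f \<in> reg X U \<and> g \<in> reg X U \<longrightarrow>
        (\<lambda>x. f x + g x) \<in> reg X U \<and> (\<lambda>x. f x * g x) \<in> reg X U) \<and>
     (\<forall>U V f. openin (zar X) U \<and> openin (zar X) V \<and> V \<subseteq> U \<and> f \<in> reg X U \<longrightarrow> f \<in> reg X V) \<and>
     (\<forall>\<U> f. (\<forall>U\<in>\<U>. openin (zar X) U \<and> f \<in> reg X U) \<longrightarrow> f \<in> reg X (\<Union>\<U>)) \<and>
     (\<forall>U f. openin (zar X) U \<and> f \<in> reg X U \<longrightarrow>
        openin (zar X) {x \<in> U. f x \<noteq> 0} \<and> (\<lambda>x. 1 / f x) \<in> reg X {x \<in> U. f x \<noteq> 0})"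

definition morphism :: "'a fspace \<Rightarrow> 'b fspace \<Rightarrow> ('a \<Rightarrow> 'b) \<Rightarrow> bool" where
  "morphism X Y \<phi> \<longleftrightarrow> continuous_map (zar X) (zar Y) \<phi> \<and>
     (\<forall>V f. openin (zar Y) V \<and> f \<in> reg Y V \<longrightarrow> f \<circ> \<phi> \<in> reg X {x \<in> pts X. \<phi> x \<in> V})"

definition isomorphism :: "'a fspace \<Rightarrow> 'b fspace \<Rightarrow> ('a \<Rightarrow> 'b) \<Rightarrow> bool" where
  "isomorphism X Y \<phi> \<longleftrightarrow> morphism X Y \<phi> \<and>
     (\<exists>\<psi>. morphism Y X \<psi> \<and> (\<forall>x\<in>pts X. \<psi> (\<phi> x) = x) \<and> (\<forall>y\<in>pts Y. \<phi> (\<psi> y) = y))"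

text \<open>The structure induced on a (locally closed) subset.\<close>

definition sub_fspace :: "'a fspace \<Rightarrow> 'a set \<Rightarrow> 'a fspace" where
  "sub_fspace X Z =
     \<lparr>zar = subtopology (zar X) Z,
      reg = (\<lambda>W. {f. \<forall>x\<in>W. \<exists>U g. openin (zar X) U \<and> x \<in> U \<and> g \<in> reg X U \<and>
                                (\<forall>y\<in>U \<inter> W. f y = g y)})\<rparr>"

definition closed_immersion :: "'a fspace \<Rightarrow> 'b fspace \<Rightarrow> ('a \<Rightarrow> 'b) \<Rightarrow> bool" where
  "closed_immersion X Y \<phi> \<longleftrightarrow>
     closedin (zar Y) (\<phi> ` pts X) \<and> isomorphism X (sub_fspace Y (\<phi> ` pts X)) \<phi>"

text \<open>The quotient structure along a map: the finest one making the map a morphism.\<close>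

definition quotient_fspace :: "'a fspace \<Rightarrow> ('a \<Rightarrow> 'b) \<Rightarrow> 'b fspace" where
  "quotient_fspace X \<phi> =
     \<lparr>zar = topology (\<lambda>U. U \<subseteq> \<phi> ` pts X \<and> openin (zar X) {x \<in> pts X. \<phi> x \<in> U}),
      reg = (\<lambda>U. {f. f \<circ> \<phi> \<in> reg X {x \<in> pts X. \<phi> x \<in> U}})\<rparr>"

lemma openin_quotient_fspace:
  "openin (zar (quotient_fspace X \<phi>)) U \<longleftrightarrow>
     U \<subseteq> \<phi> ` pts X \<and> openin (zar X) {x \<in> pts X. \<phi> x \<in> U}"
proof -
  have "istopology (\<lambda>U. U \<subseteq> \<phi> ` pts X \<and> openin (zar X) {x \<in> pts X. \<phi> x \<in> U})"
    unfolding istopology_def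
  proof (intro conjI allI impI)
    fix S T
    assume S: "S \<subseteq> \<phi> ` pts X \<and> openin (zar X) {x \<in> pts X. \<phi> x \<in> S}"
      and T: "T \<subseteq> \<phi> ` pts X \<and> openin (zar X) {x \<in> pts X. \<phi> x \<in> T}"
    show "S \<inter> T \<subseteq> \<phi> ` pts X" using S by blast
    have "{x \<in> pts X. \<phi> x \<in> S \<inter> T} = {x \<in> pts X. \<phi> x \<in> S} \<inter> {x \<in> pts X. \<phi> x \<in> T}" by blast
    then show "openin (zar X) {x \<in> pts X. \<phi> x \<in> S \<inter> T}" using S T by (simp add: openin_Int)
  next
    fix \<K>
    assume K: "\<forall>K\<in>\<K>. K \<subseteq> \<phi> ` pts X \<and> openin (zar X) {x \<in> pts X. \<phi> x \<in> K}"
    show "\<Union>\<K> \<subseteq> \<phi> ` pts X" using K by blast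
    have eq: "{x \<in> pts X. \<phi> x \<in> \<Union>\<K>} = (\<Union>K\<in>\<K>. {x \<in> pts X. \<phi> x \<in> K})" by blast
    show "openin (zar X) {x \<in> pts X. \<phi> x \<in> \<Union>\<K>}"
      unfolding eq by (rule openin_Union) (use K in blast)
  qed
  then show ?thesis
    unfolding quotient_fspace_def by (simp add: topology_inverse')
qed

text \<open>Affine \<open>n\<close>-space: points are sequences supported on \<open>{..<n}\<close>.\<close>

inductive_set polyfun :: "nat \<Rightarrow> ((nat \<Rightarrow> complex) \<Rightarrow> complex) set" for n where
  const: "(\<lambda>_. c) \<in> polyfun n"
| coord: "i < n \<Longrightarrow> (\<lambda>v. v i) \<in> polyfun n"
| add: "p \<in> polyfun n \<Longrightarrow> q \<in> polyfun n \<Longrightarrow> (\<lambda>v. p v + q v) \<in> polyfun n"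
| mult: "p \<in> polyfun n \<Longrightarrow> q \<in> polyfun n \<Longrightarrow> (\<lambda>v. p v * q v) \<in> polyfun n"

definition affine_pts :: "nat \<Rightarrow> (nat \<Rightarrow> complex) set" where
  "affine_pts n = {v. \<forall>i\<ge>n. v i = 0}"

definition affine_space :: "nat \<Rightarrow> (nat \<Rightarrow> complex) fspace" where
  "affine_space n =
     \<lparr>zar = topology_generated_by {{v \<in> affine_pts n. p v \<noteq> 0} | p. p \<in> polyfun n},
      reg = (\<lambda>W. {f. \<forall>z\<in>W. \<exists>p\<in>polyfun n. \<exists>q\<in>polyfun n. q z \<noteq> 0 \<and>
                                (\<forall>w\<in>W. q w \<noteq> 0 \<longrightarrow> f w = p w / q w)})\<rparr>"

text \<open>The point \<open>[v]\<close> of projective space is the set of non-zero multiples of \<open>v\<close>.\<close>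

definition proj_point :: "(nat \<Rightarrow> complex) \<Rightarrow> (nat \<Rightarrow> complex) set" where
  "proj_point v = {(\<lambda>i. c * v i) | c. c \<noteq> 0}"

definition proj_space :: "nat \<Rightarrow> (nat \<Rightarrow> complex) set fspace" where
  "proj_space n =
     quotient_fspace (sub_fspace (affine_space (Suc n)) (affine_pts (Suc n) - {\<lambda>_. 0})) proj_point"

text \<open>
  Products. The topology is the Zariski topology of the product variety, not the product topology:
  it is generated by the non-vanishing loci of elements of \<open>O(U) \<otimes> O(V)\<close>.
\<close>

definition tensor_functions ::
  "'a fspace \<Rightarrow> 'b fspace \<Rightarrow> 'a set \<Rightarrow> 'b set \<Rightarrow> ('a \<times> 'b \<Rightarrow> complex) set" where
  "tensor_functions X Y U V =
     {(\<lambda>z. \<Sum>i<N. a i (fst z) * b i (snd z)) | (N::nat) a b.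
        \<forall>i<N. a i \<in> reg X U \<and> b i \<in> reg Y V}"

definition prod_fspace :: "'a fspace \<Rightarrow> 'b fspace \<Rightarrow> ('a \<times> 'b) fspace" where
  "prod_fspace X Y =
     \<lparr>zar = topology_generated_by
              {{z \<in> U \<times> V. h z \<noteq> 0} | U V h. openin (zar X) U \<and> openin (zar Y) V \<and>
                                            h \<in> tensor_functions X Y U V},
      reg = (\<lambda>W. {f. \<forall>z\<in>W. \<exists>U V g h. openin (zar X) U \<and> openin (zar Y) V \<and> z \<in> U \<times> V \<and>
                        g \<in> tensor_functions X Y U V \<and> h \<in> tensor_functions X Y U V \<and> h z \<noteq> 0 \<and>
                        (\<forall>w\<in>W \<inter> U \<times> V. h w \<noteq> 0 \<longrightarrow> f w = g w / h w)})\<rparr>"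


section \<open>Dimension, smoothness, genus\<close>

text \<open>
  Bases and dimension of \<open>V / (V \<inter> W)\<close>, that is, of the image of \<open>V\<close> modulo \<open>W\<close>,
  for complex vector spaces of functions. The dimension is \<open>0\<close> by convention if infinite.
\<close>

definition quot_basis ::
  "('s \<Rightarrow> complex) set \<Rightarrow> ('s \<Rightarrow> complex) set \<Rightarrow> ('s \<Rightarrow> complex) set \<Rightarrow> bool" where
  "quot_basis V W B \<longleftrightarrow> finite B \<and> B \<subseteq> V \<and>
     (\<forall>a. (\<lambda>s. \<Sum>b\<in>B. a b * b s) \<in> W \<longrightarrow> (\<forall>b\<in>B. a b = 0)) \<and>
     (\<forall>v\<in>V. \<exists>a. (\<lambda>s. v s - (\<Sum>b\<in>B. a b * b s)) \<in> W)"

definition quot_dim :: "('s \<Rightarrow> complex) set \<Rightarrow> ('s \<Rightarrow> complex) set \<Rightarrow> nat" where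
  "quot_dim V W = (if \<exists>B. quot_basis V W B then card (SOME B. quot_basis V W B) else 0)"

definition irreducible_closed :: "'a topology \<Rightarrow> 'a set \<Rightarrow> bool" where
  "irreducible_closed T Z \<longleftrightarrow> closedin T Z \<and> Z \<noteq> {} \<and>
     (\<forall>A B. closedin T A \<and> closedin T B \<and> Z \<subseteq> A \<union> B \<longrightarrow> Z \<subseteq> A \<or> Z \<subseteq> B)"

definition irreducible_chain :: "'a topology \<Rightarrow> nat \<Rightarrow> (nat \<Rightarrow> 'a set) \<Rightarrow> bool" where
  "irreducible_chain T n Z \<longleftrightarrow>
     (\<forall>i\<le>n. irreducible_closed T (Z i)) \<and> (\<forall>i<n. Z i \<subset> Z (Suc i))"

definition has_krull_dim :: "'a topology \<Rightarrow> nat \<Rightarrow> bool" where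
  "has_krull_dim T n \<longleftrightarrow>
     (\<exists>Z. irreducible_chain T n Z) \<and> \<not> (\<exists>Z. irreducible_chain T (Suc n) Z)"

text \<open>
  The \<open>k\<close>-th power of the maximal ideal of the local ring at \<open>x\<close> (the whole local ring if
  \<open>k = 0\<close>). A germ is represented by all total functions having that germ.
\<close>

definition max_ideal_pow :: "'a fspace \<Rightarrow> 'a \<Rightarrow> nat \<Rightarrow> ('a \<Rightarrow> complex) set" where
  "max_ideal_pow X x k =
     {f. \<exists>U (N::nat) a h. openin (zar X) U \<and> x \<in> U \<and>
           (\<forall>j<N. a j \<in> reg X U \<and> (\<forall>i<k. h j i \<in> reg X U \<and> h j i x = 0)) \<and>
           (\<forall>y\<in>U. f y = (\<Sum>j<N. a j y * (\<Prod>i<k. h j i y)))}"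

definition smooth_projective_curve :: "'a fspace \<Rightarrow> bool" where
  "smooth_projective_curve C \<longleftrightarrow>
     space_with_functions C \<and>
     (\<exists>n \<phi>. closed_immersion C (proj_space n) \<phi>) \<and>
     irreducible_closed (zar C) (pts C) \<and>
     has_krull_dim (zar C) 1 \<and>
     (\<forall>x\<in>pts C. \<exists>B. quot_basis (max_ideal_pow C x 1) (max_ideal_pow C x 2) B \<and> card B = 1)"

text \<open>
  Cech cohomology \<open>H\<^sup>1(X, O_X)\<close>. Open covers are indexed by the points (\<open>N x\<close> is a neighbourhood
  of \<open>x\<close>); these are cofinal, and passing to the direct limit amounts to allowing the cover to
  shrink. A cochain is written \<open>c (x, y, z)\<close>, the value at \<open>z\<close> of its component on
  \<open>N x \<inter> N y\<close>.
\<close>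

definition point_cover :: "'a fspace \<Rightarrow> ('a \<Rightarrow> 'a set) \<Rightarrow> bool" where
  "point_cover X N \<longleftrightarrow> (\<forall>x\<in>pts X. openin (zar X) (N x) \<and> x \<in> N x)"

definition cech_cocycles :: "'a fspace \<Rightarrow> ('a \<times> 'a \<times> 'a \<Rightarrow> complex) set" where
  "cech_cocycles X =
     {c. \<exists>N. point_cover X N \<and>
           (\<forall>x\<in>pts X. \<forall>y\<in>pts X. (\<lambda>z. c (x, y, z)) \<in> reg X (N x \<inter> N y)) \<and>
           (\<forall>x\<in>pts X. \<forall>y\<in>pts X. \<forall>w\<in>pts X. \<forall>z\<in>N x \<inter> N y \<inter> N w.
              c (x, y, z) + c (y, w, z) = c (x, w, z))}"

definition cech_coboundaries :: "'a fspace \<Rightarrow> ('a \<times> 'a \<times> 'a \<Rightarrow> complex) set" where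
  "cech_coboundaries X =
     {c. \<exists>N b. point_cover X N \<and> (\<forall>x\<in>pts X. b x \<in> reg X (N x)) \<and>
           (\<forall>x\<in>pts X. \<forall>y\<in>pts X. \<forall>z\<in>N x \<inter> N y. c (x, y, z) = b y z - b x z)}"

text \<open>The genus of a smooth projective curve, as the dimension of \<open>H\<^sup>1(C, O_C)\<close>.\<close>

definition genus :: "'a fspace \<Rightarrow> nat" where
  "genus C = quot_dim (cech_cocycles C) (cech_coboundaries C)"


section \<open>Vector bundles\<close>

text \<open>A vector bundle is a total space over the base with fibrewise operations, locally trivial.\<close>

record ('c, 'e) vbundle =
  total :: "'e fspace"
  bproj :: "'e \<Rightarrow> 'c"
  badd :: "'e \<Rightarrow> 'e \<Rightarrow> 'e"
  bscale :: "complex \<Rightarrow> 'e \<Rightarrow> 'e"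

definition vector_bundle :: "'c fspace \<Rightarrow> nat \<Rightarrow> ('c, 'e) vbundle \<Rightarrow> bool" where
  "vector_bundle C r E \<longleftrightarrow>
     space_with_functions (total E) \<and>
     morphism (total E) C (bproj E) \<and>
     (\<forall>p\<in>pts C. \<exists>U \<psi>. openin (zar C) U \<and> p \<in> U \<and>
        isomorphism (sub_fspace (total E) {e \<in> pts (total E). bproj E e \<in> U})
                    (prod_fspace (sub_fspace C U) (affine_space r)) \<psi> \<and>
        (\<forall>e\<in>pts (total E). bproj E e \<in> U \<longrightarrow> fst (\<psi> e) = bproj E e) \<and>
        (\<forall>e\<in>pts (total E). \<forall>e'\<in>pts (total E). bproj E e \<in> U \<and> bproj E e' = bproj E e \<longrightarrow>
           badd E e e' \<in> pts (total E) \<and> bproj E (badd E e e') = bproj E e \<and>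
           snd (\<psi> (badd E e e')) = (\<lambda>i. snd (\<psi> e) i + snd (\<psi> e') i)) \<and>
        (\<forall>e\<in>pts (total E). \<forall>c. bproj E e \<in> U \<longrightarrow>
           bscale E c e \<in> pts (total E) \<and> bproj E (bscale E c e) = bproj E e \<and>
           snd (\<psi> (bscale E c e)) = (\<lambda>i. c * snd (\<psi> e) i)))"

definition trivial_bundle :: "'c fspace \<Rightarrow> nat \<Rightarrow> ('c, 'c \<times> (nat \<Rightarrow> complex)) vbundle" where
  "trivial_bundle C r =
     \<lparr>total = prod_fspace C (affine_space r),
      bproj = fst,
      badd = (\<lambda>e e'. (fst e, \<lambda>i. snd e i + snd e' i)),
      bscale = (\<lambda>c e. (fst e, \<lambda>i. c * snd e i))\<rparr>"

definition bundle_hom :: "('c, 'e) vbundle \<Rightarrow> ('c, 'f) vbundle \<Rightarrow> ('e \<Rightarrow> 'f) \<Rightarrow> bool" where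
  "bundle_hom E F \<phi> \<longleftrightarrow>
     morphism (total E) (total F) \<phi> \<and>
     (\<forall>e\<in>pts (total E). bproj F (\<phi> e) = bproj E e) \<and>
     (\<forall>e\<in>pts (total E). \<forall>e'\<in>pts (total E). bproj E e' = bproj E e \<longrightarrow>
        \<phi> (badd E e e') = badd F (\<phi> e) (\<phi> e')) \<and>
     (\<forall>e\<in>pts (total E). \<forall>c. \<phi> (bscale E c e) = bscale F c (\<phi> e))"

definition is_zero_vector :: "('c, 'e) vbundle \<Rightarrow> 'e \<Rightarrow> bool" where
  "is_zero_vector E e \<longleftrightarrow> e = bscale E 0 e"

text \<open>\<open>0 \<rightarrow> E' \<rightarrow> E \<rightarrow> E'' \<rightarrow> 0\<close>; exactness for vector bundles may be checked on fibres.\<close>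

definition short_exact ::
  "('c, 'f) vbundle \<Rightarrow> ('c, 'e) vbundle \<Rightarrow> ('c, 'g) vbundle \<Rightarrow> ('f \<Rightarrow> 'e) \<Rightarrow> ('e \<Rightarrow> 'g) \<Rightarrow> bool" where
  "short_exact E' E E'' \<iota> \<rho> \<longleftrightarrow>
     bundle_hom E' E \<iota> \<and> bundle_hom E E'' \<rho> \<and>
     inj_on \<iota> (pts (total E')) \<and>
     \<rho> ` pts (total E) = pts (total E'') \<and>
     (\<forall>e\<in>pts (total E). is_zero_vector E'' (\<rho> e) \<longleftrightarrow> e \<in> \<iota> ` pts (total E'))"

definition splits :: "('c, 'e) vbundle \<Rightarrow> ('c, 'g) vbundle \<Rightarrow> ('e \<Rightarrow> 'g) \<Rightarrow> bool" where
  "splits E E'' \<rho> \<longleftrightarrow>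
     (\<exists>\<sigma>. bundle_hom E'' E \<sigma> \<and> (\<forall>y\<in>pts (total E''). \<rho> (\<sigma> y) = y))"


section \<open>The ruled surface\<close>

text \<open>
  \<open>P(E)\<close> in Grothendieck's convention, for \<open>E\<close> of rank 2: a point over \<open>p\<close> is a one-dimensional
  quotient of the fibre \<open>E_p\<close>, recorded by its kernel, a line in \<open>E_p\<close>, which in turn is recorded
  by the set of its non-zero vectors.
\<close>

definition line_of :: "('c, 'e) vbundle \<Rightarrow> 'e \<Rightarrow> 'e set" where
  "line_of E e = {bscale E c e | c. c \<noteq> 0}"

definition ruled_surface :: "('c, 'e) vbundle \<Rightarrow> 'e set fspace" where
  "ruled_surface E =
     quotient_fspace (sub_fspace (total E) {e \<in> pts (total E). \<not> is_zero_vector E e}) (line_of E)"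

definition ruling :: "('c, 'e) vbundle \<Rightarrow> 'e set \<Rightarrow> 'c" where
  "ruling E x = the_elem (bproj E ` x)"

definition fibre :: "('c, 'e) vbundle \<Rightarrow> 'c \<Rightarrow> 'e set set" where
  "fibre E p = {x \<in> pts (ruled_surface E). ruling E x = p}"

text \<open>
  The section of the ruling given by the quotient \<open>\<rho> : E \<rightarrow> O_C\<close> (with kernel the image of \<open>O_C\<close>);
  it is the zero locus of the section of \<open>O_P(E)(1)\<close> induced by \<open>O_C \<rightarrow> E\<close>, so that
  \<open>O_S(C_0) = O_P(E)(1)\<close> is the tautological line bundle.
\<close>

definition tautological_section ::
  "('c, 'e) vbundle \<Rightarrow> ('c, 'g) vbundle \<Rightarrow> ('e \<Rightarrow> 'g) \<Rightarrow> 'e set set" where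
  "tautological_section E E'' \<rho> =
     {x \<in> pts (ruled_surface E). \<forall>e\<in>x. is_zero_vector E'' (\<rho> e)}"


section \<open>Divisors and their line bundles\<close>

text \<open>
  A divisor on a curve is a finitely supported function on points; a divisor on a surface is a
  finitely supported function on irreducible curves, the latter given as sets of points.
\<close>

definition point_divisor :: "'c fspace \<Rightarrow> ('c \<Rightarrow> int) \<Rightarrow> bool" where
  "point_divisor C \<delta> \<longleftrightarrow> finite {p. \<delta> p \<noteq> 0} \<and> {p. \<delta> p \<noteq> 0} \<subseteq> pts C"

definition divisor_degree :: "('c \<Rightarrow> int) \<Rightarrow> int" where
  "divisor_degree \<delta> = (\<Sum>p | \<delta> p \<noteq> 0. \<delta> p)"

definition prime_divisor :: "'a set \<Rightarrow> 'a set \<Rightarrow> int" where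
  "prime_divisor Y = (\<lambda>Z. if Z = Y then 1 else 0)"

definition pullback_divisor :: "('c, 'e) vbundle \<Rightarrow> ('c \<Rightarrow> int) \<Rightarrow> 'e set set \<Rightarrow> int" where
  "pullback_divisor E \<delta> = (\<lambda>Z. \<Sum>p | \<delta> p \<noteq> 0. \<delta> p * prime_divisor (fibre E p) Z)"

definition divisor_support :: "('a set \<Rightarrow> int) \<Rightarrow> 'a set" where
  "divisor_support D = \<Union>{Y. D Y \<noteq> 0}"

definition generates_ideal :: "'a fspace \<Rightarrow> 'a set \<Rightarrow> 'a set \<Rightarrow> ('a \<Rightarrow> complex) \<Rightarrow> bool" where
  "generates_ideal X Y U h \<longleftrightarrow>
     h \<in> reg X U \<and> (\<forall>y\<in>U \<inter> Y. h y = 0) \<and>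
     (\<forall>V f. openin (zar X) V \<and> V \<subseteq> U \<and> f \<in> reg X V \<and> (\<forall>y\<in>V \<inter> Y. f y = 0) \<longrightarrow>
        (\<exists>a\<in>reg X V. \<forall>y\<in>V. f y = a y * h y))"

definition local_equation :: "'a fspace \<Rightarrow> ('a set \<Rightarrow> int) \<Rightarrow> 'a set \<Rightarrow> ('a \<Rightarrow> complex) \<Rightarrow> bool" where
  "local_equation X D U g \<longleftrightarrow> openin (zar X) U \<and>
     (\<exists>h. (\<forall>Y. D Y \<noteq> 0 \<longrightarrow> generates_ideal X Y U (h Y)) \<and>
          g = (\<lambda>y. \<Prod>Y | D Y \<noteq> 0. h Y y powi D Y))"

text \<open>
  Sections of \<open>O_X(D)\<close> are rational functions \<open>s\<close> with \<open>div s + D \<ge> 0\<close>; they are regular off the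
  support of \<open>D\<close>, and \<open>s\<close> corresponds to the regular function \<open>s * g\<close> if \<open>g\<close> is a local equation
  of \<open>D\<close>. The following is \<open>m_x\<^sup>k L_x\<close> inside the stalk \<open>L_x\<close> of \<open>L = O_X(D)\<close>; in particular
  \<open>k = 0\<close> gives \<open>L_x\<close>.
\<close>

definition stalk_pow :: "'a fspace \<Rightarrow> ('a set \<Rightarrow> int) \<Rightarrow> 'a \<Rightarrow> nat \<Rightarrow> ('a \<Rightarrow> complex) set" where
  "stalk_pow X D x k =
     {s. \<exists>U g t. x \<in> U \<and> local_equation X D U g \<and> t \<in> max_ideal_pow X x k \<and>
           (\<forall>y\<in>U - divisor_support D. t y = s y * g y)}"

text \<open>Global sections are normalised to vanish where the rational function is not considered.\<close>

definition global_sections :: "'a fspace \<Rightarrow> ('a set \<Rightarrow> int) \<Rightarrow> ('a \<Rightarrow> complex) set" where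
  "global_sections X D =
     {s. (\<forall>y. y \<notin> pts X - divisor_support D \<longrightarrow> s y = 0) \<and> (\<forall>x\<in>pts X. s \<in> stalk_pow X D x 0)}"

definition spanned_at :: "'a fspace \<Rightarrow> ('a set \<Rightarrow> int) \<Rightarrow> 'a \<Rightarrow> bool" where
  "spanned_at X D x \<longleftrightarrow> (\<exists>s\<in>global_sections X D. s \<notin> stalk_pow X D x 1)"

text \<open>
  The fibre at \<open>x\<close> of the jet bundle \<open>J_k L\<close> is \<open>L_x / m_x^(k+1) L_x\<close>, so the rank of the jet map
  is the dimension of the image of the global sections modulo \<open>m_x^(k+1) L_x\<close>.
\<close>

definition jet_rank :: "'a fspace \<Rightarrow> ('a set \<Rightarrow> int) \<Rightarrow> nat \<Rightarrow> 'a \<Rightarrow> nat" where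
  "jet_rank X D k x = quot_dim (global_sections X D) (stalk_pow X D x (Suc k))"

definition osc_dim :: "'a fspace \<Rightarrow> ('a set \<Rightarrow> int) \<Rightarrow> nat \<Rightarrow> 'a \<Rightarrow> int" where
  "osc_dim X D k x = int (jet_rank X D k x) - 1"

definition inflectional_locus :: "'a fspace \<Rightarrow> ('a set \<Rightarrow> int) \<Rightarrow> nat \<Rightarrow> 'a set" where
  "inflectional_locus X D m = {x \<in> pts X. osc_dim X D m x < 2 * int m}"

text \<open>
  \<open>X\<close> is embedded in projective \<open>n\<close>-space by the complete linear system of \<open>O_X(D)\<close>: the map
  \<open>x \<mapsto> [\<sigma>\<^sub>0(x) : \<dots> : \<sigma>\<^sub>n(x)]\<close>, for a basis \<open>\<sigma>\<^sub>0, \<dots>, \<sigma>\<^sub>n\<close> of the global sections, is a closed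
  immersion. Values of sections are taken in a local trivialisation.
\<close>

definition embedded_by_complete_system :: "'a fspace \<Rightarrow> ('a set \<Rightarrow> int) \<Rightarrow> nat \<Rightarrow> bool" where
  "embedded_by_complete_system X D n \<longleftrightarrow>
     (\<exists>\<sigma> \<phi>. inj_on \<sigma> {..n} \<and> quot_basis (global_sections X D) {\<lambda>_. 0} (\<sigma> ` {..n}) \<and>
        closed_immersion X (proj_space n) \<phi> \<and>
        (\<forall>x\<in>pts X. \<exists>U g t. x \<in> U \<and> local_equation X D U g \<and>
           (\<forall>i\<le>n. t i \<in> reg X U \<and> (\<forall>y\<in>U - divisor_support D. t i y = \<sigma> i y * g y)) \<and>
           \<phi> x = proj_point (\<lambda>i. if i \<le> n then t i x else 0)))"

text \<open>The divisor \<open>C_0 + \<pi>\<^sup>*\<delta>\<close> of the hyperplane bundle of a scroll.\<close>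

definition scroll_divisor ::
  "('c, 'e) vbundle \<Rightarrow> ('c, 'g) vbundle \<Rightarrow> ('e \<Rightarrow> 'g) \<Rightarrow> ('c \<Rightarrow> int) \<Rightarrow> 'e set set \<Rightarrow> int" where
  "scroll_divisor E E'' \<rho> \<delta> =
     (\<lambda>Z. prime_divisor (tautological_section E E'' \<rho>) Z + pullback_divisor E \<delta> Z)"

end

theory Submission
 imports Defs "HOL-Computational_Algebra.Fundamental_Theorem_Algebra"
begin

text \<open>
Write \<open>p\<close> for the image of \<open>x\<close>. With linear coordinates \<open>X, Y\<close> on the fibres of \<open>E\<close> over a neighbourhood
of \<open>p\<close> such that \<open>Y\<close> vanishes on the line \<open>x\<close>, a section of \<open>L\<close> is \<open>\<alpha> X + \<beta> Y\<close> with \<open>\<alpha>, \<beta>\<close> regular at \<open>p\<close>, and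
it belongs to \<open>m\<^sub>x\<^sup>m\<^sup>+\<^sup>1 L\<^sub>x\<close> iff \<open>\<alpha> \<in> m\<^sub>p\<^sup>m\<^sup>+\<^sup>1\<close> and \<open>\<beta> \<in> m\<^sub>p\<^sup>m\<close>. The sections with \<open>\<alpha>, \<beta> \<in> m\<^sub>p\<^sup>m\<close> are those
of \<open>L(-m f)\<close> and have codimension at most \<open>2 m\<close>; if all of them vanish at \<open>x\<close> as sections of \<open>L(-m f)\<close>,
then the kernel of the jet map contains them and the jet rank is at most \<open>2 m\<close>. Conversely, if the
jet rank is at most \<open>2 m\<close>, the kernel contains two independent sections because \<open>h\<^sup>0(L) = 2 m + 2\<close>, and
these vanish at \<open>x\<close> as sections of \<open>L(-m f)\<close>. The bundle \<open>L(-m f)\<close> belongs to a divisor of degree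
one on \<open>C\<close>; by the extension defining \<open>E\<close> it has at most twice as many independent sections as a
bundle of degree one on a curve of genus one, that is, at most two. Hence all its sections vanish at \<open>x\<close>.
\<close>

section \<open>Dimensions of quotients of function spaces\<close>

text \<open>The bound of two on the sections of L(-m f) needs Riemann-Roch on C, and the genus is
  available only as the dimension of Cech H^1. A one-dimensional H^1 leaves room for one
  obstruction: along an increasing chain of effective divisors, adding a point fails to enlarge the
  space of functions at most once, because two failures would give two independent principal-part
  classes; and some failure exists, because otherwise every cocycle would be a coboundary. Hence an
  effective divisor of degree d has h^0 equal to d or d + 1, and equal to d when it is large. A
  pencil in degree one would come from a function with a single simple pole, whose powers keep h^0
  at d + 1 for all multiples of that point, which contradicts the large case. Global regular
  functions are shown to be constant from the finite dimension of H^0(L). The local work turns a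
  section of L into a linear form on the fibres of E: regular functions on the total space are
  locally quotients of polynomials in fibre coordinates, and divisibility on the surface becomes
  elementary algebra.\<close>

definition fsubspace :: "('s => complex) set => bool" where
 "fsubspace V \<longleftrightarrow> (%_. 0) \<in> V & (\<forall>f\<in>V. \<forall>g\<in>V. (%s. f s + g s) \<in> V) &
  (\<forall>f\<in>V. \<forall>c. (%s. c * f s) \<in> V)"

lemma fsubspaceI:
 assumes "(%_. 0) \<in> V" "\<And>f g. f \<in> V ==> g \<in> V ==> (%s. f s + g s) \<in> V"
  "\<And>f c. f \<in> V ==> (%s. c * f s) \<in> V"
 shows "fsubspace V"
 using assms by (auto simp: fsubspace_def)

lemma fsubspace_zero: "fsubspace V ==> (%_. 0) \<in> V"
 and fsubspace_add: "fsubspace V ==> f \<in> V ==> g \<in> V ==> (%s. f s + g s) \<in> V"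
 and fsubspace_scale: "fsubspace V ==> f \<in> V ==> (%s. c * f s) \<in> V"
 by (auto simp: fsubspace_def)

lemma fsubspace_diff: "fsubspace V ==> f \<in> V ==> g \<in> V ==> (%s. f s - g s) \<in> V"
 using fsubspace_add[of V f "%s. (-1) * g s"] fsubspace_scale[of V g "-1"] by simp

lemma fsubspace_Int: "fsubspace V ==> fsubspace W ==> fsubspace (V \<inter> W)"
 by (auto simp: fsubspace_def)

lemma fsubspace_sum:
 assumes "fsubspace V" "\<And>i. i \<in> I ==> f i \<in> V"
 shows "(%s. \<Sum>i\<in>I. c i * f i s) \<in> V"
proof (cases "finite I")
 case True
 then show ?thesis using assms(2)
 proof (induction I)
  case empty
  then show ?case using assms(1) by (simp add: fsubspace_zero)
 next
  case (insert x F)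
  then show ?case
   using fsubspace_add[OF assms(1) fsubspace_scale[OF assms(1)], of "f x" _ "c x"] by simp
 qed
next
 case False
 then show ?thesis using assms(1) by (simp add: fsubspace_zero)
qed

text \<open>\<open>dlt V Z n\<close> says that \<open>V / (V \<inter> Z)\<close> has dimension less than \<open>n\<close>.\<close>

definition dlt :: "('s => complex) set => ('s => complex) set => nat => bool" where
 "dlt V Z n \<longleftrightarrow> (\<forall>v. (\<forall>i<n. v i \<in> V) -->
  (\<exists>c. (\<exists>i<n. c i ~= 0) & (%s. \<Sum>i<n. c i * v i s) \<in> Z))"

lemma not_dlt_0: "\<not> dlt V Z 0"
 by (simp add: dlt_def)

lemma dlt_index:
 assumes "dlt V Z n" "finite I" "card I = n" "\<And>i. i \<in> I ==> v i \<in> V"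
 obtains c where "\<exists>i\<in>I. c i ~= 0" "(%s. \<Sum>i\<in>I. c i * v i s) \<in> Z"
proof -
 obtain h where h: "bij_betw h {..<n} I"
  using ex_bij_betw_nat_finite[OF assms(2)] assms(3) by (auto simp: atLeast0LessThan)
 then have "\<forall>i<n. v (h i) \<in> V" using assms(4) by (auto simp: bij_betw_def)
 then obtain c where c: "\<exists>i<n. c i ~= 0" "(%s. \<Sum>i<n. c i * v (h i) s) \<in> Z"
  using assms(1)[unfolded dlt_def, rule_format, of "%i. v (h i)"] by blast
 define d where "d = (%i. c (inv_into {..<n} h i))"
 have dh: "d (h i) = c i" if "i < n" for i
  using that h by (simp add: d_def bij_betw_def)
 have "(\<Sum>i\<in>I. d i * v i s) = (\<Sum>i<n. c i * v (h i) s)" for s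
  using sum.reindex_bij_betw[OF h, of "%i. d i * v i s"] dh by simp
 moreover have "\<exists>i\<in>I. d i ~= 0" using c(1) dh h by (metis bij_betwE lessThan_iff)
 ultimately show thesis using that c(2) by simp
qed

lemma dlt_mono:
 assumes "dlt V Z n" "n \<le> m" shows "dlt V Z m"
 unfolding dlt_def
proof (intro allI impI)
 fix v assume "\<forall>i<m. v i \<in> V"
 then obtain c where c: "\<exists>i<n. c i ~= 0" "(%s. \<Sum>i<n. c i * v i s) \<in> Z"
  using assms(1)[unfolded dlt_def, rule_format, of v] assms(2) order_less_le_trans by blast
 have "(\<Sum>i<m. (if i < n then c i else 0) * v i s) = (\<Sum>i<n. c i * v i s)" for s
  by (rule sum.mono_neutral_cong_right) (use assms in auto)
 then show "\<exists>c. (\<exists>i<m. c i ~= 0) & (%s. \<Sum>i<m. c i * v i s) \<in> Z"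
  using c assms(2) by (intro exI[of _ "%i. if i < n then c i else 0"]) auto
qed

lemma dlt_subset:
 assumes "dlt V Z n" "V' \<subseteq> V" "fsubspace V'" "V' \<inter> Z \<subseteq> Z'"
 shows "dlt V' Z' n"
 unfolding dlt_def
proof (intro allI impI)
 fix v assume v: "\<forall>i<n. v i \<in> V'"
 then obtain c where c: "\<exists>i<n. c i ~= 0" "(%s. \<Sum>i<n. c i * v i s) \<in> Z"
  using assms(1)[unfolded dlt_def, rule_format, of v] assms(2) by blast
 moreover have "(%s. \<Sum>i<n. c i * v i s) \<in> V'"
  by (rule fsubspace_sum[OF assms(3)]) (use v in auto)
 ultimately show "\<exists>c. (\<exists>i<n. c i ~= 0) & (%s. \<Sum>i<n. c i * v i s) \<in> Z'" using assms(4) by blast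
qed

lemma dlt_1:
 assumes "V \<subseteq> Z" shows "dlt V Z (Suc 0)"
 unfolding dlt_def
proof (intro allI impI)
 fix v assume "\<forall>i<Suc 0. v i \<in> V"
 then have "v 0 \<in> Z" using assms by auto
 then show "\<exists>c. (\<exists>i<Suc 0. c i ~= 0) & (%s. \<Sum>i<Suc 0. c i * v i s) \<in> Z"
  by (intro exI[of _ "%_. 1"]) simp
qed

text \<open>The vector \<open>w\<close> need not lie in \<open>V\<close>, so it is never part of a
  relation. Instead a member of the family with nonzero coefficient along \<open>w\<close> serves as
  pivot and corrects the other members into \<open>V0\<close>.\<close>

lemma dlt_codim_one:
 assumes V0: "fsubspace V0" and d: "dlt V0 Z M"
  and codim: "\<And>v. v \<in> V ==> \<exists>c. (%s. v s - c * w s) \<in> V0"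
 shows "dlt V Z (Suc M)"
 unfolding dlt_def
proof (intro allI impI)
 fix v assume v: "\<forall>i<Suc M. v i \<in> V"
 have "\<exists>k. \<forall>i<Suc M. (%s. v i s - k i * w s) \<in> V0"
  by (rule choice_iff'[THEN iffD1, rule_format]) (use v codim in auto)
 then obtain k where k: "\<And>i. i < Suc M ==> (%s. v i s - k i * w s) \<in> V0" by blast
 show "\<exists>c. (\<exists>i<Suc M. c i ~= 0) & (%s. \<Sum>i<Suc M. c i * v i s) \<in> Z"
 proof (cases "\<forall>i<Suc M. k i = 0")
  case True
  then have "\<forall>i<Suc M. v i \<in> V0" using k by fastforce
  then show ?thesis using dlt_mono[OF d, of "Suc M"] unfolding dlt_def by simp
 next
  case False
  then obtain j where j: "j < Suc M" "k j ~= 0" by blast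
  define I where "I = {..<Suc M} - {j}"
  define u where "u = (%i s. v i s - k i / k j * v j s)"
  have "u i \<in> V0" if "i \<in> I" for i
  proof -
   have "(%s. (v i s - k i * w s) - k i / k j * (v j s - k j * w s)) \<in> V0"
    by (rule fsubspace_diff[OF V0 k fsubspace_scale[OF V0 k[OF j(1)]]]) (use that in \<open>simp add: I_def\<close>)
   also have "(%s. (v i s - k i * w s) - k i / k j * (v j s - k j * w s)) = u i"
    using j by (auto simp: u_def field_simps)
   finally show ?thesis .
  qed
  moreover have "finite I" "card I = M" using j by (auto simp: I_def)
  ultimately obtain c where c: "\<exists>i\<in>I. c i ~= 0" "(%s. \<Sum>i\<in>I. c i * u i s) \<in> Z"
   using dlt_index[OF d] by metis
  \<comment> \<open>The pivot receives minus the total of the multiples subtracted from the other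
    members, so the relation among the \<open>u i\<close> becomes one among the
    \<open>v i\<close>.\<close>
  define c' where "c' = (%i. if i = j then - (\<Sum>i\<in>I. c i * k i / k j) else c i)"
  have "(\<Sum>i<Suc M. c' i * v i s) = (\<Sum>i\<in>I. c i * u i s)" for s
  proof -
   have "(\<Sum>i<Suc M. c' i * v i s) = c' j * v j s + (\<Sum>i\<in>I. c' i * v i s)"
    unfolding I_def by (rule sum.remove) (use j in auto)
   also have "(\<Sum>i\<in>I. c' i * v i s) = (\<Sum>i\<in>I. c i * v i s)"
    by (rule sum.cong) (auto simp: c'_def I_def)
   also have "c' j * v j s + (\<Sum>i\<in>I. c i * v i s) = (\<Sum>i\<in>I. c i * u i s)"
    by (simp add: c'_def u_def sum_subtractf sum_distrib_right right_diff_distrib mult.assoc)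
   finally show ?thesis .
  qed
  moreover have "\<exists>i<Suc M. c' i ~= 0" using c(1) by (auto simp: I_def c'_def)
  ultimately show ?thesis using c(2) by (intro exI[of _ c']) simp
 qed
qed

text \<open>Adjoining the \<open>w i\<close> one at a time gives a chain of subspaces from
  \<open>V \<inter> Z'\<close> up to \<open>V\<close>, and each step raises the dimension by at most
  one.\<close>

lemma dlt_span:
 assumes V: "fsubspace V" and Z': "fsubspace Z'" and w: "\<And>i. i < n ==> w i \<in> V"
  and span: "\<And>v. v \<in> V ==> \<exists>c. (%s. v s - (\<Sum>i<n. c i * w i s)) \<in> Z'"
  and d: "dlt (V \<inter> Z') Z (Suc b)"
 shows "dlt V Z (Suc (b + n))"
proof -
 define W where "W = (%k. {v \<in> V. \<exists>c. (%s. v s - (\<Sum>i<k. c i * w i s)) \<in> Z'})"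
 have sub: "fsubspace (W k)" for k
 proof (rule fsubspaceI)
  show "(%_. 0) \<in> W k" unfolding W_def
   using fsubspace_zero[OF V] fsubspace_zero[OF Z'] by (auto intro!: exI[of _ "%_. 0"])
 next
  fix f g assume "f \<in> W k" "g \<in> W k"
  then obtain c d where f: "f \<in> V" "(%s. f s - (\<Sum>i<k. c i * w i s)) \<in> Z'"
   and g: "g \<in> V" "(%s. g s - (\<Sum>i<k. d i * w i s)) \<in> Z'" unfolding W_def by blast
  have "(%s. (f s + g s) - (\<Sum>i<k. (c i + d i) * w i s)) \<in> Z'"
   using fsubspace_add[OF Z' f(2) g(2)]
   by (simp add: sum.distrib distrib_right algebra_simps)
  then show "(%s. f s + g s) \<in> W k" unfolding W_def using fsubspace_add[OF V f(1) g(1)]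
   by (auto intro!: exI[of _ "%i. c i + d i"])
 next
  fix f a assume "f \<in> W k"
  then obtain c where f: "f \<in> V" "(%s. f s - (\<Sum>i<k. c i * w i s)) \<in> Z'" unfolding W_def by blast
  have "(%s. a * f s - (\<Sum>i<k. (a * c i) * w i s)) \<in> Z'"
   using fsubspace_scale[OF Z' f(2), of a]
   by (simp add: sum_distrib_left right_diff_distrib mult.assoc)
  then show "(%s. a * f s) \<in> W k" unfolding W_def using fsubspace_scale[OF V f(1)]
   by (auto intro!: exI[of _ "%i. a * c i"])
 qed
 have "k \<le> n ==> dlt (W k) Z (Suc (b + k))" for k
 proof (induction k)
  case 0
  have "W 0 = V \<inter> Z'" by (auto simp: W_def)
  then show ?case using d by simp
 next
  case (Suc k)
  have "dlt (W (Suc k)) Z (Suc (Suc (b + k)))"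
  proof (rule dlt_codim_one[OF sub])
   show "dlt (W k) Z (Suc (b + k))" using Suc by simp
   fix v assume "v \<in> W (Suc k)"
   then obtain c where v: "v \<in> V" "(%s. v s - (\<Sum>i<Suc k. c i * w i s)) \<in> Z'"
    unfolding W_def by blast
   have "(%s. (v s - c k * w k s) - (\<Sum>i<k. c i * w i s)) \<in> Z'"
    using v(2) by (simp add: algebra_simps)
   moreover have "(%s. v s - c k * w k s) \<in> V"
    using fsubspace_diff[OF V v(1) fsubspace_scale[OF V w]] Suc.prems by simp
   ultimately show "\<exists>c. (%s. v s - c * w k s) \<in> W k" unfolding W_def by blast
  qed
  then show ?case by simp
 qed
 then have "dlt (W n) Z (Suc (b + n))" by simp
 moreover have "W n = V" using span by (auto simp: W_def)
 ultimately show ?thesis by simp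
qed

lemma dlt_basis:
 assumes V: "fsubspace V" and Z: "fsubspace Z" and d: "dlt V Z (Suc n)" and nd: "\<not> dlt V Z n"
 shows "\<exists>w. (\<forall>i<n. w i \<in> V) &
  (\<forall>c. (%s. \<Sum>i<n. c i * w i s) \<in> Z --> (\<forall>i<n. c i = 0)) &
  (\<forall>v\<in>V. \<exists>c. (%s. v s - (\<Sum>i<n. c i * w i s)) \<in> Z)"
proof -
 obtain w where w: "\<And>i. i < n ==> w i \<in> V"
  and ind: "\<And>c. (%s. \<Sum>i<n. c i * w i s) \<in> Z ==> \<forall>i<n. c i = 0"
  using nd unfolding dlt_def by blast
 have "\<exists>c. (%s. v s - (\<Sum>i<n. c i * w i s)) \<in> Z" if v: "v \<in> V" for v
 proof -
  define u where "u = (%i. if i = n then v else w i)"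
  have "\<forall>i<Suc n. u i \<in> V" using v w by (auto simp: u_def less_Suc_eq)
  then obtain c where c: "\<exists>i<Suc n. c i ~= 0" "(%s. \<Sum>i<Suc n. c i * u i s) \<in> Z"
   using d unfolding dlt_def by blast
  have c2: "(%s. (\<Sum>i<n. c i * w i s) + c n * v s) \<in> Z" using c(2) by (simp add: u_def)
  \<comment> \<open>If the new vector had coefficient zero, the relation would live among the
    \<open>w i\<close>, whose independence kills it; hence one can solve for
    \<open>v\<close>.\<close>
  have cn: "c n ~= 0"
  proof
   assume "c n = 0"
   then have "\<forall>i<n. c i = 0" using c2 ind by simp
   then show False using c(1) \<open>c n = 0\<close> by (auto simp: less_Suc_eq)
  qed
  have "(%s. (1 / c n) * ((\<Sum>i<n. c i * w i s) + c n * v s)) \<in> Z" by (rule fsubspace_scale[OF Z c2])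
  also have "(%s. (1 / c n) * ((\<Sum>i<n. c i * w i s) + c n * v s))
    = (%s. v s - (\<Sum>i<n. (- c i / c n) * w i s))"
   using cn by (simp add: fun_eq_iff field_simps sum_negf sum_divide_distrib[symmetric])
  finally show ?thesis by (rule exI[of _ "%i. - c i / c n"])
 qed
 with w ind show ?thesis by (intro exI[of _ w] conjI allI impI ballI) auto
qed

text \<open>\<open>dlt V Z (Suc n)\<close> without \<open>dlt V Z n\<close> says that the dimension
  is exactly \<open>n\<close>. The least valid bound is positive because the empty family has no
  nonzero coefficient.\<close>

lemma dlt_exact:
 assumes "dlt V Z N"
 obtains n where "n < N" "dlt V Z (Suc n)" "\<not> dlt V Z n"
proof -
 define k where "k = (LEAST k. dlt V Z k)"
 have k: "dlt V Z k" unfolding k_def using assms by (rule LeastI)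
 then have "k ~= 0" using not_dlt_0 by metis
 then obtain n where n: "k = Suc n" using not0_implies_Suc by blast
 have "\<not> dlt V Z n" using not_less_Least[of n "dlt V Z"] n k_def by auto
 moreover have "n < N" using assms n Least_le[of "dlt V Z" N] k_def by simp
 ultimately show thesis using that k n by simp
qed

text \<open>A basis of \<open>V\<close> modulo \<open>Z'\<close> has at most \<open>a\<close>
  members; adjoining it to \<open>V \<inter> Z'\<close> reduces the claim to
  \<open>dlt_span\<close>. It serves as subadditivity of dimension in extensions.\<close>

lemma dlt_ext:
 assumes V: "fsubspace V" and Z': "fsubspace Z'"
  and d': "dlt V Z' (Suc a)" and d: "dlt (V \<inter> Z') Z (Suc b)"
 shows "dlt V Z (Suc (a + b))"
proof -
 obtain n where n: "n < Suc a" "dlt V Z' (Suc n)" "\<not> dlt V Z' n" using dlt_exact[OF d'] .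
 from dlt_basis[OF V Z' n(2,3)] obtain w where w: "\<forall>i<n. w i \<in> V"
  "\<forall>v\<in>V. \<exists>c. (%s. v s - (\<Sum>i<n. c i * w i s)) \<in> Z'"
  by (elim exE conjE) (rule that)
 have "dlt V Z (Suc (b + n))" by (rule dlt_span[OF V Z' w(1)[rule_format] w(2)[rule_format] d])
 then show ?thesis by (rule dlt_mono) (use n in simp)
qed

text \<open>Bases only test elements of \<open>V\<close> for membership in \<open>W\<close>. For
  jets this allows \<open>stalk_pow\<close> to be treated as a subspace only after intersection with
  the space of sections.\<close>

lemma quot_basis_Int:
 assumes "fsubspace V" shows "quot_basis V (V \<inter> W) = quot_basis V W"
proof (rule ext)
 fix B
 have 1: "(%s. \<Sum>b\<in>B. a b * b s) \<in> V" if "B \<subseteq> V" for a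
  using fsubspace_sum[OF assms, of B "%b. b"] that by auto
 have 2: "(%s. v s - (\<Sum>b\<in>B. a b * b s)) \<in> V" if "B \<subseteq> V" "v \<in> V" for v a
  using fsubspace_diff[OF assms that(2) 1[OF that(1)]] .
 show "quot_basis V (V \<inter> W) B = quot_basis V W B"
  unfolding quot_basis_def using 1 2 by auto
qed

lemma quot_basis_dlt:
 assumes V: "fsubspace V" and W: "fsubspace W" and B: "quot_basis V W B"
 shows "dlt V W (Suc (card B))" "\<not> dlt V W (card B)"
proof -
 have fin: "finite B" using B by (simp add: quot_basis_def)
 define n where "n = card B"
 obtain h where h: "bij_betw h {..<n} B"
  using ex_bij_betw_nat_finite[OF fin] n_def by (auto simp: atLeast0LessThan)
 have "dlt V W (Suc (0 + n))"
 proof (rule dlt_span[OF V W])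
  show "h i \<in> V" if "i < n" for i
   using that h B by (auto simp: bij_betw_def quot_basis_def)
  show "\<exists>c. (%s. v s - (\<Sum>i<n. c i * h i s)) \<in> W" if v: "v \<in> V" for v
  proof -
   obtain a where "(%s. v s - (\<Sum>b\<in>B. a b * b s)) \<in> W"
   proof -
    have "\<forall>v\<in>V. \<exists>a. (%s. v s - (\<Sum>b\<in>B. a b * b s)) \<in> W"
     using B by (simp add: quot_basis_def)
    from bspec[OF this v] show thesis using that by (elim exE)
   qed
   moreover have "(\<Sum>b\<in>B. a b * b s) = (\<Sum>i<n. (a \<circ> h) i * h i s)" for s
    using sum.reindex_bij_betw[OF h, of "%b. a b * b s"] by simp
   ultimately have "(%s. v s - (\<Sum>i<n. (a \<circ> h) i * h i s)) \<in> W" by simp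
   then show ?thesis by (rule exI[of _ "a \<circ> h"])
  qed
  show "dlt (V \<inter> W) W (Suc 0)" by (rule dlt_1) simp
 qed
 then show "dlt V W (Suc (card B))" by (simp add: n_def)
 show "\<not> dlt V W (card B)"
 proof
  assume "dlt V W (card B)"
  then obtain c where "\<exists>i\<in>B. c i ~= 0" "(%s. \<Sum>b\<in>B. c b * b s) \<in> W"
   using dlt_index[OF _ fin refl, of V W "%b. b"] B unfolding quot_basis_def by blast
  then show False using B unfolding quot_basis_def by blast
 qed
qed

lemma quot_basis_exists:
 assumes V: "fsubspace V" and W: "fsubspace W" and "dlt V W N"
 shows "\<exists>B. quot_basis V W B"
proof -
 obtain n where n: "n < N" "dlt V W (Suc n)" "\<not> dlt V W n" using dlt_exact[OF assms(3)] .
 from dlt_basis[OF V W n(2,3)] obtain w where w: "\<forall>i<n. w i \<in> V"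
  "\<forall>c. (%s. \<Sum>i<n. c i * w i s) \<in> W --> (\<forall>i<n. c i = 0)"
  "\<forall>v\<in>V. \<exists>c. (%s. v s - (\<Sum>i<n. c i * w i s)) \<in> W"
  by (elim exE conjE) (rule that)
 have inj: "inj_on w {..<n}"
 proof (rule inj_onI, rule ccontr)
  fix i j assume ij: "i \<in> {..<n}" "j \<in> {..<n}" "w i = w j" "i ~= j"
  \<comment> \<open>\<open>quot_basis\<close> speaks of a set of vectors and not of a family, so
    repetitions must be excluded: equal vectors at two indices satisfy the relation with
    coefficients 1 and -1.\<close>
  define c :: "nat => complex" where "c = (%k. if k = i then 1 else if k = j then -1 else 0)"
  have "(\<Sum>k<n. c k * w k s) = (\<Sum>k\<in>{i,j}. c k * w k s)" for s
   by (rule sum.mono_neutral_right) (use ij in \<open>auto simp: c_def\<close>)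
  then have "(\<Sum>k<n. c k * w k s) = 0" for s using ij by (simp add: c_def)
  then have "\<forall>k<n. c k = 0" using w(2)[rule_format, of c] fsubspace_zero[OF W] by simp
  then show False using ij by (auto simp: c_def)
 qed
 have s: "(\<Sum>b\<in>w ` {..<n}. a b * b s) = (\<Sum>i<n. a (w i) * w i s)" for a s
  using sum.reindex[OF inj, of "%b. a b * b s"] by simp
 have "quot_basis V W (w ` {..<n})"
  unfolding quot_basis_def s
 proof (intro conjI allI ballI impI)
  show "w ` {..<n} \<subseteq> V" using w(1) by auto
  fix a b assume "(%s. \<Sum>i<n. a (w i) * w i s) \<in> W" "b \<in> w ` {..<n}"
  then show "a b = 0" using w(2)[rule_format, of "a \<circ> w"] by auto
 next
  fix v assume "v \<in> V"
  from bspec[OF w(3) this] obtain c where c: "(%s. v s - (\<Sum>i<n. c i * w i s)) \<in> W"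
   by (elim exE)
  define a where "a = (%b. c (inv_into {..<n} w b))"
  have "(\<Sum>i<n. a (w i) * w i s) = (\<Sum>i<n. c i * w i s)" for s
   by (rule sum.cong) (auto simp: a_def inv_into_f_f[OF inj])
  then show "\<exists>a. (%s. v s - (\<Sum>i<n. a (w i) * w i s)) \<in> W" using c by (intro exI[of _ a]) simp
 qed simp
 then show ?thesis by blast
qed

text \<open>The bound by \<open>N\<close> rules out the default value 0 that \<open>quot_dim\<close>
  takes on infinite-dimensional quotients, so that the chosen basis computes the dimension.\<close>

lemma quot_dim_less_iff:
 assumes V: "fsubspace V" and W: "fsubspace (V \<inter> W)" and N: "dlt V (V \<inter> W) N"
 shows "quot_dim V W < n \<longleftrightarrow> dlt V (V \<inter> W) n"
proof -
 have ex: "\<exists>B. quot_basis V (V \<inter> W) B" using quot_basis_exists[OF V W N] .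
 define B where "B = (SOME B. quot_basis V (V \<inter> W) B)"
 have B: "quot_basis V (V \<inter> W) B" unfolding B_def using ex by (rule someI_ex)
 have "quot_dim V W = card B"
  using ex by (simp add: quot_dim_def B_def quot_basis_Int[OF V])
 then show ?thesis
  using quot_basis_dlt[OF V W B] dlt_mono[of V "V \<inter> W" "Suc (card B)" n]
   dlt_mono[of V "V \<inter> W" n "card B"] by (metis Suc_leI not_le)
qed

section \<open>Germs on spaces with functions\<close>

text \<open>A germ at \<open>p\<close> is represented by a total function regular on some
  neighbourhood, and equality of germs is agreement along \<open>nhd X p\<close>. This avoids
  carrying common neighbourhoods through every computation.\<close>

definition regat :: "'a fspace => 'a => ('a => complex) => bool" where
 "regat X p f \<longleftrightarrow> (\<exists>U. openin (zar X) U & p \<in> U & f \<in> reg X U)"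

abbreviation nhd :: "'a fspace => 'a => 'a filter" where
 "nhd X p \<equiv> nhdsin (zar X) p"

lemma eventually_nhdI:
 "openin (zar X) U ==> p \<in> U ==> (\<And>y. y \<in> U ==> P y) ==> eventually P (nhd X p)"
 by (auto simp: eventually_nhdsin)

lemma eventually_nhdE:
 assumes "eventually P (nhd X p)" "p \<in> pts X"
 obtains U where "openin (zar X) U" "p \<in> U" "\<And>y. y \<in> U ==> P y"
 using assms by (auto simp: eventually_nhdsin)

lemma eventually_nhd_self: "eventually P (nhd X p) ==> p \<in> pts X ==> P p"
 by (auto simp: eventually_nhdsin)

lemma eventually_nhd_nhd:
 assumes "eventually P (nhd X p)" shows "\<forall>\<^sub>F y in nhd X p. eventually P (nhd X y)"
 using assms by (auto simp: eventually_nhdsin)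

lemma regat_pts: "regat X p f ==> p \<in> pts X"
 by (meson openin_subset regat_def subsetD)

locale fsp =
 fixes X :: "'a fspace"
 assumes swf: "space_with_functions X"
begin

lemmas swf_clauses =
 swf[unfolded space_with_functions_def, THEN conjunct1, rule_format]
 swf[unfolded space_with_functions_def, THEN conjunct2, THEN conjunct1, rule_format]
 swf[unfolded space_with_functions_def, THEN conjunct2, THEN conjunct2, THEN conjunct1, rule_format]
 swf[unfolded space_with_functions_def, THEN conjunct2, THEN conjunct2, THEN conjunct2, THEN conjunct1, rule_format]
 swf[unfolded space_with_functions_def, THEN conjunct2, THEN conjunct2, THEN conjunct2, THEN conjunct2, THEN conjunct1, rule_format]
 swf[unfolded space_with_functions_def, THEN conjunct2, THEN conjunct2, THEN conjunct2, THEN conjunct2, THEN conjunct2, rule_format]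

lemma reg_cong: "f \<in> reg X U ==> (\<And>x. x \<in> U ==> g x = f x) ==> g \<in> reg X U"
 by (rule swf_clauses(1)) auto

lemma reg_const: "openin (zar X) U ==> (%_. c) \<in> reg X U"
 by (rule swf_clauses(2))

lemma reg_add: "openin (zar X) U ==> f \<in> reg X U ==> g \<in> reg X U ==> (%x. f x + g x) \<in> reg X U"
 by (rule swf_clauses(3)[THEN conjunct1]) auto

lemma reg_mult: "openin (zar X) U ==> f \<in> reg X U ==> g \<in> reg X U ==> (%x. f x * g x) \<in> reg X U"
 by (rule swf_clauses(3)[THEN conjunct2]) auto

lemma reg_restrict: "f \<in> reg X U ==> openin (zar X) U ==> openin (zar X) V ==> V \<subseteq> U ==> f \<in> reg X V"
 by (rule swf_clauses(4)) auto

lemma reg_Union: "(\<And>U. U \<in> \<U> ==> openin (zar X) U & f \<in> reg X U) ==> f \<in> reg X (\<Union>\<U>)"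
 by (rule swf_clauses(5)) auto

lemma reg_open: "openin (zar X) U ==> f \<in> reg X U ==> openin (zar X) {x \<in> U. f x ~= 0}"
 by (rule swf_clauses(6)[THEN conjunct1]) auto

lemma reg_inverse: "openin (zar X) U ==> f \<in> reg X U ==> (%x. 1 / f x) \<in> reg X {x \<in> U. f x ~= 0}"
 by (rule swf_clauses(6)[THEN conjunct2]) auto

lemma regatI: "openin (zar X) U ==> p \<in> U ==> f \<in> reg X U ==> regat X p f"
 by (auto simp: regat_def)

lemma reg_iff: "openin (zar X) U ==> f \<in> reg X U \<longleftrightarrow> (\<forall>p\<in>U. regat X p f)"
proof
 assume U: "openin (zar X) U" and f: "\<forall>p\<in>U. regat X p f"
 define \<U> where "\<U> = {V. openin (zar X) V & V \<subseteq> U & f \<in> reg X V}"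
 have "\<exists>V\<in>\<U>. p \<in> V" if p: "p \<in> U" for p
 proof -
  obtain V where V: "openin (zar X) V" "p \<in> V" "f \<in> reg X V" using f p by (auto simp: regat_def)
  then have "U \<inter> V \<in> \<U>" using U reg_restrict[OF V(3,1), of "U \<inter> V"] by (auto simp: \<U>_def)
  then show ?thesis using p V by blast
 qed
 then have "U = \<Union>\<U>" by (auto simp: \<U>_def)
 moreover have "f \<in> reg X (\<Union>\<U>)" by (rule reg_Union) (auto simp: \<U>_def)
 ultimately show "f \<in> reg X U" by simp
qed (auto simp: regat_def)

lemma regat_ev: "regat X p f ==> \<forall>\<^sub>F y in nhd X p. regat X y f"
 unfolding regat_def by (auto simp: eventually_nhdsin)

lemma regat_cong:
 assumes "regat X p f" "\<forall>\<^sub>F y in nhd X p. g y = f y" shows "regat X p g"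
proof -
 obtain U where U: "openin (zar X) U" "p \<in> U" "f \<in> reg X U" using assms(1) by (auto simp: regat_def)
 obtain V where V: "openin (zar X) V" "p \<in> V" "\<And>y. y \<in> V ==> g y = f y"
  using eventually_nhdE[OF assms(2) regat_pts[OF assms(1)]] by blast
 have "f \<in> reg X (U \<inter> V)" using reg_restrict[OF U(3,1), of "U \<inter> V"] U V by auto
 then have "g \<in> reg X (U \<inter> V)" by (rule reg_cong) (use V in auto)
 then show ?thesis using U V by (auto simp: regat_def)
qed

lemma regat_common:
 assumes "regat X p f" "regat X p g"
 obtains U where "openin (zar X) U" "p \<in> U" "f \<in> reg X U" "g \<in> reg X U"
proof -
 obtain U where U: "openin (zar X) U" "p \<in> U" "f \<in> reg X U" using assms(1) by (auto simp: regat_def)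
 obtain V where V: "openin (zar X) V" "p \<in> V" "g \<in> reg X V" using assms(2) by (auto simp: regat_def)
 show thesis
  by (rule that[of "U \<inter> V"]) (use U V reg_restrict[of f U "U \<inter> V"] reg_restrict[of g V "U \<inter> V"] in auto)
qed

lemma regat_const: "p \<in> pts X ==> regat X p (%_. c)"
 by (rule regatI[of "pts X"]) (auto intro: reg_const)

lemma regat_add: "regat X p f ==> regat X p g ==> regat X p (%x. f x + g x)"
 by (erule (1) regat_common) (auto intro: regatI reg_add)

lemma regat_mult: "regat X p f ==> regat X p g ==> regat X p (%x. f x * g x)"
 by (erule (1) regat_common) (auto intro: regatI reg_mult)

lemma regat_scale: "regat X p f ==> regat X p (%x. c * f x)"
 by (rule regat_mult[OF regat_const[OF regat_pts]])

lemma regat_diff: "regat X p f ==> regat X p g ==> regat X p (%x. f x - g x)"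
 using regat_add[OF _ regat_scale[of p g "-1"], of f] by simp

lemma regat_uminus: "regat X p f ==> regat X p (%x. - f x)"
 using regat_scale[of p f "-1"] by simp

lemma regat_sum: "p \<in> pts X ==> (\<And>i. i \<in> I ==> regat X p (f i)) ==> regat X p (%x. \<Sum>i\<in>I. f i x)"
 by (induction I rule: infinite_finite_induct) (auto intro: regat_const regat_add)

lemma regat_prod: "p \<in> pts X ==> (\<And>i. i \<in> I ==> regat X p (f i)) ==> regat X p (%x. \<Prod>i\<in>I. f i x)"
 by (induction I rule: infinite_finite_induct) (auto intro: regat_const regat_mult)

lemma regat_power: "regat X p f ==> regat X p (%x. f x ^ n)"
 by (induction n) (auto intro: regat_const regat_mult regat_pts)

lemma regat_nz:
 assumes "regat X p f" "f p ~= 0" shows "\<forall>\<^sub>F y in nhd X p. f y ~= 0"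
proof -
 obtain U where U: "openin (zar X) U" "p \<in> U" "f \<in> reg X U" using assms(1) by (auto simp: regat_def)
 show ?thesis by (rule eventually_nhdI[OF reg_open[OF U(1,3)]]) (use U assms in auto)
qed

lemma regat_inverse:
 assumes "regat X p f" "f p ~= 0" shows "regat X p (%x. 1 / f x)"
proof -
 obtain U where U: "openin (zar X) U" "p \<in> U" "f \<in> reg X U" using assms(1) by (auto simp: regat_def)
 show ?thesis by (rule regatI[OF reg_open[OF U(1,3)] _ reg_inverse[OF U(1,3)]]) (use U assms in auto)
qed

lemma regat_divide: "regat X p f ==> regat X p g ==> g p ~= 0 ==> regat X p (%x. f x / g x)"
 using regat_mult[OF _ regat_inverse, of p f g] by simp

lemma regat_powi: "regat X p f ==> f p ~= 0 ==> regat X p (%x. f x powi k)"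
 by (cases "k \<ge> 0") (auto simp: power_int_def intro: regat_power
   dest: regat_power[OF regat_inverse] simp flip: power_inverse inverse_eq_divide)

text \<open>\<open>G y t\<close> reads that \<open>t\<close> solves some local problem near
  \<open>y\<close>. Taking at each point the value of any solution there gives a function that
  agrees near \<open>y\<close> with every solution at \<open>y\<close>, because the values of
  solutions are unique.\<close>

lemma glue:
 assumes V: "openin (zar X) V"
  and ex: "\<And>y. y \<in> V ==> \<exists>t. G y t"
  and reg: "\<And>y t. y \<in> V ==> G y t ==> regat X y t"
  and ev: "\<And>y t. y \<in> V ==> G y t ==> \<forall>\<^sub>F y' in nhd X y. G y' t"
  and uniq: "\<And>y t t'. y \<in> V ==> G y t ==> G y t' ==> t y = t' y"
 obtains T where "T \<in> reg X V" "\<And>y t. y \<in> V ==> G y t ==> T y = t y"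
proof -
 define T where "T = (%y. (SOME t. G y t) y)"
 have T: "T y = t y" if "y \<in> V" "G y t" for y t
  unfolding T_def by (rule uniq[OF that(1) someI_ex[OF ex[OF that(1)]] that(2)])
 have "regat X y T" if y: "y \<in> V" for y
 proof -
  obtain t where t: "G y t" using ex y by blast
  have "\<forall>\<^sub>F y' in nhd X y. y' \<in> V" using V y by (auto simp: eventually_nhdsin)
  then have "\<forall>\<^sub>F y' in nhd X y. T y' = t y'" using ev[OF y t]
   by eventually_elim (rule T)
  then show ?thesis by (rule regat_cong[OF reg[OF y t]])
 qed
 then show thesis using that T reg_iff[OF V] by blast
qed

text \<open>Finitely many germs are regular on a common neighbourhood, so the open set in
  \<open>max_ideal_pow\<close> can be replaced by conditions at \<open>x\<close> and an equation
  along \<open>nhd X x\<close>.\<close>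

lemma max_ideal_pow_iff:
 assumes x: "x \<in> pts X"
 shows "f \<in> max_ideal_pow X x k \<longleftrightarrow> (\<exists>(N::nat) a h.
  (\<forall>j<N. regat X x (a j) & (\<forall>i<k. regat X x (h j i) & h j i x = 0)) &
  (\<forall>\<^sub>F y in nhd X x. f y = (\<Sum>j<N. a j y * (\<Prod>i<k. h j i y))))" (is "_ \<longleftrightarrow> ?R")
proof
 assume "f \<in> max_ideal_pow X x k"
 then obtain U N a h where *: "openin (zar X) U" "x \<in> U"
  "\<forall>j<(N::nat). a j \<in> reg X U & (\<forall>i<k. h j i \<in> reg X U & h j i x = 0)"
  "\<forall>y\<in>U. f y = (\<Sum>j<N. a j y * (\<Prod>i<k. h j i y))" unfolding max_ideal_pow_def by blast
 have "\<forall>j<N. regat X x (a j) & (\<forall>i<k. regat X x (h j i) & h j i x = 0)"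
  using * by (auto intro: regatI)
 moreover have "\<forall>\<^sub>F y in nhd X x. f y = (\<Sum>j<N. a j y * (\<Prod>i<k. h j i y))"
  by (rule eventually_nhdI[OF *(1,2)]) (use * in auto)
 ultimately show ?R by blast
next
 assume ?R
 then obtain N a h where *:
  "\<forall>j<(N::nat). regat X x (a j) & (\<forall>i<k. regat X x (h j i) & h j i x = 0)"
  "\<forall>\<^sub>F y in nhd X x. f y = (\<Sum>j<N. a j y * (\<Prod>i<k. h j i y))" by blast
 have "\<forall>\<^sub>F y in nhd X x. \<forall>j\<in>{..<N}. regat X y (a j)"
  using *(1) by (intro eventually_ball_finite) (auto intro: regat_ev)
 moreover have "\<forall>\<^sub>F y in nhd X x. \<forall>j\<in>{..<N}. \<forall>i\<in>{..<k}. regat X y (h j i)"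
  using *(1) by (intro eventually_ball_finite ballI) (auto intro: regat_ev)
 ultimately have "\<forall>\<^sub>F y in nhd X x. (\<forall>j<N. regat X y (a j)) & (\<forall>j<N. \<forall>i<k. regat X y (h j i)) &
   f y = (\<Sum>j<N. a j y * (\<Prod>i<k. h j i y))" using *(2)
  by eventually_elim auto
 then obtain U where U: "openin (zar X) U" "x \<in> U" and
  "\<forall>y\<in>U. (\<forall>j<N. regat X y (a j)) & (\<forall>j<N. \<forall>i<k. regat X y (h j i)) &
   f y = (\<Sum>j<N. a j y * (\<Prod>i<k. h j i y))" using x unfolding eventually_nhdsin by blast
 then show "f \<in> max_ideal_pow X x k" unfolding max_ideal_pow_def
  using *(1) reg_iff[OF U(1)] by (intro CollectI exI[of _ U] exI[of _ N] exI[of _ a] exI[of _ h]) auto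
qed

lemma max_ideal_pow_regat:
 assumes "f \<in> max_ideal_pow X x k" "x \<in> pts X" shows "regat X x f"
proof -
 obtain N a h where *:
  "\<forall>j<(N::nat). regat X x (a j) & (\<forall>i<k. regat X x (h j i) & h j i x = 0)"
  "\<forall>\<^sub>F y in nhd X x. f y = (\<Sum>j<N. a j y * (\<Prod>i<k. h j i y))"
  using assms max_ideal_pow_iff by blast
 show ?thesis
  by (rule regat_cong[OF _ *(2)])
   (use * assms(2) in \<open>auto intro!: regat_sum regat_mult regat_prod\<close>)
qed

lemma max_ideal_pow_cong:
 assumes "f \<in> max_ideal_pow X x k" "x \<in> pts X" "\<forall>\<^sub>F y in nhd X x. g y = f y"
 shows "g \<in> max_ideal_pow X x k"
proof -
 obtain N a h where *:
  "\<forall>j<(N::nat). regat X x (a j) & (\<forall>i<k. regat X x (h j i) & h j i x = 0)"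
  "\<forall>\<^sub>F y in nhd X x. f y = (\<Sum>j<N. a j y * (\<Prod>i<k. h j i y))"
  using assms max_ideal_pow_iff by blast
 have "\<forall>\<^sub>F y in nhd X x. g y = (\<Sum>j<N. a j y * (\<Prod>i<k. h j i y))"
  using *(2) assms(3) by eventually_elim simp
 then show ?thesis using * max_ideal_pow_iff[OF assms(2)] by blast
qed

lemma max_ideal_pow_mult:
 assumes "f \<in> max_ideal_pow X x k" "x \<in> pts X" "regat X x g"
 shows "(%y. g y * f y) \<in> max_ideal_pow X x k"
proof -
 obtain N a h where *:
  "\<forall>j<(N::nat). regat X x (a j) & (\<forall>i<k. regat X x (h j i) & h j i x = 0)"
  "\<forall>\<^sub>F y in nhd X x. f y = (\<Sum>j<N. a j y * (\<Prod>i<k. h j i y))"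
  using assms max_ideal_pow_iff by blast
 have "\<forall>\<^sub>F y in nhd X x. g y * f y = (\<Sum>j<N. (g y * a j y) * (\<Prod>i<k. h j i y))"
  using *(2) by eventually_elim (simp add: sum_distrib_left mult.assoc)
 moreover have "\<forall>j<N. regat X x (%y. g y * a j y) & (\<forall>i<k. regat X x (h j i) & h j i x = 0)"
  using *(1) assms(3) by (auto intro: regat_mult)
 ultimately show ?thesis unfolding max_ideal_pow_iff[OF assms(2)]
  by (intro exI[of _ N] exI[of _ "%j y. g y * a j y"] exI[of _ h]) simp
qed

lemma max_ideal_pow_add:
 assumes "f \<in> max_ideal_pow X x k" "g \<in> max_ideal_pow X x k" "x \<in> pts X"
 shows "(%y. f y + g y) \<in> max_ideal_pow X x k"
proof -
 obtain N a h where *: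
  "\<forall>j<(N::nat). regat X x (a j) & (\<forall>i<k. regat X x (h j i) & h j i x = 0)"
  "\<forall>\<^sub>F y in nhd X x. f y = (\<Sum>j<N. a j y * (\<Prod>i<k. h j i y))"
  using assms max_ideal_pow_iff by blast
 obtain N' a' h' where **:
  "\<forall>j<(N'::nat). regat X x (a' j) & (\<forall>i<k. regat X x (h' j i) & h' j i x = 0)"
  "\<forall>\<^sub>F y in nhd X x. g y = (\<Sum>j<N'. a' j y * (\<Prod>i<k. h' j i y))"
  using assms max_ideal_pow_iff by blast
 define a'' where "a'' = (%j. if j < N then a j else a' (j - N))"
 define h'' where "h'' = (%j. if j < N then h j else h' (j - N))"
 have s: "(\<Sum>j<N+N'. a'' j y * (\<Prod>i<k. h'' j i y)) = (\<Sum>j<N. a j y * (\<Prod>i<k. h j i y)) + (\<Sum>j<N'. a' j y * (\<Prod>i<k. h' j i y))" for y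
  unfolding a''_def h''_def
  by (induction N') simp_all
 have "\<forall>\<^sub>F y in nhd X x. f y + g y = (\<Sum>j<N+N'. a'' j y * (\<Prod>i<k. h'' j i y))"
  using *(2) **(2) by eventually_elim (simp add: s)
 moreover have "\<forall>j<N+N'. regat X x (a'' j) & (\<forall>i<k. regat X x (h'' j i) & h'' j i x = 0)"
  using *(1) **(1) by (auto simp: a''_def h''_def)
 ultimately show ?thesis unfolding max_ideal_pow_iff[OF assms(3)] by blast
qed

lemma max_ideal_pow_prod:
 assumes "regat X x a" "\<And>i. i < k ==> regat X x (h i)" "\<And>i. i < k ==> h i x = 0"
 shows "(%y. a y * (\<Prod>i<k. h i y)) \<in> max_ideal_pow X x k"
 unfolding max_ideal_pow_iff[OF regat_pts[OF assms(1)]]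
 by (rule exI[of _ 1], rule exI[of _ "%_. a"], rule exI[of _ "%_. h"]) (use assms in simp)

lemma max_ideal_pow_power:
 assumes "regat X x a" "regat X x z" "z x = 0"
 shows "(%y. a y * z y ^ k) \<in> max_ideal_pow X x k"
 using max_ideal_pow_prod[of x a k "%_. z"] assms by simp

lemma max_ideal_pow_0_iff: "x \<in> pts X ==> f \<in> max_ideal_pow X x 0 \<longleftrightarrow> regat X x f"
 using max_ideal_pow_regat[of f x 0] max_ideal_pow_prod[of x f 0] by auto

lemma max_ideal_pow_1_iff:
 assumes "x \<in> pts X" shows "f \<in> max_ideal_pow X x (Suc 0) \<longleftrightarrow> regat X x f & f x = 0"
proof
 assume f: "f \<in> max_ideal_pow X x (Suc 0)"
 then obtain N a h where *:
  "\<forall>j<(N::nat). regat X x (a j) & (\<forall>i<Suc 0. regat X x (h j i) & h j i x = 0)"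
  "\<forall>\<^sub>F y in nhd X x. f y = (\<Sum>j<N. a j y * (\<Prod>i<Suc 0. h j i y))"
  using assms max_ideal_pow_iff by blast
 have "f x = 0" using eventually_nhd_self[OF *(2) assms] *(1) by simp
 then show "regat X x f & f x = 0" using max_ideal_pow_regat[OF f assms] by simp
next
 assume "regat X x f & f x = 0"
 then show "f \<in> max_ideal_pow X x (Suc 0)"
  using max_ideal_pow_prod[OF regat_const[OF assms, of 1], of "Suc 0" "%_. f"] by simp
qed

text \<open>When \<open>Z\<close> is open, a local extension of \<open>f\<close> coincides with
  \<open>f\<close> on a smaller open set, and regularity is a local property.\<close>

lemma regat_sub_fspace:
 assumes Z: "openin (zar X) Z" and W: "openin (zar X) W" "W \<subseteq> Z"
 shows "f \<in> reg (sub_fspace X Z) W \<longleftrightarrow> f \<in> reg X W"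
proof
 assume "f \<in> reg (sub_fspace X Z) W"
 then have *: "\<exists>U g. openin (zar X) U & x \<in> U & g \<in> reg X U & (\<forall>y\<in>U \<inter> W. f y = g y)"
  if "x \<in> W" for x using that by (auto simp: sub_fspace_def)
 show "f \<in> reg X W" unfolding reg_iff[OF W(1)]
 proof
  fix x assume x: "x \<in> W"
  then obtain U g where U: "openin (zar X) U" "x \<in> U" "g \<in> reg X U" "\<forall>y\<in>U \<inter> W. f y = g y"
   using * by blast
  have "\<forall>\<^sub>F y in nhd X x. f y = g y"
   by (rule eventually_nhdI[of _ "U \<inter> W"]) (use U W x in auto)
  then show "regat X x f" using regat_cong[OF regatI[OF U(1-3)]] by blast
 qed
next
 assume "f \<in> reg X W"
 then show "f \<in> reg (sub_fspace X Z) W" using W by (auto simp: sub_fspace_def)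
qed

lemma openin_sub_fspace:
 "openin (zar X) Z ==> openin (zar (sub_fspace X Z)) W \<longleftrightarrow> openin (zar X) W & W \<subseteq> Z"
 by (simp add: sub_fspace_def openin_open_subtopology)

lemma swf_sub_fspace:
 assumes Z: "openin (zar X) Z" shows "space_with_functions (sub_fspace X Z)"
proof -
 note o = openin_sub_fspace[OF Z] and r = regat_sub_fspace[OF Z]
 show ?thesis unfolding space_with_functions_def
 proof (intro conjI allI impI)
  fix U f g assume "f \<in> reg (sub_fspace X Z) U & (\<forall>x\<in>U. g x = f x)"
  then show "g \<in> reg (sub_fspace X Z) U" unfolding sub_fspace_def by simp
 next
  fix \<U> f assume *: "\<forall>U\<in>\<U>. openin (zar (sub_fspace X Z)) U & f \<in> reg (sub_fspace X Z) U"
  have "openin (zar X) U & f \<in> reg X U" if "U \<in> \<U>" for U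
   using bspec[OF * that] r[of U f] unfolding o by simp
  then have "f \<in> reg X (\<Union>\<U>)" by (rule reg_Union)
  moreover have "openin (zar X) (\<Union>\<U>)" "\<Union>\<U> \<subseteq> Z" using * by (auto simp: o)
  ultimately show "f \<in> reg (sub_fspace X Z) (\<Union>\<U>)" by (simp add: r)
 next
  fix U V f assume "openin (zar (sub_fspace X Z)) U & openin (zar (sub_fspace X Z)) V & V \<subseteq> U & f \<in> reg (sub_fspace X Z) U"
  then show "f \<in> reg (sub_fspace X Z) V" by (auto simp: o r intro: reg_restrict)
 next
  fix U f assume *: "openin (zar (sub_fspace X Z)) U & f \<in> reg (sub_fspace X Z) U"
  then have *: "openin (zar X) U" "f \<in> reg X U" "U \<subseteq> Z" by (auto simp: o r)
  then show "openin (zar (sub_fspace X Z)) {x \<in> U. f x ~= 0}" by (auto simp: o intro: reg_open)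
  show "(%x. 1 / f x) \<in> reg (sub_fspace X Z) {x \<in> U. f x ~= 0}"
   using reg_inverse[OF *(1,2)] reg_open[OF *(1,2)] *(3) by (subst r) auto
 qed (auto simp: o r intro: reg_const reg_add reg_mult)
qed

end

lemma topspace_quotient_fspace: "pts (quotient_fspace X \<phi>) = \<phi> ` pts X"
proof -
 have "openin (zar (quotient_fspace X \<phi>)) (\<phi> ` pts X)"
  unfolding openin_quotient_fspace by (simp cong: conj_cong)
 moreover have "U \<subseteq> \<phi> ` pts X" if "openin (zar (quotient_fspace X \<phi>)) U" for U
  using that unfolding openin_quotient_fspace by simp
 ultimately show ?thesis by (metis openin_subset openin_topspace subset_antisym)
qed

lemma reg_quotient_fspace: "f \<in> reg (quotient_fspace X \<phi>) U \<longleftrightarrow> f \<circ> \<phi> \<in> reg X {x \<in> pts X. \<phi> x \<in> U}"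
 by (simp add: quotient_fspace_def)

lemma (in fsp) swf_quotient_fspace: "space_with_functions (quotient_fspace X \<phi>)"
proof -
 let ?P = "%U. {x \<in> pts X. \<phi> x \<in> U}"
 note o = openin_quotient_fspace[of X \<phi>] and r = reg_quotient_fspace[of _ X \<phi>]
 show ?thesis unfolding space_with_functions_def
 proof (intro conjI allI impI)
  fix U f g assume "f \<in> reg (quotient_fspace X \<phi>) U & (\<forall>x\<in>U. g x = f x)"
  then show "g \<in> reg (quotient_fspace X \<phi>) U"
   unfolding r using reg_cong[of "f \<circ> \<phi>" "?P U" "g \<circ> \<phi>"] by simp
 next
  fix U c assume "openin (zar (quotient_fspace X \<phi>)) U"
  then show "(%_. c) \<in> reg (quotient_fspace X \<phi>) U" unfolding r o by (simp add: o_def reg_const)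
 next
  fix U f g assume "openin (zar (quotient_fspace X \<phi>)) U & f \<in> reg (quotient_fspace X \<phi>) U & g \<in> reg (quotient_fspace X \<phi>) U"
  then show "(%x. f x + g x) \<in> reg (quotient_fspace X \<phi>) U" "(%x. f x * g x) \<in> reg (quotient_fspace X \<phi>) U"
   unfolding r o using reg_add[of "?P U" "f \<circ> \<phi>" "g \<circ> \<phi>"] reg_mult[of "?P U" "f \<circ> \<phi>" "g \<circ> \<phi>"]
   by (simp_all add: comp_def)
 next
  fix U V f assume "openin (zar (quotient_fspace X \<phi>)) U & openin (zar (quotient_fspace X \<phi>)) V & V \<subseteq> U & f \<in> reg (quotient_fspace X \<phi>) U"
  then show "f \<in> reg (quotient_fspace X \<phi>) V" unfolding r o by (auto intro: reg_restrict)
 next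
  fix \<U> f assume *: "\<forall>U\<in>\<U>. openin (zar (quotient_fspace X \<phi>)) U & f \<in> reg (quotient_fspace X \<phi>) U"
  have "f \<circ> \<phi> \<in> reg X (\<Union>(?P ` \<U>))" by (rule reg_Union) (use * in \<open>auto simp: r o\<close>)
  also have "\<Union>(?P ` \<U>) = ?P (\<Union>\<U>)" by auto
  finally show "f \<in> reg (quotient_fspace X \<phi>) (\<Union>\<U>)" unfolding r .
 next
  fix U f assume *: "openin (zar (quotient_fspace X \<phi>)) U & f \<in> reg (quotient_fspace X \<phi>) U"
  have eq: "?P {x \<in> U. f x ~= 0} = {x \<in> ?P U. (f \<circ> \<phi>) x ~= 0}" by auto
  show "openin (zar (quotient_fspace X \<phi>)) {x \<in> U. f x ~= 0}"
   unfolding o eq using * reg_open[of "?P U" "f \<circ> \<phi>"] by (auto simp: o r)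
  have "(%x. 1 / (f \<circ> \<phi>) x) \<in> reg X {x \<in> ?P U. (f \<circ> \<phi>) x ~= 0}"
   by (rule reg_inverse) (use *[unfolded o r] in blast)+
  then show "(%x. 1 / f x) \<in> reg (quotient_fspace X \<phi>) {x \<in> U. f x ~= 0}"
   unfolding r eq by (simp add: o_def)
 qed
qed

section \<open>Irreducible spaces\<close>

text \<open>The filter generated by the nonempty open sets. On an irreducible space it plays the
  part of the generic point: a rational function is a total function up to agreement along this
  filter.\<close>

definition generic :: "'a fspace => 'a filter" where
 "generic X = (INF U\<in>{U. openin (zar X) U & U ~= {}}. principal U)"

locale irr_fsp = fsp +
 assumes nonempty: "pts X ~= {}"
  and opens_meet: "openin (zar X) U ==> openin (zar X) V ==> U ~= {} ==> V ~= {} ==> U \<inter> V ~= {}"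
begin

lemma eventually_generic:
 "eventually P (generic X) \<longleftrightarrow> (\<exists>U. openin (zar X) U & U ~= {} & (\<forall>y\<in>U. P y))"
 unfolding generic_def
proof (subst eventually_INF_base)
 show "{U. openin (zar X) U & U ~= {}} ~= {}" using nonempty openin_topspace by blast
 show "\<exists>x\<in>{U. openin (zar X) U & U ~= {}}. principal x \<le> inf (principal a) (principal b)"
  if "a \<in> {U. openin (zar X) U & U ~= {}}" "b \<in> {U. openin (zar X) U & U ~= {}}" for a b
  using that opens_meet[of a b] by (intro bexI[of _ "a \<inter> b"]) auto
qed (auto simp: eventually_principal)

lemma generic_not_bot: "generic X ~= bot"
 using eventually_generic[of "%_. False"] by (auto simp: trivial_limit_def)

lemma eventually_genericI: "openin (zar X) U ==> U ~= {} ==> (\<And>y. y \<in> U ==> P y) ==> eventually P (generic X)"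
 by (auto simp: eventually_generic)

lemma eventually_nhd_generic: "eventually P (nhd X p) ==> p \<in> pts X ==> eventually P (generic X)"
 by (auto simp: eventually_generic eventually_nhdsin)

lemma eventually_generic_obtain:
 assumes "eventually P (generic X)" obtains y where "y \<in> pts X" "P y"
 using assms openin_subset by (fastforce simp: eventually_generic)

text \<open>The locus where the difference is nonzero is open; if it were nonempty near
  \<open>p\<close> it would be generic, against the generic agreement.\<close>

lemma identity_nhd:
 assumes "regat X p f" "regat X p g" "\<forall>\<^sub>F y in generic X. f y = g y"
 shows "\<forall>\<^sub>F y in nhd X p. f y = g y"
proof -
 obtain U where U: "openin (zar X) U" "p \<in> U" "(%y. f y - g y) \<in> reg X U"
  using regat_diff[OF assms(1,2)] by (auto simp: regat_def)
 have "\<not> (\<exists>y\<in>U. f y ~= g y)"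
 proof
  assume "\<exists>y\<in>U. f y ~= g y"
  then have "\<forall>\<^sub>F y in generic X. f y - g y ~= 0"
   by (intro eventually_genericI[OF reg_open[OF U(1,3)]]) auto
  then have "\<forall>\<^sub>F y in generic X. False" using assms(3) by eventually_elim simp
  then show False using generic_not_bot by (simp add: trivial_limit_def)
 qed
 then show ?thesis using U by (auto intro: eventually_nhdI)
qed

lemma identity_at:
 assumes "regat X p f" "regat X p g" "\<forall>\<^sub>F y in generic X. f y = g y" shows "f p = g p"
 using eventually_nhd_self[OF identity_nhd[OF assms] regat_pts[OF assms(1)]] .

lemma generic_nz:
 assumes "regat X p f" "f p ~= 0" shows "\<forall>\<^sub>F y in generic X. f y ~= 0"
 using eventually_nhd_generic[OF regat_nz[OF assms] regat_pts[OF assms(1)]] .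

lemma generic_dichotomy:
 assumes "regat X p f"
 shows "(\<forall>\<^sub>F y in nhd X p. f y = 0) \<or> (\<forall>\<^sub>F y in generic X. f y ~= 0)"
proof -
 obtain U where U: "openin (zar X) U" "p \<in> U" "f \<in> reg X U" using assms by (auto simp: regat_def)
 show ?thesis
 proof (cases "\<forall>y\<in>U. f y = 0")
  case True then show ?thesis using U by (auto intro: eventually_nhdI)
 next
  case False then show ?thesis
   by (intro disjI2 eventually_genericI[OF reg_open[OF U(1,3)]]) auto
 qed
qed

text \<open>Local quotients by \<open>h\<close> agree where \<open>h\<close> is nonzero, hence
  generically, hence wherever both are regular; so they glue. This turns divisibility of germs into
  the clause of \<open>generates_ideal\<close> about open sets.\<close>

lemma divides_local_global:
 assumes V: "openin (zar X) V" and h: "\<forall>\<^sub>F y in generic X. h y ~= 0"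
  and loc: "\<And>y. y \<in> V ==> \<exists>a. regat X y a & (\<forall>\<^sub>F y' in nhd X y. f y' = a y' * h y')"
 shows "\<exists>a\<in>reg X V. \<forall>y\<in>V. f y = a y * h y"
proof -
 define G where "G = (%y a. regat X y a & (\<forall>\<^sub>F y' in nhd X y. f y' = a y' * h y'))"
 obtain T where T: "T \<in> reg X V" "\<And>y t. y \<in> V ==> G y t ==> T y = t y"
 proof (rule glue[OF V, of G])
  show "\<exists>t. G y t" if "y \<in> V" for y using loc[OF that] by (auto simp: G_def)
  show "regat X y t" if "G y t" for y t using that by (simp add: G_def)
  show "\<forall>\<^sub>F y' in nhd X y. G y' t" if "G y t" for y t
   using that eventually_nhd_nhd[of "%y'. f y' = t y' * h y'"] regat_ev[of y t]
   unfolding G_def by (auto intro: eventually_conj)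
  fix y t t' assume y: "y \<in> V" and g: "G y t" "G y t'"
  then have "y \<in> pts X" by (auto simp: G_def intro: regat_pts)
  then have "\<forall>\<^sub>F y' in generic X. f y' = t y' * h y'" "\<forall>\<^sub>F y' in generic X. f y' = t' y' * h y'"
   using g by (auto simp: G_def intro: eventually_nhd_generic)
  then have "\<forall>\<^sub>F y' in generic X. t y' = t' y'" using h by eventually_elim auto
  then show "t y = t' y" using g by (intro identity_at) (auto simp: G_def)
 qed (use that in blast)
 have "f y = T y * h y" if y: "y \<in> V" for y
 proof -
  obtain a where a: "G y a" using loc[OF y] by (auto simp: G_def)
  then have "f y = a y * h y"
   unfolding G_def by (elim conjE) (rule eventually_nhd_self, assumption, rule regat_pts)
  then show ?thesis using T(2)[OF y a] by simp
 qed
 then show ?thesis using T(1) by blast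
qed

text \<open>Two generators of the same ideal divide each other, and cancelling \<open>h\<close>
  generically shows that the two quotients are inverse germs.\<close>

lemma generates_ideal_unit:
 assumes h: "generates_ideal X Y U h" and h': "generates_ideal X Y U' h'"
  and U: "openin (zar X) U" "openin (zar X) U'" "y \<in> U" "y \<in> U'"
  and nz: "\<forall>\<^sub>F y in generic X. h y ~= 0"
 obtains a where "regat X y a" "a y ~= 0" "\<forall>\<^sub>F y' in nhd X y. h' y' = a y' * h y'"
proof -
 let ?V = "U \<inter> U'"
 have V: "openin (zar X) ?V" "y \<in> ?V" using U by auto
 have "h' \<in> reg X ?V" "\<forall>y\<in>?V \<inter> Y. h' y = 0"
  using h' V U reg_restrict[of h' U' ?V] by (auto simp: generates_ideal_def)
 then obtain a where a: "a \<in> reg X ?V" "\<forall>y\<in>?V. h' y = a y * h y"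
  using h V unfolding generates_ideal_def by (elim conjE) (drule spec[of _ ?V], drule spec[of _ h'], auto)
 have "h \<in> reg X ?V" "\<forall>y\<in>?V \<inter> Y. h y = 0"
  using h V U reg_restrict[of h U ?V] by (auto simp: generates_ideal_def)
 then obtain b where b: "b \<in> reg X ?V" "\<forall>y\<in>?V. h y = b y * h' y"
  using h' V unfolding generates_ideal_def by (elim conjE) (drule spec[of _ ?V], drule spec[of _ h], auto)
 have ra: "regat X y a" "regat X y b" using a b V by (auto intro: regatI)
 have "\<forall>\<^sub>F y in generic X. y \<in> ?V" by (rule eventually_genericI[OF V(1)]) (use V in auto)
 then have "\<forall>\<^sub>F y in generic X. b y * a y = 1"
  using nz by eventually_elim (use a b in \<open>metis mult.assoc mult_cancel_right1\<close>)
 then have "b y * a y = 1"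
  by (intro identity_at[of y "%y. b y * a y" "%_. 1"] regat_mult ra regat_const regat_pts[OF ra(1)])
 then have "a y ~= 0" by auto
 moreover have "\<forall>\<^sub>F y' in nhd X y. h' y' = a y' * h y'" by (rule eventually_nhdI[OF V]) (use a in auto)
 ultimately show thesis using that ra by blast
qed

end

text \<open>Appending \<open>f0\<close> to a family in \<open>V0\<close> produces a relation in
  which \<open>f0\<close> has coefficient zero, since \<open>Z\<close> lies in \<open>V0\<close>.
  Thus an element outside \<open>V0\<close> makes the dimension of \<open>V\<close> strictly
  larger.\<close>

lemma dlt_extra:
 assumes V0: "fsubspace V0" and Z: "Z \<subseteq> V0" "fsubspace Z" and f0: "f0 \<in> V" "f0 \<notin> V0"
  and sub: "V0 \<subseteq> V" and d: "dlt V Z (Suc n)"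
 shows "dlt V0 Z n"
 unfolding dlt_def
proof (intro allI impI)
 fix v assume v: "\<forall>i<n. v i \<in> V0"
 define u where "u = (%i. if i = n then f0 else v i)"
 have "\<forall>i<Suc n. u i \<in> V" using v f0 sub by (auto simp: u_def less_Suc_eq)
 then obtain c where c: "\<exists>i<Suc n. c i ~= 0" "(%s. \<Sum>i<Suc n. c i * u i s) \<in> Z"
  using d[unfolded dlt_def, rule_format, of u] by auto
 have c2: "(%s. (\<Sum>i<n. c i * v i s) + c n * f0 s) \<in> Z" using c(2) by (simp add: u_def)
 have S: "(%s. \<Sum>i<n. c i * v i s) \<in> V0" by (rule fsubspace_sum[OF V0]) (use v in auto)
 have "c n = 0"
 proof (rule ccontr)
  assume cn: "c n ~= 0"
  have "(%s. ((\<Sum>i<n. c i * v i s) + c n * f0 s) - (\<Sum>i<n. c i * v i s)) \<in> V0"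
   by (rule fsubspace_diff[OF V0 _ S]) (use c2 Z in auto)
  then have "(%s. c n * f0 s) \<in> V0" by simp
  from fsubspace_scale[OF V0 this, of "1 / c n"] show False using cn f0 by simp
 qed
 then show "\<exists>c. (\<exists>i<n. c i ~= 0) & (%s. \<Sum>i<n. c i * v i s) \<in> Z"
  using c c2 by (intro exI[of _ c]) (auto simp: less_Suc_eq)
qed

section \<open>Curves and orders of vanishing\<close>

definition uniformizer :: "'c fspace => 'c => ('c => complex) => bool" where
 "uniformizer C p z \<longleftrightarrow> regat C p z & z p = 0 & (\<forall>\<^sub>F y in generic C. z y ~= 0) &
  (\<forall>f. regat C p f & f p = 0 --> (\<exists>g. regat C p g & (\<forall>\<^sub>F y in nhd C p. f y = g y * z y)))"

text \<open>The facts about a smooth projective curve on which the divisor theory rests: the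
  cofinite topology, discrete valuation rings as local rings, and one function field common to all
  points (\<open>fraction\<close>). They are derived from the projective embedding further
  on.\<close>

locale curve = irr_fsp C for C :: "'c fspace" +
 assumes cofinite: "openin (zar C) U ==> U ~= {} ==> finite (pts C - U)"
  and points_closed: "p \<in> pts C ==> openin (zar C) (pts C - {p})"
  and not_open: "p \<in> pts C ==> \<not> openin (zar C) {p}"
  and uniformizer_exists: "p \<in> pts C ==> \<exists>z. uniformizer C p z"
  and dvr: "regat C p f ==> uniformizer C p z ==> (\<forall>\<^sub>F y in nhd C p. f y = 0) \<or>
   (\<exists>k g. regat C p g & g p ~= 0 & (\<forall>\<^sub>F y in nhd C p. f y = g y * z y ^ k))"
  and fraction: "openin (zar C) W ==> W ~= {} ==> f \<in> reg C W ==> p \<in> pts C ==>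
   \<exists>a b. regat C p a & regat C p b & (\<forall>\<^sub>F y in generic C. b y ~= 0 & f y = a y / b y)"
begin

definition zz :: "'c => 'c => complex" where
 "zz p = (SOME z. uniformizer C p z)"

lemma uniformizer_zz: "p \<in> pts C ==> uniformizer C p (zz p)"
 unfolding zz_def by (rule someI_ex[OF uniformizer_exists])

lemma zz_regat: "p \<in> pts C ==> regat C p (zz p)"
 and zz_zero: "p \<in> pts C ==> zz p p = 0"
 and zz_generic: "p \<in> pts C ==> \<forall>\<^sub>F y in generic C. zz p y ~= 0"
 using uniformizer_zz by (auto simp: uniformizer_def)

lemma zz_divides:
 assumes "regat C p f" "f p = 0"
 obtains g where "regat C p g" "\<forall>\<^sub>F y in nhd C p. f y = g y * zz p y"
 using uniformizer_zz[OF regat_pts[OF assms(1)]] assms unfolding uniformizer_def by blast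

lemma cofinite_open: "finite A ==> openin (zar C) (pts C - A)"
proof (induction A rule: finite_induct)
 case (insert x A)
 have "pts C - insert x A = (pts C - A) \<inter> (pts C - {x})" by auto
 moreover have "openin (zar C) (pts C - {x})"
  using points_closed[of x] by (cases "x \<in> pts C") auto
 ultimately show ?case using insert by auto
qed simp

lemma infinite_pts: "infinite (pts C)"
proof
 assume f: "finite (pts C)"
 obtain p where p: "p \<in> pts C" using nonempty by blast
 have "openin (zar C) (pts C - (pts C - {p}))" using f by (intro cofinite_open) simp
 then show False using not_open[OF p] p by (simp add: double_diff)
qed

lemma generic_iff_finite: "eventually P (generic C) \<longleftrightarrow> finite {y \<in> pts C. \<not> P y}"
proof
 assume "eventually P (generic C)"
 then obtain U where U: "openin (zar C) U" "U ~= {}" "\<forall>y\<in>U. P y" by (auto simp: eventually_generic)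
 have "{y \<in> pts C. \<not> P y} \<subseteq> pts C - U" using U by auto
 then show "finite {y \<in> pts C. \<not> P y}" using cofinite[OF U(1,2)] finite_subset by blast
next
 assume f: "finite {y \<in> pts C. \<not> P y}"
 show "eventually P (generic C)"
 proof (rule eventually_genericI[OF cofinite_open[OF f]])
  show "pts C - {y \<in> pts C. \<not> P y} ~= {}" using infinite_pts f by (metis finite.emptyI finite_Diff2)
 qed auto
qed

lemma generic_neq: "\<forall>\<^sub>F y in generic C. y ~= p"
 unfolding generic_iff_finite by (rule finite_subset[of _ "{p}"]) auto

lemma generic_pts: "\<forall>\<^sub>F y in generic C. y \<in> pts C"
 unfolding generic_iff_finite by simp

lemma generic_punctured:
 assumes "eventually P (generic C)" "p \<in> pts C"
 shows "\<forall>\<^sub>F y in nhd C p. y ~= p --> P y"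
proof -
 have fin: "finite ({y \<in> pts C. \<not> P y} - {p})" using assms by (simp add: generic_iff_finite)
 show ?thesis by (rule eventually_nhdI[OF cofinite_open[OF fin]]) (use assms(2) in auto)
qed

text \<open>Order at least \<open>k\<close> of a rational function at \<open>p\<close>. The equation
  is demanded only generically, so the values of the total function at single points, including
  \<open>p\<close>, do not matter; the zero function has every order.\<close>

definition ordge :: "'c => int => ('c => complex) => bool" where
 "ordge p k f \<longleftrightarrow> (\<exists>h. regat C p h & (\<forall>\<^sub>F y in generic C. f y = h y * zz p y powi k))"

definition ordeq :: "'c => int => ('c => complex) => bool" where
 "ordeq p k f \<longleftrightarrow> (\<exists>h. regat C p h & h p ~= 0 & (\<forall>\<^sub>F y in generic C. f y = h y * zz p y powi k))"

lemma ordge_pts: "ordge p k f ==> p \<in> pts C"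
 by (auto simp: ordge_def intro: regat_pts)

lemma ordeq_imp_ordge: "ordeq p k f ==> ordge p k f"
 by (auto simp: ordge_def ordeq_def)

lemma ordge_cong: "ordge p k f ==> \<forall>\<^sub>F y in generic C. g y = f y ==> ordge p k g"
proof -
 assume "ordge p k f" and gf: "\<forall>\<^sub>F y in generic C. g y = f y"
 then obtain h where h: "regat C p h" "\<forall>\<^sub>F y in generic C. f y = h y * zz p y powi k"
  by (auto simp: ordge_def)
 have "\<forall>\<^sub>F y in generic C. g y = h y * zz p y powi k" using gf h(2) by eventually_elim simp
 then show ?thesis using h(1) by (auto simp: ordge_def)
qed

lemma ordge_mono:
 assumes "ordge p k f" "j \<le> k" shows "ordge p j f"
proof -
 obtain h where h: "regat C p h" "\<forall>\<^sub>F y in generic C. f y = h y * zz p y powi k"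
  using assms(1) by (auto simp: ordge_def)
 have p: "p \<in> pts C" using h by (rule_tac regat_pts)
 have "regat C p (%y. h y * zz p y ^ nat (k - j))" using h p by (intro regat_mult regat_power zz_regat)
 moreover have "\<forall>\<^sub>F y in generic C. f y = (h y * zz p y ^ nat (k - j)) * zz p y powi j"
  using h(2) zz_generic[OF p]
 proof eventually_elim
  case (elim y)
  have "zz p y powi k = zz p y powi (k - j) * zz p y powi j" using elim by (simp flip: power_int_add)
  moreover have "zz p y powi (k - j) = zz p y ^ nat (k - j)" using assms(2) by (simp add: power_int_def)
  ultimately show ?case using elim by simp
 qed
 ultimately show ?thesis unfolding ordge_def by blast
qed

lemma ordge_add:
 assumes "ordge p k f" "ordge p k g" shows "ordge p k (%y. f y + g y)"
proof -
 obtain h where h: "regat C p h" "\<forall>\<^sub>F y in generic C. f y = h y * zz p y powi k"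
  using assms(1) by (auto simp: ordge_def)
 obtain h' where h': "regat C p h'" "\<forall>\<^sub>F y in generic C. g y = h' y * zz p y powi k"
  using assms(2) by (auto simp: ordge_def)
 have "\<forall>\<^sub>F y in generic C. f y + g y = (h y + h' y) * zz p y powi k"
  using h(2) h'(2) by eventually_elim (simp add: distrib_right)
 then show ?thesis using regat_add[OF h(1) h'(1)] unfolding ordge_def by blast
qed

lemma ordge_scale:
 assumes "ordge p k f" shows "ordge p k (%y. c * f y)"
proof -
 obtain h where h: "regat C p h" "\<forall>\<^sub>F y in generic C. f y = h y * zz p y powi k"
  using assms(1) by (auto simp: ordge_def)
 have "\<forall>\<^sub>F y in generic C. c * f y = (c * h y) * zz p y powi k"
  using h(2) by eventually_elim simp
 then show ?thesis using regat_scale[OF h(1)] unfolding ordge_def by blast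
qed

lemma ordge_diff: "ordge p k f ==> ordge p k g ==> ordge p k (%y. f y - g y)"
 using ordge_add[of p k f "%y. (-1) * g y"] ordge_scale[of p k g "-1"] by simp

lemma ordge_zero: "p \<in> pts C ==> ordge p k (%_. 0)"
 unfolding ordge_def by (rule exI[of _ "%_. 0"]) (simp add: regat_const)

lemma ordge_sum: "p \<in> pts C ==> (\<And>i. i \<in> I ==> ordge p k (f i)) ==> ordge p k (%y. \<Sum>i\<in>I. f i y)"
 by (induction I rule: infinite_finite_induct) (auto intro: ordge_zero ordge_add)

lemma ordge_mult:
 assumes "ordge p j f" "ordge p k g" shows "ordge p (j + k) (%y. f y * g y)"
proof -
 obtain h where h: "regat C p h" "\<forall>\<^sub>F y in generic C. f y = h y * zz p y powi j"
  using assms(1) by (auto simp: ordge_def)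
 obtain h' where h': "regat C p h'" "\<forall>\<^sub>F y in generic C. g y = h' y * zz p y powi k"
  using assms(2) by (auto simp: ordge_def)
 have "\<forall>\<^sub>F y in generic C. f y * g y = (h y * h' y) * zz p y powi (j + k)"
  using h(2) h'(2) zz_generic[OF ordge_pts[OF assms(1)]] by eventually_elim (simp add: power_int_add)
 then show ?thesis using regat_mult[OF h(1) h'(1)] unfolding ordge_def by blast
qed

lemma ordge_regat: "regat C p f ==> ordge p 0 f"
 unfolding ordge_def by (rule exI[of _ f]) simp

lemma ordeq_zz: "p \<in> pts C ==> ordeq p k (%y. zz p y powi k)"
 unfolding ordeq_def by (rule exI[of _ "%_. 1"]) (simp add: regat_const)

lemma ordeq_mult:
 assumes "ordeq p j f" "ordeq p k g" shows "ordeq p (j + k) (%y. f y * g y)"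
proof -
 obtain h where h: "regat C p h" "h p ~= 0" "\<forall>\<^sub>F y in generic C. f y = h y * zz p y powi j"
  using assms(1) by (auto simp: ordeq_def)
 obtain h' where h': "regat C p h'" "h' p ~= 0" "\<forall>\<^sub>F y in generic C. g y = h' y * zz p y powi k"
  using assms(2) by (auto simp: ordeq_def)
 have "\<forall>\<^sub>F y in generic C. f y * g y = (h y * h' y) * zz p y powi (j + k)"
  using h(3) h'(3) zz_generic[OF regat_pts[OF h(1)]] by eventually_elim (simp add: power_int_add)
 then show ?thesis using regat_mult[OF h(1) h'(1)] h(2) h'(2) unfolding ordeq_def
  by (intro exI[of _ "%y. h y * h' y"]) simp
qed

lemma ordeq_inverse:
 assumes "ordeq p j f" shows "ordeq p (- j) (%y. 1 / f y)"
proof -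
 obtain h where h: "regat C p h" "h p ~= 0" "\<forall>\<^sub>F y in generic C. f y = h y * zz p y powi j"
  using assms(1) by (auto simp: ordeq_def)
 have "\<forall>\<^sub>F y in generic C. 1 / f y = (1 / h y) * zz p y powi (- j)"
  using h(3) by eventually_elim (simp add: power_int_minus field_simps)
 then show ?thesis using regat_inverse[OF h(1,2)] h(2) unfolding ordeq_def
  by (intro exI[of _ "%y. 1 / h y"]) simp
qed

lemma ordeq_generic_nz: "ordeq p k f ==> \<forall>\<^sub>F y in generic C. f y ~= 0"
proof -
 assume "ordeq p k f"
 then obtain h where h: "regat C p h" "h p ~= 0" "\<forall>\<^sub>F y in generic C. f y = h y * zz p y powi k"
  by (auto simp: ordeq_def)
 show ?thesis using h(3) zz_generic[OF regat_pts[OF h(1)]] generic_nz[OF h(1,2)]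
  by eventually_elim simp
qed

lemma ordeq_ordge_iff:
 assumes "ordeq p k f" shows "ordge p j f \<longleftrightarrow> j \<le> k"
proof
 assume "ordge p j f"
 obtain h where h: "regat C p h" "h p ~= 0" "\<forall>\<^sub>F y in generic C. f y = h y * zz p y powi k"
  using assms(1) by (auto simp: ordeq_def)
 obtain g where g: "regat C p g" "\<forall>\<^sub>F y in generic C. f y = g y * zz p y powi j"
  using \<open>ordge p j f\<close> by (auto simp: ordge_def)
 have p: "p \<in> pts C" using h by (rule_tac regat_pts)
 show "j \<le> k"
 proof (rule ccontr)
  assume jk: "\<not> j \<le> k"
  have "\<forall>\<^sub>F y in generic C. h y = g y * zz p y ^ nat (j - k)"
   using h(3) g(2) zz_generic[OF p]
  proof eventually_elim
   case (elim y)
   have "zz p y powi j = zz p y powi (j - k) * zz p y powi k" using elim by (simp flip: power_int_add)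
   moreover have "zz p y powi (j - k) = zz p y ^ nat (j - k)" using jk by (simp add: power_int_def)
   moreover have "zz p y powi k ~= 0" using elim by simp
   ultimately show ?case using elim by simp
  qed
  then have "h p = g p * zz p p ^ nat (j - k)"
   by (rule identity_at[OF h(1) regat_mult[OF g(1) regat_power[OF zz_regat[OF p]]]])
  then show False using h(2) zz_zero[OF p] jk by simp
 qed
qed (use ordge_mono[OF ordeq_imp_ordge[OF assms]] in blast)

lemma ordeq_unique: "ordeq p k f ==> ordeq p j f ==> k = j"
 using ordeq_ordge_iff ordeq_imp_ordge by (meson order_antisym)

lemma ordge_dichotomy:
 assumes "ordge p j f"
 shows "(\<forall>\<^sub>F y in generic C. f y = 0) \<or> (\<exists>k\<ge>j. ordeq p k f)"
proof -
 obtain h where h: "regat C p h" "\<forall>\<^sub>F y in generic C. f y = h y * zz p y powi j"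
  using assms by (auto simp: ordge_def)
 have p: "p \<in> pts C" using h by (rule_tac regat_pts)
 from dvr[OF h(1) uniformizer_zz[OF p]] show ?thesis
 proof (elim disjE exE conjE)
  assume "\<forall>\<^sub>F y in nhd C p. h y = 0"
  then have "\<forall>\<^sub>F y in generic C. h y = 0" using p by (rule eventually_nhd_generic)
  then have "\<forall>\<^sub>F y in generic C. f y = 0" using h(2) by eventually_elim simp
  then show ?thesis ..
 next
  fix k g assume g: "regat C p g" "g p ~= 0" "\<forall>\<^sub>F y in nhd C p. h y = g y * zz p y ^ k"
  have "\<forall>\<^sub>F y in generic C. h y = g y * zz p y ^ k" using g(3) p by (rule eventually_nhd_generic)
  then have "\<forall>\<^sub>F y in generic C. f y = g y * zz p y powi (int k + j)"
   using h(2) zz_generic[OF p] by eventually_elim (simp add: power_int_add)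
  then have "ordeq p (int k + j) f" using g unfolding ordeq_def by blast
  then show ?thesis by (intro disjI2 exI[of _ "int k + j"]) simp
 qed
qed

text \<open>A germ vanishing at \<open>p\<close> is divisible by the uniformizer, so functions of
  order at least \<open>j\<close> modulo those of order at least \<open>j + 1\<close> form a line,
  spanned here by \<open>f0\<close>; \<open>c\<close> is the quotient of the leading values at
  \<open>p\<close>.\<close>

lemma leading_coefficient:
 assumes f: "ordge p j f" and f0: "ordge p j f0" "\<not> ordge p (j + 1) f0"
 shows "\<exists>c. ordge p (j + 1) (%y. f y - c * f0 y)"
proof -
 obtain h where h: "regat C p h" "\<forall>\<^sub>F y in generic C. f y = h y * zz p y powi j"
  using f by (auto simp: ordge_def)
 obtain h0 where h0: "regat C p h0" "\<forall>\<^sub>F y in generic C. f0 y = h0 y * zz p y powi j"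
  using f0 by (auto simp: ordge_def)
 have p: "p \<in> pts C" using h by (rule_tac regat_pts)
 have key: "ordge p (j + 1) f'" if h': "regat C p h'" "h' p = 0" "\<forall>\<^sub>F y in generic C. f' y = h' y * zz p y powi j" for f' h'
 proof -
  obtain g where g: "regat C p g" "\<forall>\<^sub>F y in nhd C p. h' y = g y * zz p y"
   using zz_divides[OF h'(1,2)] .
  have "\<forall>\<^sub>F y in generic C. f' y = g y * zz p y powi (j + 1)"
   using eventually_nhd_generic[OF g(2) p] h'(3) zz_generic[OF p]
   by eventually_elim (simp add: power_int_add)
  then show ?thesis using g(1) unfolding ordge_def by blast
 qed
 have nz: "h0 p ~= 0" using key[OF h0(1) _ h0(2)] f0(2) by auto
 define c where "c = h p / h0 p"
 have "\<forall>\<^sub>F y in generic C. f y - c * f0 y = (h y - c * h0 y) * zz p y powi j"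
  using h(2) h0(2) by eventually_elim (simp add: algebra_simps)
 then have "ordge p (j + 1) (%y. f y - c * f0 y)"
  by (intro key[of "%y. h y - c * h0 y"] regat_diff regat_scale h(1) h0(1)) (use nz in \<open>simp_all add: c_def\<close>)
 then show ?thesis ..
qed

text \<open>Away from finitely many points \<open>h\<close> and the uniformizer are regular and the
  latter is nonzero. This lets rational functions define Cech cocycles.\<close>

lemma ordge_generic_regat:
 assumes "ordge p k f" shows "\<forall>\<^sub>F y in generic C. regat C y f"
proof -
 obtain h where h: "regat C p h" "\<forall>\<^sub>F y in generic C. f y = h y * zz p y powi k"
  using assms by (auto simp: ordge_def)
 have p: "p \<in> pts C" using h by (rule_tac regat_pts)
 obtain U where U: "openin (zar C) U" "U ~= {}" "\<And>y. y \<in> U ==> f y = h y * zz p y powi k"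
  using h(2) by (auto simp: eventually_generic)
 have "\<forall>\<^sub>F y in generic C. y \<in> U" using U by (auto intro: eventually_genericI)
 then show ?thesis
  using eventually_nhd_generic[OF regat_ev[OF h(1)] p]
   eventually_nhd_generic[OF regat_ev[OF zz_regat[OF p]] p] zz_generic[OF p]
 proof eventually_elim
  case (elim y)
  have "\<forall>\<^sub>F y' in nhd C y. f y' = h y' * zz p y' powi k"
   using U elim by (intro eventually_nhdI[OF U(1)]) auto
  moreover have "regat C y (%y. h y * zz p y powi k)"
   by (rule regat_mult[OF _ regat_powi]) (use elim in auto)
  ultimately show ?case using regat_cong by simp
 qed
qed

section \<open>Linear systems on a curve\<close>

definition LL :: "('c => int) => ('c => complex) set" where
 "LL D = {f. \<forall>p\<in>pts C. ordge p (- D p) f}"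

text \<open>Many total functions represent the same rational function, so dimensions of the spaces
  \<open>LL D\<close> are taken modulo these representatives of zero.\<close>

definition ZZ :: "('c => complex) set" where
 "ZZ = {f. \<forall>\<^sub>F y in generic C. f y = 0}"

lemma fsubspace_LL: "fsubspace (LL D)"
 by (rule fsubspaceI) (auto simp: LL_def intro: ordge_zero ordge_add ordge_scale)

lemma fsubspace_ZZ: "fsubspace ZZ"
proof (rule fsubspaceI)
 fix f g assume "f \<in> ZZ" "g \<in> ZZ"
 then have "\<forall>\<^sub>F y in generic C. f y = 0" "\<forall>\<^sub>F y in generic C. g y = 0" by (auto simp: ZZ_def)
 then have "\<forall>\<^sub>F y in generic C. f y + g y = 0" by eventually_elim simp
 then show "(%y. f y + g y) \<in> ZZ" by (simp add: ZZ_def)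
qed (auto simp: ZZ_def elim: eventually_mono)

lemma ZZ_subset_LL: "ZZ \<subseteq> LL D"
 unfolding ZZ_def LL_def by (auto intro: ordge_cong[OF ordge_zero])

lemma LL_mono: "(\<And>q. D q \<le> D' q) ==> LL D \<subseteq> LL D'"
 unfolding LL_def by (auto intro: ordge_mono)

definition pd :: "'c => 'c => int" where
 "pd p = (%q. if q = p then 1 else 0)"

text \<open>Adding \<open>p\<close> enlarges the space of functions; equivalently some function in
  L(D + p) has order exactly -(D(p) + 1) at \<open>p\<close>. A non-jump is a principal part that
  cannot be realised, that is, an obstruction in H^1.\<close>

definition jump :: "('c => int) => 'c => bool" where
 "jump D p \<longleftrightarrow> (\<exists>f. f \<in> LL (%q. D q + pd p q) & f \<notin> LL D)"

definition hd0 :: "('c => int) => nat => bool" where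
 "hd0 D n \<longleftrightarrow> dlt (LL D) ZZ (Suc n) & \<not> dlt (LL D) ZZ n"

lemma hd0_unique: "hd0 D n ==> hd0 D m ==> n = m"
 unfolding hd0_def by (metis dlt_mono not_less_eq_eq order_antisym)

lemma LL_subset_add: "LL D \<subseteq> LL (%q. D q + pd p q)"
 by (rule LL_mono) (simp add: pd_def)

lemma not_jump_LL: "\<not> jump D p ==> LL (%q. D q + pd p q) = LL D"
 using LL_subset_add[of D p] by (auto simp: jump_def)

text \<open>Away from \<open>p\<close> the conditions for D and D + p coincide, and at
  \<open>p\<close> a single leading coefficient is at stake.\<close>

lemma LL_codim:
 assumes p: "p \<in> pts C" and f0: "f0 \<in> LL (%q. D q + pd p q)" "f0 \<notin> LL D"
  and v: "v \<in> LL (%q. D q + pd p q)"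
 shows "\<exists>c. (%s. v s - c * f0 s) \<in> LL D"
proof -
 have o: "ordge q (- D q - pd p q) v" "ordge q (- D q - pd p q) f0" if "q \<in> pts C" for q
  using f0(1) v that by (auto simp: LL_def)
 have "\<not> ordge p (- D p) f0"
 proof
  assume "ordge p (- D p) f0"
  moreover have "ordge q (- D q) f0" if "q \<in> pts C" "q ~= p" for q
   using o(2)[OF that(1)] that(2) by (simp add: pd_def)
  ultimately have "\<forall>q\<in>pts C. ordge q (- D q) f0" by blast
  then show False using f0(2) by (simp add: LL_def)
 qed
 then obtain c where c: "ordge p (- D p) (%y. v y - c * f0 y)"
  using leading_coefficient[of p "- D p - 1" v f0] o[OF p] by (auto simp: pd_def)
 have "ordge q (- D q) (%y. v y - c * f0 y)" if "q \<in> pts C" for q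
 proof (cases "q = p")
  case False
  then show ?thesis using o[OF that] by (intro ordge_diff ordge_scale) (auto simp: pd_def)
 qed (use c in simp)
 then show ?thesis by (auto simp: LL_def)
qed

lemma hd0_jump:
 assumes p: "p \<in> pts C" and j: "jump D p" and h: "hd0 D n"
 shows "hd0 (%q. D q + pd p q) (Suc n)"
proof -
 obtain f0 where f0: "f0 \<in> LL (%q. D q + pd p q)" "f0 \<notin> LL D" using j by (auto simp: jump_def)
 have "dlt (LL (%q. D q + pd p q)) ZZ (Suc (Suc n))"
  by (rule dlt_codim_one[OF fsubspace_LL, of D], use h in \<open>simp add: hd0_def\<close>)
   (rule LL_codim[OF p f0])
 moreover have "\<not> dlt (LL (%q. D q + pd p q)) ZZ (Suc n)"
  using dlt_extra[OF fsubspace_LL ZZ_subset_LL fsubspace_ZZ f0 LL_subset_add] h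
  by (auto simp: hd0_def)
 ultimately show ?thesis by (simp add: hd0_def)
qed

lemma dlt_LL_add:
 assumes p: "p \<in> pts C" and h: "dlt (LL D) ZZ n"
 shows "dlt (LL (%q. D q + pd p q)) ZZ (Suc n)"
proof (cases "jump D p")
 case True
 then obtain f0 where f0: "f0 \<in> LL (%q. D q + pd p q)" "f0 \<notin> LL D" by (auto simp: jump_def)
 show ?thesis by (rule dlt_codim_one[OF fsubspace_LL h]) (rule LL_codim[OF p f0])
next
 case False then show ?thesis using h dlt_mono[OF h] by (simp add: not_jump_LL)
qed

end

section \<open>Curves of genus one\<close>

lemma cech_coboundaries_combination:
 assumes "space_with_functions X" "f \<in> cech_coboundaries X" "g \<in> cech_coboundaries X"
 shows "(%s. a * f s + b * g s) \<in> cech_coboundaries X"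
proof -
 interpret fsp X by unfold_locales (rule assms)
 obtain N u where N: "point_cover X N" "\<forall>x\<in>pts X. u x \<in> reg X (N x)"
  "\<forall>x\<in>pts X. \<forall>y\<in>pts X. \<forall>z\<in>N x \<inter> N y. f (x, y, z) = u y z - u x z"
  using assms(2) unfolding cech_coboundaries_def by auto
 obtain M v where M: "point_cover X M" "\<forall>x\<in>pts X. v x \<in> reg X (M x)"
  "\<forall>x\<in>pts X. \<forall>y\<in>pts X. \<forall>z\<in>M x \<inter> M y. g (x, y, z) = v y z - v x z"
  using assms(3) unfolding cech_coboundaries_def by auto
 have "point_cover X (%x. N x \<inter> M x)" using N M by (auto simp: point_cover_def)
 moreover have "(%z. a * u x z + b * v x z) \<in> reg X (N x \<inter> M x)" if x: "x \<in> pts X" for x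
 proof -
  have o: "openin (zar X) (N x)" "openin (zar X) (M x)" "openin (zar X) (N x \<inter> M x)"
   using N M x by (auto simp: point_cover_def)
  have "u x \<in> reg X (N x \<inter> M x)" "v x \<in> reg X (N x \<inter> M x)"
   using reg_restrict[OF _ o(1,3)] reg_restrict[OF _ o(2,3)] N M x by auto
  then show ?thesis using o by (intro reg_add reg_mult reg_const)
 qed
 moreover have "a * f (x, y, z) + b * g (x, y, z) = (a * u y z + b * v y z) - (a * u x z + b * v x z)"
  if "x \<in> pts X" "y \<in> pts X" "z \<in> (N x \<inter> M x) \<inter> (N y \<inter> M y)" for x y z
 proof -
  have "f (x, y, z) = u y z - u x z" "g (x, y, z) = v y z - v x z" using that N(3) M(3) by auto
  then show ?thesis by algebra
 qed
 ultimately show ?thesis unfolding cech_coboundaries_def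
  by (intro CollectI exI[of _ "%x. N x \<inter> M x"] exI[of _ "%x z. a * u x z + b * v x z"]) simp
qed

text \<open>The value 1 differs from the default 0 of \<open>quot_dim\<close>, so a basis really
  exists, and it is a single class \<open>b\<close> spanning H^1.\<close>

lemma genus_oneE:
 assumes "genus X = 1"
 obtains b where "b \<in> cech_cocycles X" "b \<notin> cech_coboundaries X"
  "\<And>v. v \<in> cech_cocycles X ==> \<exists>a. (%s. v s - a * b s) \<in> cech_coboundaries X"
proof -
 have ex: "\<exists>B. quot_basis (cech_cocycles X) (cech_coboundaries X) B"
  using assms by (auto simp: genus_def quot_dim_def split: if_splits)
 define B where "B = (SOME B. quot_basis (cech_cocycles X) (cech_coboundaries X) B)"
 have B: "quot_basis (cech_cocycles X) (cech_coboundaries X) B"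
  unfolding B_def using ex by (rule someI_ex)
 have "card B = 1" using assms ex by (simp add: genus_def quot_dim_def B_def)
 then obtain b where b: "B = {b}" by (auto simp: card_1_singleton_iff)
 have q: "b \<in> cech_cocycles X" "\<forall>a. (%s. a b * b s) \<in> cech_coboundaries X --> a b = 0"
  "\<forall>v\<in>cech_cocycles X. \<exists>a. (%s. v s - a b * b s) \<in> cech_coboundaries X"
  using B unfolding quot_basis_def b by simp_all
 show thesis
 proof (rule that[OF q(1)])
  show "b \<notin> cech_coboundaries X" using q(2)[rule_format, of "%_. 1"] by auto
  fix v assume "v \<in> cech_cocycles X"
  from bspec[OF q(3) this] obtain a where "(%s. v s - a b * b s) \<in> cech_coboundaries X" by (elim exE)
  then show "\<exists>a. (%s. v s - a * b s) \<in> cech_coboundaries X" by (rule exI[of _ "a b"])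
 qed
qed

context curve
begin

text \<open>The differences of the rational 0-cochain that is \<open>f\<close> at the index
  \<open>p\<close> and 0 at all other indices. Its class is the obstruction to a rational function
  with principal part \<open>f\<close> at \<open>p\<close> and no other poles.\<close>

definition coc :: "'c => ('c => complex) => 'c \<times> 'c \<times> 'c => complex" where
 "coc p f = (%(x, y, z). (if y = p then f z else 0) - (if x = p then f z else 0))"

lemma coc_cocycle:
 assumes p: "p \<in> pts C" and f: "\<forall>\<^sub>F y in generic C. regat C y f"
 shows "coc p f \<in> cech_cocycles C"
proof -
 define U where "U = {y \<in> pts C. y ~= p --> regat C y f}"
 have "finite (pts C - U)"
  using f finite_subset[of "pts C - U" "{y \<in> pts C. \<not> regat C y f}"] by (auto simp: generic_iff_finite U_def)
 from cofinite_open[OF this] have U: "openin (zar C) U" "p \<in> U"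
  using p by (auto simp: U_def Diff_Diff_Int Int_absorb1 elim: back_subst[of "openin (zar C)"])
 \<comment> \<open>The neighbourhood of \<open>p\<close> avoids the other poles of \<open>f\<close>,
   and all other points get the complement of \<open>p\<close>; on overlaps of the two kinds
   \<open>f\<close> is regular.\<close>
 define N where "N = (%x. if x = p then U else pts C - {p})"
 have N: "point_cover C N" using U points_closed[OF p] by (auto simp: point_cover_def N_def)
 have "(%z. coc p f (x, y, z)) \<in> reg C (N x \<inter> N y)" if xy: "x \<in> pts C" "y \<in> pts C" for x y
 proof -
  have o: "openin (zar C) (N x \<inter> N y)" using N xy by (auto simp: point_cover_def)
  show ?thesis
  proof (cases "(x = p) = (y = p)")
   case True
   have "(%z. coc p f (x, y, z)) = (%_. 0)" using True by (auto simp: coc_def)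
   then show ?thesis using reg_const[OF o] by simp
  next
   case False
   then have sub: "z \<in> N x \<inter> N y ==> regat C z f" for z by (auto simp: N_def U_def split: if_splits)
   have "(%z. coc p f (x, y, z)) = (if y = p then f else (%z. - f z))"
    using False by (auto simp: coc_def)
   then show ?thesis unfolding reg_iff[OF o] using sub by (auto intro: regat_uminus)
  qed
 qed
 then show ?thesis unfolding cech_cocycles_def using N
  by (intro CollectI exI[of _ N]) (auto simp: coc_def)
qed

text \<open>Two obstruction classes in a one-dimensional H^1 are proportional, so a nontrivial
  combination is a coboundary; correcting the prescribed parts by the bounding cochain gives one
  rational function \<open>g\<close>. The points \<open>p\<close> and \<open>p'\<close> may
  coincide.\<close>

lemma cech_dependent:
 assumes g1: "genus C = 1" and p: "p \<in> pts C" "p' \<in> pts C"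
  and f: "\<forall>\<^sub>F y in generic C. regat C y f" "\<forall>\<^sub>F y in generic C. regat C y f'"
 obtains c c' g where "c ~= 0 \<or> c' ~= 0"
  "\<And>x. x \<in> pts C ==> ordge x 0 (%y. g y - ((if x = p then c * f y else 0) + (if x = p' then c' * f' y else 0)))"
proof -
 obtain b where b: "b \<in> cech_cocycles C" "b \<notin> cech_coboundaries C"
  "\<And>v. v \<in> cech_cocycles C ==> \<exists>a. (%s. v s - a * b s) \<in> cech_coboundaries C"
  by (rule genus_oneE[OF g1]) auto
 obtain a where a: "(%s. coc p f s - a * b s) \<in> cech_coboundaries C"
  using b(3)[OF coc_cocycle[OF p(1) f(1)]] by (elim exE)
 obtain a' where a': "(%s. coc p' f' s - a' * b s) \<in> cech_coboundaries C"
  using b(3)[OF coc_cocycle[OF p(2) f(2)]] by (elim exE)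
 \<comment> \<open>The classes of the two cocycles are \<open>a\<close> and \<open>a'\<close> times
   that of \<open>b\<close>; the coefficients are chosen with c a + c' a' = 0 and not both
   zero.\<close>
 define c where "c = (if a = 0 then 1 else a')"
 define c' where "c' = (if a = 0 then 0 else - a)"
 have "(%s. c * (coc p f s - a * b s) + c' * (coc p' f' s - a' * b s)) \<in> cech_coboundaries C"
  by (rule cech_coboundaries_combination[OF swf a a'])
 also have "(%s. c * (coc p f s - a * b s) + c' * (coc p' f' s - a' * b s)) = (%s. c * coc p f s + c' * coc p' f' s)"
  by (rule ext) (simp add: c_def c'_def algebra_simps)
 finally obtain N u where N: "point_cover C N" "\<forall>x\<in>pts C. u x \<in> reg C (N x)"
  "\<forall>x\<in>pts C. \<forall>y\<in>pts C. \<forall>z\<in>N x \<inter> N y. c * coc p f (x, y, z) + c' * coc p' f' (x, y, z) = u y z - u x z"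
  unfolding cech_coboundaries_def by auto
 define B where "B = (%x y. (if x = p then c * f y else 0) + (if x = p' then c' * f' y else 0))"
 obtain x0 where x0: "x0 \<in> pts C" using nonempty by blast
 \<comment> \<open>The cochain \<open>u\<close> compares the prescribed parts at different indices,
   so \<open>B x\<close> minus \<open>u x\<close> is generically independent of \<open>x\<close>;
   the index \<open>x0\<close> is arbitrary.\<close>
 define g where "g = (%z. B x0 z - u x0 z)"
 have "ordge x 0 (%y. g y - B x y)" if x: "x \<in> pts C" for x
 proof -
  have "openin (zar C) (N x)" "x \<in> N x" "openin (zar C) (N x0)" "x0 \<in> N x0"
   using N(1) x x0 by (auto simp: point_cover_def)
  then have "\<forall>\<^sub>F y in generic C. y \<in> N x" "\<forall>\<^sub>F y in generic C. y \<in> N x0"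
   by (auto intro: eventually_genericI)
  then have ev: "\<forall>\<^sub>F y in generic C. g y - B x y = - u x y"
  proof eventually_elim
   case (elim y)
   then have "c * coc p f (x0, x, y) + c' * coc p' f' (x0, x, y) = u x y - u x0 y" using N(3) x x0 by auto
   moreover have "c * coc p f (x0, x, y) + c' * coc p' f' (x0, x, y) = B x y - B x0 y"
    by (auto simp: coc_def B_def algebra_simps)
   ultimately have "u x y - u x0 y = B x y - B x0 y" by simp
   then show ?case unfolding g_def by algebra
  qed
  have "regat C x (u x)" using N x by (auto simp: point_cover_def intro: regatI)
  from ordge_cong[OF ordge_regat[OF regat_uminus[OF this]] ev] show ?thesis .
 qed
 moreover have "c ~= 0 \<or> c' ~= 0" by (auto simp: c_def c'_def)
 ultimately show thesis using that[of c c' g] unfolding B_def by blast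
qed

text \<open>The functions \<open>f\<close> and \<open>f'\<close> with poles just beyond D at
  \<open>p\<close> and just beyond D' at \<open>p'\<close> have dependent classes, giving
  \<open>g\<close> with these principal parts. If \<open>f'\<close> does not occur, \<open>g\<close>
  lies in L(D + p) = L(D), too small for the pole of \<open>f\<close>. If it occurs, the term of
  \<open>f\<close> is absorbed because D + p is below D', and \<open>g\<close> lies in L(D' + p') =
  L(D'), too small for the pole of \<open>f'\<close>.\<close>

lemma nonjumps_exclusive:
 assumes g1: "genus C = 1" and p: "p \<in> pts C" "p' \<in> pts C"
  and nj: "\<not> jump D p" "\<not> jump D' p'" and D: "\<And>q. 0 \<le> D q" "\<And>q. D q + pd p q \<le> D' q"
 shows False
proof -
 define f where "f = (%y. zz p y powi (- (D p + 1)))"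
 define f' where "f' = (%y. zz p' y powi (- (D' p' + 1)))"
 have of: "ordeq p (- (D p + 1)) f" "ordeq p' (- (D' p' + 1)) f'"
  unfolding f_def f'_def by (intro ordeq_zz p)+
 obtain c c' g where cc: "c ~= 0 \<or> c' ~= 0" and
  g: "\<And>x. x \<in> pts C ==> ordge x 0 (%y. g y - ((if x = p then c * f y else 0) + (if x = p' then c' * f' y else 0)))"
  by (rule cech_dependent[OF g1 p ordge_generic_regat[OF ordeq_imp_ordge[OF of(1)]] ordge_generic_regat[OF ordeq_imp_ordge[OF of(2)]]])
   (rule that)
 have D'0: "0 \<le> D' q" for q using D(1)[of q] D(2)[of q] by (auto simp: pd_def split: if_splits)
 define F where "F = (%x y. (if x = p then c * f y else 0) + (if x = p' then c' * f' y else 0))"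
 have gE: "ordge x k g" if "x \<in> pts C" "ordge x k (F x)" "k \<le> 0" for x k
  using ordge_add[OF ordge_mono[OF g[OF that(1)] that(3)] that(2)] unfolding F_def by simp
 have FE: "ordge x k (F x)" if "x \<in> pts C" "ordge x k g" "k \<le> 0" for x k
  using ordge_diff[OF that(2) ordge_mono[OF g[OF that(1)] that(3)]] unfolding F_def by simp
 show False
 proof (cases "c' = 0")
  case True
  then have c: "c ~= 0" using cc by simp
  have F: "F x = (%y. if x = p then c * f y else 0)" for x using True by (auto simp: F_def)
  have "ordge x (- (D x + pd p x)) g" if x: "x \<in> pts C" for x
   by (rule gE[OF x]) (use D(1)[of x] D(1)[of p] x p ordge_scale[OF ordeq_imp_ordge[OF of(1)], of c]
    in \<open>auto simp: F pd_def intro: ordge_zero\<close>)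
  then have "g \<in> LL D" using nj(1) by (auto simp: LL_def jump_def)
  then have "ordge p (- D p) (F p)" using p D(1)[of p] by (intro FE) (auto simp: LL_def)
  then have "ordge p (- D p) (%y. c * f y)" by (simp add: F)
  from ordge_scale[OF this, of "1 / c"] show False using ordeq_ordge_iff[OF of(1), of "- D p"] c by simp
 next
  case False
  have cf: "ordge x (- D' x) (%y. if x = p then c * f y else 0)" if x: "x \<in> pts C" for x
   using ordge_scale[OF ordge_mono[OF ordeq_imp_ordge[OF of(1)], of "- D' p"], of c] D(2)[of p] x
   by (cases "x = p") (auto simp: pd_def intro: ordge_zero)
  have "ordge x (- (D' x + pd p' x)) g" if x: "x \<in> pts C" for x
  proof (rule gE[OF x])
   have "ordge x (- (D' x + pd p' x)) (%y. if x = p' then c' * f' y else 0)"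
    using x ordge_scale[OF ordeq_imp_ordge[OF of(2)], of c'] by (auto simp: pd_def intro: ordge_zero)
   moreover have "ordge x (- (D' x + pd p' x)) (%y. if x = p then c * f y else 0)"
    by (rule ordge_mono[OF cf[OF x]]) (simp add: pd_def)
   ultimately show "ordge x (- (D' x + pd p' x)) (F x)" unfolding F_def by (intro ordge_add)
  qed (use D'0[of x] D'0[of p'] in \<open>simp add: pd_def\<close>)
  then have "g \<in> LL D'" using nj(2) by (auto simp: LL_def jump_def)
  then have "ordge p' (- D' p') (F p')" using p D'0[of p'] by (intro FE) (auto simp: LL_def)
  from ordge_diff[OF this cf[OF p(2)]] have "ordge p' (- D' p') (%y. c' * f' y)"
   by (simp add: F_def)
  from ordge_scale[OF this, of "1 / c'"] show False
   using ordeq_ordge_iff[OF of(2), of "- D' p'"] False by simp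
 qed
qed

text \<open>Induction on the pole order: a jump at k p supplies a function with a pole of order
  exactly k + 1 at \<open>p\<close>, which removes the leading term.\<close>

lemma principal_part:
 assumes p: "p \<in> pts C" and j: "\<And>k::nat. jump (%q. int k * pd p q) p"
  and f: "ordge p (- int k) f"
 shows "\<exists>g\<in>LL (%q. int k * pd p q). ordge p 0 (%y. f y - g y)"
 using f
proof (induction k arbitrary: f)
 case 0
 then show ?case by (intro bexI[of _ "%_. 0"]) (auto simp: LL_def intro: ordge_zero)
next
 case (Suc k)
 obtain f0 where f0: "f0 \<in> LL (%q. int k * pd p q + pd p q)" "f0 \<notin> LL (%q. int k * pd p q)"
  using j[of k] by (auto simp: jump_def)
 have eq: "(%q. int k * pd p q + pd p q) = (%q. int (Suc k) * pd p q)" by (auto simp: algebra_simps)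
 have o: "ordge q (- (int k * pd p q + pd p q)) f0" if "q \<in> pts C" for q using f0 that by (simp add: LL_def)
 have "\<not> ordge p (- int (Suc k) + 1) f0"
 proof
  assume "ordge p (- int (Suc k) + 1) f0"
  moreover have "ordge q 0 f0" if "q \<in> pts C" "q ~= p" for q using o[OF that(1)] that(2) by (simp add: pd_def)
  ultimately have "f0 \<in> LL (%q. int k * pd p q)" by (auto simp: LL_def pd_def)
  then show False using f0 by simp
 qed
 moreover have "- (int k * pd p p + pd p p) = - int (Suc k)" by (simp add: pd_def)
 then have "ordge p (- int (Suc k)) f0" using o[OF p] by (simp only:)
 ultimately obtain c where "ordge p (- int (Suc k) + 1) (%y. f y - c * f0 y)"
  using leading_coefficient[OF Suc.prems] by blast
 then have "ordge p (- int k) (%y. f y - c * f0 y)" by simp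
 from Suc.IH[OF this] obtain g where g: "g \<in> LL (%q. int k * pd p q)" "ordge p 0 (%y. (f y - c * f0 y) - g y)"
  by (elim bexE)
 have "g \<in> LL (%q. int (Suc k) * pd p q)" 
  by (rule subsetD[OF LL_mono g(1)]) (simp add: pd_def)
 then have "(%y. g y + c * f0 y) \<in> LL (%q. int (Suc k) * pd p q)"
  using f0(1) unfolding eq by (intro fsubspace_add[OF fsubspace_LL] fsubspace_scale[OF fsubspace_LL])
 moreover have "ordge p 0 (%y. f y - (g y + c * f0 y))" using g(2) by (simp add: algebra_simps)
 ultimately show ?case by (intro bexI[of _ "%y. g y + c * f0 y"])
qed

text \<open>A regular function on a nonempty open set is a quotient of germs at any given point, and
  a denominator has finite order there.\<close>

lemma reg_ordge:
 assumes "openin (zar C) W" "W ~= {}" "f \<in> reg C W" "p \<in> pts C"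
 shows "\<exists>k::nat. ordge p (- int k) f"
proof -
 obtain a b where ab: "regat C p a" "regat C p b" "\<forall>\<^sub>F y in generic C. b y ~= 0 & f y = a y / b y"
  using fraction[OF assms] by blast
 obtain k where k: "ordeq p k b"
 proof -
  have "\<not> (\<forall>\<^sub>F y in generic C. b y = 0)"
  proof
   assume "\<forall>\<^sub>F y in generic C. b y = 0"
   then have "\<forall>\<^sub>F y in generic C. False" using ab(3) by eventually_elim simp
   then show False using generic_not_bot by (simp add: trivial_limit_def)
  qed
  then show thesis using ordge_dichotomy[OF ordge_regat[OF ab(2)]] that by blast
 qed
 have "ordge p (0 + - k) (%y. a y * (1 / b y))"
  by (rule ordge_mult[OF ordge_regat[OF ab(1)] ordeq_imp_ordge[OF ordeq_inverse[OF k]]])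
 moreover have "\<forall>\<^sub>F y in generic C. f y = a y * (1 / b y)" using ab(3) by eventually_elim simp
 ultimately have "ordge p (- k) f" using ordge_cong[of p "- k"] by simp
 then have "ordge p (- int (nat k)) f" by (rule ordge_mono) simp
 then show ?thesis ..
qed

text \<open>If every step from k p to (k + 1) p were a jump, all principal parts could be realised
  and every 1-cocycle would be a coboundary, which contradicts genus one.\<close>

lemma nonjump_exists:
 assumes g1: "genus C = 1"
 shows "\<exists>p\<in>pts C. \<exists>k::nat. \<not> jump (%q. int k * pd p q) p"
proof (rule ccontr)
 assume "\<not> ?thesis"
 then have j: "jump (%q. int k * pd p q) p" if "p \<in> pts C" for p and k :: nat using that by blast
 obtain b where b: "b \<in> cech_cocycles C" "b \<notin> cech_coboundaries C"
  by (rule genus_oneE[OF g1]) auto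
 obtain N where N: "point_cover C N"
  "\<forall>x\<in>pts C. \<forall>y\<in>pts C. (%z. b (x, y, z)) \<in> reg C (N x \<inter> N y)"
  "\<forall>x\<in>pts C. \<forall>y\<in>pts C. \<forall>w\<in>pts C. \<forall>z\<in>N x \<inter> N y \<inter> N w. b (x, y, z) + b (y, w, z) = b (x, w, z)"
  using b(1) unfolding cech_cocycles_def by auto
 have No: "openin (zar C) (N x)" "x \<in> N x" if "x \<in> pts C" for x using N(1) that by (auto simp: point_cover_def)
 obtain x0 where x0: "x0 \<in> pts C" using nonempty by blast
 \<comment> \<open>The component \<open>b (x0, x, z)\<close> is regular at \<open>x\<close> as soon
   as \<open>x\<close> lies in \<open>N x0\<close>, so only finitely many points contribute
   poles.\<close>
 define F where "F = pts C - N x0"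
 have finF: "finite F" unfolding F_def using No[OF x0] by (intro cofinite) auto
 have meet: "openin (zar C) (N x \<inter> N y)" "N x \<inter> N y ~= {}" if "x \<in> pts C" "y \<in> pts C" for x y
  using No[OF that(1)] No[OF that(2)] opens_meet[of "N x" "N y"] by auto
 have "\<exists>g. (\<forall>q\<in>pts C. q ~= p --> ordge q 0 g) & ordge p 0 (%z. b (x0, p, z) - g z)" if p: "p \<in> pts C" for p
 proof -
  obtain k where "ordge p (- int k) (%z. b (x0, p, z))"
   using reg_ordge[OF meet[OF x0 p] _ p] N(2) x0 p by blast
  from principal_part[OF p j[OF p] this] obtain g where
   "g \<in> LL (%q. int k * pd p q)" "ordge p 0 (%z. b (x0, p, z) - g z)" by (elim bexE)
  then show ?thesis by (intro exI[of _ g]) (auto simp: LL_def pd_def)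
 qed
 then obtain G where G: "\<And>p q. p \<in> pts C ==> q \<in> pts C ==> q ~= p ==> ordge q 0 (G p)"
  "\<And>p. p \<in> pts C ==> ordge p 0 (%z. b (x0, p, z) - G p z)" by metis
 \<comment> \<open>The sum of finitely many principal parts, each regular away from its own point.
   Subtracting it leaves a regular germ \<open>h x\<close> at every \<open>x\<close>, and these
   germs bound \<open>b\<close>.\<close>
 define g where "g = (%z. \<Sum>p\<in>F. G p z)"
 have Fp: "F \<subseteq> pts C" by (auto simp: F_def)
 have "ordge x 0 (%z. b (x0, x, z) - g z)" if x: "x \<in> pts C" for x
 proof (cases "x \<in> F")
  case True
  have "ordge x 0 (%z. \<Sum>p\<in>F - {x}. G p z)"
   by (rule ordge_sum[OF x], rule G(1)) (use Fp x in auto)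
  from ordge_diff[OF G(2)[OF x] this] show ?thesis
   unfolding g_def by (simp add: sum.remove[OF finF True] algebra_simps)
 next
  case False
  have "ordge x 0 (%z. \<Sum>p\<in>F. G p z)"
   by (rule ordge_sum[OF x], rule G(1)) (use Fp x False in auto)
  moreover have "ordge x 0 (%z. b (x0, x, z))"
   by (rule ordge_regat, rule regatI[OF meet(1)[OF x0 x]])
    (use False x No[OF x] N(2) x0 in \<open>auto simp: F_def\<close>)
  ultimately show ?thesis unfolding g_def by (intro ordge_diff)
 qed
 then have "\<exists>h. regat C x h & (\<forall>\<^sub>F y in generic C. b (x0, x, y) - g y = h y)" if "x \<in> pts C" for x
  using that by (fastforce simp: ordge_def)
 then obtain h where h: "\<And>x. x \<in> pts C ==> regat C x (h x)"
  "\<And>x. x \<in> pts C ==> \<forall>\<^sub>F y in generic C. b (x0, x, y) - g y = h x y" by metis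
 have "\<exists>U. openin (zar C) U & x \<in> U & h x \<in> reg C U" if "x \<in> pts C" for x
  using h(1)[OF that] by (simp add: regat_def)
 then obtain U where U: "\<And>x. x \<in> pts C ==> openin (zar C) (U x)" "\<And>x. x \<in> pts C ==> x \<in> U x"
  "\<And>x. x \<in> pts C ==> h x \<in> reg C (U x)" by metis
 define M where "M = (%x. N x \<inter> U x)"
 have Mo: "openin (zar C) (M x)" "x \<in> M x" "h x \<in> reg C (M x)" if x: "x \<in> pts C" for x
  using No[OF x] U(1,2)[OF x] reg_restrict[OF U(3)[OF x] U(1)[OF x], of "M x"] by (auto simp: M_def)
 have "b (x, y, z) = h y z - h x z" if x: "x \<in> pts C" and y: "y \<in> pts C" and z: "z \<in> M x \<inter> M y" for x y z
 proof (rule identity_at[of z "%z. b (x, y, z)" "%z. h y z - h x z"])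
  show "regat C z (%z. b (x, y, z))"
   by (rule regatI[OF meet(1)[OF x y]]) (use z N(2) x y in \<open>auto simp: M_def\<close>)
  show "regat C z (%z. h y z - h x z)"
   using regatI[OF Mo(1)[OF x] _ Mo(3)[OF x]] regatI[OF Mo(1)[OF y] _ Mo(3)[OF y]] z by (intro regat_diff) auto
  have "\<forall>\<^sub>F w in generic C. w \<in> N x" "\<forall>\<^sub>F w in generic C. w \<in> N y" "\<forall>\<^sub>F w in generic C. w \<in> N x0"
   using No[OF x] No[OF y] No[OF x0] by (auto intro: eventually_genericI)
  then show "\<forall>\<^sub>F w in generic C. b (x, y, w) = h y w - h x w"
   using h(2)[OF x] h(2)[OF y]
  proof eventually_elim
   case (elim w)
   have "b (x0, x, w) + b (x, y, w) = b (x0, y, w)" using N(3) x y x0 elim(1,2,3) by auto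
   then show ?case using elim(4,5) by (simp add: algebra_simps)
  qed
 qed
 then have "b \<in> cech_coboundaries C" unfolding cech_coboundaries_def
  by (intro CollectI exI[of _ M] exI[of _ h]) (use Mo in \<open>auto simp: point_cover_def\<close>)
 then show False using b(2) by simp
qed

end

section \<open>Degrees of divisors and Riemann-Roch bounds in genus one\<close>

context curve
begin

lemma divisor_degree_eq:
 assumes "finite S" "{p. D p ~= 0} \<subseteq> S" shows "divisor_degree D = sum D S"
 unfolding divisor_degree_def by (rule sum.mono_neutral_left) (use assms in auto)

lemma degree_add:
 assumes "point_divisor C D" "point_divisor C D'"
 shows "divisor_degree (%q. D q + D' q) = divisor_degree D + divisor_degree D'"
proof -
 let ?S = "{p. D p ~= 0} \<union> {p. D' p ~= 0}"
 have fin: "finite ?S" using assms by (simp add: point_divisor_def)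
 show ?thesis
  unfolding divisor_degree_eq[OF fin Un_upper1] divisor_degree_eq[OF fin Un_upper2]
  by (subst divisor_degree_eq[OF fin]) (auto simp: sum.distrib)
qed

lemma degree_uminus: "divisor_degree (%q. - D q) = - divisor_degree D"
 by (simp add: divisor_degree_def sum_negf)

lemma degree_zero: "divisor_degree (%q. 0) = 0"
 by (simp add: divisor_degree_def)

lemma degree_mult: "divisor_degree (%q. n * D q) = n * divisor_degree D"
 by (cases "n = 0") (simp_all add: divisor_degree_def sum_distrib_left)

lemma degree_pd: "divisor_degree (pd p) = 1"
 by (subst divisor_degree_eq[of "{p}"]) (auto simp: pd_def)

lemma degree_nonneg: "(\<And>q. 0 \<le> D q) ==> 0 \<le> divisor_degree D"
 by (simp add: divisor_degree_def sum_nonneg)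

lemma pd_nonneg: "0 \<le> pd p q"
 by (simp add: pd_def)

lemma point_divisor_zero: "point_divisor C (%_. 0)"
 by (simp add: point_divisor_def)

lemma point_divisor_pd: "p \<in> pts C ==> point_divisor C (pd p)"
 by (auto simp: point_divisor_def pd_def)

lemma point_divisor_add: "point_divisor C D ==> point_divisor C D' ==> point_divisor C (%q. D q + D' q)"
proof -
 assume "point_divisor C D" "point_divisor C D'"
 moreover have "{p. D p + D' p ~= 0} \<subseteq> {p. D p ~= 0} \<union> {p. D' p ~= 0}" by auto
 ultimately show ?thesis unfolding point_divisor_def
  by (intro conjI; (elim conjE)?) (blast intro: finite_subset, blast)
qed

lemma point_divisor_mult: "point_divisor C D ==> point_divisor C (%q. n * D q)"
 unfolding point_divisor_def by (auto intro: finite_subset[of _ "{p. D p ~= 0}"])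

lemma point_divisor_uminus: "point_divisor C D ==> point_divisor C (%q. - D q)"
 by (simp add: point_divisor_def)

lemma point_divisor_diff: "point_divisor C D ==> point_divisor C D' ==> point_divisor C (%q. D q - D' q)"
 using point_divisor_add[OF _ point_divisor_uminus, of D D'] by simp

text \<open>Between comparable divisors the difference of degrees counts the points still missing,
  and difference zero forces equality; the points are added singly.\<close>

lemma divisor_induct:
 assumes D0: "point_divisor C D0" and D: "point_divisor C D" and le: "\<And>q. D0 q \<le> D q"
  and base: "P D0"
  and step: "\<And>D p. p \<in> pts C ==> point_divisor C D ==> (\<And>q. D0 q \<le> D q) ==> P D ==> P (%q. D q + pd p q)"
 shows "P D"
 using D le
proof (induction "nat (divisor_degree D - divisor_degree D0)" arbitrary: D)
 case 0
 have "D = D0"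
 proof (rule ccontr)
  assume "D ~= D0"
  then obtain p where "D p ~= D0 p" by auto
  then have p: "D0 p < D p" using 0 by (simp add: order_less_le)
  let ?S = "{p. D p ~= 0} \<union> {p. D0 p ~= 0}"
  have "finite ?S" "p \<in> ?S" using 0 D0 p by (auto simp: point_divisor_def)
  then have "sum D0 ?S < sum D ?S" using 0 p by (intro sum_strict_mono_ex1) auto
  then have "divisor_degree D0 < divisor_degree D"
   using divisor_degree_eq[of ?S D] divisor_degree_eq[of ?S D0] \<open>finite ?S\<close> by auto
  then show False using 0 by simp
 qed
 then show ?case using base by simp
next
 case (Suc n)
 have "D ~= D0" using Suc(2) by auto
 then obtain p where "D p ~= D0 p" by auto
 then have p: "D0 p < D p" using Suc by (simp add: order_less_le)
 have pC: "p \<in> pts C" using p D0 Suc(3) by (cases "D p = 0") (auto simp: point_divisor_def)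
 define D' where "D' = (%q. D q - pd p q)"
 have D': "point_divisor C D'" unfolding D'_def by (intro point_divisor_diff Suc point_divisor_pd pC)
 have eq: "D = (%q. D' q + pd p q)" by (simp add: D'_def)
 have "divisor_degree D = divisor_degree D' + 1"
  using degree_add[OF D' point_divisor_pd[OF pC]] by (simp add: degree_pd eq[symmetric])
 then have n: "n = nat (divisor_degree D' - divisor_degree D0)" using Suc(2) by simp
 have le': "D0 q \<le> D' q" for q using Suc(4)[of q] p by (auto simp: D'_def pd_def)
 have "P D'" by (rule Suc(1)[OF n D' le'])
 then have "P (%q. D' q + pd p q)" using step[OF pC D' le'] by simp
 then show ?case using eq by simp
qed

text \<open>This characterises nonzero rational functions: the zero function satisfies
  \<open>ordeq\<close> at no point and for no order.\<close>

definition merom :: "('c => complex) => bool" where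
 "merom f \<longleftrightarrow> (\<forall>p\<in>pts C. \<exists>k. ordeq p k f)"

text \<open>The value 0 off the curve makes the principal divisor a
  \<open>point_divisor\<close>.\<close>

definition dv :: "('c => complex) => 'c => int" where
 "dv f p = (if p \<in> pts C then THE k. ordeq p k f else 0)"

lemma dv: "merom f ==> p \<in> pts C ==> ordeq p (dv f p) f"
proof -
 assume "merom f" and p: "p \<in> pts C"
 then obtain k where k: "ordeq p k f" by (auto simp: merom_def)
 have "(THE k. ordeq p k f) = k" using k ordeq_unique by (intro the_equality) auto
 then show ?thesis using k p by (simp add: dv_def)
qed

lemma dv_eq: "ordeq p k f ==> merom f ==> dv f p = k"
 by (rule ordeq_unique[OF dv]) (auto intro: ordge_pts ordeq_imp_ordge)

lemma LL_merom:
 assumes "f \<in> LL D" "f \<notin> ZZ" shows "merom f"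
 unfolding merom_def
proof
 fix p assume "p \<in> pts C"
 then have "ordge p (- D p) f" using assms(1) by (simp add: LL_def)
 from ordge_dichotomy[OF this] show "\<exists>k. ordeq p k f" using assms(2) by (auto simp: ZZ_def)
qed

lemma point_divisor_dv:
 assumes f: "merom f" shows "point_divisor C (dv f)"
proof -
 obtain p where p: "p \<in> pts C" using nonempty by blast
 have o: "ordeq p (dv f p) f" by (rule dv[OF f p])
 have "\<forall>\<^sub>F y in generic C. dv f y = 0"
  using ordge_generic_regat[OF ordeq_imp_ordge[OF o]] ordeq_generic_nz[OF o]
 proof eventually_elim
  case (elim y)
  then have "ordeq y 0 f" unfolding ordeq_def by (intro exI[of _ f]) simp
  then show ?case using f by (rule dv_eq)
 qed
 then have "finite {y \<in> pts C. dv f y ~= 0}" by (simp add: generic_iff_finite)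
 moreover have "{p. dv f p ~= 0} = {y \<in> pts C. dv f y ~= 0}" by (auto simp: dv_def)
 ultimately show ?thesis by (auto simp: point_divisor_def)
qed

lemma merom_inverse: "merom f ==> merom (%y. 1 / f y)"
 unfolding merom_def by (auto dest: ordeq_inverse)

lemma dv_inverse: "merom f ==> dv (%y. 1 / f y) p = - dv f p"
 using dv_eq[OF ordeq_inverse[OF dv] merom_inverse, of f p] by (cases "p \<in> pts C") (auto simp: dv_def)

lemma LL_mult:
 assumes f: "merom f" and g: "g \<in> LL D"
 shows "(%y. f y * g y) \<in> LL (%q. D q - dv f q)"
proof -
 have "ordge p (- (D p - dv f p)) (%y. f y * g y)" if p: "p \<in> pts C" for p
  using ordge_mult[OF ordeq_imp_ordge[OF dv[OF f p]], of "- D p" g] g p by (simp add: LL_def)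
 then show ?thesis by (simp add: LL_def)
qed

lemma merom_nz: "merom f ==> \<forall>\<^sub>F y in generic C. f y ~= 0"
proof -
 assume "merom f"
 moreover obtain p where "p \<in> pts C" using nonempty by blast
 ultimately have "ordeq p (dv f p) f" by (rule dv)
 then show ?thesis by (rule ordeq_generic_nz)
qed

text \<open>Multiplication by \<open>f\<close> embeds L(D) in L(D - div f), and a relation between
  the images can be divided by \<open>f\<close>, which is generically nonzero.\<close>

lemma dlt_LL_mult:
 assumes f: "merom f" and d: "dlt (LL (%q. D q - dv f q)) ZZ n"
 shows "dlt (LL D) ZZ n"
 unfolding dlt_def
proof (intro allI impI)
 fix v assume "\<forall>i<n. v i \<in> LL D"
 then have "\<forall>i<n. (%y. f y * v i y) \<in> LL (%q. D q - dv f q)" using LL_mult[OF f] by simp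
 then obtain c where c: "\<exists>i<n. c i ~= 0" "(%s. \<Sum>i<n. c i * (f s * v i s)) \<in> ZZ"
  using d[unfolded dlt_def, rule_format, of "%i y. f y * v i y"] by auto
 have "\<forall>\<^sub>F s in generic C. (\<Sum>i<n. c i * (f s * v i s)) = 0" using c(2) by (simp add: ZZ_def)
 then have "\<forall>\<^sub>F s in generic C. (\<Sum>i<n. c i * v i s) = 0" using merom_nz[OF f]
 proof eventually_elim
  case (elim s)
  have "(\<Sum>i<n. c i * (f s * v i s)) = f s * (\<Sum>i<n. c i * v i s)"
   by (simp add: sum_distrib_left mult.left_commute)
  then show ?case using elim by simp
 qed
 then show "\<exists>c. (\<exists>i<n. c i ~= 0) & (%s. \<Sum>i<n. c i * v i s) \<in> ZZ"
  using c(1) by (intro exI[of _ c]) (simp add: ZZ_def)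
qed

lemma hd0_mult:
 assumes f: "merom f" shows "hd0 (%q. D q - dv f q) n \<longleftrightarrow> hd0 D n"
proof -
 have "dlt (LL (%q. D q - dv f q)) ZZ n \<longleftrightarrow> dlt (LL D) ZZ n" for n
  using dlt_LL_mult[OF f, of D n] dlt_LL_mult[OF merom_inverse[OF f], of "%q. D q - dv f q" n]
  by (auto simp: dv_inverse[OF f])
 then show ?thesis by (simp add: hd0_def)
qed

end

text \<open>Constancy of global functions is an assumption here; for the curve of the theorem it is
  derived from the finite dimension of the space of sections of L.\<close>

locale genus_one_curve = curve +
 assumes genus_one: "genus C = 1"
  and constants: "f \<in> reg C (pts C) ==> \<exists>c. \<forall>y\<in>pts C. f y = c"
begin

text \<open>An element of L(0) is given only generically; its regular representatives at the points
  of C have unique values and glue to a global regular function.\<close>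

lemma LL_0: "f \<in> LL (%_. 0) ==> \<exists>c. \<forall>\<^sub>F y in generic C. f y = c"
proof -
 assume f: "f \<in> LL (%_. 0)"
 define G where "G = (%y t. regat C y t & (\<forall>\<^sub>F y in generic C. f y = t y))"
 have ex: "\<exists>t. G y t" if "y \<in> pts C" for y
  using f that by (auto simp: LL_def ordge_def G_def)
 obtain T where T: "T \<in> reg C (pts C)" "\<And>y t. y \<in> pts C ==> G y t ==> T y = t y"
 proof (rule glue[OF openin_topspace, of G])
  show "\<forall>\<^sub>F y' in nhd C y. G y' t" if "G y t" for y t
   using that regat_ev[of y t] by (auto simp: G_def elim: eventually_mono)
  show "t y = t' y" if "G y t" "G y t'" for y t t'
  proof (rule identity_at)
   have "\<forall>\<^sub>F y in generic C. f y = t y" "\<forall>\<^sub>F y in generic C. f y = t' y" using that by (auto simp: G_def)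
   then show "\<forall>\<^sub>F y in generic C. t y = t' y" by eventually_elim simp
  qed (use that in \<open>auto simp: G_def\<close>)
 qed (use ex in \<open>auto simp: G_def\<close>)
 obtain c where c: "\<forall>y\<in>pts C. T y = c" using constants[OF T(1)] by blast
 obtain p where p: "p \<in> pts C" using nonempty by blast
 obtain t where t: "G p t" using ex[OF p] by blast
 have ft: "\<forall>\<^sub>F y in generic C. f y = t y" using t by (simp add: G_def)
 have "\<forall>\<^sub>F y in generic C. regat C y t" using t regat_ev p by (auto simp: G_def intro: eventually_nhd_generic)
 then have "\<forall>\<^sub>F y in generic C. f y = c" using ft generic_pts
 proof eventually_elim
  case (elim y)
  then have "G y t" using ft by (simp add: G_def)
  then show ?case using T(2)[of y t] elim c by simp
 qed
 then show ?thesis ..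
qed

lemma hd0_zero: "hd0 (%_. 0) 1"
proof -
 have "dlt (LL (%_. 0)) ZZ (Suc (Suc 0))"
 proof (rule dlt_codim_one[OF fsubspace_ZZ dlt_1])
  fix v assume "v \<in> LL (%_. 0)"
  then obtain c where "\<forall>\<^sub>F y in generic C. v y = c" using LL_0 by blast
  then show "\<exists>c. (%s. v s - c * 1) \<in> ZZ" by (intro exI[of _ c]) (simp add: ZZ_def)
 qed simp
 moreover have "\<not> dlt (LL (%_. 0)) ZZ (Suc 0)"
 proof
  assume d: "dlt (LL (%_. 0)) ZZ (Suc 0)"
  have "(%_. 1) \<in> LL (%_. 0)" by (simp add: LL_def ordge_regat regat_const)
  then obtain c :: "nat => complex" where "c 0 ~= 0" "(%s. c 0) \<in> ZZ"
   using d[unfolded dlt_def, rule_format, of "%_ _. 1"] by auto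
  then show False using generic_not_bot by (simp add: ZZ_def trivial_limit_def)
 qed
 ultimately show ?thesis by (simp add: hd0_def)
qed

text \<open>Each added point raises h^0 by one unless it is a non-jump. The second alternative
  remembers an earlier non-jump below D, which is the evidence that excludes another one.\<close>

lemma hd0_effective:
 assumes D: "point_divisor C D" "\<And>q. 0 \<le> D q"
 shows "hd0 D (nat (divisor_degree D) + 1) \<or> (hd0 D (nat (divisor_degree D)) &
  (\<exists>D1 p1. p1 \<in> pts C & (\<forall>q. 0 \<le> D1 q) & (\<forall>q. D1 q + pd p1 q \<le> D q) & \<not> jump D1 p1))"
 using point_divisor_zero D
proof (rule divisor_induct, goal_cases)
 case 1
 then show ?case using hd0_zero by (simp add: degree_zero)
next
 case (2 D p)
 have deg: "nat (divisor_degree (%q. D q + pd p q)) = Suc (nat (divisor_degree D))"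
  using degree_add[OF 2(2) point_divisor_pd[OF 2(1)]] degree_nonneg[of D] 2(3) by (simp add: degree_pd)
 show ?case
 proof (cases "jump D p")
  case True
  note j = hd0_jump[OF 2(1) True]
  have le: "D1 q + pd p1 q \<le> D q + pd p q" if "\<And>q. D1 q + pd p1 q \<le> D q" for D1 p1 q
   using that[of q] pd_nonneg[of p q] by simp
  from 2(4) show ?thesis unfolding deg using j[of "nat (divisor_degree D) + 1"] j[of "nat (divisor_degree D)"] le
   by (elim disjE) (simp, blast)
 next
  case False
  have "hd0 D (nat (divisor_degree D) + 1)"
   using 2(4)
  proof (elim disjE exE conjE)
   fix D1 p1 assume "p1 \<in> pts C" "\<forall>q. 0 \<le> D1 q" "\<forall>q. D1 q + pd p1 q \<le> D q" "\<not> jump D1 p1"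
   then have False using nonjumps_exclusive[OF genus_one _ 2(1) _ False, of p1 D1] by blast
   then show ?thesis ..
  qed
  then have "hd0 (%q. D q + pd p q) (Suc (nat (divisor_degree D)))"
   unfolding hd0_def not_jump_LL[OF False] by simp
  then show ?thesis unfolding deg using 2 False by (intro disjI2 conjI exI[of _ D] exI[of _ p]) auto
 qed
qed

lemma hd0_degree_bounds:
 assumes D: "point_divisor C D" "\<And>q. 0 \<le> D q"
 obtains n where "hd0 D n" "divisor_degree D \<le> int n" "int n \<le> divisor_degree D + 1"
proof -
 have "0 \<le> divisor_degree D" by (rule degree_nonneg) (rule D(2))
 then show thesis
  using hd0_effective[OF D] that[of "nat (divisor_degree D) + 1"] that[of "nat (divisor_degree D)"]
  by (elim disjE conjE) simp_all
qed

text \<open>Once the non-jump at k p has been passed, no later step can fail, so h^0 stays equal to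
  the degree.\<close>

lemma hd0_nonspecial:
 obtains p and k :: nat where "p \<in> pts C"
  "\<And>D. point_divisor C D ==> (\<And>q. int k * pd p q \<le> D q) ==> hd0 D (nat (divisor_degree D))"
proof -
 obtain p and k :: nat where p: "p \<in> pts C" and nj: "\<not> jump (%q. int k * pd p q) p"
  using nonjump_exists[OF genus_one] by blast
 define D0 where "D0 = (%q. int k * pd p q + pd p q)"
 have D0: "point_divisor C D0" unfolding D0_def by (intro point_divisor_add point_divisor_mult point_divisor_pd p)
 have pos: "0 \<le> int k * pd p q" for q by (simp add: pd_def)
 have pk: "point_divisor C (%q. int k * pd p q)" by (intro point_divisor_mult point_divisor_pd p)
 have degk: "divisor_degree (%q. int k * pd p q) = int k" by (simp add: degree_mult degree_pd)
 have "hd0 (%q. int k * pd p q) (k + 1)"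
  using hd0_effective[OF pk pos] unfolding degk
 proof (elim disjE exE conjE)
  fix D1 p1 assume "p1 \<in> pts C" "\<forall>q. 0 \<le> D1 q" "\<forall>q. D1 q + pd p1 q \<le> int k * pd p q" "\<not> jump D1 p1"
  then have False using nonjumps_exclusive[OF genus_one _ p _ nj, of p1 D1] by blast
  then show ?thesis ..
 qed simp
 then have h0: "hd0 D0 (k + 1)" unfolding D0_def hd0_def not_jump_LL[OF nj] .
 have deg0: "divisor_degree D0 = int k + 1" unfolding D0_def
  using degree_add[OF pk point_divisor_pd[OF p]] by (simp add: degk degree_pd)
 have "hd0 D (nat (divisor_degree D))" if D: "point_divisor C D" and le: "\<And>q. D0 q \<le> D q" for D
  using D0 D le
 proof (rule divisor_induct, goal_cases)
  case 1
  then show ?case using h0 by (simp add: deg0 nat_add_distrib)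
 next
  case (2 D p')
  have D_nonneg: "0 \<le> D q" for q using 2(3)[of q] pos[of q] by (simp add: D0_def pd_def split: if_splits)
  have "jump D p'"
  proof (rule ccontr)
   assume "\<not> jump D p'"
   from nonjumps_exclusive[OF genus_one p 2(1) nj this pos] 2(3) show False
    by (simp add: D0_def)
  qed
  from hd0_jump[OF 2(1) this 2(4)] show ?case
   using degree_add[OF 2(2) point_divisor_pd[OF 2(1)]] degree_nonneg[of D] D_nonneg
   by (simp add: degree_pd nat_add_distrib)
 qed
 \<comment> \<open>The bound handed out is \<open>k + 1\<close>, because \<open>D0\<close> is k p +
   p.\<close>
 then show thesis using that[of p "k + 1"] p by (simp add: D0_def algebra_simps)
qed

text \<open>With Z and P the divisors of zeros and poles, n Z and n P are linearly equivalent.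
  Comparing their common h^0 with the bounds degree and degree + 1 gives n deg Z <= n deg P +
  1.\<close>

lemma degree_dv_le:
 assumes f: "merom f" shows "divisor_degree (dv f) \<le> 0"
proof -
 define Z where "Z = (%q. max (dv f q) 0)"
 define P where "P = (%q. max (- dv f q) 0)"
 have fin: "point_divisor C Z" "point_divisor C P"
  using point_divisor_dv[OF f] unfolding point_divisor_def Z_def P_def
  by (auto intro: finite_subset[of _ "{p. dv f p ~= 0}"])
 have ZP: "dv f = (%q. Z q - P q)" by (auto simp: Z_def P_def)
 have "divisor_degree Z = divisor_degree (dv f) + divisor_degree P"
  using degree_add[OF point_divisor_dv[OF f] fin(2)] by (simp add: ZP)
 moreover have "int n * divisor_degree Z \<le> int n * divisor_degree P + 1" for n
 proof -
  have pZ: "point_divisor C (%q. int n * Z q)" "\<And>q. 0 \<le> int n * Z q"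
   using fin by (auto intro: point_divisor_mult simp: Z_def)
  have pP: "point_divisor C (%q. int n * P q)" "\<And>q. 0 \<le> int n * P q"
   using fin by (auto intro: point_divisor_mult simp: P_def)
  obtain a where a: "hd0 (%q. int n * Z q) a" "int n * divisor_degree Z \<le> int a"
   by (rule hd0_degree_bounds[OF pZ]) (simp add: degree_mult that)
  obtain b where b: "hd0 (%q. int n * P q) b" "int b \<le> int n * divisor_degree P + 1"
   by (rule hd0_degree_bounds[OF pP]) (simp add: degree_mult that)
  have "hd0 (%q. D q - int n * dv f q) a \<longleftrightarrow> hd0 D a" for D
  proof (induction n)
   case (Suc n)
   have "(%q. D q - int (Suc n) * dv f q) = (%q. (D q - int n * dv f q) - dv f q)"
    by (auto simp: algebra_simps)
   then show ?case using Suc hd0_mult[OF f, of "%q. D q - int n * dv f q" a] by simp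
  qed simp
  from this[of "%q. int n * Z q"] a(1) have "hd0 (%q. int n * P q) a"
   by (simp add: ZP algebra_simps)
  then show ?thesis using hd0_unique[OF _ b(1), of a] a(2) b(2) by simp
 qed
 \<comment> \<open>Over the integers the case n = 2 already absorbs the defect 1.\<close>
 from this[of 2] have "2 * divisor_degree Z \<le> 2 * divisor_degree P + 1" by simp
 ultimately show ?thesis by simp
qed

lemma degree_dv: "merom f ==> divisor_degree (dv f) = 0"
proof -
 assume f: "merom f"
 have "dv (%y. 1 / f y) = (%q. - dv f q)" by (rule ext) (rule dv_inverse[OF f])
 then show ?thesis
  using degree_dv_le[OF f] degree_dv_le[OF merom_inverse[OF f]] degree_uminus[of "dv f"] by simp
qed

lemma dlt_LL_diff:
 assumes p: "p \<in> pts C" and d: "dlt (LL (%q. D q - int k * pd p q)) ZZ n"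
 shows "dlt (LL D) ZZ (n + k)"
 using d
proof (induction k arbitrary: n)
 case (Suc k)
 have "(%q. D q - int (Suc k) * pd p q + pd p q) = (%q. D q - int k * pd p q)"
  by (auto simp: algebra_simps)
 then have "dlt (LL (%q. D q - int k * pd p q)) ZZ (Suc n)"
  using dlt_LL_add[OF p Suc.prems] by simp
 from Suc.IH[OF this] show ?case by simp
qed simp

text \<open>Two independent functions would make D equivalent to a point q and give a function with
  one simple pole, at q. Its powers force h^0(n q) = n + 1 for all n. With k p nonspecial, L(k q - k
  p) is still nonzero, so k q is equivalent to a divisor above k p, for which h^0 must be k.\<close>

theorem dlt_LL_degree_one:
 assumes D: "point_divisor C D" and deg: "divisor_degree D = 1"
 shows "dlt (LL D) ZZ 2"
proof (rule ccontr)
 assume nd: "\<not> dlt (LL D) ZZ 2"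
 then have "\<not> LL D \<subseteq> ZZ" using dlt_mono[OF dlt_1, of "LL D" ZZ 2] by auto
 then obtain f1 where f1: "f1 \<in> LL D" "f1 \<notin> ZZ" by blast
 have m1: "merom f1" by (rule LL_merom[OF f1])
 \<comment> \<open>Adding the divisor of \<open>f1\<close> makes D effective of degree one, hence a
   single point.\<close>
 define D1 where "D1 = (%q. D q + dv f1 q)"
 have D1: "point_divisor C D1" unfolding D1_def by (intro point_divisor_add D point_divisor_dv m1)
 have deg1: "divisor_degree D1 = 1" unfolding D1_def
  using degree_add[OF D point_divisor_dv[OF m1]] degree_dv[OF m1] deg by simp
 have D1pos: "0 \<le> D1 q" for q
 proof (cases "q \<in> pts C")
  case True
  then have "ordge q (- D q) f1" using f1 by (simp add: LL_def)
  then show ?thesis using ordeq_ordge_iff[OF dv[OF m1 True], of "- D q"] by (simp add: D1_def)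
 next
  case False
  then have "D q = 0" using D by (auto simp: point_divisor_def)
  then show ?thesis using False by (simp add: D1_def dv_def)
 qed
 have nd1: "\<not> dlt (LL D1) ZZ 2"
  using nd dlt_LL_mult[OF merom_inverse[OF m1], of D 2] by (auto simp: D1_def dv_inverse[OF m1])
 obtain q where q: "q \<in> pts C" "D1 = pd q"
 proof -
  have fin: "finite {p. D1 p ~= 0}" using D1 by (simp add: point_divisor_def)
  have "{p. D1 p ~= 0} ~= {}"
  proof
   assume "{p. D1 p ~= 0} = {}"
   then show False using deg1 unfolding divisor_degree_def by (simp only: sum.empty)
  qed
  then obtain q where q: "D1 q ~= 0" by blast
  have qC: "q \<in> pts C" using q D1 by (auto simp: point_divisor_def)
  have "divisor_degree D1 = D1 q + sum D1 ({p. D1 p ~= 0} - {q})"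
   unfolding divisor_degree_def using fin q by (intro sum.remove) auto
  moreover have "0 \<le> sum D1 ({p. D1 p ~= 0} - {q})" using D1pos by (intro sum_nonneg)
  moreover have "1 \<le> D1 q" using D1pos[of q] q by simp
  ultimately have "D1 q = 1" and s: "sum D1 ({p. D1 p ~= 0} - {q}) = 0" using deg1 by auto
  have "\<forall>r\<in>{p. D1 p ~= 0} - {q}. D1 r = 0"
   using s fin D1pos by (subst (asm) sum_nonneg_eq_0_iff) auto
  then have "D1 = pd q" using \<open>D1 q = 1\<close> by (auto simp: pd_def fun_eq_iff)
  then show thesis using that qC by blast
 qed
 \<comment> \<open>Otherwise L(q) would consist of constants only and have dimension one.\<close>
 have "jump (%_. 0) q"
 proof (rule ccontr)
  assume "\<not> jump (%_. 0) q"
  then have "LL D1 = LL (%_. 0)" using not_jump_LL[of "%_. 0" q] q by simp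
  then show False using hd0_zero nd1 by (simp add: hd0_def numeral_2_eq_2)
 qed
 then obtain f where f: "f \<in> LL (pd q)" "f \<notin> LL (%_. 0)" by (auto simp: jump_def)
 have of: "ordge x (- pd q x) f" if "x \<in> pts C" for x using f(1) that by (simp add: LL_def)
 have nf: "\<not> ordge q 0 f"
 proof
  assume "ordge q 0 f"
  moreover have "ordge x 0 f" if "x \<in> pts C" "x ~= q" for x using of[OF that(1)] that(2) by (simp add: pd_def)
  ultimately show False using f(2) by (auto simp: LL_def)
 qed
 have fq: "ordeq q (- 1) f"
 proof -
  have "ordge q (- 1) f" using of[OF q(1)] by (simp add: pd_def)
  from ordge_dichotomy[OF this] nf obtain k where k: "k \<ge> - 1" "ordeq q k f"
   using ordge_cong[OF ordge_zero[OF q(1)], of f 0] by auto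
  then have "k < 0" using nf ordeq_ordge_iff[of q k f 0] by auto
  then have "k = - 1" using k by simp
  then show ?thesis using k by simp
 qed
 have pw: "ordeq q (- int n) (%y. f y ^ n)" "\<And>x. x \<in> pts C ==> x ~= q ==> ordge x 0 (%y. f y ^ n)" for n
 proof (induction n)
  case 0
  { case 1 show ?case unfolding ordeq_def
    by (rule exI[of _ "%_. 1"]) (simp add: regat_const q) }
  { case 2 then show ?case by (simp add: ordge_regat regat_const) }
 next
  case (Suc n)
  { case 1 show ?case using ordeq_mult[OF fq Suc(1)] by simp }
  { case (2 x) then show ?case using ordge_mult[OF of[OF 2(1)] Suc(2)[OF 2]] by (simp add: pd_def) }
 qed
 have hn: "hd0 (%x. int n * pd q x) (n + 1)" for n
 proof (induction n)
  case 0 then show ?case using hd0_zero by simp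
 next
  case (Suc n)
  have "(%y. f y ^ Suc n) \<in> LL (%x. int n * pd q x + pd q x)"
  proof -
   have "ordge x (- (int n * pd q x + pd q x)) (%y. f y ^ Suc n)" if "x \<in> pts C" for x
    using ordeq_imp_ordge[OF pw(1)[of "Suc n"]] pw(2)[OF that, of "Suc n"]
    by (cases "x = q") (simp_all add: pd_def add.commute)
   then show ?thesis by (simp add: LL_def)
  qed
  moreover have "(%y. f y ^ Suc n) \<notin> LL (%x. int n * pd q x)"
   using ordeq_ordge_iff[OF pw(1)[of "Suc n"], of "- int n"] q(1) by (auto simp: LL_def pd_def)
  ultimately have "jump (%x. int n * pd q x) q" by (auto simp: jump_def)
  from hd0_jump[OF q(1) this Suc] show ?case by (simp add: algebra_simps)
 qed
 obtain p k where p: "p \<in> pts C" and ns: "\<And>D. point_divisor C D ==>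
   (\<And>q. int k * pd p q \<le> D q) ==> hd0 D (nat (divisor_degree D))"
  by (rule hd0_nonspecial) blast
 \<comment> \<open>Imposing a zero of order k at \<open>p\<close> costs at most k of the k + 1
   dimensions of L(k q).\<close>
 have "\<not> LL (%x. int k * pd q x - int k * pd p x) \<subseteq> ZZ"
 proof
  assume "LL (%x. int k * pd q x - int k * pd p x) \<subseteq> ZZ"
  then have "dlt (LL (%x. int k * pd q x)) ZZ (Suc 0 + k)" by (intro dlt_LL_diff[OF p] dlt_1)
  then show False using hn[of k] by (simp add: hd0_def)
 qed
 then obtain g where g: "g \<in> LL (%x. int k * pd q x - int k * pd p x)" "g \<notin> ZZ" by blast
 have mg: "merom g" by (rule LL_merom[OF g])
 define D' where "D' = (%x. int k * pd q x + dv g x)"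
 have pq: "point_divisor C (%x. int k * pd q x)" by (intro point_divisor_mult point_divisor_pd q)
 have D': "point_divisor C D'" unfolding D'_def by (intro point_divisor_add pq point_divisor_dv mg)
 have "int k * pd p x \<le> D' x" for x
 proof (cases "x \<in> pts C")
  case True
  then have "ordge x (- (int k * pd q x - int k * pd p x)) g" using g by (simp add: LL_def)
  then show ?thesis using ordeq_ordge_iff[OF dv[OF mg True]] by (simp add: D'_def)
 next
  case False
  then show ?thesis using p q by (auto simp: D'_def dv_def pd_def)
 qed
 from ns[OF D' this] have "hd0 D' (nat (divisor_degree D'))" .
 moreover have "divisor_degree D' = int k" unfolding D'_def
  using degree_add[OF pq point_divisor_dv[OF mg]] degree_dv[OF mg] by (simp add: degree_mult degree_pd)
 moreover have "hd0 D' (k + 1)"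
  using hn[of k] hd0_mult[OF mg, of D' "k + 1"] by (simp add: D'_def)
 ultimately show False using hd0_unique[of D' k "k + 1"] by simp
qed

end

section \<open>Polynomial functions and Hilbert's basis theorem\<close>

lemma polyfun_scale: "p \<in> polyfun n ==> (%v. c * p v) \<in> polyfun n"
 by (rule polyfun.mult[OF polyfun.const])

lemma polyfun_sum: "(\<And>i. i \<in> I ==> f i \<in> polyfun n) ==> (%v. \<Sum>i\<in>I. f i v) \<in> polyfun n"
 by (induction I rule: infinite_finite_induct) (auto intro: polyfun.intros)

lemma polyfun_power: "p \<in> polyfun n ==> (%v. p v ^ k) \<in> polyfun n"
 by (induction k) (auto intro: polyfun.intros)

lemma polyfun_mono: "p \<in> polyfun n ==> n \<le> m ==> p \<in> polyfun m"
 by (induction rule: polyfun.induct) (auto intro: polyfun.intros)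

text \<open>Induction over the construction of \<open>p\<close>; the increment of a product is that
  of the first factor times the second, plus the first at \<open>w\<close> times that of the second.
  It makes the coordinates centred at a point generate its maximal ideal.\<close>

lemma polyfun_taylor:
 assumes "p \<in> polyfun n"
 shows "\<exists>g. (\<forall>j<n. g j \<in> polyfun n) & (\<forall>v. p v = p w + (\<Sum>j<n. g j v * (v j - w j)))"
 using assms
proof (induction rule: polyfun.induct)
 case (const c)
 show ?case by (rule exI[of _ "%_ _. 0"]) (simp add: polyfun.const)
next
 case (coord i)
 have "(\<Sum>j<n. (if j = i then 1 else 0) * (v j - w j)) = v i - w i" for v
 proof -
  have "(\<Sum>j<n. (if j = i then 1 else 0) * (v j - w j)) = (\<Sum>j<n. if j = i then v j - w j else 0)"
   by (intro sum.cong) auto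
  then show ?thesis using coord by simp
 qed
 then show ?case by (intro exI[of _ "%j _. if j = i then 1 else 0"]) (auto intro: polyfun.const)
next
 case (add p q)
 then obtain g h where gh: "\<forall>j<n. g j \<in> polyfun n" "\<forall>v. p v = p w + (\<Sum>j<n. g j v * (v j - w j))"
  "\<forall>j<n. h j \<in> polyfun n" "\<forall>v. q v = q w + (\<Sum>j<n. h j v * (v j - w j))" by auto
 have *: "p v + q v = (p w + q w) + (\<Sum>j<n. (g j v + h j v) * (v j - w j))" for v
 proof -
  have "p v = p w + (\<Sum>j<n. g j v * (v j - w j))" "q v = q w + (\<Sum>j<n. h j v * (v j - w j))"
   using gh(2,4) by blast+
  moreover have "(\<Sum>j<n. (g j v + h j v) * (v j - w j)) = (\<Sum>j<n. g j v * (v j - w j)) + (\<Sum>j<n. h j v * (v j - w j))"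
   unfolding sum.distrib[symmetric] distrib_right ..
  ultimately show ?thesis by algebra
 qed
 show ?case by (intro exI[of _ "%j v. g j v + h j v"] conjI allI impI polyfun.add *) (use gh(1,3) in auto)
next
 case (mult p q)
 then obtain g h where gh: "\<forall>j<n. g j \<in> polyfun n" "\<forall>v. p v = p w + (\<Sum>j<n. g j v * (v j - w j))"
  "\<forall>j<n. h j \<in> polyfun n" "\<forall>v. q v = q w + (\<Sum>j<n. h j v * (v j - w j))" by auto
 have *: "p v * q v = (p w * q w) + (\<Sum>j<n. (g j v * q v + p w * h j v) * (v j - w j))" for v
 proof -
  have "(\<Sum>j<n. (g j v * q v + p w * h j v) * (v j - w j))
    = (\<Sum>j<n. g j v * (v j - w j)) * q v + p w * (\<Sum>j<n. h j v * (v j - w j))"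
   unfolding sum_distrib_left sum_distrib_right sum.distrib[symmetric]
   by (rule sum.cong) (simp_all add: algebra_simps)
  moreover have "p v = p w + (\<Sum>j<n. g j v * (v j - w j))" "q v = q w + (\<Sum>j<n. h j v * (v j - w j))"
   using gh(2,4) by blast+
  ultimately show ?thesis by algebra
 qed
 show ?case
  by (intro exI[of _ "%j v. g j v * q v + p w * h j v"] conjI allI impI polyfun.intros *)
   (use gh(1,3) mult(1,2) in auto)
qed

definition pideal :: "nat => ((nat => complex) => complex) set => bool" where
 "pideal n J \<longleftrightarrow> J \<subseteq> polyfun n & (%_. 0) \<in> J & (\<forall>f\<in>J. \<forall>g\<in>J. (%v. f v + g v) \<in> J) &
  (\<forall>f\<in>J. \<forall>p\<in>polyfun n. (%v. p v * f v) \<in> J)"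

definition comb :: "nat => ((nat => complex) => complex) set => ((nat => complex) => complex) set" where
 "comb n F = {f. \<exists>g. (\<forall>b\<in>F. g b \<in> polyfun n) & f = (%v. \<Sum>b\<in>F. g b v * b v)}"

lemma pideal_sum:
 assumes J: "pideal n J" and "\<And>b. b \<in> F ==> g b \<in> polyfun n" "\<And>b. b \<in> F ==> h b \<in> J"
 shows "(%v. \<Sum>b\<in>F. g b v * h b v) \<in> J"
 using assms(2,3)
proof (induction F rule: infinite_finite_induct)
 case (insert x F)
 then have "(%v. g x v * h x v) \<in> J" "(%v. \<Sum>b\<in>F. g b v * h b v) \<in> J"
  using J by (auto simp: pideal_def)
 then show ?case using J insert(1,2) by (simp add: pideal_def)
qed (use J in \<open>auto simp: pideal_def\<close>)

lemma pideal_add: "pideal n J ==> f \<in> J ==> g \<in> J ==> (%v. f v + g v) \<in> J"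
 by (simp add: pideal_def)

lemma comb_subset: "pideal n J ==> F \<subseteq> J ==> comb n F \<subseteq> J"
 unfolding comb_def by (auto intro: pideal_sum)

lemma comb_mono:
 assumes "F \<subseteq> F'" "finite F'" shows "comb n F \<subseteq> comb n F'"
proof
 fix f assume "f \<in> comb n F"
 then obtain g where g: "\<forall>b\<in>F. g b \<in> polyfun n" "f = (%v. \<Sum>b\<in>F. g b v * b v)" by (auto simp: comb_def)
 define g' where "g' = (%b. if b \<in> F then g b else (%_. 0))"
 have "(\<Sum>b\<in>F'. g' b v * b v) = (\<Sum>b\<in>F. g b v * b v)" for v
  by (rule sum.mono_neutral_cong_right) (use assms in \<open>auto simp: g'_def\<close>)
 then have "f = (%v. \<Sum>b\<in>F'. g' b v * b v)" using g by simp
 moreover have "\<forall>b\<in>F'. g' b \<in> polyfun n" using g by (auto simp: g'_def intro: polyfun.const)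
 ultimately show "f \<in> comb n F'" unfolding comb_def by blast
qed

lemma comb_add:
 assumes "f \<in> comb n F" "g \<in> comb n F" shows "(%v. f v + g v) \<in> comb n F"
proof -
 obtain a b where ab: "\<forall>c\<in>F. a c \<in> polyfun n" "f = (%v. \<Sum>c\<in>F. a c v * c v)"
  "\<forall>c\<in>F. b c \<in> polyfun n" "g = (%v. \<Sum>c\<in>F. b c v * c v)" using assms by (auto simp: comb_def)
 have "(%v. f v + g v) = (%v. \<Sum>c\<in>F. (a c v + b c v) * c v)"
  using ab by (simp add: sum.distrib distrib_right)
 moreover have "\<forall>c\<in>F. (%v. a c v + b c v) \<in> polyfun n" using ab by (auto intro: polyfun.add)
 ultimately show ?thesis unfolding comb_def by (intro CollectI exI[of _ "%c v. a c v + b c v"]) simp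
qed

lemma comb_zero: "(%_. 0) \<in> comb n F"
 unfolding comb_def by (intro CollectI exI[of _ "%_ _. 0"]) (simp add: polyfun.const)

text \<open>Degree strictly below \<open>d\<close> in the last variable, with coefficients in the
  first \<open>n\<close> variables; the strict bound leaves only zero for \<open>d = 0\<close>. No
  uniqueness of the coefficients is claimed.\<close>

definition polydeg :: "nat => nat => ((nat => complex) => complex) set" where
 "polydeg n d = {f. \<exists>a. (\<forall>i<d. a i \<in> polyfun n) & f = (%v. \<Sum>i<d. a i v * v n ^ i)}"

lemma polydeg_Suc_iff:
 "f \<in> polydeg n (Suc d) \<longleftrightarrow> (\<exists>a\<in>polyfun n. \<exists>r\<in>polydeg n d. f = (%v. a v * v n ^ d + r v))"
proof
 assume "f \<in> polydeg n (Suc d)"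
 then obtain a where a: "\<forall>i<Suc d. a i \<in> polyfun n" "f = (%v. \<Sum>i<Suc d. a i v * v n ^ i)"
  by (auto simp: polydeg_def)
 then have "(%v. \<Sum>i<d. a i v * v n ^ i) \<in> polydeg n d" unfolding polydeg_def
  by (intro CollectI exI[of _ a]) simp
 moreover have "f = (%v. a d v * v n ^ d + (\<Sum>i<d. a i v * v n ^ i))" using a by (simp add: add.commute)
 ultimately show "\<exists>a\<in>polyfun n. \<exists>r\<in>polydeg n d. f = (%v. a v * v n ^ d + r v)" using a by auto
next
 assume "\<exists>a\<in>polyfun n. \<exists>r\<in>polydeg n d. f = (%v. a v * v n ^ d + r v)"
 then obtain a b where ab: "a \<in> polyfun n" "\<forall>i<d. b i \<in> polyfun n"
  "f = (%v. a v * v n ^ d + (\<Sum>i<d. b i v * v n ^ i))" by (auto simp: polydeg_def)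
 define c where "c = (%i. if i = d then a else b i)"
 have "f = (%v. \<Sum>i<Suc d. c i v * v n ^ i)" using ab(3) by (simp add: c_def add.commute)
 moreover have "\<forall>i<Suc d. c i \<in> polyfun n" using ab by (auto simp: c_def less_Suc_eq)
 ultimately show "f \<in> polydeg n (Suc d)" by (auto simp: polydeg_def)
qed

lemma polydeg_0: "polydeg n 0 = {%_. 0}"
 by (auto simp: polydeg_def)

lemma polydeg_add: "f \<in> polydeg n d ==> g \<in> polydeg n d ==> (%v. f v + g v) \<in> polydeg n d"
proof (induction d arbitrary: f g)
 case 0 then show ?case by (simp add: polydeg_0)
next
 case (Suc d)
 from Suc.prems obtain a r b s where *: "a \<in> polyfun n" "r \<in> polydeg n d" "f = (%v. a v * v n ^ d + r v)"
  "b \<in> polyfun n" "s \<in> polydeg n d" "g = (%v. b v * v n ^ d + s v)" unfolding polydeg_Suc_iff by blast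
 then have "(%v. f v + g v) = (%v. (a v + b v) * v n ^ d + (r v + s v))" by (simp add: algebra_simps)
 then show ?case unfolding polydeg_Suc_iff using * Suc.IH
  by (intro bexI[of _ "%v. a v + b v"] bexI[of _ "%v. r v + s v"]) (auto intro: polyfun.add)
qed

lemma polydeg_mult: "p \<in> polyfun n ==> f \<in> polydeg n d ==> (%v. p v * f v) \<in> polydeg n d"
proof (induction d arbitrary: f)
 case 0 then show ?case by (simp add: polydeg_0)
next
 case (Suc d)
 from Suc.prems obtain a r where *: "a \<in> polyfun n" "r \<in> polydeg n d" "f = (%v. a v * v n ^ d + r v)"
  unfolding polydeg_Suc_iff by blast
 then have "(%v. p v * f v) = (%v. (p v * a v) * v n ^ d + p v * r v)" by (simp add: algebra_simps)
 then show ?case unfolding polydeg_Suc_iff using * Suc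
  by (intro bexI[of _ "%v. p v * a v"] bexI[of _ "%v. p v * r v"]) (auto intro: polyfun.mult)
qed

lemma polydeg_Suc: "f \<in> polydeg n d ==> f \<in> polydeg n (Suc d)"
 unfolding polydeg_Suc_iff by (intro bexI[of _ "%_. 0"] bexI[of _ f]) (auto intro: polyfun.const)

lemma polydeg_mono: "f \<in> polydeg n d ==> d \<le> e ==> f \<in> polydeg n e"
 by (induction e) (auto simp: le_Suc_eq intro: polydeg_Suc)

lemma polydeg_sum: "(\<And>i. i \<in> I ==> f i \<in> polydeg n d) ==> (%v. \<Sum>i\<in>I. f i v) \<in> polydeg n d"
 using polydeg_mono[of "%_. 0" n 0 d]
 by (induction I rule: infinite_finite_induct) (auto simp: polydeg_0 intro: polydeg_add)

lemma polydeg_shift: "f \<in> polydeg n d ==> (%v. v n * f v) \<in> polydeg n (Suc d)"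
proof (induction d arbitrary: f)
 case 0 then show ?case using polydeg_Suc by (auto simp: polydeg_0)
next
 case (Suc d)
 from Suc.prems obtain a r where *: "a \<in> polyfun n" "r \<in> polydeg n d" "f = (%v. a v * v n ^ d + r v)"
  unfolding polydeg_Suc_iff by blast
 then have "(%v. v n * f v) = (%v. a v * v n ^ Suc d + v n * r v)" by (simp add: algebra_simps)
 then show ?case unfolding polydeg_Suc_iff[of _ n "Suc d"]
  by (intro bexI[OF _ *(1)] bexI[OF _ Suc.IH[OF *(2)]])
qed

lemma polydeg_shifts: "f \<in> polydeg n d ==> (%v. v n ^ k * f v) \<in> polydeg n (d + k)"
proof (induction k)
 case (Suc k)
 from polydeg_shift[OF Suc.IH[OF Suc.prems]] show ?case by (simp add: mult.assoc)
qed simp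

lemma polydeg_times: "f \<in> polydeg n d ==> g \<in> polydeg n e ==> (%v. f v * g v) \<in> polydeg n (d + e)"
proof (induction d arbitrary: f)
 case 0 then show ?case using polydeg_mono[of "%_. 0" n 0 e] by (auto simp: polydeg_0)
next
 case (Suc d)
 from Suc.prems obtain a r where *: "a \<in> polyfun n" "r \<in> polydeg n d" "f = (%v. a v * v n ^ d + r v)"
  unfolding polydeg_Suc_iff by blast
 have "(%v. a v * (v n ^ d * g v)) \<in> polydeg n (Suc (d + e))"
  using polydeg_mono[OF polydeg_mult[OF *(1) polydeg_shifts[OF Suc.prems(2), of d]]] by simp
 moreover have "(%v. r v * g v) \<in> polydeg n (Suc (d + e))"
  using polydeg_Suc[OF Suc.IH[OF *(2) Suc.prems(2)]] .
 ultimately have "(%v. a v * (v n ^ d * g v) + r v * g v) \<in> polydeg n (Suc (d + e))" by (rule polydeg_add)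
 then show ?case using *(3) by (simp add: algebra_simps)
qed

lemma polyfun_Suc_polydeg: "f \<in> polyfun (Suc n) ==> \<exists>d. f \<in> polydeg n d"
proof (induction rule: polyfun.induct)
 have c: "p \<in> polydeg n 1" if "p \<in> polyfun n" for p
  unfolding One_nat_def polydeg_Suc_iff polydeg_0 using that by (intro bexI[of _ p] bexI[of _ "%_. 0"]) auto
 { case (const c) show ?case using c[OF polyfun.const] by blast }
 case (coord i)
 then show ?case
 proof (cases "i < n")
  case True then show ?thesis using c[OF polyfun.coord] by blast
 next
  case False
  then have "i = n" using coord by simp
  then show ?thesis using polydeg_shift[OF c[OF polyfun.const, of 1]] by auto
 qed
next
 case (add p q)
 then obtain d e where "p \<in> polydeg n d" "q \<in> polydeg n e" by blast
 then have "p \<in> polydeg n (max d e)" "q \<in> polydeg n (max d e)" by (auto intro: polydeg_mono)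
 then show ?case using polydeg_add by blast
next
 case (mult p q) then show ?case using polydeg_times by blast
qed

text \<open>The ideal of leading coefficients from the classical proof of the basis theorem, in the
  fixed degree \<open>d\<close>, zero included.\<close>

definition lead :: "nat => ((nat => complex) => complex) set => nat => ((nat => complex) => complex) set" where
 "lead n J d = {a \<in> polyfun n. \<exists>r\<in>polydeg n d. (%v. a v * v n ^ d + r v) \<in> J}"

lemma pideal_lead:
 assumes J: "pideal (Suc n) J" shows "pideal n (lead n J d)"
 unfolding pideal_def
proof (intro conjI ballI)
 show "lead n J d \<subseteq> polyfun n" by (auto simp: lead_def)
 have "(%_. 0) \<in> polydeg n d" by (rule polydeg_mono[of _ n 0]) (simp_all add: polydeg_0)
 then show "(%_. 0) \<in> lead n J d" using J
  by (auto simp: lead_def pideal_def intro!: polyfun.const bexI[of _ "%_. 0"])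
 fix f assume "f \<in> lead n J d"
 then obtain r where f: "f \<in> polyfun n" "r \<in> polydeg n d" "(%v. f v * v n ^ d + r v) \<in> J" by (auto simp: lead_def)
 { fix g assume "g \<in> lead n J d"
  then obtain s where g: "g \<in> polyfun n" "s \<in> polydeg n d" "(%v. g v * v n ^ d + s v) \<in> J" by (auto simp: lead_def)
  have "(%v. (f v * v n ^ d + r v) + (g v * v n ^ d + s v)) \<in> J" using J f(3) g(3) by (simp add: pideal_def)
  then have "(%v. (f v + g v) * v n ^ d + (r v + s v)) \<in> J" by (simp add: algebra_simps)
  then show "(%v. f v + g v) \<in> lead n J d" unfolding lead_def
   using polyfun.add[OF f(1) g(1)] polydeg_add[OF f(2) g(2)] by auto }
 { fix p :: "(nat => complex) => complex" assume p: "p \<in> polyfun n"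
  have "(%v. p v * (f v * v n ^ d + r v)) \<in> J" using J f(3) polyfun_mono[OF p, of "Suc n"] by (auto simp: pideal_def)
  then have "(%v. (p v * f v) * v n ^ d + p v * r v) \<in> J" by (simp add: algebra_simps)
  then show "(%v. p v * f v) \<in> lead n J d" unfolding lead_def
   using polyfun.mult[OF p f(1)] polydeg_mult[OF p f(2)] by auto }
qed

lemma lead_mono:
 assumes J: "pideal (Suc n) J" and "d \<le> e" shows "lead n J d \<subseteq> lead n J e"
proof
 fix f assume "f \<in> lead n J d"
 then obtain r where f: "f \<in> polyfun n" "r \<in> polydeg n d" "(%v. f v * v n ^ d + r v) \<in> J" by (auto simp: lead_def)
 have "(%v. v n ^ (e - d)) \<in> polyfun (Suc n)" by (intro polyfun_power polyfun.coord) simp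
 then have "(%v. v n ^ (e - d) * (f v * v n ^ d + r v)) \<in> J" using J f(3) by (auto simp: pideal_def)
 also have "(%v. v n ^ (e - d) * (f v * v n ^ d + r v)) = (%v. f v * v n ^ e + v n ^ (e - d) * r v)"
 proof
  fix v :: "nat => complex"
  have "v n ^ e = v n ^ (e - d) * v n ^ d" using assms(2) by (simp flip: power_add)
  then show "v n ^ (e - d) * (f v * v n ^ d + r v) = f v * v n ^ e + v n ^ (e - d) * r v"
   by (simp add: algebra_simps)
 qed
 finally show "f \<in> lead n J e" unfolding lead_def
  using f(1) polydeg_shifts[OF f(2), of "e - d"] assms(2) by (auto intro!: bexI[of _ "%v. v n ^ (e - d) * r v"])
qed

text \<open>Generators of the leading ideal in degree \<open>d\<close> are lifted to
  \<open>J\<close>. Multiplied by powers of the last variable they cancel leading terms in every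
  degree from \<open>d\<close> on in which the leading ideal is still generated by
  \<open>A\<close>.\<close>

lemma lead_reduction:
 assumes J: "pideal (Suc n) J" and A: "finite A" "A \<subseteq> lead n J d"
 obtains F where "finite F" "F \<subseteq> J"
  "\<And>e f. d \<le> e ==> lead n J e \<subseteq> comb n A ==> f \<in> J ==> f \<in> polydeg n (Suc e) ==>
   \<exists>g\<in>comb (Suc n) F. (%v. f v - g v) \<in> polydeg n e"
proof -
 have "\<forall>a\<in>A. \<exists>r. r \<in> polydeg n d & (%v. a v * v n ^ d + r v) \<in> J" using A by (auto simp: lead_def)
 from bchoice[OF this] obtain r where r': "\<forall>a\<in>A. r a \<in> polydeg n d & (%v. a v * v n ^ d + r a v) \<in> J"
  by (elim exE)
 have r: "r a \<in> polydeg n d" "(%v. a v * v n ^ d + r a v) \<in> J" if "a \<in> A" for a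
  using bspec[OF r' that] by (rule conjunct1, rule conjunct2)
 define h where "h = (%a v. a v * v n ^ d + r a v)"
 have "\<exists>g\<in>comb (Suc n) (h ` A). (%v. f v - g v) \<in> polydeg n e"
  if e: "d \<le> e" "lead n J e \<subseteq> comb n A" and f: "f \<in> J" "f \<in> polydeg n (Suc e)" for e f
 proof -
  obtain a s where a: "a \<in> polyfun n" "s \<in> polydeg n e" "f = (%v. a v * v n ^ e + s v)"
   using f(2) unfolding polydeg_Suc_iff by blast
  then have "a \<in> lead n J e" using f by (auto simp: lead_def)
  then obtain c where c: "\<forall>b\<in>A. c b \<in> polyfun n" "a = (%v. \<Sum>b\<in>A. c b v * b v)" using e(2) by (auto simp: comb_def)
  \<comment> \<open>The coefficients that express the leading coefficient of \<open>f\<close>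
    through \<open>A\<close>, shifted from degree \<open>d\<close> to degree
    \<open>e\<close>.\<close>
  define g where "g = (%v. \<Sum>b\<in>A. (c b v * v n ^ (e - d)) * h b v)"
  have "g \<in> comb (Suc n) (h ` A)"
  proof -
   have c1: "pideal (Suc n) (comb (Suc n) (h ` A))"
    unfolding pideal_def
   proof (intro conjI ballI)
    show "comb (Suc n) (h ` A) \<subseteq> polyfun (Suc n)"
     using r(2) J by (auto simp: comb_def pideal_def h_def intro!: polyfun_sum polyfun.mult)
    show "(%v. p v * f v) \<in> comb (Suc n) (h ` A)" if f: "f \<in> comb (Suc n) (h ` A)" and p: "p \<in> polyfun (Suc n)" for f p
    proof -
     obtain g where g: "\<forall>b\<in>h ` A. g b \<in> polyfun (Suc n)" "f = (%v. \<Sum>b\<in>h ` A. g b v * b v)"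
      using f by (auto simp: comb_def)
     show ?thesis unfolding comb_def
      by (rule CollectI, rule exI[of _ "%b v. p v * g b v"])
       (use g p in \<open>auto simp: sum_distrib_left mult.assoc intro: polyfun.mult\<close>)
    qed
   qed (auto intro: comb_zero comb_add)
   have c2: "h b \<in> comb (Suc n) (h ` A)" if "b \<in> A" for b
   proof -
    have "(\<Sum>b'\<in>h ` A. (if b' = h b then 1 else 0) * b' v) = (\<Sum>b'\<in>h ` A. if b' = h b then b' v else 0)" for v
     by (intro sum.cong) auto
    then have "h b = (%v. \<Sum>b'\<in>h ` A. (if b' = h b then 1 else 0) * b' v)"
     using that A by auto
    then show ?thesis unfolding comb_def
     by (intro CollectI exI[of _ "%b' _. if b' = h b then 1 else 0"]) (auto intro: polyfun.const)
   qed
   show ?thesis unfolding g_def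
    by (rule pideal_sum[OF c1 _ c2]) (use c in \<open>auto intro!: polyfun.mult polyfun_power polyfun.coord intro: polyfun_mono\<close>)
  qed
  moreover have "(%v. f v - g v) \<in> polydeg n e"
  proof -
   define t where "t = (%v. \<Sum>b\<in>A. (- c b v) * (v n ^ (e - d) * r b v))"
   have "(%v. (- c b v) * (v n ^ (e - d) * r b v)) \<in> polydeg n e" if "b \<in> A" for b
   proof (rule polydeg_mult)
    show "(%v. - c b v) \<in> polyfun n" using polyfun_scale[of "c b" n "-1"] c(1) that by simp
    show "(%v. v n ^ (e - d) * r b v) \<in> polydeg n e" using polydeg_shifts[OF r(1)[OF that], of "e - d"] e(1) by simp
   qed
   then have "t \<in> polydeg n e" unfolding t_def by (rule polydeg_sum)
   then have "(%v. s v + t v) \<in> polydeg n e" using a(2) by (intro polydeg_add)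
   moreover have "f v - g v = s v + t v" for v
   proof -
    have ve: "v n ^ e = v n ^ (e - d) * v n ^ d" using e(1) by (simp flip: power_add)
    have "g v = a v * v n ^ e - t v"
     unfolding g_def t_def h_def c(2) sum_distrib_right sum_subtractf[symmetric] ve
     by (rule sum.cong[OF refl]) algebra
    then show ?thesis using a(3) by simp
   qed
   ultimately show ?thesis by simp
  qed
  ultimately show ?thesis by blast
 qed
 moreover have "finite (h ` A)" "h ` A \<subseteq> J" using A r(2) by (auto simp: h_def)
 ultimately show thesis using that by metis
qed

text \<open>Induction on the number of variables. The leading ideals grow with the degree and their
  union is finitely generated, so from some degree M on one generating set serves them all; finitely
  many generators are added for the degrees below M. Reduction of the degree in the last variable
  finishes.\<close>

theorem hilbert_basis: "pideal n J ==> \<exists>F. finite F & F \<subseteq> J & J \<subseteq> comb n F"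
proof (induction n arbitrary: J)
 case 0
 have const: "\<exists>c. p = (%_. c)" if "p \<in> polyfun 0" for p :: "(nat => complex) => complex"
  using that by (induction rule: polyfun.induct) auto
 show ?case
 proof (cases "J \<subseteq> {%_. 0}")
  case True
  then show ?thesis using comb_zero by (intro exI[of _ "{}"]) auto
 next
  case False
  then obtain f where f: "f \<in> J" "f ~= (%_. 0)" by blast
  then obtain c where c: "f = (%_. c)" using const 0 by (auto simp: pideal_def)
  have "J \<subseteq> comb 0 {f}"
  proof
   fix g assume "g \<in> J"
   then obtain d where d: "g = (%_. d)" using const 0 by (auto simp: pideal_def)
   show "g \<in> comb 0 {f}" unfolding comb_def
    by (intro CollectI exI[of _ "%_ _. d / c"]) (use d c f in \<open>auto intro: polyfun.const\<close>)
  qed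
  then show ?thesis using f by (intro exI[of _ "{f}"]) auto
 qed
next
 case (Suc n)
 note J = Suc.prems
 have "\<exists>A. finite A & A \<subseteq> lead n J d & lead n J d \<subseteq> comb n A" for d
  by (rule Suc.IH[OF pideal_lead[OF J]])
 then have "\<exists>F. finite F & F \<subseteq> J & (\<forall>f\<in>J \<inter> polydeg n (Suc d). \<exists>g\<in>comb (Suc n) F. (%v. f v - g v) \<in> polydeg n d)" for d
 proof -
  assume ex: "\<And>d. \<exists>A. finite A & A \<subseteq> lead n J d & lead n J d \<subseteq> comb n A"
  obtain A where A: "finite A" "A \<subseteq> lead n J d" "lead n J d \<subseteq> comb n A" using ex by blast
  show ?thesis by (rule lead_reduction[OF J A(1,2)]) (use A(3) in auto)
 qed
 then obtain F where F: "\<And>d. finite (F d)" "\<And>d. F d \<subseteq> J"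
  "\<And>d f. f \<in> J ==> f \<in> polydeg n (Suc d) ==> \<exists>g\<in>comb (Suc n) (F d). (%v. f v - g v) \<in> polydeg n d"
  by (metis IntI)
 have "pideal n (\<Union>d. lead n J d)"
  unfolding pideal_def
 proof (intro conjI ballI)
  show "(%_. 0) \<in> (\<Union>d. lead n J d)" using pideal_lead[OF J] by (auto simp: pideal_def)
  fix f g assume "f \<in> (\<Union>d. lead n J d)" "g \<in> (\<Union>d. lead n J d)"
  then obtain d e where "f \<in> lead n J d" "g \<in> lead n J e" by blast
  then have "f \<in> lead n J (max d e)" "g \<in> lead n J (max d e)" using lead_mono[OF J] by (meson max.cobounded1 max.cobounded2 subsetD)+
  then have "(%v. f v + g v) \<in> lead n J (max d e)" using pideal_lead[OF J] by (auto simp: pideal_def)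
  then show "(%v. f v + g v) \<in> (\<Union>d. lead n J d)" by blast
 next
  fix f p assume "f \<in> (\<Union>d. lead n J d)" and p: "p \<in> polyfun n"
  then obtain d where "f \<in> lead n J d" by blast
  then have "(%v. p v * f v) \<in> lead n J d" using pideal_lead[OF J] p by (auto simp: pideal_def)
  then show "(%v. p v * f v) \<in> (\<Union>d. lead n J d)" by blast
 qed (auto simp: lead_def)
 from Suc.IH[OF this] obtain A where A: "finite A" "A \<subseteq> (\<Union>d. lead n J d)" "(\<Union>d. lead n J d) \<subseteq> comb n A" by blast
 have "\<exists>M. A \<subseteq> lead n J M" using A(1,2)
 proof (induction A rule: finite_induct)
  case (insert x A)
  then obtain M d where "A \<subseteq> lead n J M" "x \<in> lead n J d" by auto
  then have "insert x A \<subseteq> lead n J (max M d)" using lead_mono[OF J, of M "max M d"] lead_mono[OF J, of d "max M d"] by auto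
  then show ?case by blast
 qed simp
 then obtain M where M: "A \<subseteq> lead n J M" by blast
 obtain F' where F': "finite F'" "F' \<subseteq> J"
  "\<And>e f. M \<le> e ==> lead n J e \<subseteq> comb n A ==> f \<in> J ==> f \<in> polydeg n (Suc e) ==>
   \<exists>g\<in>comb (Suc n) F'. (%v. f v - g v) \<in> polydeg n e" by (rule lead_reduction[OF J A(1) M]) blast
 \<comment> \<open>One batch of generators for each degree below \<open>M\<close>, and
   \<open>F'\<close> for all degrees from \<open>M\<close> on.\<close>
 define G where "G = (\<Union>d<M. F d) \<union> F'"
 have G: "finite G" "G \<subseteq> J" using F F' by (auto simp: G_def)
 have "f \<in> J ==> f \<in> polydeg n d ==> f \<in> comb (Suc n) G" for f d
 proof (induction d arbitrary: f)
  case 0 then show ?case using comb_zero by (simp add: polydeg_0)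
 next
  case (Suc d)
  have "\<exists>g\<in>comb (Suc n) G. (%v. f v - g v) \<in> polydeg n d"
  proof (cases "d < M")
   case True
   then have "F d \<subseteq> G" by (auto simp: G_def)
   from comb_mono[OF this G(1)] show ?thesis using F(3)[OF Suc.prems] by blast
  next
   case False
   have "F' \<subseteq> G" by (auto simp: G_def)
   from comb_mono[OF this G(1)] show ?thesis using F'(3)[of d f] Suc.prems False A(3) by fastforce
  qed
  then obtain g where g: "g \<in> comb (Suc n) G" "(%v. f v - g v) \<in> polydeg n d" by (elim bexE)
  have "g \<in> J" using comb_subset[OF J G(2)] g by blast
  then have "(%v. p v * g v) \<in> J" if "p \<in> polyfun (Suc n)" for p
   using J that by (auto simp: pideal_def)
  from this[OF polyfun.const] have "(%v. (-1) * g v) \<in> J" .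
  from pideal_add[OF J Suc.prems(1) this] have "(%v. f v - g v) \<in> J" by simp
  from comb_add[OF Suc.IH[OF this g(2)] g(1)] show ?case by simp
 qed
 moreover have "\<exists>d. f \<in> polydeg n d" if "f \<in> J" for f
  by (rule polyfun_Suc_polydeg) (use that J in \<open>auto simp: pideal_def\<close>)
 ultimately have "J \<subseteq> comb (Suc n) G" by blast
 then show ?case using G by blast
qed

text \<open>Elimination in place of determinants: 1 - m x x is a unit at \<open>p\<close>, so
  \<open>b x\<close> can be expressed by the other generators modulo \<open>I\<close>, and
  substitution keeps the coefficients in the maximal ideal. The set \<open>I\<close> is any module
  of germs; it will be a principal ideal or the zero ideal.\<close>

lemma (in fsp) nakayama:
 assumes fin: "finite B"
  and I0: "(%_. 0) \<in> I" and Iadd: "\<And>f g. f \<in> I ==> g \<in> I ==> (%y. f y + g y) \<in> I"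
  and Imult: "\<And>a f. regat X p a ==> f \<in> I ==> (%y. a y * f y) \<in> I"
  and Icong: "\<And>f g. f \<in> I ==> \<forall>\<^sub>F y in nhd X p. g y = f y ==> g \<in> I"
  and m: "\<And>i j. i \<in> B ==> j \<in> B ==> regat X p (m i j) & m i j p = 0"
  and eq: "\<And>i. i \<in> B ==> (%y. b i y - (\<Sum>j\<in>B. m i j y * b j y)) \<in> I"
  and p: "p \<in> pts X" and "i \<in> B"
 shows "b i \<in> I"
 using fin m eq \<open>i \<in> B\<close>
proof (induction B arbitrary: m i rule: finite_induct)
 case (insert x F)
 define u where "u = (%y. 1 - m x x y)"
 have mx: "regat X p (m x x)" "m x x p = 0" using insert by auto
 have u: "regat X p u" "u p ~= 0"
  unfolding u_def using regat_diff[OF regat_const[OF p, of 1] mx(1)] mx(2) by simp_all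
 have ui: "regat X p (%y. 1 / u y)" by (rule regat_inverse[OF u])
 have ex: "(%y. b x y - (\<Sum>j\<in>F. (m x j y / u y) * b j y)) \<in> I"
 proof (rule Icong[OF Imult[OF ui insert.prems(2)[of x]]])
  show "\<forall>\<^sub>F y in nhd X p. b x y - (\<Sum>j\<in>F. (m x j y / u y) * b j y) =
    1 / u y * (b x y - (\<Sum>j\<in>insert x F. m x j y * b j y))"
   using regat_nz[OF u]
  proof eventually_elim
   case (elim y)
   have "(\<Sum>j\<in>insert x F. m x j y * b j y) = m x x y * b x y + (\<Sum>j\<in>F. m x j y * b j y)"
    using insert by simp
   then have "b x y - (\<Sum>j\<in>insert x F. m x j y * b j y) = u y * b x y - (\<Sum>j\<in>F. m x j y * b j y)"
    by (simp add: u_def algebra_simps)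
   moreover have "(\<Sum>j\<in>F. (m x j y / u y) * b j y) = (\<Sum>j\<in>F. m x j y * b j y) / u y"
    by (simp add: sum_divide_distrib)
   ultimately show ?case using elim by (simp add: diff_divide_distrib)
  qed
 qed simp
 \<comment> \<open>The coefficients after substituting the expression for \<open>b x\<close>; both
   summands vanish at \<open>p\<close>.\<close>
 define m' where "m' = (%i j y. m i j y + m i x y * (m x j y / u y))"
 have IH: "b i \<in> I" if "i \<in> F" for i
 proof (rule insert.IH[of m', OF _ _ that])
  fix i j assume ij: "i \<in> F" "j \<in> F"
  have "regat X p (m i j)" "regat X p (m i x)" "regat X p (m x j)" "m i j p = 0" "m i x p = 0"
   using insert.prems(1) ij by auto
  then show "regat X p (m' i j) & m' i j p = 0" unfolding m'_def
   using u by (auto intro!: regat_add regat_mult regat_divide)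
 next
  fix i assume i: "i \<in> F"
  have "(%y. (b i y - (\<Sum>j\<in>insert x F. m i j y * b j y)) +
    m i x y * (b x y - (\<Sum>j\<in>F. (m x j y / u y) * b j y))) \<in> I"
   by (intro Iadd Imult ex) (use insert.prems i in auto)
  moreover have "(%y. (b i y - (\<Sum>j\<in>insert x F. m i j y * b j y)) +
    m i x y * (b x y - (\<Sum>j\<in>F. (m x j y / u y) * b j y))) = (%y. b i y - (\<Sum>j\<in>F. m' i j y * b j y))"
  proof
   fix y
   have "(\<Sum>j\<in>insert x F. m i j y * b j y) = m i x y * b x y + (\<Sum>j\<in>F. m i j y * b j y)"
    using insert by simp
   moreover have "(\<Sum>j\<in>F. m' i j y * b j y) = (\<Sum>j\<in>F. m i j y * b j y) + m i x y * (\<Sum>j\<in>F. (m x j y / u y) * b j y)"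
    by (simp add: m'_def sum.distrib distrib_right sum_distrib_left mult.assoc)
   ultimately show "(b i y - (\<Sum>j\<in>insert x F. m i j y * b j y)) +
     m i x y * (b x y - (\<Sum>j\<in>F. (m x j y / u y) * b j y)) = b i y - (\<Sum>j\<in>F. m' i j y * b j y)"
    by (simp add: right_diff_distrib)
  qed
  ultimately show "(%y. b i y - (\<Sum>j\<in>F. m' i j y * b j y)) \<in> I" by (simp only:)
 qed
 show ?case
 proof (cases "i = x")
  case True
  have sum_in: "(%y. \<Sum>j\<in>G. (m x j y / u y) * b j y) \<in> I" if "G \<subseteq> F" for G
   using finite_subset[OF that insert.hyps(1)] that
  proof (induction G rule: finite_induct)
   case (insert j G)
   have "regat X p (%y. m x j y / u y)" using insert.prems insert.hyps u \<open>\<And>i j. [|i \<in> Set.insert x F; j \<in> Set.insert x F|] ==> regat X p (m i j) & m i j p = 0\<close>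
    by (intro regat_divide) auto
   from Iadd[OF Imult[OF this IH] insert.IH] show ?case using insert by simp
  qed (simp add: I0)
  from Iadd[OF ex sum_in[OF subset_refl]] show ?thesis using True by simp
 qed (use IH insert.prems in auto)
qed simp

section \<open>Smooth projective curves\<close>

text \<open>Products of polynomials make the principal open sets a basis, and not merely a subbasis,
  of the generated topology.\<close>

lemma openin_affine_space:
 assumes "openin (zar (affine_space n)) O'" "w \<in> O'"
 shows "\<exists>q\<in>polyfun n. q w ~= 0 & {v \<in> affine_pts n. q v ~= 0} \<subseteq> O'"
proof -
 have "generate_topology_on {{v \<in> affine_pts n. p v ~= 0} | p. p \<in> polyfun n} O'"
  using assms(1) by (simp add: affine_space_def openin_topology_generated_by_iff)
 then show ?thesis using assms(2)
 proof (induction arbitrary: w rule: generate_topology_on.induct)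
  case (Int a b)
  have "\<exists>q\<in>polyfun n. q w ~= 0 & {v \<in> affine_pts n. q v ~= 0} \<subseteq> a" by (rule Int.IH(1)) (use Int in simp)
  moreover have "\<exists>q\<in>polyfun n. q w ~= 0 & {v \<in> affine_pts n. q v ~= 0} \<subseteq> b" by (rule Int.IH(2)) (use Int in simp)
  ultimately obtain q r where "q \<in> polyfun n" "q w ~= 0" "{v \<in> affine_pts n. q v ~= 0} \<subseteq> a"
   "r \<in> polyfun n" "r w ~= 0" "{v \<in> affine_pts n. r v ~= 0} \<subseteq> b" by (elim bexE conjE)
  then show ?case by (intro bexI[of _ "%v. q v * r v"]) (auto intro: polyfun.mult)
 next
  case (UN K) then show ?case by (meson UnionE Union_upper order_trans)
 qed auto
qed

lemma openin_affine_space_nz: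
 "p \<in> polyfun n ==> openin (zar (affine_space n)) {v \<in> affine_pts n. p v ~= 0}"
 unfolding affine_space_def by (auto intro!: topology_generated_by_Basis)

lemma topspace_affine_space: "pts (affine_space n) = affine_pts n"
proof -
 have "affine_pts n \<in> {{v \<in> affine_pts n. p v ~= 0} | p. p \<in> polyfun n}"
  by (rule CollectI, rule exI[of _ "%_. 1"]) (simp add: polyfun.const)
 then show ?thesis unfolding affine_space_def by auto
qed

lemma reg_affine_spaceE:
 assumes "f \<in> reg (affine_space n) W" "z \<in> W"
 obtains p q where "p \<in> polyfun n" "q \<in> polyfun n" "q z ~= 0" "\<And>w. w \<in> W ==> q w ~= 0 ==> f w = p w / q w"
 using assms unfolding affine_space_def by auto

lemma reg_sub_fspace_iff: "f \<in> reg (sub_fspace X Z) W \<longleftrightarrow>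
  (\<forall>x\<in>W. \<exists>U g. openin (zar X) U & x \<in> U & g \<in> reg X U & (\<forall>y\<in>U \<inter> W. f y = g y))"
 by (simp add: sub_fspace_def)

lemma proj_point_self: "v \<in> proj_point v"
 unfolding proj_point_def by (rule CollectI, rule exI[of _ 1]) simp

lemma proj_point_eq: "w \<in> proj_point v ==> proj_point w = proj_point v"
proof -
 assume "w \<in> proj_point v"
 then obtain c where c: "c ~= 0" "w = (%i. c * v i)" by (auto simp: proj_point_def)
 show ?thesis
 proof
  show "proj_point w \<subseteq> proj_point v"
  proof
   fix u assume "u \<in> proj_point w"
   then obtain d where "d ~= 0" "u = (%i. d * w i)" by (auto simp: proj_point_def)
   then show "u \<in> proj_point v" unfolding proj_point_def
    using c by (intro CollectI exI[of _ "d * c"]) auto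
  qed
  show "proj_point v \<subseteq> proj_point w"
  proof
   fix u assume "u \<in> proj_point v"
   then obtain d where "d ~= 0" "u = (%i. d * v i)" by (auto simp: proj_point_def)
   then show "u \<in> proj_point w" unfolding proj_point_def
    using c by (intro CollectI exI[of _ "d / c"]) auto
  qed
 qed
qed

text \<open>Affine charts: the point \<open>\<xi> y\<close> lists the coordinates of \<open>y \<in> U\<close> in an affine space, in which
 regular functions are locally quotients of polynomials.\<close>

definition affchart :: "'c fspace => 'c set => nat => ('c => nat => complex) => bool" where
 "affchart C U N \<xi> \<longleftrightarrow> openin (zar C) U &
  (\<forall>y\<in>U. \<forall>y'\<in>U. (\<forall>i<N. \<xi> y i = \<xi> y' i) --> y = y') &
  (\<forall>p\<in>U. \<forall>i<N. regat C p (%y. \<xi> y i)) &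
  (\<forall>W f q. openin (zar C) W & f \<in> reg C W & q \<in> W \<inter> U -->
    (\<exists>P\<in>polyfun N. \<exists>Q\<in>polyfun N. Q (\<xi> q) ~= 0 &
     (\<forall>y\<in>U. Q (\<xi> y) ~= 0 --> y \<in> W & f y = P (\<xi> y) / Q (\<xi> y))))"

text \<open>The standard charts of projective space, pulled back. All n + 1 homogeneous coordinates
  are kept after division by the i-th, including the one equal to 1, which avoids
  renumbering.\<close>

lemma affchart_exists:
 assumes swf: "space_with_functions C" and \<phi>: "closed_immersion C (proj_space n) \<phi>"
 shows "\<exists>U \<xi>. (\<forall>i\<le>n. affchart C (U i) (Suc n) (\<xi> i)) & (\<Union>i\<le>n. U i) = pts C"
proof -
 interpret fsp C by unfold_locales (rule swf)
 let ?A = "affine_space (Suc n)"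
 define A0 where "A0 = affine_pts (Suc n) - {%_. 0}"
 define X0 where "X0 = sub_fspace ?A A0"
 let ?P = "proj_space n"
 have P: "?P = quotient_fspace X0 proj_point" by (simp add: proj_space_def X0_def A0_def)
 have ptsX0: "pts X0 = A0" by (simp add: X0_def sub_fspace_def topspace_affine_space A0_def Int_absorb1)
 have ptsP: "pts ?P = proj_point ` A0" unfolding P topspace_quotient_fspace ptsX0 ..
 define R where "R = \<phi> ` pts C"
 have iso: "isomorphism C (sub_fspace ?P R) \<phi>" using \<phi> by (simp add: closed_immersion_def R_def)
 then obtain \<psi> where m\<phi>: "morphism C (sub_fspace ?P R) \<phi>" and m\<psi>: "morphism (sub_fspace ?P R) C \<psi>"
  and inv: "\<And>x. x \<in> pts C ==> \<psi> (\<phi> x) = x" by (auto simp: isomorphism_def)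
 have subR: "pts (sub_fspace ?P R) = pts ?P \<inter> R" by (simp add: sub_fspace_def)
 have \<phi>P: "\<phi> y \<in> pts ?P" if "y \<in> pts C" for y
  using m\<phi> that subR by (auto simp: morphism_def continuous_map_def)
 have pull: "openin (zar C) {y \<in> pts C. \<phi> y \<in> V} & f \<circ> \<phi> \<in> reg C {y \<in> pts C. \<phi> y \<in> V}"
  if V: "openin (zar ?P) V" and f: "f \<in> reg ?P V" for V f
 proof -
  have o: "openin (zar (sub_fspace ?P R)) (V \<inter> R)" using V by (auto simp: sub_fspace_def openin_subtopology)
  have "f \<in> reg (sub_fspace ?P R) (V \<inter> R)" using V f by (auto simp: sub_fspace_def)
  then have "f \<circ> \<phi> \<in> reg C {y \<in> pts C. \<phi> y \<in> V \<inter> R}" 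
   using m\<phi>[unfolded morphism_def, THEN conjunct2, rule_format, of "V \<inter> R" f] o by simp
  moreover have "openin (zar C) {y \<in> pts C. \<phi> y \<in> V \<inter> R}"
   using m\<phi> o by (auto simp: morphism_def continuous_map_def)
  moreover have "{y \<in> pts C. \<phi> y \<in> V \<inter> R} = {y \<in> pts C. \<phi> y \<in> V}" by (auto simp: R_def)
  ultimately show ?thesis by simp
 qed
 have openX0: "openin (zar X0) {w \<in> A0. q w ~= 0}" if "q \<in> polyfun (Suc n)" for q
  unfolding X0_def sub_fspace_def using openin_affine_space_nz[OF that]
  by (auto simp: openin_subtopology A0_def intro!: exI[of _ "{v \<in> affine_pts (Suc n). q v ~= 0}"])
 define V where "V = (%i. {x \<in> pts ?P. \<exists>w\<in>x. w i ~= 0})"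
 have inV: "proj_point w \<in> V i \<longleftrightarrow> w i ~= 0" if "w \<in> A0" for w i
  using that by (auto simp: V_def ptsP proj_point_def intro!: exI[of _ 1])
 have preV: "{w \<in> pts X0. proj_point w \<in> V i} = {w \<in> A0. w i ~= 0}" for i
  using inV by (auto simp: ptsX0)
 have Vo: "openin (zar ?P) (V i)" if "i \<le> n" for i
 proof -
  have "openin (zar X0) {w \<in> A0. (%v. v i) w ~= 0}" by (rule openX0) (use that in \<open>auto intro: polyfun.coord\<close>)
  then show ?thesis unfolding P openin_quotient_fspace preV
   using ptsP P topspace_quotient_fspace[of X0 proj_point] by (auto simp: V_def)
 qed
 \<comment> \<open>Ratios of coordinates do not depend on the representative of the point, so an
   arbitrary choice is harmless.\<close>
 define \<eta> where "\<eta> = (%(i::nat) (x::(nat => complex) set) (j::nat). (SOME w. w \<in> x) j / (SOME w. w \<in> x) i)"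
 have \<eta>: "\<eta> i (proj_point w) j = w j / w i" for i w j
 proof -
  have "(SOME u. u \<in> proj_point w) \<in> proj_point w" by (rule someI[of "%u. u \<in> proj_point w", OF proj_point_self])
  then obtain c where c: "c ~= 0" "(SOME u. u \<in> proj_point w) = (%i. c * w i)" by (auto simp: proj_point_def)
  show ?thesis unfolding \<eta>_def using c by (subst c(2), subst c(2)) simp
 qed
 have \<eta>reg: "(%x. \<eta> i x j) \<in> reg ?P (V i)" if i: "i \<le> n" and j: "j \<le> n" for i j
 proof -
  have "(%x. \<eta> i x j) \<circ> proj_point \<in> reg X0 {w \<in> A0. w i ~= 0}"
   unfolding X0_def reg_sub_fspace_iff
  proof
   fix w assume w: "w \<in> {w \<in> A0. w i ~= 0}"
   have "(%w. w j / w i) \<in> reg ?A {v \<in> affine_pts (Suc n). v i ~= 0}"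
    unfolding affine_space_def fspace.select_convs mem_Collect_eq
    by (rule ballI, rule bexI[of _ "%v. v j"], rule bexI[of _ "%v. v i"]) (use i j in \<open>auto intro: polyfun.coord\<close>)
   moreover have "openin (zar ?A) {v \<in> affine_pts (Suc n). v i ~= 0}"
    by (rule openin_affine_space_nz[OF polyfun.coord]) (use i in simp)
   ultimately show "\<exists>U g. openin (zar ?A) U & w \<in> U & g \<in> reg ?A U &
     (\<forall>y\<in>U \<inter> {w \<in> A0. w i ~= 0}. ((%x. \<eta> i x j) \<circ> proj_point) y = g y)"
    using w by (intro exI[of _ "{v \<in> affine_pts (Suc n). v i ~= 0}"] conjI exI[of _ "%w. w j / w i"])
     (auto simp: \<eta> A0_def)
  qed
  then show ?thesis unfolding P reg_quotient_fspace preV .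
 qed
 define U where "U = (%i. {y \<in> pts C. \<phi> y \<in> V i})"
 define \<xi> where "\<xi> = (%i y. \<eta> i (\<phi> y))"
 have chart: "\<xi> i y \<in> A0" "\<xi> i y i = 1" "proj_point (\<xi> i y) = \<phi> y" if y: "y \<in> U i" for i y
 proof -
  obtain w where w: "w \<in> A0" "\<phi> y = proj_point w" using y ptsP by (auto simp: U_def V_def)
  then have wi: "w i ~= 0" using y inV by (auto simp: U_def)
  have e: "\<xi> i y = (%j. (1 / w i) * w j)" by (auto simp: \<xi>_def w(2) \<eta>)
  show 1: "\<xi> i y i = 1" using e wi by simp
  have "\<xi> i y \<in> affine_pts (Suc n)" using e w(1) by (auto simp: A0_def affine_pts_def)
  then show "\<xi> i y \<in> A0" using 1 by (auto simp: A0_def)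
  have "\<xi> i y \<in> proj_point w" unfolding proj_point_def using e wi by (intro CollectI exI[of _ "1 / w i"]) auto
  then show "proj_point (\<xi> i y) = \<phi> y" using proj_point_eq w by simp
 qed
 have "affchart C (U i) (Suc n) (\<xi> i)" if i: "i \<le> n" for i
  unfolding affchart_def
 proof (intro conjI ballI allI impI)
  show oU: "openin (zar C) (U i)" using pull[OF Vo[OF i] \<eta>reg[OF i i]] by (auto simp: U_def)
  show "y = y'" if y: "y \<in> U i" "y' \<in> U i" and e: "\<forall>j<Suc n. \<xi> i y j = \<xi> i y' j" for y y'
  proof -
   have "\<xi> i y = \<xi> i y'"
   proof
    fix j show "\<xi> i y j = \<xi> i y' j"
     using e chart(1)[OF y(1)] chart(1)[OF y(2)] by (cases "j < Suc n") (auto simp: A0_def affine_pts_def)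
   qed
   then have "\<phi> y = \<phi> y'" using chart(3)[OF y(1)] chart(3)[OF y(2)] by simp
   then show ?thesis using inv y by (metis (no_types, lifting) U_def mem_Collect_eq)
  qed
  show "regat C p (%y. \<xi> i y j)" if "p \<in> U i" "j < Suc n" for p j
  proof (rule regatI[OF oU that(1)])
   have "(%x. \<eta> i x j) \<circ> \<phi> \<in> reg C (U i)" using pull[OF Vo[OF i] \<eta>reg[OF i]] that(2) by (auto simp: U_def)
   then show "(%y. \<xi> i y j) \<in> reg C (U i)" by (simp add: \<xi>_def comp_def)
  qed
  fix W f q assume asm: "openin (zar C) W & f \<in> reg C W & q \<in> W \<inter> U i"
  then have W: "openin (zar C) W" "f \<in> reg C W" "q \<in> W" "q \<in> U i" "q \<in> pts C" by (auto simp: U_def)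
  define T where "T = {x \<in> pts (sub_fspace ?P R). \<psi> x \<in> W}"
  have "openin (zar (sub_fspace ?P R)) T" using m\<psi> W by (auto simp: morphism_def continuous_map_def T_def)
  then obtain V' where V': "openin (zar ?P) V'" "T = V' \<inter> R" by (auto simp: sub_fspace_def openin_subtopology)
  have fT: "f \<circ> \<psi> \<in> reg (sub_fspace ?P R) T" using m\<psi> W by (auto simp: morphism_def T_def)
  have qT: "\<phi> q \<in> T" unfolding T_def subR using W inv \<phi>P by (auto simp: R_def)
  then obtain V'' g where V'': "openin (zar ?P) V''" "\<phi> q \<in> V''" "g \<in> reg ?P V''" "\<forall>y\<in>V'' \<inter> T. (f \<circ> \<psi>) y = g y"
   using fT unfolding sub_fspace_def by auto
  define V0 where "V0 = V' \<inter> V''"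
  have V0: "openin (zar ?P) V0" "\<phi> q \<in> V0" using V' V'' qT by (auto simp: V0_def)
  have "openin (zar X0) {w \<in> A0. proj_point w \<in> V0}" using V0(1) unfolding P openin_quotient_fspace ptsX0 by simp
  then obtain T1 where T1: "openin (zar ?A) T1" "{w \<in> A0. proj_point w \<in> V0} = T1 \<inter> A0"
   unfolding X0_def sub_fspace_def fspace.select_convs openin_subtopology by blast
  let ?w = "\<xi> i q"
  have w: "?w \<in> A0" "proj_point ?w = \<phi> q" using chart W by auto
  then have "?w \<in> {w \<in> A0. proj_point w \<in> V0}" using V0(2) by simp
  then have "?w \<in> T1" unfolding T1(2) by blast
  from openin_affine_space[OF T1(1) this] obtain q1 where q1: "q1 \<in> polyfun (Suc n)" "q1 ?w ~= 0"
   "{v \<in> affine_pts (Suc n). q1 v ~= 0} \<subseteq> T1" by blast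
  have "g \<circ> proj_point \<in> reg X0 {w \<in> pts X0. proj_point w \<in> V''}"
   using V''(3) unfolding P reg_quotient_fspace .
  moreover have "?w \<in> {w \<in> pts X0. proj_point w \<in> V''}" using w V'' ptsX0 by simp
  ultimately obtain U2 g2 where U2: "openin (zar ?A) U2" "?w \<in> U2" "g2 \<in> reg ?A U2"
   "\<forall>y\<in>U2 \<inter> {w \<in> pts X0. proj_point w \<in> V''}. (g \<circ> proj_point) y = g2 y"
   unfolding X0_def reg_sub_fspace_iff by blast
  from openin_affine_space[OF U2(1,2)] obtain q2 where q2: "q2 \<in> polyfun (Suc n)" "q2 ?w ~= 0"
   "{v \<in> affine_pts (Suc n). q2 v ~= 0} \<subseteq> U2" by blast
  obtain P3 Q3 where PQ: "P3 \<in> polyfun (Suc n)" "Q3 \<in> polyfun (Suc n)" "Q3 ?w ~= 0"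
   "\<And>w. w \<in> U2 ==> Q3 w ~= 0 ==> g2 w = P3 w / Q3 w" by (rule reg_affine_spaceE[OF U2(3,2)]) (rule that)
  show "\<exists>P\<in>polyfun (Suc n). \<exists>Q\<in>polyfun (Suc n). Q (\<xi> i q) ~= 0 &
     (\<forall>y\<in>U i. Q (\<xi> i y) ~= 0 --> y \<in> W & f y = P (\<xi> i y) / Q (\<xi> i y))"
  \<comment> \<open>The factors \<open>q1\<close> and \<open>q2\<close> force a point where the
    denominator is nonzero into the neighbourhoods on which the quotient formula holds.\<close>
  proof (rule bexI[of _ "%v. P3 v * (q1 v * q2 v)"], rule bexI[of _ "%v. Q3 v * (q1 v * q2 v)"],
    intro conjI ballI impI)
   fix y assume y: "y \<in> U i" "Q3 (\<xi> i y) * (q1 (\<xi> i y) * q2 (\<xi> i y)) ~= 0"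
   have yC: "y \<in> pts C" using y by (simp add: U_def)
   have c: "\<xi> i y \<in> A0" "proj_point (\<xi> i y) = \<phi> y" using chart[OF y(1)] by auto
   have "\<xi> i y \<in> T1" using q1(3) y(2) c(1) by (auto simp: A0_def)
   then have "\<xi> i y \<in> {w \<in> A0. proj_point w \<in> V0}" using c(1) unfolding T1(2) by blast
   then have "\<phi> y \<in> V0" using c(2) by simp
   then have T: "\<phi> y \<in> T" "\<phi> y \<in> V''" using V' yC by (auto simp: V0_def R_def)
   show "y \<in> W" using T inv[OF yC] by (simp add: T_def)
   have "\<xi> i y \<in> U2" using q2(3) y(2) c(1) by (auto simp: A0_def)
   moreover from this have "\<xi> i y \<in> U2 \<inter> {w \<in> pts X0. proj_point w \<in> V''}" using c T ptsX0 by simp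
   from bspec[OF U2(4) this] have "g (\<phi> y) = g2 (\<xi> i y)" using c(2) by simp
   ultimately have "g (\<phi> y) = P3 (\<xi> i y) / Q3 (\<xi> i y)"
    using PQ(4)[of "\<xi> i y"] y(2) by simp
   moreover have "f y = g (\<phi> y)" using bspec[OF V''(4) IntI[OF T(2,1)]] inv[OF yC] by simp
   ultimately show "f y = P3 (\<xi> i y) * (q1 (\<xi> i y) * q2 (\<xi> i y)) / (Q3 (\<xi> i y) * (q1 (\<xi> i y) * q2 (\<xi> i y)))"
    using y(2) by simp
  qed (use PQ q1 q2 in \<open>auto intro: polyfun.mult\<close>)
 qed
 moreover have "(\<Union>i\<le>n. U i) = pts C"
 proof
  show "pts C \<subseteq> (\<Union>i\<le>n. U i)"
  proof
   fix y assume y: "y \<in> pts C"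
   obtain w where w: "w \<in> A0" "\<phi> y = proj_point w" using \<phi>P[OF y] ptsP by auto
   then obtain i where "w i ~= 0" by (auto simp: A0_def)
   moreover then have "i \<le> n" using w(1) by (auto simp: A0_def affine_pts_def not_less_eq_eq)
   ultimately show "y \<in> (\<Union>i\<le>n. U i)" using y w inV by (auto simp: U_def)
  qed
 qed (auto simp: U_def)
 ultimately show ?thesis by blast
qed

locale chart_at = irr_fsp X for X :: "'c fspace" +
 fixes U :: "'c set" and N :: nat and \<xi> :: "'c => nat => complex" and p :: 'c
 assumes chart: "affchart X U N \<xi>" and pU: "p \<in> U"
begin

lemma openU: "openin (zar X) U" and inj: "y \<in> U ==> y' \<in> U ==> (\<And>i. i < N ==> \<xi> y i = \<xi> y' i) ==> y = y'"
 and coord_regat: "q \<in> U ==> i < N ==> regat X q (%y. \<xi> y i)"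
 using chart by (auto simp: affchart_def)

lemma chart_quotient:
 assumes "openin (zar X) W" "f \<in> reg X W" "q \<in> W" "q \<in> U"
 obtains P Q where "P \<in> polyfun N" "Q \<in> polyfun N" "Q (\<xi> q) ~= 0"
  "\<And>y. y \<in> U ==> Q (\<xi> y) ~= 0 ==> y \<in> W" "\<And>y. y \<in> U ==> Q (\<xi> y) ~= 0 ==> f y = P (\<xi> y) / Q (\<xi> y)"
proof -
 have "\<exists>P\<in>polyfun N. \<exists>Q\<in>polyfun N. Q (\<xi> q) ~= 0 &
     (\<forall>y\<in>U. Q (\<xi> y) ~= 0 --> y \<in> W & f y = P (\<xi> y) / Q (\<xi> y))"
  using chart[unfolded affchart_def, THEN conjunct2, THEN conjunct2, THEN conjunct2, rule_format, of W f q] assms by simp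
 then show thesis using that by (elim bexE conjE) simp
qed

lemma pX: "p \<in> pts X"
 using openin_subset[OF openU] pU by blast

lemma polyfun_regat: "P \<in> polyfun N ==> q \<in> U ==> regat X q (%y. P (\<xi> y))"
proof (induction rule: polyfun.induct)
 case (const c)
 then show ?case using regat_const openin_subset[OF openU] by blast
qed (auto intro: coord_regat regat_add regat_mult)

lemma germ_quotient:
 assumes f: "regat X p f"
 obtains P Q where "P \<in> polyfun N" "Q \<in> polyfun N" "Q (\<xi> p) ~= 0"
  "\<forall>\<^sub>F y in nhd X p. Q (\<xi> y) ~= 0 & f y = P (\<xi> y) / Q (\<xi> y)"
proof -
 obtain W where W: "openin (zar X) W" "p \<in> W" "f \<in> reg X W" using f by (auto simp: regat_def)
 obtain P Q where PQ: "P \<in> polyfun N" "Q \<in> polyfun N" "Q (\<xi> p) ~= 0"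
  "\<And>y. y \<in> U ==> Q (\<xi> y) ~= 0 ==> y \<in> W" "\<And>y. y \<in> U ==> Q (\<xi> y) ~= 0 ==> f y = P (\<xi> y) / Q (\<xi> y)"
  by (rule chart_quotient[OF W(1,3,2) pU]) (rule that)
 have "\<forall>\<^sub>F y in nhd X p. Q (\<xi> y) ~= 0" by (rule regat_nz[OF polyfun_regat[OF PQ(2) pU] PQ(3)])
 moreover have "\<forall>\<^sub>F y in nhd X p. y \<in> U" by (rule eventually_nhdI[OF openU pU])
 ultimately have "\<forall>\<^sub>F y in nhd X p. Q (\<xi> y) ~= 0 & f y = P (\<xi> y) / Q (\<xi> y)"
  by eventually_elim (use PQ(5) in auto)
 then show thesis using that PQ(1-3) by blast
qed

definition bb :: "nat => 'c => complex" where
 "bb j = (%y. \<xi> y j - \<xi> p j)"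

lemma bb: "j < N ==> regat X p (bb j)" "bb j p = 0"
 unfolding bb_def by (auto intro!: regat_diff coord_regat pU regat_const pX)

text \<open>The numerator of a germ vanishing at \<open>p\<close> vanishes at the image of
  \<open>p\<close> in the chart, and its first-order expansion there writes it through the centred
  coordinates \<open>bb j\<close>.\<close>

lemma maximal_ideal_generated:
 assumes f: "regat X p f" "f p = 0"
 shows "\<exists>a. (\<forall>j<N. regat X p (a j)) & (\<forall>\<^sub>F y in nhd X p. f y = (\<Sum>j<N. a j y * bb j y))"
proof -
 obtain P Q where PQ: "P \<in> polyfun N" "Q \<in> polyfun N" "Q (\<xi> p) ~= 0"
  "\<forall>\<^sub>F y in nhd X p. Q (\<xi> y) ~= 0 & f y = P (\<xi> y) / Q (\<xi> y)" by (rule germ_quotient[OF f(1)]) (rule that)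
 have P0: "P (\<xi> p) = 0" using eventually_nhd_self[OF PQ(4) pX] f(2) PQ(3) by auto
 obtain g where g: "\<forall>j<N. g j \<in> polyfun N" "\<forall>v. P v = P (\<xi> p) + (\<Sum>j<N. g j v * (v j - \<xi> p j))"
  using polyfun_taylor[OF PQ(1), of "\<xi> p"] by blast
 have g2: "P v = (\<Sum>j<N. g j v * (v j - \<xi> p j))" for v using g(2)[rule_format, of v] unfolding P0 by (simp only: add_0)
 have "\<forall>j<N. regat X p (%y. g j (\<xi> y) / Q (\<xi> y))"
  using g(1) PQ(2,3) by (intro allI impI regat_divide[OF polyfun_regat polyfun_regat] pU) auto
 moreover have "\<forall>\<^sub>F y in nhd X p. f y = (\<Sum>j<N. g j (\<xi> y) / Q (\<xi> y) * bb j y)"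
  using PQ(4)
 proof eventually_elim
  case (elim y)
  then have "f y = P (\<xi> y) / Q (\<xi> y)" by simp
  also have "\<dots> = (\<Sum>j<N. g j (\<xi> y) / Q (\<xi> y) * bb j y)"
   unfolding g2[of "\<xi> y"] sum_divide_distrib bb_def by simp
  finally show ?case .
 qed
 ultimately show ?thesis by (intro exI[of _ "%j y. g j (\<xi> y) / Q (\<xi> y)"]) simp
qed

text \<open>In a product of two germs vanishing at \<open>p\<close> one factor is expanded in the
  \<open>bb l\<close> and the other stays as a coefficient in the maximal ideal, which is the shape
  required by Nakayama.\<close>

lemma square_maximal_ideal_form:
 assumes f: "f \<in> max_ideal_pow X p 2"
 shows "\<exists>m. (\<forall>l<N. regat X p (m l) & m l p = 0) & (\<forall>\<^sub>F y in nhd X p. f y = (\<Sum>l<N. m l y * bb l y))"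
proof -
 obtain M :: nat and a h where *: "\<forall>j<M. regat X p (a j) & (\<forall>i<(2::nat). regat X p (h j i) & h j i p = 0)"
  "\<forall>\<^sub>F y in nhd X p. f y = (\<Sum>j<M. a j y * (\<Prod>i<(2::nat). h j i y))"
  using f unfolding max_ideal_pow_iff[OF pX] by (elim exE conjE) (rule that)
 have "\<forall>j\<in>{..<M}. \<exists>e. (\<forall>l<N. regat X p (e l)) & (\<forall>\<^sub>F y in nhd X p. h j 1 y = (\<Sum>l<N. e l y * bb l y))"
  using *(1) by (intro ballI maximal_ideal_generated) auto
 from bchoice[OF this] obtain e where
  e: "\<forall>j\<in>{..<M}. (\<forall>l<N. regat X p (e j l)) & (\<forall>\<^sub>F y in nhd X p. h j 1 y = (\<Sum>l<N. e j l y * bb l y))" by (elim exE)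
 define m where "m = (%l y. \<Sum>j<M. a j y * h j 0 y * e j l y)"
 have "regat X p (m l) & m l p = 0" if "l < N" for l
  unfolding m_def using *(1) e that by (auto intro!: regat_sum regat_mult pX)
 moreover have "\<forall>\<^sub>F y in nhd X p. \<forall>j\<in>{..<M}. h j 1 y = (\<Sum>l<N. e j l y * bb l y)"
  using e by (intro eventually_ball_finite) auto
 then have "\<forall>\<^sub>F y in nhd X p. f y = (\<Sum>l<N. m l y * bb l y)" using *(2)
 proof eventually_elim
  case (elim y)
  have "f y = (\<Sum>j<M. a j y * h j 0 y * h j 1 y)" using elim(2) by (simp add: numeral_2_eq_2 mult.assoc)
  also have "\<dots> = (\<Sum>j<M. \<Sum>l<N. a j y * h j 0 y * (e j l y * bb l y))"
   using elim(1) by (intro sum.cong refl) (simp add: sum_distrib_left)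
  also have "\<dots> = (\<Sum>l<N. \<Sum>j<M. a j y * h j 0 y * (e j l y * bb l y))" by (rule sum.swap)
  also have "\<dots> = (\<Sum>l<N. m l y * bb l y)" by (simp add: m_def sum_distrib_right mult.assoc)
  finally show ?case .
 qed
 ultimately show ?thesis by (intro exI[of _ m]) auto
qed

text \<open>The maximal ideal modulo its square is spanned by \<open>z\<close>, so by Nakayama the
  centred coordinates, hence all germs vanishing at \<open>p\<close>, are multiples of
  \<open>z\<close>. Independence modulo the square shows that \<open>z\<close> is not the zero
  germ.\<close>

lemma uniformizer_from_basis:
 assumes B: "quot_basis (max_ideal_pow X p 1) (max_ideal_pow X p 2) B" "card B = 1"
 shows "\<exists>z. uniformizer X p z"
proof -
 obtain z where z: "B = {z}" using B(2) by (auto simp: card_1_singleton_iff)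
 have q: "z \<in> max_ideal_pow X p 1" "\<forall>a. (%s. a z * z s) \<in> max_ideal_pow X p 2 --> a z = 0"
  "\<forall>v\<in>max_ideal_pow X p 1. \<exists>a. (%s. v s - a z * z s) \<in> max_ideal_pow X p 2"
  using B(1) unfolding quot_basis_def z by simp_all
 have zr: "regat X p z" "z p = 0" using q(1) max_ideal_pow_1_iff[OF pX] by auto
 define I where "I = {f. \<exists>g. regat X p g & (\<forall>\<^sub>F y in nhd X p. f y = g y * z y)}"
 have II: "f \<in> I" if "regat X p g" "\<forall>\<^sub>F y in nhd X p. f y = g y * z y" for f g using that by (auto simp: I_def)
 have I0: "(%_. 0) \<in> I" by (rule II[of "%_. 0"]) (simp_all add: regat_const pX)
 have Iadd: "(%y. f y + g y) \<in> I" if fg: "f \<in> I" "g \<in> I" for f g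
 proof -
  obtain a b where ab: "regat X p a" "\<forall>\<^sub>F y in nhd X p. f y = a y * z y" "regat X p b" "\<forall>\<^sub>F y in nhd X p. g y = b y * z y"
   using fg by (auto simp: I_def)
  have "\<forall>\<^sub>F y in nhd X p. f y + g y = (a y + b y) * z y" using ab(2,4) by eventually_elim (simp add: distrib_right)
  then show ?thesis by (rule II[OF regat_add[OF ab(1,3)]])
 qed
 have Imult: "(%y. a y * f y) \<in> I" if a: "regat X p a" and f: "f \<in> I" for a f
 proof -
  obtain b where b: "regat X p b" "\<forall>\<^sub>F y in nhd X p. f y = b y * z y" using f by (auto simp: I_def)
  have "\<forall>\<^sub>F y in nhd X p. a y * f y = (a y * b y) * z y" using b(2) by eventually_elim simp
  then show ?thesis by (rule II[OF regat_mult[OF a b(1)]])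
 qed
 have Icong: "g \<in> I" if f: "f \<in> I" and g: "\<forall>\<^sub>F y in nhd X p. g y = f y" for f g
 proof -
  obtain b where b: "regat X p b" "\<forall>\<^sub>F y in nhd X p. f y = b y * z y" using f by (auto simp: I_def)
  have "\<forall>\<^sub>F y in nhd X p. g y = b y * z y" using g b(2) by eventually_elim simp
  then show ?thesis by (rule II[OF b(1)])
 qed
 have "\<forall>j\<in>{..<N}. \<exists>m. (\<forall>l<N. regat X p (m l) & m l p = 0) & (%y. bb j y - (\<Sum>l<N. m l y * bb l y)) \<in> I"
 proof
  fix j assume "j \<in> {..<N}"
  then have "bb j \<in> max_ideal_pow X p 1" using max_ideal_pow_1_iff[OF pX] bb by auto
  from bspec[OF q(3) this] obtain a where "(%s. bb j s - a z * z s) \<in> max_ideal_pow X p 2" by (elim exE)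
  from square_maximal_ideal_form[OF this] obtain m where m: "\<forall>l<N. regat X p (m l) & m l p = 0"
   "\<forall>\<^sub>F y in nhd X p. bb j y - a z * z y = (\<Sum>l<N. m l y * bb l y)" by (elim exE conjE)
  have "\<forall>\<^sub>F y in nhd X p. bb j y - (\<Sum>l<N. m l y * bb l y) = a z * z y"
   using m(2) by eventually_elim (simp add: algebra_simps)
  from II[OF regat_const[OF pX] this]
  show "\<exists>m. (\<forall>l<N. regat X p (m l) & m l p = 0) & (%y. bb j y - (\<Sum>l<N. m l y * bb l y)) \<in> I"
   using m(1) by (intro exI[of _ m]) simp
 qed
 from bchoice[OF this] obtain m where m: "\<forall>j\<in>{..<N}. (\<forall>l<N. regat X p (m j l) & m j l p = 0) & (%y. bb j y - (\<Sum>l<N. m j l y * bb l y)) \<in> I"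
  by (elim exE)
 have bI: "bb j \<in> I" if "j < N" for j
 proof (rule nakayama[of "{..<N}" I p m bb j])
  show "\<And>i j. i \<in> {..<N} ==> j \<in> {..<N} ==> regat X p (m i j) & m i j p = 0" using m by auto
  show "\<And>i. i \<in> {..<N} ==> (%y. bb i y - (\<Sum>j<N. m i j y * bb j y)) \<in> I" using m by auto
 qed (use that I0 Iadd Imult Icong pX in auto)
 have div: "\<exists>g. regat X p g & (\<forall>\<^sub>F y in nhd X p. f y = g y * z y)" if f: "regat X p f" "f p = 0" for f
 proof -
  obtain a where a: "\<forall>j<N. regat X p (a j)" "\<forall>\<^sub>F y in nhd X p. f y = (\<Sum>j<N. a j y * bb j y)"
   using maximal_ideal_generated[OF f] by blast
  have "(%y. \<Sum>j<n. a j y * bb j y) \<in> I" if "n \<le> N" for n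
   using that
  proof (induction n)
   case (Suc n)
   have "(%y. (\<Sum>j<n. a j y * bb j y) + a n y * bb n y) \<in> I"
    by (rule Iadd[OF _ Imult[OF _ bI]]) (use Suc a(1) in auto)
   then show ?case by simp
  qed (simp add: I0)
  from Icong[OF this[OF order_refl] a(2)] show ?thesis by (simp add: I_def)
 qed
 have "\<not> (\<forall>\<^sub>F y in nhd X p. z y = 0)"
 proof
  assume z0: "\<forall>\<^sub>F y in nhd X p. z y = 0"
  have "(%y. 0 * (\<Prod>i<(2::nat). z y)) \<in> max_ideal_pow X p 2"
   by (rule max_ideal_pow_prod[of p "%_. 0" 2 "%_. z"]) (use zr in \<open>auto intro: regat_const pX\<close>)
  then have "(%s. 1 * z s) \<in> max_ideal_pow X p 2" by (rule max_ideal_pow_cong[OF _ pX]) (use z0 in simp)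
  then show False using q(2)[rule_format, of "%_. 1"] by simp
 qed
 then have "\<forall>\<^sub>F y in generic X. z y ~= 0" using generic_dichotomy[OF zr(1)] by blast
 then have "uniformizer X p z" using zr div by (simp add: uniformizer_def)
 then show ?thesis by (rule exI[of _ z])
qed

text \<open>Near \<open>p\<close> the centred coordinates are multiples of \<open>z\<close>; where
  \<open>z\<close> vanishes they all do, and the chart is injective.\<close>

lemma uniformizer_isolated:
 assumes z: "uniformizer X p z" shows "\<forall>\<^sub>F y in nhd X p. z y = 0 --> y = p"
proof -
 have "\<forall>\<^sub>F y in nhd X p. z y = 0 --> bb j y = 0" if j: "j < N" for j
 proof -
  obtain g where "\<forall>\<^sub>F y in nhd X p. bb j y = g y * z y"
   using z bb(1)[OF j] bb(2)[of j] unfolding uniformizer_def by blast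
  then show ?thesis by eventually_elim simp
 qed
 then have "\<forall>\<^sub>F y in nhd X p. \<forall>j\<in>{..<N}. z y = 0 --> bb j y = 0"
  by (intro eventually_ball_finite) auto
 moreover have "\<forall>\<^sub>F y in nhd X p. y \<in> U" by (rule eventually_nhdI[OF openU pU])
 ultimately show ?thesis
 proof eventually_elim
  case (elim y)
  show ?case
  proof
   assume "z y = 0"
   then have "\<xi> y i = \<xi> p i" if "i < N" for i using elim(1) that by (auto simp: bb_def)
   then show "y = p" using inj[OF elim(2) pU] by blast
  qed
 qed
qed

text \<open>A germ that is never a unit times a power of \<open>z\<close> is divisible by all
  powers, so it lies in an ideal \<open>J\<close> with J = z J. Finite generation and Nakayama make
  \<open>J\<close> zero; this is Krull's intersection theorem for the local ring.\<close>

lemma discrete_valuation: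
 assumes f: "regat X p f" and z: "uniformizer X p z"
 shows "(\<forall>\<^sub>F y in nhd X p. f y = 0) \<or>
  (\<exists>k g. regat X p g & g p ~= 0 & (\<forall>\<^sub>F y in nhd X p. f y = g y * z y ^ k))"
proof (rule ccontr)
 assume neg: "\<not> ?thesis"
 have zr: "regat X p z" "z p = 0" "\<forall>\<^sub>F y in generic X. z y ~= 0" using z by (auto simp: uniformizer_def)
 define J where "J = {f. regat X p f & (\<forall>k. \<exists>g. regat X p g & (\<forall>\<^sub>F y in nhd X p. f y = g y * z y ^ k))}"
 have fk: "\<exists>g. regat X p g & (\<forall>\<^sub>F y in nhd X p. f y = g y * z y ^ k)" for k
 proof (induction k)
  case 0 show ?case using f by (intro exI[of _ f]) simp
 next
  case (Suc k)
  then obtain g where g: "regat X p g" "\<forall>\<^sub>F y in nhd X p. f y = g y * z y ^ k" by blast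
  have "g p = 0" using neg g by blast
  then obtain h where h: "regat X p h" "\<forall>\<^sub>F y in nhd X p. g y = h y * z y"
   using z g(1) unfolding uniformizer_def by blast
  have "\<forall>\<^sub>F y in nhd X p. f y = h y * z y ^ Suc k" using g(2) h(2) by eventually_elim simp
  then show ?case using h(1) by blast
 qed
 have fJ: "f \<in> J" using f fk by (simp add: J_def)
 have Jcong: "g' \<in> J" if gJ: "g \<in> J" and e: "\<forall>\<^sub>F y in nhd X p. g' y = g y" for g g'
 proof -
  have "regat X p g'" using regat_cong[OF _ e] that by (simp add: J_def)
  moreover have "\<exists>h. regat X p h & (\<forall>\<^sub>F y in nhd X p. g' y = h y * z y ^ k)" for k
  proof -
   obtain h where h: "regat X p h" "\<forall>\<^sub>F y in nhd X p. g y = h y * z y ^ k" using gJ by (auto simp: J_def)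
   have "\<forall>\<^sub>F y in nhd X p. g' y = h y * z y ^ k" using e h(2) by eventually_elim simp
   then show ?thesis using h(1) by blast
  qed
  ultimately show ?thesis by (simp add: J_def)
 qed
 have Jmult: "(%y. a y * g y) \<in> J" if gJ: "g \<in> J" and a: "regat X p a" for g a
 proof -
  have "\<exists>h. regat X p h & (\<forall>\<^sub>F y in nhd X p. a y * g y = h y * z y ^ k)" for k
  proof -
   obtain h where h: "regat X p h" "\<forall>\<^sub>F y in nhd X p. g y = h y * z y ^ k" using gJ by (auto simp: J_def)
   have "\<forall>\<^sub>F y in nhd X p. a y * g y = (a y * h y) * z y ^ k" using h(2) by eventually_elim simp
   then show ?thesis using regat_mult[OF a h(1)] by (intro exI[of _ "%y. a y * h y"]) simp
  qed
  then show ?thesis using that regat_mult[OF a] by (simp add: J_def)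
 qed
 have Jadd: "(%y. a y + g y) \<in> J" if gJ: "g \<in> J" "a \<in> J" for g a
 proof -
  have "\<exists>h. regat X p h & (\<forall>\<^sub>F y in nhd X p. a y + g y = h y * z y ^ k)" for k
  proof -
   obtain h where h: "regat X p h" "\<forall>\<^sub>F y in nhd X p. g y = h y * z y ^ k" using gJ by (auto simp: J_def)
   obtain h' where h': "regat X p h'" "\<forall>\<^sub>F y in nhd X p. a y = h' y * z y ^ k" using gJ by (auto simp: J_def)
   have "\<forall>\<^sub>F y in nhd X p. a y + g y = (h' y + h y) * z y ^ k" using h(2) h'(2)
    by eventually_elim (simp add: distrib_right)
   then show ?thesis using regat_add[OF h'(1) h(1)] by (intro exI[of _ "%y. h' y + h y"]) simp
  qed
  then show ?thesis using that regat_add by (simp add: J_def)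
 qed
 have Jdiv: "\<exists>c\<in>J. \<forall>\<^sub>F y in nhd X p. g y = z y * c y" if g: "g \<in> J" for g
 proof -
  have ex: "\<exists>h. regat X p h & (\<forall>\<^sub>F y in nhd X p. g y = h y * z y ^ k)" for k using g by (simp add: J_def)
  obtain c where c: "regat X p c" "\<forall>\<^sub>F y in nhd X p. g y = c y * z y ^ 1" using ex[of 1] by blast
  have "\<exists>h. regat X p h & (\<forall>\<^sub>F y in nhd X p. c y = h y * z y ^ k)" for k
  proof -
   obtain h where h: "regat X p h" "\<forall>\<^sub>F y in nhd X p. g y = h y * z y ^ Suc k" using ex[of "Suc k"] by blast
   have "\<forall>\<^sub>F y in generic X. c y = h y * z y ^ k"
    using eventually_nhd_generic[OF h(2) pX] eventually_nhd_generic[OF c(2) pX] zr(3) by eventually_elim simp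
   from identity_nhd[OF c(1) regat_mult[OF h(1) regat_power[OF zr(1)]] this] show ?thesis using h(1) by blast
  qed
  then have "c \<in> J" using c(1) by (simp add: J_def)
  moreover have "\<forall>\<^sub>F y in nhd X p. g y = z y * c y" using c(2) by eventually_elim simp
  ultimately show ?thesis by blast
 qed
 \<comment> \<open>The basis theorem speaks of polynomials, so \<open>J\<close> is generated through
   the numerators of its members.\<close>
 define JJ where "JJ = {P \<in> polyfun N. (%y. P (\<xi> y)) \<in> J}"
 have "pideal N JJ"
  unfolding pideal_def JJ_def
  using Jadd Jmult[OF _ polyfun_regat[OF _ pU]] Jmult[OF fJ regat_const[OF pX, of 0]]
  by (auto intro: polyfun.intros)
 from hilbert_basis[OF this] obtain F where F: "finite F" "F \<subseteq> JJ" "JJ \<subseteq> comb N F" by blast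
 have JF: "\<exists>m. (\<forall>b\<in>F. regat X p (m b)) & (\<forall>\<^sub>F y in nhd X p. g y = (\<Sum>b\<in>F. m b y * b (\<xi> y)))" if g: "g \<in> J" for g
 proof -
  obtain P Q where PQ: "P \<in> polyfun N" "Q \<in> polyfun N" "Q (\<xi> p) ~= 0"
   "\<forall>\<^sub>F y in nhd X p. Q (\<xi> y) ~= 0 & g y = P (\<xi> y) / Q (\<xi> y)"
   by (rule germ_quotient[of g]) (use g in \<open>auto simp: J_def\<close>)
  have "(%y. P (\<xi> y)) \<in> J"
  proof (rule Jcong[OF Jmult[OF g polyfun_regat[OF PQ(2) pU]]])
   show "\<forall>\<^sub>F y in nhd X p. P (\<xi> y) = Q (\<xi> y) * g y" using PQ(4) by eventually_elim simp
  qed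
  then have "P \<in> comb N F" using PQ(1) F(3) by (auto simp: JJ_def)
  then obtain h where h: "\<forall>b\<in>F. h b \<in> polyfun N" "P = (%v. \<Sum>b\<in>F. h b v * b v)" by (auto simp: comb_def)
  have "\<forall>b\<in>F. regat X p (%y. h b (\<xi> y) / Q (\<xi> y))"
   using h(1) PQ(2,3) by (intro ballI regat_divide[OF polyfun_regat polyfun_regat] pU) auto
  moreover have "\<forall>\<^sub>F y in nhd X p. g y = (\<Sum>b\<in>F. h b (\<xi> y) / Q (\<xi> y) * b (\<xi> y))"
   using PQ(4) by eventually_elim (simp add: h(2) sum_divide_distrib)
  ultimately show ?thesis by (intro exI[of _ "%b y. h b (\<xi> y) / Q (\<xi> y)"]) simp
 qed
 have "\<forall>b\<in>F. \<exists>m. (\<forall>b'\<in>F. regat X p (m b') & m b' p = 0) & (\<forall>\<^sub>F y in nhd X p. b (\<xi> y) - (\<Sum>b'\<in>F. m b' y * b' (\<xi> y)) = 0)"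
 proof
  fix b assume "b \<in> F"
  then have "(%y. b (\<xi> y)) \<in> J" using F(2) by (auto simp: JJ_def)
  from Jdiv[OF this] obtain c where c: "c \<in> J" "\<forall>\<^sub>F y in nhd X p. b (\<xi> y) = z y * c y" by blast
  from JF[OF c(1)] obtain m where m: "\<forall>b\<in>F. regat X p (m b)" "\<forall>\<^sub>F y in nhd X p. c y = (\<Sum>b\<in>F. m b y * b (\<xi> y))" by blast
  have "\<forall>\<^sub>F y in nhd X p. b (\<xi> y) - (\<Sum>b'\<in>F. (z y * m b' y) * b' (\<xi> y)) = 0"
   using c(2) m(2) by eventually_elim (simp add: sum_distrib_left mult.assoc)
  moreover have "\<forall>b'\<in>F. regat X p (%y. z y * m b' y) & z p * m b' p = 0" using m(1) zr by (auto intro: regat_mult)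
  ultimately show "\<exists>m. (\<forall>b'\<in>F. regat X p (m b') & m b' p = 0) & (\<forall>\<^sub>F y in nhd X p. b (\<xi> y) - (\<Sum>b'\<in>F. m b' y * b' (\<xi> y)) = 0)"
   by (intro exI[of _ "%b' y. z y * m b' y"]) simp
 qed
 from bchoice[OF this] obtain m where m: "\<forall>b\<in>F. (\<forall>b'\<in>F. regat X p (m b b') & m b b' p = 0) & (\<forall>\<^sub>F y in nhd X p. b (\<xi> y) - (\<Sum>b'\<in>F. m b b' y * b' (\<xi> y)) = 0)"
  by (elim exE)
 have bz: "(%y. b (\<xi> y)) \<in> {f. \<forall>\<^sub>F y in nhd X p. f y = 0}" if "b \<in> F" for b
 proof (rule nakayama[of F _ p m "%b y. b (\<xi> y)" b])
  show "\<And>i j. i \<in> F ==> j \<in> F ==> regat X p (m i j) & m i j p = 0" using m by blast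
  show "\<And>i. i \<in> F ==> (%y. i (\<xi> y) - (\<Sum>j\<in>F. m i j y * j (\<xi> y))) \<in> {f. \<forall>\<^sub>F y in nhd X p. f y = 0}" using m by simp
  show "(%y. f y + g y) \<in> {f. \<forall>\<^sub>F y in nhd X p. f y = 0}"
   if "f \<in> {f. \<forall>\<^sub>F y in nhd X p. f y = 0}" "g \<in> {f. \<forall>\<^sub>F y in nhd X p. f y = 0}" for f g :: "'c => complex"
  proof -
   have "\<forall>\<^sub>F y in nhd X p. f y = 0" "\<forall>\<^sub>F y in nhd X p. g y = 0" using that by auto
   then have "\<forall>\<^sub>F y in nhd X p. f y + g y = 0" by eventually_elim simp
   then show ?thesis by simp
  qed
  show "g \<in> {f. \<forall>\<^sub>F y in nhd X p. f y = 0}"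
   if "f \<in> {f. \<forall>\<^sub>F y in nhd X p. f y = 0}" "\<forall>\<^sub>F y in nhd X p. g y = f y" for f g :: "'c => complex"
  proof -
   have "\<forall>\<^sub>F y in nhd X p. f y = 0" using that by simp
   then have "\<forall>\<^sub>F y in nhd X p. g y = 0" using that(2) by eventually_elim simp
   then show ?thesis by simp
  qed
 qed (use that F pX in \<open>auto elim: eventually_mono\<close>)
 from JF[OF fJ] obtain c where c: "\<forall>\<^sub>F y in nhd X p. f y = (\<Sum>b\<in>F. c b y * b (\<xi> y))" by blast
 have "\<forall>\<^sub>F y in nhd X p. \<forall>b\<in>F. b (\<xi> y) = 0" using F(1) bz by (intro eventually_ball_finite) auto
 then have "\<forall>\<^sub>F y in nhd X p. f y = 0" using c
  by eventually_elim (auto intro!: sum.neutral)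
 then show False using neg by blast
qed

end

text \<open>The denominators \<open>Q q\<close> generate an ideal with a finite generating set,
  which involves only finitely many of them. A point missed by the corresponding neighbourhoods is a
  zero of all these, hence of its own \<open>Q y\<close>, which is nonzero there.\<close>

lemma (in irr_fsp) affchart_compact:
 assumes chart: "affchart X U N \<xi>" and O': "\<And>q. q \<in> U ==> openin (zar X) (O' q) & q \<in> O' q"
 shows "\<exists>A. finite A & A \<subseteq> U & U \<subseteq> (\<Union>q\<in>A. O' q)"
proof -
 have "\<exists>Q. Q \<in> polyfun N & Q (\<xi> q) ~= 0 & (\<forall>y\<in>U. Q (\<xi> y) ~= 0 --> y \<in> O' q)" if q: "q \<in> U" for q
 proof -
  interpret chart_at X U N \<xi> q by unfold_locales (rule chart, rule q)
  have o: "openin (zar X) (O' q)" "q \<in> O' q" using O'[OF q] by auto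
  \<comment> \<open>Writing the function 0 on the open set as a quotient supplies a denominator
    whose nonvanishing confines points to that set.\<close>
  show ?thesis by (rule chart_quotient[OF o(1) reg_const[OF o(1), of 0] o(2) q]) blast
 qed
 then obtain Q where Q: "\<And>q. q \<in> U ==> Q q \<in> polyfun N" "\<And>q. q \<in> U ==> Q q (\<xi> q) ~= 0"
  "\<And>q y. q \<in> U ==> y \<in> U ==> Q q (\<xi> y) ~= 0 ==> y \<in> O' q" by metis
 define J where "J = (\<Union>F\<in>{F. finite F & F \<subseteq> Q ` U}. comb N F)"
 have "pideal N J"
  unfolding pideal_def
 proof (intro conjI ballI)
  show "J \<subseteq> polyfun N" unfolding J_def comb_def using Q(1)
   by (auto intro!: polyfun_sum polyfun.mult)
  show "(%_. 0) \<in> J" unfolding J_def using comb_zero by (auto intro!: exI[of _ "{}"])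
  show "(%v. f v + g v) \<in> J" if "f \<in> J" "g \<in> J" for f g
  proof -
   obtain F G where FG: "finite F" "F \<subseteq> Q ` U" "f \<in> comb N F" "finite G" "G \<subseteq> Q ` U" "g \<in> comb N G"
    using \<open>f \<in> J\<close> \<open>g \<in> J\<close> unfolding J_def by blast
   then have "f \<in> comb N (F \<union> G)" "g \<in> comb N (F \<union> G)"
    using comb_mono[of F "F \<union> G" N] comb_mono[of G "F \<union> G" N] by auto
   from comb_add[OF this] show ?thesis unfolding J_def using FG by (intro UN_I[of "F \<union> G"]) auto
  qed
  show "(%v. p v * f v) \<in> J" if fJ: "f \<in> J" "p \<in> polyfun N" for f p
  proof -
   obtain F g where F: "finite F" "F \<subseteq> Q ` U" "\<forall>b\<in>F. g b \<in> polyfun N" "f = (%v. \<Sum>b\<in>F. g b v * b v)"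
    using fJ(1) unfolding J_def comb_def by auto
   have "(%v. p v * f v) \<in> comb N F" unfolding comb_def
    by (rule CollectI, rule exI[of _ "%b v. p v * g b v"])
     (use F fJ(2) in \<open>auto simp: sum_distrib_left mult.assoc intro: polyfun.mult\<close>)
   then show ?thesis unfolding J_def using F by (intro UN_I[of F]) auto
  qed
 qed
 from hilbert_basis[OF this] obtain F0 where F0: "finite F0" "F0 \<subseteq> J" "J \<subseteq> comb N F0" by blast
 have "\<forall>f\<in>F0. \<exists>F. finite F & F \<subseteq> Q ` U & f \<in> comb N F" using F0(2) by (auto simp: J_def)
 from bchoice[OF this] obtain FF where FF: "\<forall>f\<in>F0. finite (FF f) & FF f \<subseteq> Q ` U & f \<in> comb N (FF f)" by (elim exE)
 define F1 where "F1 = (\<Union>f\<in>F0. FF f)"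
 have F1: "finite F1" "F1 \<subseteq> Q ` U" using FF F0(1) by (auto simp: F1_def)
 obtain A where A: "finite A" "A \<subseteq> U" "F1 = Q ` A" using finite_subset_image[OF F1] by blast
 have "y \<in> (\<Union>q\<in>A. O' q)" if y: "y \<in> U" for y
 proof (rule ccontr)
  assume n: "y \<notin> (\<Union>q\<in>A. O' q)"
  have z1: "b (\<xi> y) = 0" if "b \<in> F1" for b using n Q(3)[OF _ y] A that by blast
  have z0: "f (\<xi> y) = 0" if f: "f \<in> F0" for f
  proof -
   obtain g where "f = (%v. \<Sum>b\<in>FF f. g b v * b v)" using FF f unfolding comb_def by blast
   then have "f (\<xi> y) = (\<Sum>b\<in>FF f. g b (\<xi> y) * b (\<xi> y))" by metis
   also have "\<dots> = 0" by (rule sum.neutral) (use z1 f in \<open>auto simp: F1_def\<close>)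
   finally show ?thesis .
  qed
  have "Q y \<in> J"
  proof -
   have "Q y = (%v. \<Sum>b\<in>{Q y}. 1 * b v)" by simp
   then have "Q y \<in> comb N {Q y}" unfolding comb_def
    by (intro CollectI exI[of _ "%_ _. 1"]) (auto intro: polyfun.const)
   then show ?thesis unfolding J_def using y by (intro UN_I[of "{Q y}"]) auto
  qed
  then obtain g where "Q y = (%v. \<Sum>b\<in>F0. g b v * b v)" using F0(3) by (auto simp: comb_def)
  then have "Q y (\<xi> y) = (\<Sum>b\<in>F0. g b (\<xi> y) * b (\<xi> y))" by simp
  also have "\<dots> = 0" by (rule sum.neutral) (use z0 in auto)
  finally have "Q y (\<xi> y) = 0" .
  then show False using Q(2)[OF y] by simp
 qed
 then show ?thesis using A by blast
qed

text \<open>For the cofinite topology: a nonempty open set contains a punctured neighbourhood of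
  every point, because a polynomial cutting out part of it has a finite order there and uniformizers
  have isolated zeros; and finitely many such neighbourhoods cover, by compactness of the
  charts.\<close>

theorem smooth_projective_curve_imp_curve:
 assumes C: "smooth_projective_curve C" shows "curve C"
proof -
 have swf: "space_with_functions C" using C by (simp add: smooth_projective_curve_def)
 interpret irr_fsp C
 proof unfold_locales
  have irr: "irreducible_closed (zar C) (pts C)" using C by (simp add: smooth_projective_curve_def)
  show "pts C ~= {}" using irr by (simp add: irreducible_closed_def)
  fix U V assume UV: "openin (zar C) U" "openin (zar C) V" "U ~= {}" "V ~= {}"
  show "U \<inter> V ~= {}"
  proof
   assume "U \<inter> V = {}"
   then have "pts C \<subseteq> (pts C - U) \<union> (pts C - V)" by auto
   moreover have "closedin (zar C) (pts C - U)" "closedin (zar C) (pts C - V)" using UV by auto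
   ultimately have "pts C \<subseteq> pts C - U \<or> pts C \<subseteq> pts C - V" using irr unfolding irreducible_closed_def by blast
   then show False using UV openin_subset by blast
  qed
 qed (rule swf)
 obtain n \<phi> where "closed_immersion C (proj_space n) \<phi>" using C by (auto simp: smooth_projective_curve_def)
 from affchart_exists[OF swf this] obtain U \<xi> where ch: "\<And>i. i \<le> n ==> affchart C (U i) (Suc n) (\<xi> i)"
  and cov: "(\<Union>i\<le>n. U i) = pts C" by blast
 have chart_at: "\<exists>i\<le>n. chart_at C (U i) (Suc n) (\<xi> i) p" if "p \<in> pts C" for p
 proof -
  have "p \<in> (\<Union>i\<le>n. U i)" using that cov by simp
  then obtain i where "i \<le> n" "p \<in> U i" by auto
  then show ?thesis using ch by (intro exI[of _ i]) (simp add: chart_at_def chart_at_axioms_def irr_fsp_axioms)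
 qed
 have closed: "openin (zar C) (pts C - {p})" if p: "p \<in> pts C" for p
 proof (subst openin_subopen, intro ballI)
  fix y assume y: "y \<in> pts C - {p}"
  obtain i where i: "chart_at C (U i) (Suc n) (\<xi> i) y" using chart_at y by blast
  interpret chart_at C "U i" "Suc n" "\<xi> i" y by (rule i)
  show "\<exists>T. openin (zar C) T & y \<in> T & T \<subseteq> pts C - {p}"
  proof (cases "p \<in> U i")
   case False
   then show ?thesis using openU pU openin_subset[OF openU] by (intro exI[of _ "U i"]) auto
  next
   case True
   then obtain j where j: "j < Suc n" "\<xi> i y j ~= \<xi> i p j" using inj[OF pU True] y by blast
   have "regat C y (%y. \<xi> i y j - \<xi> i p j)" using j by (intro regat_diff coord_regat pU regat_const pX)
   from eventually_nhdE[OF regat_nz[OF this] pX] obtain T where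
    T: "openin (zar C) T" "y \<in> T" "\<And>y. y \<in> T ==> \<xi> i y j - \<xi> i p j ~= 0" using j by auto
   then show ?thesis using openin_subset[OF T(1)] by (intro exI[of _ T]) fastforce
  qed
 qed
 have unif: "\<exists>z. uniformizer C p z" if p: "p \<in> pts C" for p
 proof -
  obtain i where i: "chart_at C (U i) (Suc n) (\<xi> i) p" using chart_at p by blast
  interpret chart_at C "U i" "Suc n" "\<xi> i" p by (rule i)
  obtain B where "quot_basis (max_ideal_pow C p 1) (max_ideal_pow C p 2) B" "card B = 1"
   using C p unfolding smooth_projective_curve_def by blast
  then show ?thesis by (rule uniformizer_from_basis)
 qed
 show ?thesis
 proof unfold_locales
  fix p assume p: "p \<in> pts C"
  show "openin (zar C) (pts C - {p})" by (rule closed[OF p])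
  show "\<exists>z. uniformizer C p z" by (rule unif[OF p])
  then obtain z where z: "uniformizer C p z" ..
  show "\<not> openin (zar C) {p}"
  proof
   assume "openin (zar C) {p}"
   then have "\<forall>\<^sub>F y in generic C. z y = 0"
    by (rule eventually_genericI) (use z in \<open>auto simp: uniformizer_def\<close>)
   moreover have "\<forall>\<^sub>F y in generic C. z y ~= 0" using z by (simp add: uniformizer_def)
   ultimately have "\<forall>\<^sub>F y in generic C. False" by eventually_elim simp
   then show False using generic_not_bot by (simp add: trivial_limit_def)
  qed
 next
  fix p f z assume f: "regat C p f" and z: "uniformizer C p z"
  obtain i where i: "chart_at C (U i) (Suc n) (\<xi> i) p" using chart_at regat_pts[OF f] by blast
  interpret chart_at C "U i" "Suc n" "\<xi> i" p by (rule i)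
  show "(\<forall>\<^sub>F y in nhd C p. f y = 0) \<or>
   (\<exists>k g. regat C p g & g p ~= 0 & (\<forall>\<^sub>F y in nhd C p. f y = g y * z y ^ k))"
   by (rule discrete_valuation[OF f z])
 next
  fix W f p assume W: "openin (zar C) W" "W ~= {}" and f: "f \<in> reg C W" and p: "p \<in> pts C"
  obtain i where i: "chart_at C (U i) (Suc n) (\<xi> i) p" using chart_at p by blast
  interpret chart_at C "U i" "Suc n" "\<xi> i" p by (rule i)
  obtain q where q: "q \<in> W" "q \<in> U i" using opens_meet[OF W(1) openU W(2)] pU by blast
  obtain P Q where PQ: "P \<in> polyfun (Suc n)" "Q \<in> polyfun (Suc n)" "Q (\<xi> i q) ~= 0"
   "\<And>y. y \<in> U i ==> Q (\<xi> i y) ~= 0 ==> y \<in> W" "\<And>y. y \<in> U i ==> Q (\<xi> i y) ~= 0 ==> f y = P (\<xi> i y) / Q (\<xi> i y)"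
   by (rule chart_quotient[OF W(1) f q]) (rule that)
  have "\<forall>\<^sub>F y in generic C. Q (\<xi> i y) ~= 0" by (rule generic_nz[OF polyfun_regat[OF PQ(2) q(2)] PQ(3)])
  moreover have "\<forall>\<^sub>F y in generic C. y \<in> U i" by (rule eventually_genericI[OF openU]) (use pU in auto)
  ultimately have "\<forall>\<^sub>F y in generic C. Q (\<xi> i y) ~= 0 & f y = P (\<xi> i y) / Q (\<xi> i y)"
   by eventually_elim (use PQ(5) in auto)
  then show "\<exists>a b. regat C p a & regat C p b & (\<forall>\<^sub>F y in generic C. b y ~= 0 & f y = a y / b y)"
   using polyfun_regat[OF PQ(1) pU] polyfun_regat[OF PQ(2) pU]
   by (intro exI[of _ "%y. P (\<xi> i y)"] exI[of _ "%y. Q (\<xi> i y)"]) simp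
 next
  fix W assume W: "openin (zar C) W" "W ~= {}"
  have "\<exists>O'. openin (zar C) O' & q \<in> O' & O' - {q} \<subseteq> W" if q: "q \<in> pts C" for q
  proof -
   obtain i where i: "chart_at C (U i) (Suc n) (\<xi> i) q" using chart_at q by blast
   interpret chart_at C "U i" "Suc n" "\<xi> i" q by (rule i)
   obtain q' where q': "q' \<in> W" "q' \<in> U i" using opens_meet[OF W(1) openU W(2)] pU by blast
   obtain P Q where PQ: "P \<in> polyfun (Suc n)" "Q \<in> polyfun (Suc n)" "Q (\<xi> i q') ~= 0"
    "\<And>y. y \<in> U i ==> Q (\<xi> i y) ~= 0 ==> y \<in> W"
    "\<And>y. y \<in> U i ==> Q (\<xi> i y) ~= 0 ==> 0 = P (\<xi> i y) / Q (\<xi> i y)"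
    by (rule chart_quotient[OF W(1) reg_const[OF W(1), of 0] q']) (rule that)
   obtain z where z: "uniformizer C q z" using unif[OF q] by blast
   have rQ: "regat C q (%y. Q (\<xi> i y))" by (rule polyfun_regat[OF PQ(2) pU])
   have gQ: "\<forall>\<^sub>F y in generic C. Q (\<xi> i y) ~= 0" by (rule generic_nz[OF polyfun_regat[OF PQ(2) q'(2)] PQ(3)])
   have "\<not> (\<forall>\<^sub>F y in nhd C q. Q (\<xi> i y) = 0)"
   proof
    assume "\<forall>\<^sub>F y in nhd C q. Q (\<xi> i y) = 0"
    then have "\<forall>\<^sub>F y in generic C. Q (\<xi> i y) = 0" using q by (rule eventually_nhd_generic)
    then have "\<forall>\<^sub>F y in generic C. False" using gQ by eventually_elim simp
    then show False using generic_not_bot by (simp add: trivial_limit_def)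
   qed
   with discrete_valuation[OF rQ z] obtain k g where g: "regat C q g" "g q ~= 0"
    "\<forall>\<^sub>F y in nhd C q. Q (\<xi> i y) = g y * z y ^ k" by blast
   have "\<forall>\<^sub>F y in nhd C q. y \<in> U i" by (rule eventually_nhdI[OF openU pU])
   then have "\<forall>\<^sub>F y in nhd C q. y ~= q --> y \<in> W"
    using g(3) regat_nz[OF g(1,2)] uniformizer_isolated[OF z]
    by eventually_elim (use PQ(4) in auto)
   then obtain O' where "openin (zar C) O'" "q \<in> O'" "\<forall>y\<in>O'. y ~= q --> y \<in> W"
    using q by (auto simp: eventually_nhdsin)
   then show ?thesis by (intro exI[of _ O']) auto
  qed
  then obtain O' where O': "\<And>q. q \<in> pts C ==> openin (zar C) (O' q) & q \<in> O' q & O' q - {q} \<subseteq> W" by metis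
  have "\<exists>A. finite A & A \<subseteq> U i & U i \<subseteq> (\<Union>q\<in>A. O' q)" if "i \<le> n" for i
   by (rule affchart_compact[OF ch[OF that]]) (use O' cov that in auto)
  then obtain A where A: "\<And>i. i \<le> n ==> finite (A i) & A i \<subseteq> U i & U i \<subseteq> (\<Union>q\<in>A i. O' q)" by metis
  have "pts C - W \<subseteq> (\<Union>i\<le>n. A i)"
  proof
   fix y assume y: "y \<in> pts C - W"
   then have "y \<in> (\<Union>i\<le>n. U i)" using cov by simp
   then obtain i where i: "i \<le> n" "y \<in> U i" by auto
   then obtain q where q: "q \<in> A i" "y \<in> O' q" using A[OF i(1)] by auto
   then have "q \<in> (\<Union>i\<le>n. U i)" using A[OF i(1)] i(1) by auto
   then have "q \<in> pts C" using cov by simp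
   from O'[OF this] have "y = q" using q y by auto
   then show "y \<in> (\<Union>i\<le>n. A i)" using q i by auto
  qed
  moreover have "finite (\<Union>i\<le>n. A i)" using A by auto
  ultimately show "finite (pts C - W)" by (rule finite_subset)
 qed
qed

section \<open>Frames of a rank two bundle\<close>

text \<open>The ring generated by the functions pulled back from \<open>U\<close> along \<pi> and by
  the coordinate functions in \<open>X\<close>: polynomials in the coordinates with coefficients
  regular on the base.\<close>

inductive_set pfun :: "'c fspace => ('e => 'c) => ('e => complex) set => 'c set => ('e => complex) set"
 for C \<pi> X U where
 base: "a \<in> reg C U ==> (%e. a (\<pi> e)) \<in> pfun C \<pi> X U"
| gen: "x \<in> X ==> x \<in> pfun C \<pi> X U"
| add: "f \<in> pfun C \<pi> X U ==> g \<in> pfun C \<pi> X U ==> (%e. f e + g e) \<in> pfun C \<pi> X U"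
| mult: "f \<in> pfun C \<pi> X U ==> g \<in> pfun C \<pi> X U ==> (%e. f e * g e) \<in> pfun C \<pi> X U"

lemma (in fsp) pfun_const: "openin (zar X) U ==> (%_. c) \<in> pfun X \<pi> S U"
 by (rule pfun.base[where a="%_. c"]) (rule reg_const)

lemma (in fsp) pfun_mono:
 assumes "f \<in> pfun X \<pi> S U" "openin (zar X) U" "openin (zar X) U'" "U' \<subseteq> U"
 shows "f \<in> pfun X \<pi> S U'"
 using assms by (induction rule: pfun.induct) (auto intro: pfun.intros reg_restrict)

definition fib :: "('c, 'e) vbundle => 'c set => 'e set" where
 "fib E U = {e \<in> pts (total E). bproj E e \<in> U}"

text \<open>Linear coordinates on the fibres over \<open>U\<close>. The last axiom extracts from
  local triviality that functions on the total space are locally quotients of polynomials in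
  \<open>X\<close> and \<open>Y\<close>; the later local arguments start from it.\<close>

locale frame =
 fixes C :: "'c fspace" and E :: "('c, 'e) vbundle" and U :: "'c set" and X Y :: "'e => complex"
 assumes openU: "openin (zar C) U"
  and X_regat: "e \<in> fib E U ==> regat (total E) e X"
  and Y_regat: "e \<in> fib E U ==> regat (total E) e Y"
  and vector_exists: "q \<in> U ==> \<exists>e\<in>pts (total E). bproj E e = q & X e = a & Y e = b"
  and vector_unique: "e \<in> fib E U ==> e' \<in> fib E U ==> bproj E e = bproj E e' ==> X e = X e' ==> Y e = Y e' ==> e = e'"
  and badd: "e \<in> fib E U ==> e' \<in> fib E U ==> bproj E e = bproj E e' ==>
   badd E e e' \<in> pts (total E) & bproj E (badd E e e') = bproj E e &
   X (badd E e e') = X e + X e' & Y (badd E e e') = Y e + Y e'"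
  and bscale: "e \<in> fib E U ==>
   bscale E c e \<in> pts (total E) & bproj E (bscale E c e) = bproj E e &
   X (bscale E c e) = c * X e & Y (bscale E c e) = c * Y e"
  and local_quotient: "openin (zar (total E)) W ==> f \<in> reg (total E) W ==> e \<in> W ==> e \<in> fib E U ==>
   \<exists>U' G H. openin (zar C) U' & U' \<subseteq> U & bproj E e \<in> U' & G \<in> pfun C (bproj E) {X, Y} U' &
    H \<in> pfun C (bproj E) {X, Y} U' & H e ~= 0 &
    (\<forall>e'\<in>fib E U'. H e' ~= 0 --> e' \<in> W & f e' = G e' / H e')"

definition coordP :: "nat => 'c \<times> (nat => complex) => complex" where
 "coordP i = (%z. snd z i)"

abbreviation pfP :: "'c fspace => 'c set => ('c \<times> (nat => complex) => complex) set" where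
 "pfP C U \<equiv> pfun C fst {coordP 0, coordP 1} U"

lemma (in fsp) polyfun_pfP:
 assumes "P \<in> polyfun 2" "openin (zar X) U" shows "(%z. P (snd z)) \<in> pfP X U"
 using assms(1)
proof (induction rule: polyfun.induct)
 case (coord i)
 then have "(%z :: 'a \<times> (nat => complex). snd z i) \<in> {coordP 0, coordP 1}"
  by (auto simp: coordP_def numeral_2_eq_2 less_Suc_eq)
 then show ?case by (rule pfun.gen)
qed (auto intro: pfun.add pfun.mult pfun_const[OF assms(2)])

text \<open>Elementary tensors are brought over a polynomial denominator, and sums keep that form.
  The initial denominator cuts out a neighbourhood inside \<open>V\<close>, so a nonzero denominator
  also certifies membership in the product of \<open>U\<close> and \<open>V\<close>.\<close>

lemma (in fsp) tensor_quotient: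
 assumes U: "openin (zar X) U" and V: "openin (zar (affine_space 2)) V"
  and h: "h \<in> tensor_functions (sub_fspace X U0) (affine_space 2) U V" and U0: "openin (zar X) U0" "U \<subseteq> U0"
  and z: "z \<in> U \<times> V"
 shows "\<exists>G\<in>pfP X U. \<exists>H\<in>pfP X U. H z ~= 0 &
  (\<forall>w\<in>U \<times> affine_pts 2. H w ~= 0 --> w \<in> U \<times> V & h w = G w / H w)"
proof -
 obtain N :: nat and a b where h: "h = (%z. \<Sum>i<N. a i (fst z) * b i (snd z))"
  and ab: "\<forall>i<N. a i \<in> reg (sub_fspace X U0) U & b i \<in> reg (affine_space 2) V"
  using h unfolding tensor_functions_def by blast
 have a: "a i \<in> reg X U" if "i < N" for i using ab that regat_sub_fspace[OF U0(1) U U0(2)] by blast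
 have "\<exists>G\<in>pfP X U. \<exists>H\<in>pfP X U. H z ~= 0 &
  (\<forall>w\<in>U \<times> affine_pts 2. H w ~= 0 --> snd w \<in> V & (\<Sum>i<n. a i (fst w) * b i (snd w)) = G w / H w)"
  if "n \<le> N" for n
  using that
 proof (induction n)
  case 0
  have "snd z \<in> V" using z by auto
  from openin_affine_space[OF V this] obtain q where q: "q \<in> polyfun 2" "q (snd z) ~= 0"
   "{v \<in> affine_pts 2. q v ~= 0} \<subseteq> V" by blast
  show ?case
   by (rule bexI[of _ "%_. 0"], rule bexI[of _ "%z. q (snd z)"])
    (use q polyfun_pfP[OF q(1) U] pfun_const[OF U] in auto)
 next
  case (Suc n)
  then obtain G H where GH: "G \<in> pfP X U" "H \<in> pfP X U" "H z ~= 0"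
   "\<forall>w\<in>U \<times> affine_pts 2. H w ~= 0 --> snd w \<in> V & (\<Sum>i<n. a i (fst w) * b i (snd w)) = G w / H w" by auto
  have bn: "b n \<in> reg (affine_space 2) V" "snd z \<in> V" using ab Suc.prems z by auto
  obtain P Q where PQ: "P \<in> polyfun 2" "Q \<in> polyfun 2" "Q (snd z) ~= 0"
   "\<And>w. w \<in> V ==> Q w ~= 0 ==> b n w = P w / Q w" by (rule reg_affine_spaceE[OF bn]) (rule that)
  have an: "a n \<in> reg X U" using a Suc.prems by simp
  have m: "(%z. G z * Q (snd z) + a n (fst z) * (P (snd z) * H z)) \<in> pfP X U" "(%z. H z * Q (snd z)) \<in> pfP X U"
   by (intro pfun.add pfun.mult GH polyfun_pfP[OF PQ(1) U] polyfun_pfP[OF PQ(2) U] pfun.base[OF an])+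
  show ?case
  proof (rule bexI[OF _ m(1)], rule bexI[OF _ m(2)], intro conjI ballI impI)
   fix w assume w: "w \<in> U \<times> affine_pts 2" "H w * Q (snd w) ~= 0"
   have 1: "snd w \<in> V" "(\<Sum>i<n. a i (fst w) * b i (snd w)) = G w / H w" using GH(4) w by auto
   have 2: "b n (snd w) = P (snd w) / Q (snd w)" using PQ(4) 1 w by auto
   have "G w * Q (snd w) / (H w * Q (snd w)) = G w / H w"
    "a n (fst w) * (P (snd w) * H w) / (H w * Q (snd w)) = a n (fst w) * (P (snd w) / Q (snd w))"
    using w(2) by simp_all
   then show "(\<Sum>i<Suc n. a i (fst w) * b i (snd w)) =
     (G w * Q (snd w) + a n (fst w) * (P (snd w) * H w)) / (H w * Q (snd w))"
    using 1 2 by (simp add: add_divide_distrib)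
   show "snd w \<in> V" by (rule 1)
  qed (use GH PQ in auto)
 qed
 from this[OF order_refl] obtain G H where GH: "G \<in> pfP X U" "H \<in> pfP X U" "H z ~= 0"
   "\<forall>w\<in>U \<times> affine_pts 2. H w ~= 0 --> snd w \<in> V & (\<Sum>i<N. a i (fst w) * b i (snd w)) = G w / H w"
  by blast
 show ?thesis
  by (rule bexI[OF _ GH(1)], rule bexI[OF _ GH(2)]) (use GH h in auto)
qed

lemma const_in_reg_affine: "(%_. c) \<in> reg (affine_space n) W"
 unfolding affine_space_def fspace.select_convs mem_Collect_eq
 by (rule ballI, rule bexI[of _ "%_. c"], rule bexI[of _ "%_. 1"]) (auto intro: polyfun.const)

lemma coord_in_reg_affine: "i < n ==> (%v. v i) \<in> reg (affine_space n) W"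
 unfolding affine_space_def fspace.select_convs mem_Collect_eq
 by (rule ballI, rule bexI[of _ "%v. v i"], rule bexI[of _ "%_. 1"]) (auto intro: polyfun.intros)

lemma tensor_product: "a \<in> reg X U ==> b \<in> reg Y V ==> (%z. a (fst z) * b (snd z)) \<in> tensor_functions X Y U V"
 unfolding tensor_functions_def
 by (intro CollectI exI[of _ "1::nat"] exI[of _ "%_. a"] exI[of _ "%_. b"]) simp

lemma topspace_prod_fspace:
 assumes "space_with_functions X" shows "pts (prod_fspace X (affine_space n)) = pts X \<times> affine_pts n"
proof
 interpret fsp X by unfold_locales (rule assms)
 show "pts (prod_fspace X (affine_space n)) \<subseteq> pts X \<times> affine_pts n"
  unfolding prod_fspace_def by (auto dest!: openin_subset simp: topspace_affine_space)
 have "(%z. (%_. 1) (fst z) * (%_. 1) (snd z)) \<in> tensor_functions X (affine_space n) (pts X) (affine_pts n)"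
  by (intro tensor_product const_in_reg_affine reg_const openin_topspace)
 moreover have "openin (zar (affine_space n)) (affine_pts n)"
  using openin_topspace[of "zar (affine_space n)"] by (simp add: topspace_affine_space)
 ultimately have "{z \<in> pts X \<times> affine_pts n. (1::complex) * 1 ~= 0} \<in> {{z \<in> U \<times> V. h z ~= 0} | U V h.
   openin (zar X) U & openin (zar (affine_space n)) V & h \<in> tensor_functions X (affine_space n) U V}"
  by (intro CollectI exI[of _ "pts X"] exI[of _ "affine_pts n"] exI[of _ "%z. 1 * 1"]) auto
 then show "pts X \<times> affine_pts n \<subseteq> pts (prod_fspace X (affine_space n))"
  unfolding prod_fspace_def by (simp, blast)
qed

lemma coord_in_reg_prod:
 assumes "space_with_functions X" "i < n"
 shows "(%z. snd z i) \<in> reg (prod_fspace X (affine_space n)) (pts X \<times> affine_pts n)"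
proof -
 interpret fsp X by unfold_locales (rule assms)
 have o: "openin (zar (affine_space n)) (affine_pts n)"
  using openin_topspace[of "zar (affine_space n)"] by (simp add: topspace_affine_space)
 have t: "(%z. (%_. 1) (fst z) * (%v. v i) (snd z)) \<in> tensor_functions X (affine_space n) (pts X) (affine_pts n)"
  "(%z. (%_. 1) (fst z) * (%_. 1) (snd z)) \<in> tensor_functions X (affine_space n) (pts X) (affine_pts n)"
  by (intro tensor_product const_in_reg_affine coord_in_reg_affine assms reg_const openin_topspace)+
 show ?thesis unfolding prod_fspace_def fspace.select_convs mem_Collect_eq
 proof
  fix z assume "z \<in> pts X \<times> affine_pts n"
  then show "\<exists>U V g h. openin (zar X) U & openin (zar (affine_space n)) V & z \<in> U \<times> V &
    g \<in> tensor_functions X (affine_space n) U V & h \<in> tensor_functions X (affine_space n) U V & h z ~= 0 &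
    (\<forall>w\<in>(pts X \<times> affine_pts n) \<inter> U \<times> V. h w ~= 0 --> snd w i = g w / h w)"
   using o t by (intro exI[of _ "pts X"] exI[of _ "affine_pts n"] exI[of _ "%z. 1 * snd z i"] exI[of _ "%z. 1 * 1"]) auto
 qed
qed

text \<open>The nonvanishing loci of polynomials in the coordinates over open sets of the base are
  closed under intersection, and they refine the generators of the product topology by
  \<open>tensor_quotient\<close>.\<close>

lemma (in fsp) openin_prod_quotient:
 assumes U0: "openin (zar X) U0"
  and O': "openin (zar (prod_fspace (sub_fspace X U0) (affine_space 2))) O'" and z: "z \<in> O'"
 shows "\<exists>U H. openin (zar X) U & U \<subseteq> U0 & fst z \<in> U & H \<in> pfP X U & H z ~= 0 &
  (\<forall>w\<in>U \<times> affine_pts 2. H w ~= 0 --> w \<in> O')"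
proof -
 have "generate_topology_on {{z \<in> U \<times> V. h z ~= 0} | U V h. openin (zar (sub_fspace X U0)) U &
   openin (zar (affine_space 2)) V & h \<in> tensor_functions (sub_fspace X U0) (affine_space 2) U V} O'"
  using O' by (simp add: prod_fspace_def openin_topology_generated_by_iff)
 then show ?thesis using z
 proof (induction arbitrary: z rule: generate_topology_on.induct)
  case (Int a b)
  have za: "z \<in> a" "z \<in> b" using Int.prems by auto
  from Int.IH(1)[OF za(1)] obtain U H where 1: "openin (zar X) U" "U \<subseteq> U0" "fst z \<in> U" "H \<in> pfP X U" "H z ~= 0"
   "\<forall>w\<in>U \<times> affine_pts 2. H w ~= 0 --> w \<in> a" by (elim exE conjE)
  from Int.IH(2)[OF za(2)] obtain U' H' where 2: "openin (zar X) U'" "U' \<subseteq> U0" "fst z \<in> U'" "H' \<in> pfP X U'" "H' z ~= 0"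
   "\<forall>w\<in>U' \<times> affine_pts 2. H' w ~= 0 --> w \<in> b" by (elim exE conjE)
  have o: "openin (zar X) (U \<inter> U')" using 1 2 by blast
  have "H \<in> pfP X (U \<inter> U')" "H' \<in> pfP X (U \<inter> U')"
   using pfun_mono[OF 1(4,1) o] pfun_mono[OF 2(4,1) o] by auto
  then show ?case using 1 2 o
   by (intro exI[of _ "U \<inter> U'"] exI[of _ "%z. H z * H' z"]) (auto intro: pfun.mult)
 next
  case (UN K)
  then obtain k where k: "k \<in> K" "z \<in> k" by blast
  from UN.IH[OF k] obtain U H where "openin (zar X) U" "U \<subseteq> U0" "fst z \<in> U" "H \<in> pfP X U" "H z ~= 0"
   "\<forall>w\<in>U \<times> affine_pts 2. H w ~= 0 --> w \<in> k" by (elim exE conjE)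
  then show ?case using k by (intro exI[of _ U] exI[of _ H]) auto
 next
  case (Basis s)
  then obtain U V h where s: "s = {z \<in> U \<times> V. h z ~= 0}" "openin (zar (sub_fspace X U0)) U"
   "openin (zar (affine_space 2)) V" "h \<in> tensor_functions (sub_fspace X U0) (affine_space 2) U V" by blast
  have U: "openin (zar X) U" "U \<subseteq> U0" using s(2) openin_sub_fspace[OF U0] by auto
  have z: "z \<in> U \<times> V" "h z ~= 0" using Basis s(1) by auto
  from tensor_quotient[OF U(1) s(3,4) U0 U(2) z(1)] obtain G H where GH: "G \<in> pfP X U" "H \<in> pfP X U" "H z ~= 0"
   "\<forall>w\<in>U \<times> affine_pts 2. H w ~= 0 --> w \<in> U \<times> V & h w = G w / H w" by (elim bexE conjE) (rule that)
  have zA: "z \<in> U \<times> affine_pts 2" using z openin_subset[OF s(3)] by (auto simp: topspace_affine_space)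
  have "G z ~= 0" using GH(3,4) z(2) zA by auto
  then show ?case using U GH s(1) z
   by (intro exI[of _ U] exI[of _ "%z. G z * H z"]) (auto intro: pfun.mult)
 qed simp
qed

theorem frame_exists:
 assumes C: "space_with_functions C" and E: "vector_bundle C 2 E" and p: "p \<in> pts C"
 shows "\<exists>U X Y. p \<in> U & frame C E U X Y"
proof -
 interpret fsp C by unfold_locales (rule C)
 define T where "T = total E"
 have swfT: "space_with_functions T" using E by (simp add: vector_bundle_def T_def)
 interpret T: fsp T by unfold_locales (rule swfT)
 have mor: "morphism T C (bproj E)" using E by (simp add: vector_bundle_def T_def)
 from E p obtain U \<psi> where U: "openin (zar C) U" "p \<in> U"
  and iso': "isomorphism (sub_fspace (total E) {e \<in> pts (total E). bproj E e \<in> U}) (prod_fspace (sub_fspace C U) (affine_space 2)) \<psi>"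
  and fst\<psi>': "\<forall>e\<in>pts (total E). bproj E e \<in> U --> fst (\<psi> e) = bproj E e"
  and add': "\<forall>e\<in>pts (total E). \<forall>e'\<in>pts (total E). bproj E e \<in> U & bproj E e' = bproj E e -->
     badd E e e' \<in> pts (total E) & bproj E (badd E e e') = bproj E e &
     snd (\<psi> (badd E e e')) = (%i. snd (\<psi> e) i + snd (\<psi> e') i)"
  and scale': "\<forall>e\<in>pts (total E). \<forall>c. bproj E e \<in> U -->
     bscale E c e \<in> pts (total E) & bproj E (bscale E c e) = bproj E e &
     snd (\<psi> (bscale E c e)) = (%i. c * snd (\<psi> e) i)"
  unfolding vector_bundle_def by (elim conjE) (drule bspec, assumption, elim exE conjE, rule that)
 note iso = iso'[folded T_def] and fst\<psi> = fst\<psi>'[folded T_def] and add = add'[folded T_def] and scale = scale'[folded T_def]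
 define EU where "EU = {e \<in> pts T. bproj E e \<in> U}"
 have EUfib: "fib E U = EU" by (simp add: fib_def EU_def T_def)
 have oEU: "openin (zar T) EU" using mor U by (auto simp: morphism_def continuous_map_def EU_def)
 let ?P = "prod_fspace (sub_fspace C U) (affine_space 2)"
 have swfU: "space_with_functions (sub_fspace C U)" by (rule swf_sub_fspace[OF U(1)])
 have ptsCU: "pts (sub_fspace C U) = U" using openin_subset[OF U(1)] by (auto simp: sub_fspace_def)
 have ptsP: "pts ?P = U \<times> affine_pts 2" using topspace_prod_fspace[OF swfU] ptsCU by simp
 have ptsEU: "pts (sub_fspace T EU) = EU" using openin_subset[OF oEU] by (auto simp: sub_fspace_def)
 obtain kk where m\<psi>: "morphism (sub_fspace T EU) ?P \<psi>" and mkk: "morphism ?P (sub_fspace T EU) kk"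
  and inv: "\<And>e. e \<in> EU ==> kk (\<psi> e) = e" "\<And>z. z \<in> pts ?P ==> \<psi> (kk z) = z"
  using iso unfolding isomorphism_def EU_def[symmetric] ptsEU by blast
 have \<psi>P: "\<psi> e \<in> U \<times> affine_pts 2" if "e \<in> EU" for e
  using m\<psi> that ptsP ptsEU by (auto simp: morphism_def continuous_map_def)
 have kkE: "kk z \<in> EU" if "z \<in> U \<times> affine_pts 2" for z
  using mkk that ptsP ptsEU by (auto simp: morphism_def continuous_map_def)
 have fst': "fst (\<psi> e) = bproj E e" if "e \<in> EU" for e using fst\<psi> that by (auto simp: EU_def)
 define X where "X = (%e. snd (\<psi> e) 0)"
 define Y where "Y = (%e. snd (\<psi> e) 1)"
 have coord_regat: "regat T e (%e. snd (\<psi> e) i)" if e: "e \<in> EU" and i: "i < 2" for e i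
 proof -
  have "(%z. snd z i) \<in> reg ?P (pts ?P)" using coord_in_reg_prod[OF swfU i] ptsP ptsCU by simp
  then have "(%z. snd z i) \<circ> \<psi> \<in> reg (sub_fspace T EU) {e \<in> pts (sub_fspace T EU). \<psi> e \<in> pts ?P}"
   using m\<psi> unfolding morphism_def by (elim conjE allE[of _ "pts ?P"] allE[of _ "%z. snd z i"]) simp
  moreover have "{e \<in> pts (sub_fspace T EU). \<psi> e \<in> pts ?P} = EU" using \<psi>P ptsP ptsEU by auto
  ultimately have "(%e. snd (\<psi> e) i) \<in> reg T EU" using T.regat_sub_fspace[OF oEU oEU] by (simp add: comp_def)
  then show ?thesis by (rule T.regatI[OF oEU e])
 qed
 have "frame C E U X Y"
 proof
  show "openin (zar C) U" by (rule U)
  show "regat (total E) e X" "regat (total E) e Y" if "e \<in> fib E U" for e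
   using coord_regat that unfolding X_def Y_def EUfib T_def by auto
  show "\<exists>e\<in>pts (total E). bproj E e = q & X e = a & Y e = b" if q: "q \<in> U" for q a b
  proof -
   define v :: "nat => complex" where "v = (%i. if i = 0 then a else if i = 1 then b else 0)"
   have v: "(q, v) \<in> U \<times> affine_pts 2" using q by (auto simp: affine_pts_def v_def)
   have "\<psi> (kk (q, v)) = (q, v)" using inv(2) v ptsP by simp
   then show ?thesis using kkE[OF v] fst'[OF kkE[OF v]]
    by (intro bexI[of _ "kk (q, v)"]) (auto simp: X_def Y_def v_def EU_def T_def)
  qed
  show "e = e'" if e: "e \<in> fib E U" "e' \<in> fib E U" "bproj E e = bproj E e'" "X e = X e'" "Y e = Y e'" for e e'
  proof -
   have e2: "e \<in> EU" "e' \<in> EU" using e EUfib by auto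
   have "snd (\<psi> e) = snd (\<psi> e')"
   proof
    fix i show "snd (\<psi> e) i = snd (\<psi> e') i"
     using \<psi>P[OF e2(1)] \<psi>P[OF e2(2)] e(4,5)
     by (cases "i \<ge> 2") (auto simp: X_def Y_def affine_pts_def not_le numeral_2_eq_2 less_Suc_eq)
   qed
   then have "\<psi> e = \<psi> e'" using fst' e2 e(3) by (simp add: prod_eq_iff)
   then show ?thesis using inv(1) e2 by metis
  qed
  show "badd E e e' \<in> pts (total E) & bproj E (badd E e e') = bproj E e &
   X (badd E e e') = X e + X e' & Y (badd E e e') = Y e + Y e'"
   if "e \<in> fib E U" "e' \<in> fib E U" "bproj E e = bproj E e'" for e e'
   using add that by (auto simp: fib_def T_def X_def Y_def)
  show "bscale E c e \<in> pts (total E) & bproj E (bscale E c e) = bproj E e &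
   X (bscale E c e) = c * X e & Y (bscale E c e) = c * Y e" if "e \<in> fib E U" for c e
   using scale that by (auto simp: fib_def T_def X_def Y_def)
  have transfer: "\<exists>G'\<in>pfun C (bproj E) {X, Y} U'. \<forall>e\<in>EU. G' e = G (\<psi> e)" if "G \<in> pfP C U'" for G U'
   using that
  proof (induction rule: pfun.induct)
   case (base a)
   then show ?case by (intro bexI[OF _ pfun.base[of a]]) (auto simp: fst')
  next
   case (gen x)
   then have "(%e. x (\<psi> e)) \<in> {X, Y}" by (auto simp: X_def Y_def coordP_def)
   then show ?case by (intro bexI[OF _ pfun.gen[of "%e. x (\<psi> e)"]]) auto
  next
   case (add f g)
   then obtain f' g' where "f' \<in> pfun C (bproj E) {X, Y} U'" "\<forall>e\<in>EU. f' e = f (\<psi> e)"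
    "g' \<in> pfun C (bproj E) {X, Y} U'" "\<forall>e\<in>EU. g' e = g (\<psi> e)" by blast
   then show ?case by (intro bexI[OF _ pfun.add[of f' _ _ _ _ g']]) auto
  next
   case (mult f g)
   then obtain f' g' where "f' \<in> pfun C (bproj E) {X, Y} U'" "\<forall>e\<in>EU. f' e = f (\<psi> e)"
    "g' \<in> pfun C (bproj E) {X, Y} U'" "\<forall>e\<in>EU. g' e = g (\<psi> e)" by blast
   then show ?case by (intro bexI[OF _ pfun.mult[of f' _ _ _ _ g']]) auto
  qed
  fix W f e assume W: "openin (zar (total E)) W" "f \<in> reg (total E) W" "e \<in> W" and eU: "e \<in> fib E U"
  have e: "e \<in> EU" using eU EUfib by simp
  define O' where "O' = {z \<in> pts ?P. kk z \<in> W \<inter> EU}"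
  have oWE: "openin (zar (sub_fspace T EU)) (W \<inter> EU)" using W(1) oEU T.openin_sub_fspace[OF oEU] by (auto simp: T_def)
  then have oO: "openin (zar ?P) O'" using mkk by (auto simp: morphism_def continuous_map_def O'_def)
  have "f \<in> reg T (W \<inter> EU)" using T.reg_restrict[of f W "W \<inter> EU"] W oEU by (auto simp: T_def)
  then have "f \<in> reg (sub_fspace T EU) (W \<inter> EU)" using T.regat_sub_fspace[OF oEU, of "W \<inter> EU"] W oEU by (auto simp: T_def)
  then have fkk: "f \<circ> kk \<in> reg ?P O'" using mkk oWE
   unfolding morphism_def O'_def by (elim conjE allE[of _ "W \<inter> EU"] allE[of _ f]) simp
  let ?z = "\<psi> e"
  have zP: "?z \<in> pts ?P" using \<psi>P[OF e] ptsP by simp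
  have zO: "?z \<in> O'" using zP inv(1)[OF e] W(3) e by (simp add: O'_def)
  have "\<forall>z\<in>O'. \<exists>U1 V1 g h. openin (zar (sub_fspace C U)) U1 & openin (zar (affine_space 2)) V1 &
   z \<in> U1 \<times> V1 & g \<in> tensor_functions (sub_fspace C U) (affine_space 2) U1 V1 &
   h \<in> tensor_functions (sub_fspace C U) (affine_space 2) U1 V1 & h z ~= 0 &
   (\<forall>w\<in>O' \<inter> U1 \<times> V1. h w ~= 0 --> (f \<circ> kk) w = g w / h w)"
   using fkk by (simp only: prod_fspace_def fspace.select_convs mem_Collect_eq)
  from bspec[OF this zO] obtain U1 V1 g h where U1: "openin (zar (sub_fspace C U)) U1" "openin (zar (affine_space 2)) V1"
   "?z \<in> U1 \<times> V1" "g \<in> tensor_functions (sub_fspace C U) (affine_space 2) U1 V1"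
   "h \<in> tensor_functions (sub_fspace C U) (affine_space 2) U1 V1" "h ?z ~= 0"
   "\<forall>w\<in>O' \<inter> U1 \<times> V1. h w ~= 0 --> (f \<circ> kk) w = g w / h w"
   by (elim exE conjE) (rule that)
  have oU1: "openin (zar C) U1" "U1 \<subseteq> U" using U1(1) openin_sub_fspace[OF U(1)] by auto
  from tensor_quotient[OF oU1(1) U1(2,4) U(1) oU1(2) U1(3)] obtain G1 H1 where 1: "G1 \<in> pfP C U1" "H1 \<in> pfP C U1"
   "H1 ?z ~= 0" "\<forall>w\<in>U1 \<times> affine_pts 2. H1 w ~= 0 --> w \<in> U1 \<times> V1 & g w = G1 w / H1 w" by (elim bexE conjE) (rule that)
  from tensor_quotient[OF oU1(1) U1(2,5) U(1) oU1(2) U1(3)] obtain G2 H2 where 2: "G2 \<in> pfP C U1" "H2 \<in> pfP C U1"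
   "H2 ?z ~= 0" "\<forall>w\<in>U1 \<times> affine_pts 2. H2 w ~= 0 --> w \<in> U1 \<times> V1 & h w = G2 w / H2 w" by (elim bexE conjE) (rule that)
  from openin_prod_quotient[OF U(1) oO zO] obtain U3 H3 where 3: "openin (zar C) U3" "U3 \<subseteq> U" "fst ?z \<in> U3"
   "H3 \<in> pfP C U3" "H3 ?z ~= 0" "\<forall>w\<in>U3 \<times> affine_pts 2. H3 w ~= 0 --> w \<in> O'" by (elim exE conjE)
  define U' where "U' = U1 \<inter> U3"
  have oU': "openin (zar C) U'" "U' \<subseteq> U" "U' \<subseteq> U1" "U' \<subseteq> U3" using oU1 3 by (auto simp: U'_def)
  note mono1 = pfun_mono[OF _ oU1(1) oU'(1,3)] and mono3 = pfun_mono[OF _ 3(1) oU'(1,4)]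
  \<comment> \<open>Clearing denominators in (G1 / H1) / (G2 / H2). The extra common factors
    \<open>H2\<close> and \<open>H3\<close> make their nonvanishing follow from that of the final
    denominator.\<close>
  have "(%z. G1 z * (H2 z * (H2 z * H3 z))) \<in> pfP C U'" by (intro pfun.mult mono1 mono3 1 2 3)
  from transfer[OF this] obtain G where G: "G \<in> pfun C (bproj E) {X, Y} U'"
   "\<forall>e\<in>EU. G e = G1 (\<psi> e) * (H2 (\<psi> e) * (H2 (\<psi> e) * H3 (\<psi> e)))" by blast
  have "(%z. H1 z * (G2 z * (H2 z * H3 z))) \<in> pfP C U'" by (intro pfun.mult mono1 mono3 1 2 3)
  from transfer[OF this] obtain H where H: "H \<in> pfun C (bproj E) {X, Y} U'"
   "\<forall>e\<in>EU. H e = H1 (\<psi> e) * (G2 (\<psi> e) * (H2 (\<psi> e) * H3 (\<psi> e)))" by blast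
  have "G2 ?z ~= 0" using 2(3,4) U1(3,6) \<psi>P[OF e] by auto
  then have "H e ~= 0" using H(2) e 1(3) 2(3) 3(5) by simp
  moreover have "bproj E e \<in> U'" using fst'[OF e] U1(3) 3(3) by (auto simp: U'_def)
  moreover have "e' \<in> W & f e' = G e' / H e'" if e': "e' \<in> fib E U'" "H e' ~= 0" for e'
  proof -
   have e2: "e' \<in> EU" using e' oU'(2) by (auto simp: EU_def fib_def T_def)
   have nz: "H1 (\<psi> e') ~= 0" "G2 (\<psi> e') ~= 0" "H2 (\<psi> e') ~= 0" "H3 (\<psi> e') ~= 0" using H(2) e2 e'(2) by auto
   have "fst (\<psi> e') \<in> U'" using fst'[OF e2] e' by (simp add: fib_def)
   then have w: "\<psi> e' \<in> U1 \<times> affine_pts 2" "\<psi> e' \<in> U3 \<times> affine_pts 2" using \<psi>P[OF e2] oU' by (auto simp: mem_Times_iff)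
   have wO: "\<psi> e' \<in> O'" using bspec[OF 3(6) w(2)] nz by simp
   have wU: "\<psi> e' \<in> U1 \<times> V1" and g: "g (\<psi> e') = G1 (\<psi> e') / H1 (\<psi> e')" and h: "h (\<psi> e') = G2 (\<psi> e') / H2 (\<psi> e')"
    using bspec[OF 1(4) w(1)] bspec[OF 2(4) w(1)] nz by simp_all
   have "h (\<psi> e') ~= 0" using h nz by simp
   then have "f (kk (\<psi> e')) = g (\<psi> e') / h (\<psi> e')" using bspec[OF U1(7) IntI[OF wO wU]] by simp
   then have "f e' = (G1 (\<psi> e') / H1 (\<psi> e')) / (G2 (\<psi> e') / H2 (\<psi> e'))" using inv(1)[OF e2] g h by simp
   moreover have "e' \<in> W" using wO inv(1)[OF e2] by (auto simp: O'_def)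
   ultimately show ?thesis using G(2) H(2) e2 nz by (simp add: field_simps)
  qed
  ultimately show "\<exists>U' G H. openin (zar C) U' & U' \<subseteq> U & bproj E e \<in> U' & G \<in> pfun C (bproj E) {X, Y} U' &
    H \<in> pfun C (bproj E) {X, Y} U' & H e ~= 0 & (\<forall>e'\<in>fib E U'. H e' ~= 0 --> e' \<in> W & f e' = G e' / H e')"
   using oU' G H by (intro exI[of _ U'] exI[of _ G] exI[of _ H]) auto
 qed
 then show ?thesis using U by blast
qed

section \<open>Rational functions without poles on the affine and the projective line\<close>

lemma poly_eq_cofinite:
 fixes p q :: "complex poly"
 assumes "finite {x. poly p x ~= poly q x}" shows "p = q"
proof (rule ccontr)
 assume "p ~= q"
 then have "finite {x. poly (p - q) x = 0}" by (intro poly_roots_finite) simp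
 then have "finite ({x. poly p x ~= poly q x} \<union> {x. poly (p - q) x = 0})" using assms by simp
 moreover have "{x. poly p x ~= poly q x} \<union> {x. poly (p - q) x = 0} = UNIV" by auto
 ultimately show False using infinite_UNIV_char_0 by metis
qed

text \<open>Take a denominator of least degree. At a root of it another representation has nonzero
  denominator, and cross multiplication shows that the numerator vanishes too, so a linear factor
  cancels. Hence there is no root and the denominator is constant.\<close>

lemma locally_rational_imp_poly:
 fixes F :: "complex => complex"
 assumes loc: "\<And>c0. \<exists>P Q. poly Q c0 ~= 0 & (\<forall>c. poly Q c ~= 0 --> F c = poly P c / poly Q c)"
 shows "\<exists>P. \<forall>c. F c = poly P c"
proof -
 define good where "good = (%P Q. Q ~= 0 & (\<forall>c. poly Q c ~= 0 --> F c = poly P c / poly Q c))"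
 define deg where "deg = (%n. \<exists>P Q. good P Q & degree Q = n)"
 obtain P0 Q0 where "poly Q0 0 ~= 0" "\<forall>c. poly Q0 c ~= 0 --> F c = poly P0 c / poly Q0 c" using loc[of 0] by (elim exE conjE)
 then have "good P0 Q0" by (auto simp: good_def)
 then have "deg (degree Q0)" by (auto simp: deg_def)
 then have "deg (Least deg)" by (rule LeastI)
 then obtain P Q where PQ: "good P Q" and dQ: "degree Q = Least deg" by (auto simp: deg_def)
 have min: "degree Q \<le> degree Q'" if "good P' Q'" for P' Q'
  unfolding dQ by (rule Least_le) (use that in \<open>auto simp: deg_def\<close>)
 have nz: "Q ~= 0" and FP: "\<And>c. poly Q c ~= 0 ==> F c = poly P c / poly Q c" using PQ by (auto simp: good_def)
 have cross: "P * Q2 = P2 * Q" if "Q2 ~= 0" "\<And>c. poly Q2 c ~= 0 ==> F c = poly P2 c / poly Q2 c" for P2 Q2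
 proof (rule poly_eq_cofinite, rule finite_subset)
  show "{x. poly (P * Q2) x ~= poly (P2 * Q) x} \<subseteq> {x. poly (Q * Q2) x = 0}"
  proof (rule subsetI, rule CollectI, rule ccontr)
   fix x assume x: "x \<in> {x. poly (P * Q2) x ~= poly (P2 * Q) x}" "poly (Q * Q2) x ~= 0"
   then have "poly P x / poly Q x = poly P2 x / poly Q2 x" using FP[of x] that(2)[of x] by simp
   then show False using x by (simp add: field_simps)
  qed
  show "finite {x. poly (Q * Q2) x = 0}" using nz that(1) by (intro poly_roots_finite) simp
 qed
 have noroot: "poly Q r ~= 0" for r
 proof
  assume r: "poly Q r = 0"
  obtain P2 Q2 where 2: "poly Q2 r ~= 0" "\<And>c. poly Q2 c ~= 0 ==> F c = poly P2 c / poly Q2 c"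
   using loc[of r] by blast
  have Q2: "Q2 ~= 0" using 2(1) by auto
  have eq: "P * Q2 = P2 * Q" by (rule cross[OF Q2 2(2)])
  then have "poly P r * poly Q2 r = poly P2 r * poly Q r" by (metis poly_mult)
  then have "poly P r = 0" using r 2(1) by simp
  then obtain P' where P': "P = [:-r, 1:] * P'" by (auto simp: poly_eq_0_iff_dvd)
  obtain Q' where Q': "Q = [:-r, 1:] * Q'" using r by (auto simp: poly_eq_0_iff_dvd)
  have Q'0: "Q' ~= 0" using nz Q' by auto
  have "[:-r, 1:] * (P' * Q2) = [:-r, 1:] * (P2 * Q')" using eq P' Q' by (simp only: ac_simps)
  then have eq': "P' * Q2 = P2 * Q'" by (simp only: mult_cancel_left pCons_eq_0_iff) simp
  have "F c = poly P' c / poly Q' c" if c: "poly Q' c ~= 0" for c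
  proof (cases "c = r")
   case False
   have e: "poly P c = (c - r) * poly P' c" "poly Q c = (c - r) * poly Q' c"
    unfolding P' Q' by (simp_all add: algebra_simps)
   then show ?thesis using FP[of c] c False by simp
  next
   case True
   have "poly P' r * poly Q2 r = poly P2 r * poly Q' r" using eq' by (metis poly_mult)
   then have "poly P2 r / poly Q2 r = poly P' r / poly Q' r" using 2(1) True c by (simp add: frac_eq_eq)
   then show ?thesis using 2(2)[OF 2(1)] True by simp
  qed
  then have "good P' Q'" using Q'0 by (simp add: good_def)
  then have "degree Q \<le> degree Q'" by (rule min)
  moreover have "degree Q = Suc (degree Q')" using Q'0 unfolding Q' by (subst degree_mult_eq) auto
  ultimately show False by simp
 qed
 then have "constant (poly Q)" using fundamental_theorem_of_algebra by blast
 then have "poly Q c = poly Q 0" for c by (simp add: constant_def)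
 then have "F c = poly (smult (1 / poly Q 0) P) c" for c using FP[OF noroot, of c] by simp
 then show ?thesis by blast
qed

text \<open>Multiplying by the power of c that clears Q(1/c) bounds the degree of \<open>P\<close>
  by one, and \<open>Q\<close> is then the reversed polynomial. This describes the sections of O(1)
  on a projective line by its two affine charts.\<close>

lemma linear_of_reciprocal:
 fixes P Q :: "complex poly"
 assumes "\<And>c. c ~= 0 ==> poly P c = c * poly Q (1 / c)"
 shows "poly P c = poly P 0 + poly Q 0 * c"
proof -
 have "monom 1 (degree Q) * P = monom 1 1 * reflect_poly Q"
 proof (rule poly_eq_cofinite, rule finite_subset[of _ "{0}"])
  show "{x. poly (monom 1 (degree Q) * P) x ~= poly (monom 1 1 * reflect_poly Q) x} \<subseteq> {0}"
  proof (rule subsetI, rule ccontr)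
   fix x assume x: "x \<in> {x. poly (monom 1 (degree Q) * P) x ~= poly (monom 1 1 * reflect_poly Q) x}" "x \<notin> {0}"
   then have "poly (monom 1 (degree Q) * P) x = poly (monom 1 1 * reflect_poly Q) x"
    using assms[of x] poly_reflect_poly_nz[of x Q] by (simp add: poly_monom inverse_eq_divide)
   then show False using x by simp
  qed
 qed simp
 then have e: "degree (monom 1 (degree Q) * P) = degree (monom 1 1 * reflect_poly Q)" by simp
 have d: "degree P \<le> 1"
 proof (cases "P = 0")
  case False
  have "degree Q + degree P = degree (monom 1 (degree Q) * P)"
   using False by (subst degree_mult_eq) (auto simp: degree_monom_eq monom_eq_0_iff)
  also have "\<dots> \<le> degree (monom (1::complex) 1) + degree (reflect_poly Q)" unfolding e by (rule degree_mult_le)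
  also have "\<dots> \<le> 1 + degree Q" by (intro add_mono degree_reflect_poly_le degree_monom_le)
  finally show ?thesis by simp
 qed simp
 define a where "a = coeff P 0"
 define b where "b = coeff P 1"
 have "P = [:a, b:]"
 proof (rule poly_eqI)
  fix n show "coeff P n = coeff [:a, b:] n"
  proof (cases "n \<le> 1")
   case True then show ?thesis by (cases n) (auto simp: a_def b_def)
  next
   case False then show ?thesis using d by (simp add: coeff_eq_0 coeff_pCons split: nat.split)
  qed
 qed
 then have P: "poly P c = a + b * c" for c by simp
 have "poly Q x = poly [:b, a:] x" if "x ~= 0" for x
 proof -
  have "a + b * (1 / x) = (1 / x) * poly Q x" using assms[of "1 / x"] that P by simp
  then show ?thesis using that by (simp add: field_simps)
 qed
 then have "{x. poly Q x ~= poly [:b, a:] x} \<subseteq> {0}" by auto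
 then have "finite {x. poly Q x ~= poly [:b, a:] x}" by (rule finite_subset) simp
 then have "Q = [:b, a:]" by (rule poly_eq_cofinite)
 then show ?thesis using P by simp
qed

section \<open>Affine line charts on a surface over a curve\<close>

text \<open>An open part \<open>V\<close> of a surface that is the product of \<open>U\<close> with
  an affine line with coordinate \<open>u\<close>, encoded as for frames by points, coordinates and
  local quotients of polynomials in \<open>u\<close>.\<close>

locale schart = C: fsp C + S: fsp S for C :: "'c fspace" and S :: "'s fspace" +
 fixes \<pi> :: "'s => 'c" and U :: "'c set" and V :: "'s set" and u :: "'s => complex"
 assumes openU: "openin (zar C) U" and openV: "openin (zar S) V"
  and piV: "y \<in> V ==> \<pi> y \<in> U"
  and u_regat: "y \<in> V ==> regat S y u"
  and pi_regat: "y \<in> V ==> regat C (\<pi> y) a ==> regat S y (%y. a (\<pi> y))"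
  and pi_open: "openin (zar C) U' ==> openin (zar S) {y \<in> V. \<pi> y \<in> U'}"
  and pt_exists: "q \<in> U ==> \<exists>y\<in>V. \<pi> y = q & u y = c"
  and pt_unique: "y \<in> V ==> y' \<in> V ==> \<pi> y = \<pi> y' ==> u y = u y' ==> y = y'"
  and local_quotient: "openin (zar S) W ==> f \<in> reg S W ==> y \<in> W ==> y \<in> V ==>
   \<exists>U' G H. openin (zar C) U' & U' \<subseteq> U & \<pi> y \<in> U' & G \<in> pfun C \<pi> {u} U' &
    H \<in> pfun C \<pi> {u} U' & H y ~= 0 &
    (\<forall>y'\<in>V. \<pi> y' \<in> U' & H y' ~= 0 --> y' \<in> W & f y' = G y' / H y')"
begin

definition pt :: "'c => complex => 's" where
 "pt q c = (SOME y. y \<in> V & \<pi> y = q & u y = c)"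

lemma pt: assumes "q \<in> U" shows "pt q c \<in> V" "\<pi> (pt q c) = q" "u (pt q c) = c"
proof -
 have "\<exists>y. y \<in> V & \<pi> y = q & u y = c" using pt_exists[OF assms] by blast
 then have "pt q c \<in> V & \<pi> (pt q c) = q & u (pt q c) = c" unfolding pt_def by (rule someI_ex)
 then show "pt q c \<in> V" "\<pi> (pt q c) = q" "u (pt q c) = c" by auto
qed

lemma pt_eq: "y \<in> V ==> pt (\<pi> y) (u y) = y"
 using pt[OF piV] by (intro pt_unique) auto

lemma ptsU: "q \<in> U ==> q \<in> pts C"
 using openin_subset[OF openU] by blast

lemma ptsV: "y \<in> V ==> y \<in> pts S"
 using openin_subset[OF openV] by blast

lemma eventually_pi:
 assumes "y \<in> V" "eventually P (nhd C (\<pi> y))" shows "\<forall>\<^sub>F y' in nhd S y. P (\<pi> y')"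
proof -
 obtain U' where U': "openin (zar C) U'" "\<pi> y \<in> U'" "\<And>q. q \<in> U' ==> P q"
  using eventually_nhdE[OF assms(2) ptsU[OF piV[OF assms(1)]]] by auto
 show ?thesis by (rule eventually_nhdI[OF pi_open[OF U'(1)]]) (use U' assms(1) in auto)
qed

lemma eventually_V: "y \<in> V ==> \<forall>\<^sub>F y' in nhd S y. y' \<in> V"
 by (rule eventually_nhdI[OF openV])

lemma pfun_regat:
 assumes "G \<in> pfun C \<pi> {u} U'" "openin (zar C) U'" "y \<in> V" "\<pi> y \<in> U'"
 shows "regat S y G"
 using assms by (induction rule: pfun.induct)
  (auto intro: pi_regat u_regat S.regat_add S.regat_mult C.regatI)

lemma pfun_section:
 assumes G: "G \<in> pfun C \<pi> {u} U'" and U': "openin (zar C) U'" "U' \<subseteq> U" "q \<in> U'" and c: "regat C q c"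
 shows "regat C q (%q'. G (pt q' (c q')))"
 using G
proof (induction rule: pfun.induct)
 have ev: "\<forall>\<^sub>F q' in nhd C q. q' \<in> U" by (rule eventually_nhdI[OF U'(1,3)]) (use U' in auto)
 { case (base a)
  have "\<forall>\<^sub>F q' in nhd C q. a (\<pi> (pt q' (c q'))) = a q'" using ev by eventually_elim (simp add: pt)
  from C.regat_cong[OF C.regatI[OF U'(1,3) base] this] show ?case . }
 { case (gen x)
  have "\<forall>\<^sub>F q' in nhd C q. x (pt q' (c q')) = c q'" using ev by eventually_elim (use gen in \<open>simp add: pt\<close>)
  from C.regat_cong[OF c this] show ?case . }
qed (auto intro: C.regat_add C.regat_mult)

lemma section_eventually:
 assumes q: "q \<in> U" and c: "regat C q c" and P: "eventually P (nhd S (pt q (c q)))"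
 shows "\<forall>\<^sub>F q' in nhd C q. P (pt q' (c q'))"
proof -
 let ?y = "pt q (c q)"
 obtain W where W: "openin (zar S) W" "?y \<in> W" "\<And>y. y \<in> W ==> P y"
  using eventually_nhdE[OF P ptsV[OF pt(1)[OF q]]] by auto
 \<comment> \<open>Representing the function 0 on \<open>W\<close> as a quotient is a device: its
   denominator \<open>H\<close> cuts out a neighbourhood inside \<open>W\<close>.\<close>
 from local_quotient[OF W(1) S.reg_const[OF W(1), of 0] W(2) pt(1)[OF q]] obtain U' G H where
  U': "openin (zar C) U'" "U' \<subseteq> U" "\<pi> ?y \<in> U'" "H \<in> pfun C \<pi> {u} U'" "H ?y ~= 0"
  "\<forall>y'\<in>V. \<pi> y' \<in> U' & H y' ~= 0 --> y' \<in> W & 0 = G y' / H y'" by (elim exE conjE) (rule that)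
 have qU': "q \<in> U'" using U'(3) pt[OF q] by simp
 have "\<forall>\<^sub>F q' in nhd C q. H (pt q' (c q')) ~= 0"
  by (rule C.regat_nz[OF pfun_section[OF U'(4,1,2) qU' c]]) (rule U'(5))
 moreover have "\<forall>\<^sub>F q' in nhd C q. q' \<in> U'" by (rule eventually_nhdI[OF U'(1) qU'])
 ultimately show ?thesis
 proof eventually_elim
  case (elim q')
  then have "q' \<in> U" using U'(2) by auto
  then have "pt q' (c q') \<in> W" using U'(6) pt[of q' "c q'"] elim by simp
  then show ?case by (rule W(3))
 qed
qed

lemma section_regat:
 assumes q: "q \<in> U" and c: "regat C q c" and f: "regat S (pt q (c q)) f"
 shows "regat C q (%q'. f (pt q' (c q')))"
proof -
 let ?y = "pt q (c q)"
 obtain W where W: "openin (zar S) W" "?y \<in> W" "f \<in> reg S W" using f by (auto simp: regat_def)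
 from local_quotient[OF W(1,3,2) pt(1)[OF q]] obtain U' G H where
  U': "openin (zar C) U'" "U' \<subseteq> U" "\<pi> ?y \<in> U'" "G \<in> pfun C \<pi> {u} U'" "H \<in> pfun C \<pi> {u} U'" "H ?y ~= 0"
  "\<forall>y'\<in>V. \<pi> y' \<in> U' & H y' ~= 0 --> y' \<in> W & f y' = G y' / H y'" by (elim exE conjE) (rule that)
 have qU': "q \<in> U'" using U'(3) pt[OF q] by simp
 have rH: "regat C q (%q'. H (pt q' (c q')))" by (rule pfun_section[OF U'(5,1,2) qU' c])
 have rG: "regat C q (%q'. G (pt q' (c q')))" by (rule pfun_section[OF U'(4,1,2) qU' c])
 have "\<forall>\<^sub>F q' in nhd C q. H (pt q' (c q')) ~= 0" by (rule C.regat_nz[OF rH]) (rule U'(6))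
 moreover have "\<forall>\<^sub>F q' in nhd C q. q' \<in> U'" by (rule eventually_nhdI[OF U'(1) qU'])
 ultimately have "\<forall>\<^sub>F q' in nhd C q. f (pt q' (c q')) = G (pt q' (c q')) / H (pt q' (c q'))"
 proof eventually_elim
  case (elim q')
  then have "q' \<in> U" using U'(2) by auto
  then show ?case using U'(7) pt[of q' "c q'"] elim by simp
 qed
 from C.regat_cong[OF C.regat_divide[OF rG rH] this] show ?thesis using U'(6) by simp
qed

lemma pfun_fibre:
 assumes "G \<in> pfun C \<pi> {u} U'" "q \<in> U"
 shows "\<exists>P. \<forall>c. G (pt q c) = poly P c"
 using assms(1)
proof (induction rule: pfun.induct)
 case (base a)
 show ?case using pt[OF assms(2)] by (intro exI[of _ "[:a q:]"]) simp
next
 case (gen x)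
 then show ?case using pt[OF assms(2)] by (intro exI[of _ "[:0, 1:]"]) simp
next
 case (add f g) then show ?case by (metis poly_add)
next
 case (mult f g) then show ?case by (metis poly_mult)
qed

text \<open>Restricted to a fibre the local quotients have denominators nonzero at any prescribed
  point, so the function has no poles on the affine line.\<close>

lemma fibre_poly:
 assumes f: "f \<in> reg S V" and q: "q \<in> U" shows "\<exists>P. \<forall>c. f (pt q c) = poly P c"
proof (rule locally_rational_imp_poly)
 fix c0
 let ?y = "pt q c0"
 from local_quotient[OF openV f pt(1)[OF q, of c0] pt(1)[OF q, of c0]] obtain U' G H where
  U': "openin (zar C) U'" "U' \<subseteq> U" "\<pi> ?y \<in> U'" "G \<in> pfun C \<pi> {u} U'" "H \<in> pfun C \<pi> {u} U'" "H ?y ~= 0"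
  "\<forall>y'\<in>V. \<pi> y' \<in> U' & H y' ~= 0 --> y' \<in> V & f y' = G y' / H y'" by (elim exE conjE) (rule that)
 obtain P Q where PQ: "\<forall>c. G (pt q c) = poly P c" "\<forall>c. H (pt q c) = poly Q c"
  using pfun_fibre[OF U'(4) q] pfun_fibre[OF U'(5) q] by blast
 show "\<exists>P Q. poly Q c0 ~= 0 & (\<forall>c. poly Q c ~= 0 --> f (pt q c) = poly P c / poly Q c)"
  using PQ U'(6,7) pt[OF q] U'(3) by (intro exI[of _ P] exI[of _ Q]) auto
qed

lemma open_fibre_cofinite:
 assumes W: "openin (zar S) W" and q: "q \<in> U" and y: "y \<in> W" "y \<in> V" "\<pi> y = q"
 shows "finite {c. pt q c \<notin> W}"
proof -
 from local_quotient[OF W S.reg_const[OF W, of 0] y(1,2)] obtain U' G H where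
  U': "openin (zar C) U'" "U' \<subseteq> U" "\<pi> y \<in> U'" "H \<in> pfun C \<pi> {u} U'" "H y ~= 0"
  "\<forall>y'\<in>V. \<pi> y' \<in> U' & H y' ~= 0 --> y' \<in> W & 0 = G y' / H y'" by (elim exE conjE) (rule that)
 obtain Q where Q: "\<forall>c. H (pt q c) = poly Q c" using pfun_fibre[OF U'(4) q] by blast
 have "pt q (u y) = y" using pt_eq[OF y(2)] y(3) by simp
 then have "poly Q (u y) ~= 0" using Q[rule_format, of "u y"] U'(5) by simp
 then have "finite {c. poly Q c = 0}" by (intro poly_roots_finite) auto
 moreover have "pt q c \<in> W" if "poly Q c ~= 0" for c
  using bspec[OF U'(6) pt(1)[OF q, of c]] U'(3) pt(2)[OF q] y(3) that Q by simp
 then have "{c. pt q c \<notin> W} \<subseteq> {c. poly Q c = 0}" by auto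
 ultimately show ?thesis by (rule finite_subset[rotated])
qed

text \<open>Difference quotients of polynomials in \<open>u\<close>: subtracting the value at u = c
  leaves a multiple of u - c, by the product rule for differences.\<close>

lemma pfun_divide_linear:
 assumes G: "G \<in> pfun C \<pi> {u} U'" and U': "openin (zar C) U'" "U' \<subseteq> U" and y: "y \<in> V" "\<pi> y \<in> U'"
  and c: "regat C (\<pi> y) c"
 shows "\<exists>G'. regat S y G' & (\<forall>\<^sub>F y' in nhd S y. G y' - G (pt (\<pi> y') (c (\<pi> y'))) = (u y' - c (\<pi> y')) * G' y')"
 using G
proof (induction rule: pfun.induct)
 have evU: "\<forall>\<^sub>F y' in nhd S y. \<pi> y' \<in> U"
  using eventually_pi[OF y(1), of "%q. q \<in> U"] eventually_nhdI[OF openU piV[OF y(1)], of "%q. q \<in> U"] by simp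
 have sec: "regat S y (%y'. g (pt (\<pi> y') (c (\<pi> y'))))" if "g \<in> pfun C \<pi> {u} U'" for g
  using pi_regat[OF y(1) pfun_section[OF that U' y(2) c]] .
 { case (base a)
  have "\<forall>\<^sub>F y' in nhd S y. a (\<pi> y') - a (\<pi> (pt (\<pi> y') (c (\<pi> y')))) = (u y' - c (\<pi> y')) * 0"
   using evU by eventually_elim (simp add: pt)
  then show ?case using S.regat_const[OF ptsV[OF y(1)], of 0] by (intro exI[of _ "%_. 0"]) simp }
 { case (gen x)
  have "\<forall>\<^sub>F y' in nhd S y. x y' - x (pt (\<pi> y') (c (\<pi> y'))) = (u y' - c (\<pi> y')) * 1"
   using evU by eventually_elim (use gen in \<open>simp add: pt\<close>)
  then show ?case using S.regat_const[OF ptsV[OF y(1)], of 1] by (intro exI[of _ "%_. 1"]) simp }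
 { case (add f g)
  then obtain F' G' where fg: "regat S y F'" "\<forall>\<^sub>F y' in nhd S y. f y' - f (pt (\<pi> y') (c (\<pi> y'))) = (u y' - c (\<pi> y')) * F' y'"
   "regat S y G'" "\<forall>\<^sub>F y' in nhd S y. g y' - g (pt (\<pi> y') (c (\<pi> y'))) = (u y' - c (\<pi> y')) * G' y'" by auto
  have "\<forall>\<^sub>F y' in nhd S y. (f y' + g y') - (f (pt (\<pi> y') (c (\<pi> y'))) + g (pt (\<pi> y') (c (\<pi> y')))) = (u y' - c (\<pi> y')) * (F' y' + G' y')"
   using fg(2,4) by eventually_elim algebra
  then show ?case using S.regat_add[OF fg(1,3)] by (intro exI[of _ "%y. F' y + G' y"]) simp }
 { case (mult f g)
  then obtain F' G' where fg: "regat S y F'" "\<forall>\<^sub>F y' in nhd S y. f y' - f (pt (\<pi> y') (c (\<pi> y'))) = (u y' - c (\<pi> y')) * F' y'"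
   "regat S y G'" "\<forall>\<^sub>F y' in nhd S y. g y' - g (pt (\<pi> y') (c (\<pi> y'))) = (u y' - c (\<pi> y')) * G' y'" by auto
  have "\<forall>\<^sub>F y' in nhd S y. (f y' * g y') - (f (pt (\<pi> y') (c (\<pi> y'))) * g (pt (\<pi> y') (c (\<pi> y')))) =
    (u y' - c (\<pi> y')) * (F' y' * g y' + f (pt (\<pi> y') (c (\<pi> y'))) * G' y')"
   using fg(2,4) by eventually_elim algebra
  moreover have "regat S y (%y'. F' y' * g y' + f (pt (\<pi> y') (c (\<pi> y'))) * G' y')"
   by (intro S.regat_add S.regat_mult fg sec mult pfun_regat[OF mult(2) U'(1) y])
  ultimately show ?case by (intro exI[of _ "%y'. F' y' * g y' + f (pt (\<pi> y') (c (\<pi> y'))) * G' y'"]) simp }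
qed

text \<open>The numerator of \<open>f\<close> vanishes along the section u = c, so it equals its own
  difference with the value there, which \<open>pfun_divide_linear\<close> divides.\<close>

lemma divide_linear:
 assumes W: "openin (zar S) W" "f \<in> reg S W" and y: "y \<in> W" "y \<in> V" and c: "regat C (\<pi> y) c" "u y = c (\<pi> y)"
  and vanish: "\<And>q. q \<in> U ==> regat C q c ==> pt q (c q) \<in> W ==> f (pt q (c q)) = 0"
 shows "\<exists>a. regat S y a & (\<forall>\<^sub>F y' in nhd S y. f y' = a y' * (u y' - c (\<pi> y')))"
proof -
 from local_quotient[OF W y] obtain U' G H where
  U': "openin (zar C) U'" "U' \<subseteq> U" "\<pi> y \<in> U'" "G \<in> pfun C \<pi> {u} U'" "H \<in> pfun C \<pi> {u} U'" "H y ~= 0"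
  "\<forall>y'\<in>V. \<pi> y' \<in> U' & H y' ~= 0 --> y' \<in> W & f y' = G y' / H y'" by (elim exE conjE) (rule that)
 from pfun_divide_linear[OF U'(4,1,2) y(2) U'(3) c(1)] obtain G' where G': "regat S y G'"
  "\<forall>\<^sub>F y' in nhd S y. G y' - G (pt (\<pi> y') (c (\<pi> y'))) = (u y' - c (\<pi> y')) * G' y'" by (elim exE conjE)
 have rH: "regat S y H" by (rule pfun_regat[OF U'(5,1) y(2) U'(3)])
 have "regat S y (%y'. H (pt (\<pi> y') (c (\<pi> y'))))"
  by (rule pi_regat[OF y(2) pfun_section[OF U'(5,1,2,3) c(1)]])
 moreover have "pt (\<pi> y) (c (\<pi> y)) = y" using pt_eq[OF y(2)] c(2) by simp
 ultimately have "\<forall>\<^sub>F y' in nhd S y. H (pt (\<pi> y') (c (\<pi> y'))) ~= 0" using U'(6) by (intro S.regat_nz) simp_all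
 moreover have "\<forall>\<^sub>F y' in nhd S y. \<pi> y' \<in> U'" by (rule eventually_pi[OF y(2)]) (rule eventually_nhdI[OF U'(1,3)])
 moreover have "\<forall>\<^sub>F y' in nhd S y. regat C (\<pi> y') c" by (rule eventually_pi[OF y(2)]) (rule C.regat_ev[OF c(1)])
 ultimately have "\<forall>\<^sub>F y' in nhd S y. f y' = G' y' / H y' * (u y' - c (\<pi> y'))"
  using G'(2) S.regat_nz[OF rH U'(6)] eventually_V[OF y(2)]
 proof eventually_elim
  case (elim y')
  have q: "\<pi> y' \<in> U" using elim U'(2) by auto
  let ?s = "pt (\<pi> y') (c (\<pi> y'))"
  have "?s \<in> W & f ?s = G ?s / H ?s" using U'(7) pt[OF q] elim by auto
  then have "G ?s = 0" using vanish[OF q] elim by simp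
  then have "G y' = (u y' - c (\<pi> y')) * G' y'" using elim by simp
  moreover have "f y' = G y' / H y'" using U'(7) elim by auto
  ultimately show ?case by simp
 qed
 then show ?thesis using S.regat_divide[OF G'(1) rH U'(6)] by (intro exI[of _ "%y'. G' y' / H y'"]) simp
qed

lemma pfun_divide_fibre:
 assumes G: "G \<in> pfun C \<pi> {u} U'" and U': "openin (zar C) U'" "U' \<subseteq> U" and y: "y \<in> V" "\<pi> y \<in> U'"
  and z: "uniformizer C (\<pi> y) z"
 shows "\<exists>G'. regat S y G' & regat S y (%y'. G (pt (\<pi> y) (u y'))) &
  (\<forall>\<^sub>F y' in nhd S y. G y' - G (pt (\<pi> y) (u y')) = z (\<pi> y') * G' y')"
 using G
proof (induction rule: pfun.induct)
 have yS: "y \<in> pts S" by (rule ptsV[OF y(1)])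
 have yU: "\<pi> y \<in> U" by (rule piV[OF y(1)])
 { case (base a)
  have ra: "regat C (\<pi> y) a" by (rule C.regatI[OF U'(1) y(2) base])
  have "regat C (\<pi> y) (%q. a q - a (\<pi> y))" by (intro C.regat_diff ra C.regat_const ptsU yU)
  then obtain g where g: "regat C (\<pi> y) g" "\<forall>\<^sub>F q in nhd C (\<pi> y). a q - a (\<pi> y) = g q * z q"
   using z unfolding uniformizer_def by fastforce
  have "\<forall>\<^sub>F y' in nhd S y. a (\<pi> y') - a (\<pi> (pt (\<pi> y) (u y'))) = z (\<pi> y') * g (\<pi> y')"
   using eventually_pi[OF y(1) g(2)] by eventually_elim (simp add: pt[OF yU])
  then show ?case using pi_regat[OF y(1) g(1)] S.regat_const[OF yS]
   by (intro exI[of _ "%y. g (\<pi> y)"]) (simp add: pt[OF yU]) }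
 { case (gen x)
  have "\<forall>\<^sub>F y' in nhd S y. x y' - x (pt (\<pi> y) (u y')) = z (\<pi> y') * 0"
   using gen pt[OF yU] by simp
  then show ?case using S.regat_const[OF yS, of 0] u_regat[OF y(1)] gen
   by (intro exI[of _ "%_. 0"]) (simp add: pt[OF yU]) }
 { case (add f g)
  then obtain F' G' where fg: "regat S y F'" "\<forall>\<^sub>F y' in nhd S y. f y' - f (pt (\<pi> y) (u y')) = z (\<pi> y') * F' y'"
   "regat S y G'" "\<forall>\<^sub>F y' in nhd S y. g y' - g (pt (\<pi> y) (u y')) = z (\<pi> y') * G' y'"
   "regat S y (%y'. f (pt (\<pi> y) (u y')))" "regat S y (%y'. g (pt (\<pi> y) (u y')))" by auto
  have "\<forall>\<^sub>F y' in nhd S y. (f y' + g y') - (f (pt (\<pi> y) (u y')) + g (pt (\<pi> y) (u y'))) = z (\<pi> y') * (F' y' + G' y')"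
   using fg(2,4) by eventually_elim algebra
  then show ?case using S.regat_add[OF fg(1,3)] S.regat_add[OF fg(5,6)]
   by (intro exI[of _ "%y. F' y + G' y"]) simp }
 { case (mult f g)
  then obtain F' G' where fg: "regat S y F'" "\<forall>\<^sub>F y' in nhd S y. f y' - f (pt (\<pi> y) (u y')) = z (\<pi> y') * F' y'"
   "regat S y G'" "\<forall>\<^sub>F y' in nhd S y. g y' - g (pt (\<pi> y) (u y')) = z (\<pi> y') * G' y'"
   "regat S y (%y'. f (pt (\<pi> y) (u y')))" "regat S y (%y'. g (pt (\<pi> y) (u y')))" by auto
  have "\<forall>\<^sub>F y' in nhd S y. (f y' * g y') - (f (pt (\<pi> y) (u y')) * g (pt (\<pi> y) (u y'))) =
    z (\<pi> y') * (F' y' * g y' + f (pt (\<pi> y) (u y')) * G' y')"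
   using fg(2,4) by eventually_elim algebra
  moreover have "regat S y (%y'. F' y' * g y' + f (pt (\<pi> y) (u y')) * G' y')"
   by (intro S.regat_add S.regat_mult fg pfun_regat[OF mult(2) U'(1) y])
  ultimately show ?case using S.regat_mult[OF fg(5,6)]
   by (intro exI[of _ "%y'. F' y' * g y' + f (pt (\<pi> y) (u y')) * G' y'"]) simp }
qed

lemma divide_fibre:
 assumes W: "openin (zar S) W" "f \<in> reg S W" and y: "y \<in> W" "y \<in> V" and z: "uniformizer C (\<pi> y) z"
  and vanish: "\<And>y'. y' \<in> W ==> \<pi> y' = \<pi> y ==> f y' = 0"
 shows "\<exists>a. regat S y a & (\<forall>\<^sub>F y' in nhd S y. f y' = a y' * z (\<pi> y'))"
proof -
 from local_quotient[OF W y] obtain U' G H where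
  U': "openin (zar C) U'" "U' \<subseteq> U" "\<pi> y \<in> U'" "G \<in> pfun C \<pi> {u} U'" "H \<in> pfun C \<pi> {u} U'" "H y ~= 0"
  "\<forall>y'\<in>V. \<pi> y' \<in> U' & H y' ~= 0 --> y' \<in> W & f y' = G y' / H y'" by (elim exE conjE) (rule that)
 have yU: "\<pi> y \<in> U" by (rule piV[OF y(2)])
 from pfun_divide_fibre[OF U'(4,1,2) y(2) U'(3) z] obtain G' where G': "regat S y G'"
  "\<forall>\<^sub>F y' in nhd S y. G y' - G (pt (\<pi> y) (u y')) = z (\<pi> y') * G' y'" by (elim exE conjE)
 have rH: "regat S y H" by (rule pfun_regat[OF U'(5,1) y(2) U'(3)])
 have "regat S y (%y'. H (pt (\<pi> y) (u y')))"
  using pfun_divide_fibre[OF U'(5,1,2) y(2) U'(3) z] by blast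
 then have "\<forall>\<^sub>F y' in nhd S y. H (pt (\<pi> y) (u y')) ~= 0" using U'(6) pt_eq[OF y(2)] by (intro S.regat_nz) simp_all
 moreover have "\<forall>\<^sub>F y' in nhd S y. \<pi> y' \<in> U'" by (rule eventually_pi[OF y(2)]) (rule eventually_nhdI[OF U'(1,3)])
 ultimately have "\<forall>\<^sub>F y' in nhd S y. f y' = G' y' / H y' * z (\<pi> y')"
  using G'(2) S.regat_nz[OF rH U'(6)] eventually_V[OF y(2)]
 proof eventually_elim
  case (elim y')
  let ?s = "pt (\<pi> y) (u y')"
  have "?s \<in> W & f ?s = G ?s / H ?s" using U'(3,7) pt[OF yU] elim by auto
  then have "G ?s = 0" using vanish[of ?s] elim pt[OF yU] by simp
  then have "G y' = z (\<pi> y') * G' y'" using elim by simp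
  moreover have "f y' = G y' / H y'" using U'(7) elim by auto
  ultimately show ?case by simp
 qed
 then show ?thesis using S.regat_divide[OF G'(1) rH U'(6)] by (intro exI[of _ "%y'. G' y' / H y'"]) simp
qed

end

section \<open>Charts of the ruled surface\<close>

context frame
begin

definition vec :: "'c => complex => complex => 'e" where
 "vec q a b = (SOME e. e \<in> pts (total E) & bproj E e = q & X e = a & Y e = b)"

lemma vec:
 assumes "q \<in> U" shows "vec q a b \<in> fib E U" "bproj E (vec q a b) = q" "X (vec q a b) = a" "Y (vec q a b) = b"
proof -
 have "\<exists>e. e \<in> pts (total E) & bproj E e = q & X e = a & Y e = b" using vector_exists[OF assms] by blast
 then have "vec q a b \<in> pts (total E) & bproj E (vec q a b) = q & X (vec q a b) = a & Y (vec q a b) = b"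
  unfolding vec_def by (rule someI_ex)
 then show "vec q a b \<in> fib E U" "bproj E (vec q a b) = q" "X (vec q a b) = a" "Y (vec q a b) = b"
  using assms by (auto simp: fib_def)
qed

lemma bscale_fib: "e \<in> fib E U ==> bscale E c e \<in> fib E U"
 using bscale by (auto simp: fib_def)

lemma badd_fib: "e \<in> fib E U ==> e' \<in> fib E U ==> bproj E e = bproj E e' ==> badd E e e' \<in> fib E U"
 using badd by (auto simp: fib_def)

lemma zero_iff: "e \<in> fib E U ==> is_zero_vector E e \<longleftrightarrow> X e = 0 & Y e = 0"
proof
 assume e: "e \<in> fib E U" and z: "is_zero_vector E e"
 then have e0: "e = bscale E 0 e" by (simp add: is_zero_vector_def)
 have "X (bscale E 0 e) = 0 & Y (bscale E 0 e) = 0" using bscale[OF e, of 0] by simp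
 then show "X e = 0 & Y e = 0" using e0 by metis
next
 assume e: "e \<in> fib E U" and z: "X e = 0 & Y e = 0"
 show "is_zero_vector E e" unfolding is_zero_vector_def
  by (rule vector_unique[OF e bscale_fib[OF e]]) (use z bscale[OF e, of 0] in auto)
qed

end

lemma (in fsp) frame_restrict:
 assumes "frame X E U x y" "openin (zar X) U'" "U' \<subseteq> U" shows "frame X E U' x y"
proof -
 interpret frame X E U x y by (rule assms)
 have sub: "e \<in> fib E U' ==> e \<in> fib E U" for e using assms(3) by (auto simp: fib_def)
 show ?thesis
 proof
  fix W f e assume W: "openin (zar (total E)) W" "f \<in> reg (total E) W" "e \<in> W" "e \<in> fib E U'"
  from local_quotient[OF W(1-3) sub[OF W(4)]] obtain U'' G H where 1: "openin (zar X) U''" "U'' \<subseteq> U" "bproj E e \<in> U''"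
   "G \<in> pfun X (bproj E) {x, y} U''" "H \<in> pfun X (bproj E) {x, y} U''" "H e ~= 0"
   "\<forall>e'\<in>fib E U''. H e' ~= 0 --> e' \<in> W & f e' = G e' / H e'" by (elim exE conjE) (rule that)
  have o: "openin (zar X) (U'' \<inter> U')" using 1 assms by blast
  have "G \<in> pfun X (bproj E) {x, y} (U'' \<inter> U')" "H \<in> pfun X (bproj E) {x, y} (U'' \<inter> U')"
   using pfun_mono[OF 1(4,1) o] pfun_mono[OF 1(5,1) o] by auto
  then show "\<exists>U'' G H. openin (zar X) U'' & U'' \<subseteq> U' & bproj E e \<in> U'' & G \<in> pfun X (bproj E) {x, y} U'' &
    H \<in> pfun X (bproj E) {x, y} U'' & H e ~= 0 & (\<forall>e'\<in>fib E U''. H e' ~= 0 --> e' \<in> W & f e' = G e' / H e')"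
   using 1 o W(4) by (intro exI[of _ "U'' \<inter> U'"] exI[of _ G] exI[of _ H]) (auto simp: fib_def)
 qed (use assms X_regat Y_regat vector_exists vector_unique badd bscale sub in auto)
qed

lemma (in fsp) frame_change:
 assumes T: "space_with_functions (total E)" and fr: "frame X E U x y" and det: "a * d - b * c ~= 0"
 shows "frame X E U (%e. a * x e + b * y e) (%e. c * x e + d * y e)" (is "frame X E U ?x ?y")
proof -
 interpret frame X E U x y by (rule fr)
 define D where "D = a * d - b * c"
 have D: "D ~= 0" using det by (simp add: D_def)
 have inv: "x e = (d * ?x e - b * ?y e) / D" "y e = (a * ?y e - c * ?x e) / D" for e
 proof -
  have 1: "D * x e = d * ?x e - b * ?y e" unfolding D_def by algebra
  have 2: "D * y e = a * ?y e - c * ?x e" unfolding D_def by algebra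
  have "x e = (D * x e) / D" "y e = (D * y e) / D" using D by simp_all
  then show "x e = (d * ?x e - b * ?y e) / D" "y e = (a * ?y e - c * ?x e) / D" unfolding 1 2 .
 qed
 have lin: "(%e. s * ?x e + t * ?y e) \<in> pfun X (bproj E) {?x, ?y} U'" if "openin (zar X) U'" for s t U'
  by (rule pfun.add[OF pfun.mult[OF pfun_const[OF that] pfun.gen] pfun.mult[OF pfun_const[OF that] pfun.gen]]) simp_all
 have transfer: "G \<in> pfun X (bproj E) {?x, ?y} U'" if "G \<in> pfun X (bproj E) {x, y} U'" "openin (zar X) U'" for G U'
  using that
 proof (induction rule: pfun.induct)
  case (gen w)
  have "x = (%e. d / D * ?x e + (- b / D) * ?y e)" "y = (%e. (- c / D) * ?x e + a / D * ?y e)"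
   by (rule ext, rule trans[OF inv(1)], simp add: diff_divide_distrib)
    (rule ext, rule trans[OF inv(2)], simp add: diff_divide_distrib)
  then show ?case using gen lin[OF gen(2), of "d / D" "- b / D"] lin[OF gen(2), of "- c / D" "a / D"] by auto
 qed (rule pfun.base pfun.add pfun.mult; simp)+
 interpret T: fsp "total E" by unfold_locales (rule T)
 show ?thesis
 proof
  show "openin (zar X) U" by (rule openU)
  show "\<exists>e\<in>pts (total E). bproj E e = q & ?x e = s & ?y e = t" if "q \<in> U" for q s t
  proof -
   let ?e = "vec q ((d * s - b * t) / D) ((a * t - c * s) / D)"
   have "a * ((d * s - b * t) / D) + b * ((a * t - c * s) / D) = (a * (d * s - b * t) + b * (a * t - c * s)) / D"
    by (simp add: add_divide_distrib)
   also have "a * (d * s - b * t) + b * (a * t - c * s) = s * D" unfolding D_def by algebra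
   finally have 1: "a * ((d * s - b * t) / D) + b * ((a * t - c * s) / D) = s" using D by simp
   have "c * ((d * s - b * t) / D) + d * ((a * t - c * s) / D) = (c * (d * s - b * t) + d * (a * t - c * s)) / D"
    by (simp add: add_divide_distrib)
   also have "c * (d * s - b * t) + d * (a * t - c * s) = t * D" unfolding D_def by algebra
   finally have 2: "c * ((d * s - b * t) / D) + d * ((a * t - c * s) / D) = t" using D by simp
   show ?thesis using vec[OF that, of "(d * s - b * t) / D" "(a * t - c * s) / D"] 1 2
    by (intro bexI[of _ ?e]) (auto simp: fib_def)
  qed
  show "e = e'" if "e \<in> fib E U" "e' \<in> fib E U" "bproj E e = bproj E e'" "?x e = ?x e'" "?y e = ?y e'" for e e'
  proof (rule vector_unique[OF that(1-3)])
   show "x e = x e'" by (rule trans[OF inv(1) trans[OF _ inv(1)[symmetric]]]) (simp only: that(4,5))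
   show "y e = y e'" by (rule trans[OF inv(2) trans[OF _ inv(2)[symmetric]]]) (simp only: that(4,5))
  qed
  show "badd E e e' \<in> pts (total E) & bproj E (badd E e e') = bproj E e &
   ?x (badd E e e') = ?x e + ?x e' & ?y (badd E e e') = ?y e + ?y e'"
   if "e \<in> fib E U" "e' \<in> fib E U" "bproj E e = bproj E e'" for e e'
   using badd[OF that] by (simp add: algebra_simps)
  show "bscale E k e \<in> pts (total E) & bproj E (bscale E k e) = bproj E e &
   ?x (bscale E k e) = k * ?x e & ?y (bscale E k e) = k * ?y e" if "e \<in> fib E U" for k e
   using bscale[OF that, of k] by (simp add: algebra_simps)
  fix W f e assume W: "openin (zar (total E)) W" "f \<in> reg (total E) W" "e \<in> W" "e \<in> fib E U"
  from local_quotient[OF W] obtain U' G H where "openin (zar X) U'" "U' \<subseteq> U" "bproj E e \<in> U'"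
   "G \<in> pfun X (bproj E) {x, y} U'" "H \<in> pfun X (bproj E) {x, y} U'" "H e ~= 0"
   "\<forall>e'\<in>fib E U'. H e' ~= 0 --> e' \<in> W & f e' = G e' / H e'" by (elim exE conjE) (rule that)
  then show "\<exists>U' G H. openin (zar X) U' & U' \<subseteq> U & bproj E e \<in> U' & G \<in> pfun X (bproj E) {?x, ?y} U' &
    H \<in> pfun X (bproj E) {?x, ?y} U' & H e ~= 0 & (\<forall>e'\<in>fib E U'. H e' ~= 0 --> e' \<in> W & f e' = G e' / H e')"
   by (intro exI[of _ U'] exI[of _ G] exI[of _ H] conjI transfer)
 next
  fix e assume e: "e \<in> fib E U"
  show "regat (total E) e ?x" "regat (total E) e ?y"
   by (intro T.regat_add T.regat_scale X_regat Y_regat e)+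
 qed
qed

lemma (in fsp) frame_swap: "space_with_functions (total E) ==> frame X E U x y ==> frame X E U y x"
 using frame_change[of E U x y 0 0 1 1] by simp

text \<open>Restriction of a function on the product to the constant section with value
  \<open>v\<close>. The section \<open>i1\<close> of E below arises in this way from the total space
  of the trivial bundle.\<close>

lemma section_regat_prod:
 assumes swf: "space_with_functions C" and v: "v \<in> affine_pts n"
  and O': "openin (zar (prod_fspace C (affine_space n))) O'" and F: "F \<in> reg (prod_fspace C (affine_space n)) O'"
  and q: "(q, v) \<in> O'" "q \<in> pts C"
 shows "regat C q (%q. F (q, v))"
proof -
 interpret fsp C by unfold_locales (rule swf)
 let ?B = "{{z \<in> U \<times> V. h z ~= 0} | U V h. openin (zar C) U & openin (zar (affine_space n)) V &
       h \<in> tensor_functions C (affine_space n) U V}"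
 have tens: "(%q. h (q, v)) \<in> reg C U" if h: "h \<in> tensor_functions C (affine_space n) U V" and U: "openin (zar C) U" for h U V
 proof -
  obtain N :: nat and a b where h2: "h = (%z. \<Sum>i<N. a i (fst z) * b i (snd z))"
   and ab: "\<forall>i<N. a i \<in> reg C U & b i \<in> reg (affine_space n) V" using h unfolding tensor_functions_def by blast
  show ?thesis unfolding reg_iff[OF U] h2 fst_conv snd_conv
   using ab U openin_subset[OF U] by (intro ballI regat_sum regat_mult regat_const) (auto intro: regatI)
 qed
 have "generate_topology_on ?B O'" using O' by (simp add: prod_fspace_def openin_topology_generated_by_iff)
 then have ev: "\<forall>\<^sub>F q in nhd C q. (q, v) \<in> O'" using q
 proof (induction arbitrary: q rule: generate_topology_on.induct)
  case (Int a b)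
  have "\<forall>\<^sub>F q in nhd C q. (q, v) \<in> a" "\<forall>\<^sub>F q in nhd C q. (q, v) \<in> b" using Int by auto
  then show ?case by eventually_elim simp
 next
  case (UN K)
  then obtain k where k: "k \<in> K" "(q, v) \<in> k" by blast
  have "\<forall>\<^sub>F q in nhd C q. (q, v) \<in> k" by (rule UN.IH[OF k]) (rule UN.prems)
  then show ?case by eventually_elim (use k in auto)
 next
  case (Basis s)
  then obtain U V h where s: "s = {z \<in> U \<times> V. h z ~= 0}" "openin (zar C) U" "h \<in> tensor_functions C (affine_space n) U V"
   by blast
  show ?case by (rule eventually_nhdI[OF reg_open[OF s(2) tens[OF s(3,2)]]]) (use Basis s(1) in auto)
 qed simp
 have "\<forall>z\<in>O'. \<exists>U V g h. openin (zar C) U & openin (zar (affine_space n)) V & z \<in> U \<times> V &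
   g \<in> tensor_functions C (affine_space n) U V & h \<in> tensor_functions C (affine_space n) U V & h z ~= 0 &
   (\<forall>w\<in>O' \<inter> U \<times> V. h w ~= 0 --> F w = g w / h w)"
  using F by (simp only: prod_fspace_def fspace.select_convs mem_Collect_eq)
 from bspec[OF this q(1)] obtain U V g h where 1: "openin (zar C) U" "(q, v) \<in> U \<times> V"
  "g \<in> tensor_functions C (affine_space n) U V" "h \<in> tensor_functions C (affine_space n) U V" "h (q, v) ~= 0"
  "\<forall>w\<in>O' \<inter> U \<times> V. h w ~= 0 --> F w = g w / h w" by (elim exE conjE) (rule that)
 have r: "regat C q (%q. g (q, v))" "regat C q (%q. h (q, v))"
  using regatI[OF 1(1) _ tens[OF 1(3,1)]] regatI[OF 1(1) _ tens[OF 1(4,1)]] 1(2) by auto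
 have "\<forall>\<^sub>F q in nhd C q. q \<in> U" by (rule eventually_nhdI[OF 1(1)]) (use 1(2) in auto)
 then have "\<forall>\<^sub>F q in nhd C q. F (q, v) = g (q, v) / h (q, v)"
  using ev regat_nz[OF r(2) 1(5)] by eventually_elim (use 1(2,6) in auto)
 then show ?thesis by (rule regat_cong[OF regat_divide[OF r 1(5)]])
qed

locale scroll = curve C for C :: "'c fspace" +
 fixes E :: "('c, 'e) vbundle"
  and \<iota> :: "'c \<times> (nat => complex) => 'e" and \<rho> :: "'e => 'c \<times> (nat => complex)"
 assumes vb: "vector_bundle C 2 E"
  and se: "short_exact (trivial_bundle C 1) E (trivial_bundle C 1) \<iota> \<rho>"
begin

abbreviation "S \<equiv> ruled_surface E"
abbreviation "\<pi> \<equiv> ruling E"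

lemma swfT: "space_with_functions (total E)"
 using vb by (simp add: vector_bundle_def)

lemma fspT: "fsp (total E)"
 by unfold_locales (rule swfT)

sublocale T: fsp "total E" by (rule fspT)

lemma bproj_morphism: "morphism (total E) C (bproj E)"
 using vb by (simp add: vector_bundle_def)

lemma bproj_pts: "e \<in> pts (total E) ==> bproj E e \<in> pts C"
 using bproj_morphism by (auto simp: morphism_def continuous_map_def)

lemma openin_fib: "openin (zar C) U ==> openin (zar (total E)) (fib E U)"
 using bproj_morphism by (auto simp: morphism_def continuous_map_def fib_def)

lemma bproj_regat:
 assumes e: "e \<in> pts (total E)" and a: "regat C (bproj E e) a" shows "regat (total E) e (%e. a (bproj E e))"
proof -
 obtain U where U: "openin (zar C) U" "bproj E e \<in> U" "a \<in> reg C U" using a by (auto simp: regat_def)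
 have "a \<circ> bproj E \<in> reg (total E) (fib E U)"
  using bproj_morphism[unfolded morphism_def, THEN conjunct2, rule_format, of U a] U by (simp add: fib_def)
 then show ?thesis using T.regatI[OF openin_fib[OF U(1)], of e] e U by (simp add: fib_def comp_def)
qed

lemma frame_at: "p \<in> pts C ==> \<exists>U X Y. p \<in> U & frame C E U X Y"
 by (rule frame_exists[OF swf vb])

definition NZ :: "'e set" where
 "NZ = {e \<in> pts (total E). \<not> is_zero_vector E e}"

lemma NZ_pts: "e \<in> NZ ==> e \<in> pts (total E)"
 by (simp add: NZ_def)

lemma frame_NZ: "frame C E U X Y ==> e \<in> fib E U ==> e \<in> NZ \<longleftrightarrow> X e ~= 0 \<or> Y e ~= 0"
 using frame.zero_iff[of C E U X Y e] by (auto simp: NZ_def fib_def)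

lemma open_NZ: "openin (zar (total E)) NZ"
proof (subst openin_subopen, intro ballI)
 fix e assume e: "e \<in> NZ"
 obtain U X Y where fr: "bproj E e \<in> U" "frame C E U X Y" using frame_at[OF bproj_pts[OF NZ_pts[OF e]]] by blast
 have eU: "e \<in> fib E U" using fr NZ_pts[OF e] by (simp add: fib_def)
 have oU: "openin (zar (total E)) (fib E U)" by (rule openin_fib[OF frame.openU[OF fr(2)]])
 have "\<forall>\<^sub>F e' in nhd (total E) e. X e' ~= 0 \<or> Y e' ~= 0"
 proof (cases "X e = 0")
  case True
  then have "Y e ~= 0" using frame_NZ[OF fr(2) eU] e by simp
  from T.regat_nz[OF frame.Y_regat[OF fr(2) eU] this] show ?thesis by eventually_elim simp
 next
  case False
  from T.regat_nz[OF frame.X_regat[OF fr(2) eU] this] show ?thesis by eventually_elim simp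
 qed
 moreover have "\<forall>\<^sub>F e' in nhd (total E) e. e' \<in> fib E U" by (rule eventually_nhdI[OF oU eU])
 ultimately have "\<forall>\<^sub>F e' in nhd (total E) e. e' \<in> NZ"
  by eventually_elim (use frame_NZ[OF fr(2)] in auto)
 then obtain W where "openin (zar (total E)) W" "e \<in> W" "\<forall>e'\<in>W. e' \<in> NZ"
  using NZ_pts[OF e] by (auto simp: eventually_nhdsin)
 then show "\<exists>W. openin (zar (total E)) W & e \<in> W & W \<subseteq> NZ" by blast
qed

lemma S_quotient: "S = quotient_fspace (sub_fspace (total E) NZ) (line_of E)"
 by (simp add: ruled_surface_def NZ_def)

lemma pts_sub: "pts (sub_fspace (total E) NZ) = NZ"
 using openin_subset[OF open_NZ] by (auto simp: sub_fspace_def)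

lemma pts_S: "pts S = line_of E ` NZ"
 unfolding S_quotient topspace_quotient_fspace pts_sub ..

lemma swfS: "space_with_functions S"
proof -
 interpret sub: fsp "sub_fspace (total E) NZ" by unfold_locales (rule T.swf_sub_fspace[OF open_NZ])
 show ?thesis unfolding S_quotient by (rule sub.swf_quotient_fspace)
qed

lemma fspS: "fsp S"
 by unfold_locales (rule swfS)

sublocale S: fsp S by (rule fspS)

text \<open>The cone over \<open>W\<close> in the nonzero vectors; openness and regularity on the
  quotient are read off there.\<close>

definition pre :: "'e set set => 'e set" where
 "pre W = {e \<in> NZ. line_of E e \<in> W}"

lemma openin_S: "openin (zar S) W \<longleftrightarrow> W \<subseteq> pts S & openin (zar (total E)) (pre W)"
 unfolding S_quotient openin_quotient_fspace T.openin_sub_fspace[OF open_NZ] pts_sub topspace_quotient_fspace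
 by (auto simp: pre_def)

lemma reg_S: "openin (zar S) W ==> f \<in> reg S W \<longleftrightarrow> (\<forall>e\<in>pre W. regat (total E) e (f \<circ> line_of E))"
proof -
 assume W: "openin (zar S) W"
 then have o: "openin (zar (total E)) (pre W)" by (simp add: openin_S)
 have "f \<in> reg S W \<longleftrightarrow> f \<circ> line_of E \<in> reg (sub_fspace (total E) NZ) (pre W)"
  unfolding S_quotient reg_quotient_fspace pts_sub by (simp add: pre_def)
 also have "\<dots> \<longleftrightarrow> f \<circ> line_of E \<in> reg (total E) (pre W)"
  by (rule T.regat_sub_fspace[OF open_NZ o]) (auto simp: pre_def)
 finally show ?thesis unfolding T.reg_iff[OF o] .
qed

lemma line_of_props:
 assumes e: "e \<in> NZ"
 shows "e \<in> line_of E e" and "e' \<in> line_of E e ==> \<exists>c. c ~= 0 & e' = bscale E c e"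
  and "c ~= 0 ==> bscale E c e \<in> NZ" and "bproj E (bscale E c e) = bproj E e"
  and "\<pi> (line_of E e) = bproj E e"
proof -
 obtain U X Y where fr: "bproj E e \<in> U" "frame C E U X Y" using frame_at[OF bproj_pts[OF NZ_pts[OF e]]] by blast
 interpret frame C E U X Y by (rule fr)
 have eU: "e \<in> fib E U" using fr NZ_pts[OF e] by (simp add: fib_def)
 have "bscale E 1 e = e"
  by (rule vector_unique[OF bscale_fib[OF eU] eU]) (use bscale[OF eU, of 1] in auto)
 then show 1: "e \<in> line_of E e" unfolding line_of_def by (intro CollectI exI[of _ 1]) simp
 show "e' \<in> line_of E e ==> \<exists>c. c ~= 0 & e' = bscale E c e" by (auto simp: line_of_def)
 show b: "bproj E (bscale E c e) = bproj E e" for c using bscale[OF eU] by simp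
 show "c ~= 0 ==> bscale E c e \<in> NZ"
  using frame_NZ[OF fr(2) bscale_fib[OF eU]] frame_NZ[OF fr(2) eU] e bscale[OF eU, of c] by simp
 have "bproj E ` line_of E e = {bproj E e}" using 1 b by (auto simp: line_of_def)
 then show "\<pi> (line_of E e) = bproj E e" by (simp add: ruling_def)
qed

lemma line_eq:
 assumes fr: "frame C E U X Y" and e: "e \<in> fib E U" "e \<in> NZ" "e' \<in> fib E U" "bproj E e' = bproj E e"
  and c: "c ~= 0" "X e' = c * X e" "Y e' = c * Y e"
 shows "line_of E e' = line_of E e"
proof -
 interpret frame C E U X Y by (rule fr)
 have *: "bscale E d e' = bscale E (d * c) e" for d
  by (rule vector_unique[OF bscale_fib[OF e(3)] bscale_fib[OF e(1)]])
   (use bscale[OF e(3), of d] bscale[OF e(1), of "d * c"] e(4) c in auto)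
 show ?thesis
 proof
  show "line_of E e' \<subseteq> line_of E e" unfolding line_of_def using * c(1) by auto
  show "line_of E e \<subseteq> line_of E e'"
  proof
   fix w assume "w \<in> line_of E e"
   then obtain d where d: "d ~= 0" "w = bscale E d e" by (auto simp: line_of_def)
   have "w = bscale E (d / c) e'" using *[of "d / c"] c(1) d(2) by simp
   then show "w \<in> line_of E e'" unfolding line_of_def using d(1) c(1) by (intro CollectI exI[of _ "d / c"]) simp
  qed
 qed
qed

lemma pts_SE:
 assumes "y \<in> pts S" obtains e where "e \<in> NZ" "y = line_of E e"
 using assms unfolding pts_S by blast

lemma pi_pts: "y \<in> pts S ==> \<pi> y \<in> pts C"
 by (metis pts_SE line_of_props(5) bproj_pts NZ_pts)

text \<open>The affine coordinate on the projective line of the fibre; all vectors of the line give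
  the same ratio, so the choice is immaterial.\<close>

definition us :: "('e => complex) => ('e => complex) => 'e set => complex" where
 "us X Y y = Y (SOME e. e \<in> y) / X (SOME e. e \<in> y)"

definition vs :: "'c set => ('e => complex) => 'e set set" where
 "vs U X = {y \<in> pts S. \<exists>e\<in>y. e \<in> fib E U & X e ~= 0}"

lemma us_line:
 assumes fr: "frame C E U X Y" and e: "e \<in> NZ" "e \<in> fib E U" shows "us X Y (line_of E e) = Y e / X e"
proof -
 have "(SOME e'. e' \<in> line_of E e) \<in> line_of E e" by (rule someI[of "%e'. e' \<in> line_of E e", OF line_of_props(1)[OF e(1)]])
 from line_of_props(2)[OF e(1) this] obtain c where c: "c ~= 0" "(SOME e'. e' \<in> line_of E e) = bscale E c e" by blast
 show ?thesis unfolding us_def c(2) using frame.bscale[OF fr e(2), of c] c(1) by simp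
qed

lemma vs_line:
 assumes fr: "frame C E U X Y" and e: "e \<in> NZ" shows "line_of E e \<in> vs U X \<longleftrightarrow> e \<in> fib E U & X e ~= 0"
proof
 assume "line_of E e \<in> vs U X"
 then obtain e' where e': "e' \<in> line_of E e" "e' \<in> fib E U" "X e' ~= 0" by (auto simp: vs_def)
 from line_of_props(2)[OF e e'(1)] obtain c where c: "c ~= 0" "e' = bscale E c e" by blast
 have "e \<in> fib E U" using e' c line_of_props(4)[OF e] NZ_pts[OF e] by (simp add: fib_def)
 then show "e \<in> fib E U & X e ~= 0" using frame.bscale[OF fr, of e c] e' c by simp
next
 assume "e \<in> fib E U & X e ~= 0"
 then show "line_of E e \<in> vs U X" using e line_of_props(1)[OF e] by (auto simp: vs_def pts_S)
qed

lemma frame_normalize: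
 assumes fr: "frame C E U X Y" and y: "y \<in> vs U X"
 obtains e where "e \<in> NZ" "e \<in> fib E U" "y = line_of E e" "X e = 1" "Y e = us X Y y" "bproj E e = \<pi> y"
proof -
 interpret frame C E U X Y by (rule fr)
 obtain e where e: "e \<in> NZ" "y = line_of E e" using y by (auto simp: vs_def elim: pts_SE)
 then have eU: "e \<in> fib E U" "X e ~= 0" using vs_line[OF fr e(1)] y by auto
 define e' where "e' = bscale E (1 / X e) e"
 have 1: "e' \<in> NZ" unfolding e'_def using line_of_props(3)[OF e(1)] eU by simp
 have 2: "e' \<in> fib E U" unfolding e'_def by (rule bscale_fib[OF eU(1)])
 have 3: "X e' = 1" "Y e' = Y e / X e" "bproj E e' = bproj E e"
  unfolding e'_def using bscale[OF eU(1), of "1 / X e"] eU by auto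
 have "line_of E e' = line_of E e"
  by (rule line_eq[OF fr eU(1) e(1) 2 3(3), of "1 / X e"]) (use 3 eU in auto)
 then show thesis using that[of e'] 1 2 3 e us_line[OF fr e(1) eU(1)] line_of_props(5)[OF e(1)] by simp
qed

lemma open_vs:
 assumes fr: "frame C E U X Y" shows "openin (zar S) (vs U X)"
proof -
 interpret frame C E U X Y by (rule fr)
 have "pre (vs U X) = NZ \<inter> {e \<in> fib E U. X e ~= 0}" using vs_line[OF fr] by (auto simp: pre_def)
 moreover have "X \<in> reg (total E) (fib E U)" unfolding T.reg_iff[OF openin_fib[OF openU]] using X_regat by blast
 then have "openin (zar (total E)) {e \<in> fib E U. X e ~= 0}" by (rule T.reg_open[OF openin_fib[OF openU]])
 ultimately show ?thesis unfolding openin_S using open_NZ by (auto simp: vs_def)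
qed

lemma open_pi: "openin (zar C) U ==> openin (zar S) {y \<in> pts S. \<pi> y \<in> U}"
proof -
 assume U: "openin (zar C) U"
 have "pre {y \<in> pts S. \<pi> y \<in> U} = NZ \<inter> fib E U"
  using line_of_props(5) NZ_pts by (auto simp: pre_def pts_S fib_def)
 then show ?thesis unfolding openin_S using open_NZ openin_fib[OF U] by auto
qed

lemma pi_regat_S:
 assumes y: "y \<in> pts S" and a: "regat C (\<pi> y) a" shows "regat S y (%y. a (\<pi> y))"
proof -
 obtain U where U: "openin (zar C) U" "\<pi> y \<in> U" "a \<in> reg C U" using a by (auto simp: regat_def)
 let ?W = "{y \<in> pts S. \<pi> y \<in> U}"
 have "(%y. a (\<pi> y)) \<in> reg S ?W" unfolding reg_S[OF open_pi[OF U(1)]]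
 proof
  fix e assume "e \<in> pre ?W"
  then have e: "e \<in> NZ" "bproj E e \<in> U" using line_of_props(5) by (auto simp: pre_def)
  have "regat (total E) e (%e. a (bproj E e))"
   by (rule bproj_regat[OF NZ_pts[OF e(1)]]) (use U e in \<open>auto intro: regatI\<close>)
  moreover have "\<forall>\<^sub>F e' in nhd (total E) e. ((%y. a (\<pi> y)) \<circ> line_of E) e' = a (bproj E e')"
   by (rule eventually_nhdI[OF open_NZ e(1)]) (simp add: line_of_props(5))
  ultimately show "regat (total E) e ((%y. a (\<pi> y)) \<circ> line_of E)" by (rule T.regat_cong)
 qed
 then show ?thesis by (rule S.regatI[OF open_pi[OF U(1)], rotated]) (use y U in auto)
qed

lemma schart_of_frame:
 assumes fr: "frame C E U X Y" shows "schart C S \<pi> U (vs U X) (us X Y)"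
proof -
 interpret frame C E U X Y by (rule fr)
 show ?thesis
 proof
  show "openin (zar C) U" by (rule openU)
  show "openin (zar S) (vs U X)" by (rule open_vs[OF fr])
  show "\<pi> y \<in> U" if "y \<in> vs U X" for y
   by (rule frame_normalize[OF fr that]) (auto simp: fib_def)
  show "regat S y (us X Y)" if y: "y \<in> vs U X" for y
  proof (rule S.regatI[OF open_vs[OF fr] y])
   show "us X Y \<in> reg S (vs U X)" unfolding reg_S[OF open_vs[OF fr]]
   proof
    fix e assume "e \<in> pre (vs U X)"
    then have e: "e \<in> NZ" "e \<in> fib E U" "X e ~= 0" using vs_line[OF fr] by (auto simp: pre_def)
    have o: "openin (zar (total E)) (NZ \<inter> fib E U)" using open_NZ openin_fib[OF openU] by blast
    have "\<forall>\<^sub>F e' in nhd (total E) e. (us X Y \<circ> line_of E) e' = Y e' / X e'"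
     by (rule eventually_nhdI[OF o]) (use e us_line[OF fr] in auto)
    then show "regat (total E) e (us X Y \<circ> line_of E)"
     by (rule T.regat_cong[OF T.regat_divide[OF Y_regat[OF e(2)] X_regat[OF e(2)] e(3)]])
   qed
  qed
  show "regat S y (%y. a (\<pi> y))" if "y \<in> vs U X" "regat C (\<pi> y) a" for y a
   by (rule pi_regat_S) (use that in \<open>auto simp: vs_def\<close>)
  show "openin (zar S) {y \<in> vs U X. \<pi> y \<in> U'}" if "openin (zar C) U'" for U'
  proof -
   have "{y \<in> vs U X. \<pi> y \<in> U'} = vs U X \<inter> {y \<in> pts S. \<pi> y \<in> U'}" by (auto simp: vs_def)
   then show ?thesis using openin_Int[OF open_vs[OF fr] open_pi[OF that]] by simp
  qed
  show "\<exists>y\<in>vs U X. \<pi> y = q & us X Y y = c" if q: "q \<in> U" for q c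
  proof -
   let ?e = "vec q 1 c"
   have e: "?e \<in> fib E U" "?e \<in> NZ" using vec[OF q] frame_NZ[OF fr] by auto
   show ?thesis using e vs_line[OF fr e(2)] us_line[OF fr e(2,1)] line_of_props(5)[OF e(2)] vec[OF q, of 1 c]
    by (intro bexI[of _ "line_of E ?e"]) auto
  qed
  show "y = y'" if y: "y \<in> vs U X" "y' \<in> vs U X" "\<pi> y = \<pi> y'" "us X Y y = us X Y y'" for y y'
  proof -
   obtain e where e: "e \<in> fib E U" "y = line_of E e" "X e = 1" "Y e = us X Y y" "bproj E e = \<pi> y"
    by (rule frame_normalize[OF fr y(1)]) (rule that)
   obtain e' where e': "e' \<in> fib E U" "y' = line_of E e'" "X e' = 1" "Y e' = us X Y y'" "bproj E e' = \<pi> y'"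
    by (rule frame_normalize[OF fr y(2)]) (rule that)
   have "e = e'" by (rule vector_unique[OF e(1) e'(1)]) (use e e' y in auto)
   then show ?thesis using e e' by simp
  qed
  fix W f y assume W: "openin (zar S) W" "f \<in> reg S W" "y \<in> W" and yV: "y \<in> vs U X"
  obtain e where e: "e \<in> NZ" "e \<in> fib E U" "y = line_of E e" "X e = 1" "Y e = us X Y y" "bproj E e = \<pi> y"
   by (rule frame_normalize[OF fr yV]) (rule that)
  have oW: "openin (zar (total E)) (pre W)" using W(1) by (simp add: openin_S)
  have fW: "f \<circ> line_of E \<in> reg (total E) (pre W)" unfolding T.reg_iff[OF oW] using reg_S[OF W(1)] W(2) by blast
  have eW: "e \<in> pre W" using e W(3) by (simp add: pre_def)
  from local_quotient[OF oW fW eW e(2)] obtain U' G H where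
   U': "openin (zar C) U'" "U' \<subseteq> U" "bproj E e \<in> U'" "G \<in> pfun C (bproj E) {X, Y} U'" "H \<in> pfun C (bproj E) {X, Y} U'" "H e ~= 0"
   "\<forall>e'\<in>fib E U'. H e' ~= 0 --> e' \<in> pre W & (f \<circ> line_of E) e' = G e' / H e'" by (elim exE conjE) (rule that)
  \<comment> \<open>Dehomogenisation: on vectors normalised to X = 1, polynomials in
    \<open>X\<close> and \<open>Y\<close> become polynomials in the coordinate Y/X.\<close>
  have transfer: "\<exists>G1\<in>pfun C \<pi> {us X Y} U'. \<forall>e'\<in>NZ \<inter> fib E U. X e' = 1 --> G1 (line_of E e') = G e'"
   if "G \<in> pfun C (bproj E) {X, Y} U'" for G
   using that
  proof (induction rule: pfun.induct)
   case (base a)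
   then show ?case by (intro bexI[OF _ pfun.base[of a]]) (auto simp: line_of_props(5))
  next
   case (gen x)
   then consider "x = X" | "x = Y" by blast
   then show ?case
   proof cases
    case 1 then show ?thesis by (intro bexI[OF _ pfun_const[OF U'(1), of 1]]) auto
   next
    case 2 then show ?thesis by (intro bexI[OF _ pfun.gen[of "us X Y"]]) (auto simp: us_line[OF fr])
   qed
  next
   case (add f g)
   then obtain f' g' where fg: "f' \<in> pfun C \<pi> {us X Y} U'" "\<forall>e'\<in>NZ \<inter> fib E U. X e' = 1 --> f' (line_of E e') = f e'"
    "g' \<in> pfun C \<pi> {us X Y} U'" "\<forall>e'\<in>NZ \<inter> fib E U. X e' = 1 --> g' (line_of E e') = g e'" by auto
   show ?case by (intro bexI[OF _ pfun.add[OF fg(1,3)]]) (use fg in auto)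
  next
   case (mult f g)
   then obtain f' g' where fg: "f' \<in> pfun C \<pi> {us X Y} U'" "\<forall>e'\<in>NZ \<inter> fib E U. X e' = 1 --> f' (line_of E e') = f e'"
    "g' \<in> pfun C \<pi> {us X Y} U'" "\<forall>e'\<in>NZ \<inter> fib E U. X e' = 1 --> g' (line_of E e') = g e'" by auto
   show ?case by (intro bexI[OF _ pfun.mult[OF fg(1,3)]]) (use fg in auto)
  qed
  obtain G1 where G1: "G1 \<in> pfun C \<pi> {us X Y} U'" "\<forall>e'\<in>NZ \<inter> fib E U. X e' = 1 --> G1 (line_of E e') = G e'"
   using transfer[OF U'(4)] by blast
  obtain H1 where H1: "H1 \<in> pfun C \<pi> {us X Y} U'" "\<forall>e'\<in>NZ \<inter> fib E U. X e' = 1 --> H1 (line_of E e') = H e'"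
   using transfer[OF U'(5)] by blast
  have "y' \<in> W & f y' = G1 y' / H1 y'" if y': "y' \<in> vs U X" "\<pi> y' \<in> U'" "H1 y' ~= 0" for y'
  proof -
   obtain e' where e': "e' \<in> NZ" "e' \<in> fib E U" "y' = line_of E e'" "X e' = 1" "bproj E e' = \<pi> y'"
    by (rule frame_normalize[OF fr y'(1)]) (rule that)
   have "e' \<in> fib E U'" using e' y'(2) by (simp add: fib_def)
   moreover have "H1 y' = H e'" "G1 y' = G e'" using G1(2) H1(2) e' by auto
   ultimately show ?thesis using U'(7) y'(3) e'(3) by (auto simp: pre_def)
  qed
  moreover have "H1 y ~= 0" using H1(2) e U'(6) by auto
  ultimately show "\<exists>U' G H. openin (zar C) U' & U' \<subseteq> U & \<pi> y \<in> U' & G \<in> pfun C \<pi> {us X Y} U' &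
    H \<in> pfun C \<pi> {us X Y} U' & H y ~= 0 & (\<forall>y'\<in>vs U X. \<pi> y' \<in> U' & H y' ~= 0 --> y' \<in> W & f y' = G y' / H y')"
   using U' G1(1) H1(1) e(6) by (intro exI[of _ U'] exI[of _ G1] exI[of _ H1]) auto
 qed
qed

text \<open>A constant linear change of coordinates moves \<open>e\<close> to (1, 0), so that its
  line becomes the origin of the chart; the two cases depend on which coordinate of \<open>e\<close>
  can be inverted.\<close>

lemma good_frame:
 assumes e: "e \<in> NZ" and U0: "openin (zar C) U0" "bproj E e \<in> U0"
 obtains U X Y where "bproj E e \<in> U" "U \<subseteq> U0" "frame C E U X Y" "X e = 1" "Y e = 0"
proof -
 obtain U X Y where fr: "bproj E e \<in> U" "frame C E U X Y" using frame_at[OF bproj_pts[OF NZ_pts[OF e]]] by blast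
 have eU: "e \<in> fib E U" using fr NZ_pts[OF e] by (simp add: fib_def)
 have "\<exists>X' Y'. frame C E U X' Y' & X' e = 1 & Y' e = 0"
 proof (cases "X e = 0")
  case False
  have "frame C E U (%w. (1 / X e) * X w + 0 * Y w) (%w. (- Y e / X e) * X w + 1 * Y w)"
   by (rule frame_change[OF swfT fr(2)]) (use False in simp)
  then have "\<exists>Y'. frame C E U (%w. (1 / X e) * X w + 0 * Y w) Y' & (1 / X e) * X e + 0 * Y e = 1 & Y' e = 0"
   using False by (intro exI[of _ "%w. (- Y e / X e) * X w + 1 * Y w"] conjI) auto
  then show ?thesis by (rule exI[of _ "%w. (1 / X e) * X w + 0 * Y w"])
 next
  case True
  then have Y: "Y e ~= 0" using frame_NZ[OF fr(2) eU] e by simp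
  have "frame C E U (%w. 0 * X w + (1 / Y e) * Y w) (%w. 1 * X w + 0 * Y w)"
   by (rule frame_change[OF swfT fr(2)]) (use Y in simp)
  then have "\<exists>Y'. frame C E U (%w. 0 * X w + (1 / Y e) * Y w) Y' & 0 * X e + (1 / Y e) * Y e = 1 & Y' e = 0"
   using True Y by (intro exI[of _ "%w. 1 * X w + 0 * Y w"] conjI) auto
  then show ?thesis by (rule exI[of _ "%w. 0 * X w + (1 / Y e) * Y w"])
 qed
 then obtain X' Y' where "frame C E U X' Y'" "X' e = 1" "Y' e = 0" by blast
 moreover have "openin (zar C) (U \<inter> U0)" using frame.openU[OF fr(2)] U0 by blast
 ultimately show thesis using that[of "U \<inter> U0" X' Y'] fr U0 frame_restrict[of E U X' Y' "U \<inter> U0"] by auto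
qed

lemma fibre_outside_chart:
 assumes fr: "frame C E U X Y" and y: "y \<in> pts S" "y' \<in> pts S" "y \<notin> vs U X" "y' \<notin> vs U X" "\<pi> y = \<pi> y'" "\<pi> y \<in> U"
 shows "y = y'"
proof -
 obtain e e' where e: "e \<in> NZ" "y = line_of E e" "e' \<in> NZ" "y' = line_of E e'" using y by (meson pts_SE)
 then have p: "bproj E e = \<pi> y" "bproj E e' = \<pi> y" using line_of_props(5) y(5) by auto
 have f: "e \<in> fib E U" "e' \<in> fib E U" using p y(6) e NZ_pts by (auto simp: fib_def)
 have X: "X e = 0" "X e' = 0" using vs_line[OF fr e(1)] vs_line[OF fr e(3)] f y e by auto
 then have Y: "Y e ~= 0" "Y e' ~= 0" using frame_NZ[OF fr f(1)] frame_NZ[OF fr f(2)] e by auto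
 have "line_of E e = line_of E e'"
  by (rule line_eq[OF fr f(2) e(3) f(1), of "Y e / Y e'"]) (use p X Y in auto)
 then show ?thesis using e by simp
qed

text \<open>A point of \<open>W\<close> lies on a constant section, which stays in \<open>W\<close>
  over almost all base points. On such a fibre \<open>W\<close> is cofinite in the affine line, and
  at most one point lies outside the chart. Two nonempty open sets therefore meet on a general
  fibre, which gives irreducibility.\<close>

lemma open_covers_fibres:
 assumes W: "openin (zar S) W" "W ~= {}"
 shows "\<forall>\<^sub>F q in generic C. finite {y \<in> pts S. \<pi> y = q & y \<notin> W} & infinite {y \<in> pts S. \<pi> y = q}"
proof -
 obtain y where y: "y \<in> W" using W by blast
 then have yS: "y \<in> pts S" using openin_subset[OF W(1)] by auto
 obtain e where e: "e \<in> NZ" "y = line_of E e" using yS by (rule pts_SE)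
 obtain U X Y where fr: "bproj E e \<in> U" "frame C E U X Y" "X e = 1"
  by (rule good_frame[OF e(1) openin_topspace bproj_pts[OF NZ_pts[OF e(1)]]]) (rule that)
 interpret sc: schart C S \<pi> U "vs U X" "us X Y" by (rule schart_of_frame[OF fr(2)])
 have eU: "e \<in> fib E U" using fr NZ_pts[OF e(1)] by (simp add: fib_def)
 have yV: "y \<in> vs U X" using vs_line[OF fr(2) e(1)] eU fr(3) e(2) by simp
 have q0: "\<pi> y \<in> U" by (rule sc.piV[OF yV])
 define c where "c = us X Y y"
 have "sc.pt (\<pi> y) c = y" unfolding c_def by (rule sc.pt_eq[OF yV])
 then have "\<forall>\<^sub>F y' in nhd S (sc.pt (\<pi> y) c). y' \<in> W" using eventually_nhdI[OF W(1) y, of "%y. y \<in> W"] by simp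
 from sc.section_eventually[OF q0 regat_const[OF pi_pts[OF yS], of c] this]
 have "\<forall>\<^sub>F q in nhd C (\<pi> y). sc.pt q c \<in> W" .
 then have "\<forall>\<^sub>F q in generic C. sc.pt q c \<in> W" using pi_pts[OF yS] by (rule eventually_nhd_generic)
 moreover have "\<forall>\<^sub>F q in generic C. q \<in> U" by (rule eventually_genericI[OF sc.openU]) (use q0 in auto)
 ultimately show ?thesis
 proof eventually_elim
  case (elim q)
  have fin: "finite {c. sc.pt q c \<notin> W}"
   by (rule sc.open_fibre_cofinite[OF W(1) elim(2,1) sc.pt(1)[OF elim(2)] sc.pt(2)[OF elim(2)]])
  have out: "finite {y \<in> pts S. \<pi> y = q & y \<notin> vs U X}"
  proof (cases "{y \<in> pts S. \<pi> y = q & y \<notin> vs U X} = {}")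
   case False
   then obtain y1 where y1: "y1 \<in> pts S" "\<pi> y1 = q" "y1 \<notin> vs U X" by blast
   have "{y \<in> pts S. \<pi> y = q & y \<notin> vs U X} \<subseteq> {y1}"
    using fibre_outside_chart[OF fr(2) _ y1(1) _ y1(3)] y1(2) elim(2) by auto
   then show ?thesis by (rule finite_subset) simp
  next
   case True
   show ?thesis unfolding True by simp
  qed
  have "{y \<in> pts S. \<pi> y = q & y \<notin> W} \<subseteq> sc.pt q ` {c. sc.pt q c \<notin> W} \<union> {y \<in> pts S. \<pi> y = q & y \<notin> vs U X}"
  proof
   fix y' assume y': "y' \<in> {y \<in> pts S. \<pi> y = q & y \<notin> W}"
   show "y' \<in> sc.pt q ` {c. sc.pt q c \<notin> W} \<union> {y \<in> pts S. \<pi> y = q & y \<notin> vs U X}"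
   proof (cases "y' \<in> vs U X")
    case True
    have "y' = sc.pt q (us X Y y')" using sc.pt_eq[OF True] y' by simp
    then have "y' \<in> sc.pt q ` {c. sc.pt q c \<notin> W}" using y' by (metis (mono_tags, lifting) imageI mem_Collect_eq)
    then show ?thesis by simp
   qed (use y' in simp)
  qed
  then have "finite {y \<in> pts S. \<pi> y = q & y \<notin> W}" by (rule finite_subset) (use fin out in simp)
  moreover have "infinite {y \<in> pts S. \<pi> y = q}"
  proof
   assume "finite {y \<in> pts S. \<pi> y = q}"
   moreover have "range (sc.pt q) \<subseteq> {y \<in> pts S. \<pi> y = q}" using sc.pt[OF elim(2)] sc.ptsV by auto
   ultimately have "finite (range (sc.pt q))" by (rule finite_subset[rotated])
   moreover have "inj (sc.pt q)" by (rule inj_on_inverseI[of _ "us X Y"]) (rule sc.pt(3)[OF elim(2)])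
   ultimately have "finite (UNIV :: complex set)" by (rule finite_imageD)
   then show False using infinite_UNIV_char_0 by blast
  qed
  ultimately show ?case by simp
 qed
qed

lemma irrS: "irr_fsp S"
proof unfold_locales
 obtain p where p: "p \<in> pts C" using nonempty by blast
 obtain U X Y where fr: "p \<in> U" "frame C E U X Y" using frame_at[OF p] by blast
 interpret sc: schart C S \<pi> U "vs U X" "us X Y" by (rule schart_of_frame[OF fr(2)])
 show "pts S ~= {}" using sc.pt(1)[OF fr(1)] sc.ptsV by blast
 fix W W' assume W: "openin (zar S) W" "openin (zar S) W'" "W ~= {}" "W' ~= {}"
 have "\<forall>\<^sub>F q in generic C. W \<inter> W' ~= {}"
  using open_covers_fibres[OF W(1,3)] open_covers_fibres[OF W(2,4)]
 proof eventually_elim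
  case (elim q)
  show ?case
  proof
   assume "W \<inter> W' = {}"
   then have "{y \<in> pts S. \<pi> y = q} \<subseteq> {y \<in> pts S. \<pi> y = q & y \<notin> W} \<union> {y \<in> pts S. \<pi> y = q & y \<notin> W'}" by blast
   then have "finite {y \<in> pts S. \<pi> y = q}" by (rule finite_subset) (use elim in simp)
   then show False using elim by simp
  qed
 qed
 then show "W \<inter> W' ~= {}" using eventually_generic_obtain by blast
qed

sublocale S: irr_fsp S by (rule irrS)

end

section \<open>The hyperplane bundle of a scroll\<close>

context frame
begin

lemma pfun_vec:
 assumes C: "space_with_functions C" and G: "G \<in> pfun C (bproj E) {X, Y} U'" and U': "openin (zar C) U'" "U' \<subseteq> U" "q \<in> U'"
 shows "regat C q (%q. G (vec q a b))"
proof -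
 interpret C: fsp C by unfold_locales (rule C)
 have ev: "\<forall>\<^sub>F q' in nhd C q. q' \<in> U" by (rule eventually_nhdI[OF U'(1,3)]) (use U' in auto)
 have qC: "q \<in> pts C" using openin_subset[OF U'(1)] U'(3) by auto
 show ?thesis using G
 proof (induction rule: pfun.induct)
  case (base g)
  have "\<forall>\<^sub>F q' in nhd C q. g (bproj E (vec q' a b)) = g q'" using ev by eventually_elim (simp add: vec)
  from C.regat_cong[OF C.regatI[OF U'(1,3) base] this] show ?case .
 next
  case (gen x)
  then consider "x = X" | "x = Y" by blast
  then show ?case
  proof cases
   case 1
   have "\<forall>\<^sub>F q' in nhd C q. x (vec q' a b) = a" using ev by eventually_elim (simp add: 1 vec)
   from C.regat_cong[OF C.regat_const[OF qC] this] show ?thesis .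
  next
   case 2
   have "\<forall>\<^sub>F q' in nhd C q. x (vec q' a b) = b" using ev by eventually_elim (simp add: 2 vec)
   from C.regat_cong[OF C.regat_const[OF qC] this] show ?thesis .
  qed
 qed (auto intro: C.regat_add C.regat_mult)
qed

lemma vec_regat:
 assumes C: "space_with_functions C" and q: "q \<in> U" and f: "regat (total E) (vec q a b) f"
 shows "regat C q (%q. f (vec q a b))"
proof -
 interpret C: fsp C by unfold_locales (rule C)
 obtain W where W: "openin (zar (total E)) W" "vec q a b \<in> W" "f \<in> reg (total E) W" using f by (auto simp: regat_def)
 from local_quotient[OF W(1,3,2) vec(1)[OF q]] obtain U' G H where
  U': "openin (zar C) U'" "U' \<subseteq> U" "bproj E (vec q a b) \<in> U'" "G \<in> pfun C (bproj E) {X, Y} U'"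
  "H \<in> pfun C (bproj E) {X, Y} U'" "H (vec q a b) ~= 0"
  "\<forall>e'\<in>fib E U'. H e' ~= 0 --> e' \<in> W & f e' = G e' / H e'" by (elim exE conjE) (rule that)
 have qU': "q \<in> U'" using U'(3) vec[OF q] by simp
 have rG: "regat C q (%q. G (vec q a b))" by (rule pfun_vec[OF C U'(4,1,2) qU'])
 have rH: "regat C q (%q. H (vec q a b))" by (rule pfun_vec[OF C U'(5,1,2) qU'])
 have "\<forall>\<^sub>F q' in nhd C q. q' \<in> U'" by (rule eventually_nhdI[OF U'(1) qU'])
 then have "\<forall>\<^sub>F q' in nhd C q. f (vec q' a b) = G (vec q' a b) / H (vec q' a b)"
  using C.regat_nz[OF rH U'(6)]
 proof eventually_elim
  case (elim q')
  then have "q' \<in> U" using U'(2) by auto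
  then have "vec q' a b \<in> fib E U'" using vec[of q' a b] elim by (simp add: fib_def)
  then show ?case using U'(7) elim by auto
 qed
 from C.regat_cong[OF C.regat_divide[OF rG rH U'(6)] this] show ?thesis .
qed

end

context scroll
begin

text \<open>The linear form on the fibres of E given by \<rho>; the tautological section consists of
  the lines on which it vanishes.\<close>

definition RR :: "'e => complex" where
 "RR e = snd (\<rho> e) 0"

definition d0 :: "nat => complex" where
 "d0 = (%j. if j = 0 then 1 else 0)"

text \<open>The nowhere vanishing section of E that spans the image of the trivial subbundle, hence
  the kernel of \<open>RR\<close>.\<close>

definition i1 :: "'c => 'e" where
 "i1 q = \<iota> (q, d0)"

lemma pts_trivial: "pts (total (trivial_bundle C 1)) = pts C \<times> affine_pts 1"
 using topspace_prod_fspace[OF swf, of 1] by (simp add: trivial_bundle_def)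

lemma d0: "d0 \<in> affine_pts 1"
 by (auto simp: d0_def affine_pts_def)

lemma hom_\<iota>: "bundle_hom (trivial_bundle C 1) E \<iota>" and hom_\<rho>: "bundle_hom E (trivial_bundle C 1) \<rho>"
 using se by (auto simp: short_exact_def)

lemma \<rho>_pts: "e \<in> pts (total E) ==> \<rho> e \<in> pts C \<times> affine_pts 1"
 using hom_\<rho> pts_trivial by (auto simp: bundle_hom_def morphism_def continuous_map_def)

lemma is_zero_trivial: "z \<in> pts C \<times> affine_pts 1 ==> is_zero_vector (trivial_bundle C 1) z \<longleftrightarrow> snd z 0 = 0"
proof -
 assume z: "z \<in> pts C \<times> affine_pts 1"
 have "is_zero_vector (trivial_bundle C 1) z \<longleftrightarrow> snd z = (%_. 0)"
  by (auto simp: is_zero_vector_def trivial_bundle_def prod_eq_iff)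
 also have "\<dots> \<longleftrightarrow> snd z 0 = 0"
 proof
  assume "snd z 0 = 0"
  show "snd z = (%_. 0)"
  proof
   fix i show "snd z i = 0" using z \<open>snd z 0 = 0\<close> by (cases i) (auto simp: affine_pts_def)
  qed
 qed simp
 finally show ?thesis .
qed

lemma RR_regat: "e \<in> pts (total E) ==> regat (total E) e RR"
proof -
 assume e: "e \<in> pts (total E)"
 let ?P = "prod_fspace C (affine_space 1)"
 have m: "morphism (total E) ?P \<rho>" using hom_\<rho> by (simp add: bundle_hom_def trivial_bundle_def)
 have pP: "pts ?P = pts C \<times> affine_pts 1" by (rule topspace_prod_fspace[OF swf])
 have "(%z. snd z 0) \<in> reg ?P (pts ?P)" unfolding pP by (rule coord_in_reg_prod[OF swf]) simp
 then have "(%z. snd z 0) \<circ> \<rho> \<in> reg (total E) {e \<in> pts (total E). \<rho> e \<in> pts ?P}"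
  using m[unfolded morphism_def, THEN conjunct2, rule_format, of "pts ?P" "%z. snd z 0"] by simp
 moreover have "{e \<in> pts (total E). \<rho> e \<in> pts ?P} = pts (total E)" using \<rho>_pts pP by auto
 ultimately have "RR \<in> reg (total E) (pts (total E))" by (simp add: RR_def[abs_def] comp_def)
 then show ?thesis by (rule T.regatI[OF openin_topspace e])
qed

lemma RR_add: "e \<in> pts (total E) ==> e' \<in> pts (total E) ==> bproj E e' = bproj E e ==> RR (badd E e e') = RR e + RR e'"
 using hom_\<rho> by (simp add: bundle_hom_def RR_def trivial_bundle_def)

lemma RR_scale: "e \<in> pts (total E) ==> RR (bscale E c e) = c * RR e"
 using hom_\<rho> by (simp add: bundle_hom_def RR_def trivial_bundle_def)

lemma i1:
 assumes q: "q \<in> pts C" shows "i1 q \<in> NZ" "bproj E (i1 q) = q" "RR (i1 q) = 0"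
proof -
 have z: "(q, d0) \<in> pts (total (trivial_bundle C 1))" using q d0 pts_trivial by simp
 have z0: "(q, %_. 0) \<in> pts (total (trivial_bundle C 1))" using q pts_trivial by (simp add: affine_pts_def)
 have iP: "i1 q \<in> pts (total E)" using hom_\<iota> z by (auto simp: bundle_hom_def morphism_def continuous_map_def i1_def)
 show "bproj E (i1 q) = q" using hom_\<iota> z by (auto simp: bundle_hom_def trivial_bundle_def i1_def)
 have "is_zero_vector (trivial_bundle C 1) (\<rho> (i1 q))" using se iP z by (auto simp: short_exact_def i1_def)
 then show "RR (i1 q) = 0" using is_zero_trivial[OF \<rho>_pts[OF iP]] by (simp add: RR_def)
 have "\<not> is_zero_vector E (i1 q)"
 proof
  assume "is_zero_vector E (i1 q)"
  then have "\<iota> (q, d0) = bscale E 0 (\<iota> (q, d0))" by (simp add: is_zero_vector_def i1_def)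
  also have "\<dots> = \<iota> (bscale (trivial_bundle C 1) 0 (q, d0))" using hom_\<iota> z by (simp add: bundle_hom_def)
  also have "bscale (trivial_bundle C 1) 0 (q, d0) = (q, %_. 0)" by (simp add: trivial_bundle_def)
  finally have "(q, d0) = (q, %_. 0)" using se z z0 by (auto simp: short_exact_def inj_on_def)
  then have "d0 = (%_. 0)" by simp
  then have "d0 0 = 0" by (rule fun_cong)
  then show False by (simp add: d0_def)
 qed
 then show "i1 q \<in> NZ" using iP by (simp add: NZ_def)
qed

lemma RR_surj: "q \<in> pts C ==> \<exists>e. e \<in> pts (total E) & bproj E e = q & RR e = 1"
proof -
 assume q: "q \<in> pts C"
 have "(q, d0) \<in> \<rho> ` pts (total E)" using se q d0 pts_trivial by (simp add: short_exact_def)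
 then obtain e where e: "e \<in> pts (total E)" "\<rho> e = (q, d0)" by auto
 have "bproj (trivial_bundle C 1) (\<rho> e) = bproj E e" using hom_\<rho> e(1) by (simp add: bundle_hom_def)
 then show ?thesis using e by (intro exI[of _ e]) (simp add: trivial_bundle_def RR_def d0_def)
qed

definition C0 :: "'e set set" where
 "C0 = tautological_section E (trivial_bundle C 1) \<rho>"

lemma line_C0: "e \<in> NZ ==> line_of E e \<in> C0 \<longleftrightarrow> RR e = 0"
proof -
 assume e: "e \<in> NZ"
 have z: "is_zero_vector (trivial_bundle C 1) (\<rho> w) \<longleftrightarrow> RR w = 0" if "w \<in> NZ" for w
  using is_zero_trivial[OF \<rho>_pts[OF NZ_pts[OF that]]] by (simp only: RR_def)
 have w: "w \<in> NZ" if "w \<in> line_of E e" for w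
  using line_of_props(2)[OF e that] line_of_props(3)[OF e] by (elim exE conjE) simp
 have "line_of E e \<in> C0 \<longleftrightarrow> (\<forall>w\<in>line_of E e. RR w = 0)"
  unfolding C0_def tautological_section_def
  using e by (auto simp only: pts_S z w)
 also have "\<dots> \<longleftrightarrow> RR e = 0"
  using line_of_props(1)[OF e] RR_scale[OF NZ_pts[OF e]] by (auto simp: line_of_def)
 finally show ?thesis .
qed

text \<open>Together with \<open>r1\<close>, the coefficients of the linear form \<open>RR\<close>
  with respect to \<open>X\<close> and \<open>Y\<close>, regular on \<open>U\<close> and without
  common zero.\<close>

definition r0 :: "'c set => ('e => complex) => ('e => complex) => 'c => complex" where
 "r0 U X Y q = RR (frame.vec E X Y q 1 0)"

definition r1 :: "'c set => ('e => complex) => ('e => complex) => 'c => complex" where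
 "r1 U X Y q = RR (frame.vec E X Y q 0 1)"

lemma frame_RR:
 assumes fr: "frame C E U X Y" and e: "e \<in> fib E U"
 shows "RR e = r0 U X Y (bproj E e) * X e + r1 U X Y (bproj E e) * Y e"
proof -
 interpret frame C E U X Y by (rule fr)
 let ?q = "bproj E e"
 have q: "?q \<in> U" using e by (simp add: fib_def)
 let ?a = "vec ?q 1 0" and ?b = "vec ?q 0 1"
 note a = vec[OF q, of 1 0] and b = vec[OF q, of 0 1]
 have ab: "bscale E (X e) ?a \<in> fib E U" "bscale E (Y e) ?b \<in> fib E U" using bscale_fib a b by auto
 have p: "bproj E (bscale E (X e) ?a) = ?q" "bproj E (bscale E (Y e) ?b) = ?q" using bscale a b by auto
 have "e = badd E (bscale E (X e) ?a) (bscale E (Y e) ?b)"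
  by (rule vector_unique[OF e badd_fib[OF ab]])
   (use badd[OF ab] p bscale[OF a(1), of "X e"] bscale[OF b(1), of "Y e"] a b in auto)
 then have "RR e = RR (bscale E (X e) ?a) + RR (bscale E (Y e) ?b)"
  using RR_add[of "bscale E (X e) ?a" "bscale E (Y e) ?b"] ab p by (simp add: fib_def)
 also have "\<dots> = X e * RR ?a + Y e * RR ?b" using RR_scale a b by (simp add: fib_def)
 finally show ?thesis by (simp add: r0_def r1_def)
qed

lemma r_regat: "frame C E U X Y ==> q \<in> U ==> regat C q (r0 U X Y)" "frame C E U X Y ==> q \<in> U ==> regat C q (r1 U X Y)"
proof -
 assume fr: "frame C E U X Y" and q: "q \<in> U"
 interpret frame C E U X Y by (rule fr)
 have v: "vec q a b \<in> pts (total E)" for a b using vec[OF q] by (simp add: fib_def)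
 show "regat C q (r0 U X Y)" unfolding r0_def[abs_def] by (rule vec_regat[OF swf q RR_regat[OF v]])
 show "regat C q (r1 U X Y)" unfolding r1_def[abs_def] by (rule vec_regat[OF swf q RR_regat[OF v]])
qed

lemma r_nz:
 assumes fr: "frame C E U X Y" and q: "q \<in> U" shows "r0 U X Y q ~= 0 \<or> r1 U X Y q ~= 0"
proof -
 have "q \<in> pts C" using openin_subset[OF frame.openU[OF fr]] q by auto
 then obtain e where e: "e \<in> pts (total E)" "bproj E e = q" "RR e = 1" using RR_surj by blast
 then have "e \<in> fib E U" using q by (simp add: fib_def)
 from frame_RR[OF fr this] show ?thesis using e by auto
qed

lemma i1_regat:
 assumes fr: "frame C E U X Y" and q: "q \<in> U" shows "regat C q (%q. X (i1 q))"
proof -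
 interpret frame C E U X Y by (rule fr)
 let ?P = "prod_fspace C (affine_space 1)"
 have m: "morphism ?P (total E) \<iota>" using hom_\<iota> by (simp add: bundle_hom_def trivial_bundle_def)
 have qC: "q \<in> pts C" using openin_subset[OF openU] q by auto
 have oU: "openin (zar (total E)) (fib E U)" by (rule openin_fib[OF openU])
 let ?O = "{z \<in> pts ?P. \<iota> z \<in> fib E U}"
 have o: "openin (zar ?P) ?O" using m oU by (auto simp: morphism_def continuous_map_def)
 have "X \<in> reg (total E) (fib E U)" unfolding T.reg_iff[OF oU] using X_regat by blast
 then have F: "X \<circ> \<iota> \<in> reg ?P ?O" using m[unfolded morphism_def, THEN conjunct2, rule_format, of "fib E U" X] oU by simp
 have "(q, d0) \<in> pts ?P" using topspace_prod_fspace[OF swf, of 1] qC d0 by simp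
 then have "(q, d0) \<in> ?O" using i1[OF qC] q NZ_pts by (simp add: fib_def i1_def)
 from section_regat_prod[OF swf d0 o F this qC] show ?thesis by (simp add: i1_def comp_def)
qed

lemma fibre_eq: "fibre E q = {y \<in> pts S. \<pi> y = q}"
 by (simp add: fibre_def)

lemma fibre_nonempty: "q \<in> pts C ==> \<exists>e. e \<in> NZ & bproj E e = q & RR e = 1"
proof -
 assume q: "q \<in> pts C"
 obtain e where e: "e \<in> pts (total E)" "bproj E e = q" "RR e = 1" using RR_surj[OF q] by blast
 have "\<not> is_zero_vector E e"
 proof
  assume "is_zero_vector E e"
  then have "RR e = RR (bscale E 0 e)" by (simp add: is_zero_vector_def)
  then show False using RR_scale[OF e(1), of 0] e(3) by simp
 qed
 then show ?thesis using e by (auto simp: NZ_def)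
qed

lemma fibre_inj: "q \<in> pts C ==> fibre E q = fibre E q' ==> q = q'"
proof -
 assume q: "q \<in> pts C" and e: "fibre E q = fibre E q'"
 obtain w where w: "w \<in> NZ" "bproj E w = q" using fibre_nonempty[OF q] by blast
 then have "line_of E w \<in> fibre E q" by (auto simp: fibre_eq pts_S line_of_props(5))
 then have "line_of E w \<in> fibre E q'" using e by simp
 then show ?thesis using w line_of_props(5) by (auto simp: fibre_eq)
qed

lemma C0_neq_fibre: "C0 ~= fibre E q"
proof
 assume e: "C0 = fibre E q"
 obtain q' where q': "q' \<in> pts C" "q' ~= q" using infinite_pts by (metis finite.emptyI finite.insertI insertI1 rev_finite_subset subsetI)
 have "line_of E (i1 q') \<in> C0" using line_C0[OF i1(1)[OF q'(1)]] i1(3)[OF q'(1)] by simp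
 then show False using e line_of_props(5)[OF i1(1)[OF q'(1)]] i1(2)[OF q'(1)] q'(2) by (simp add: fibre_eq)
qed

definition DD :: "('c => int) => 'e set set => int" where
 "DD \<delta> = scroll_divisor E (trivial_bundle C 1) \<rho> \<delta>"

lemma DD_eq: "DD \<delta> Z = (if Z = C0 then 1 else 0) + (\<Sum>p | \<delta> p ~= 0. \<delta> p * (if Z = fibre E p then 1 else 0))"
 by (simp add: DD_def scroll_divisor_def pullback_divisor_def prime_divisor_def C0_def)

text \<open>Distinct base points have distinct fibres and none of these is C0, so the summands of
  the divisor do not interfere.\<close>

lemma DD_fibre:
 assumes \<delta>: "point_divisor C \<delta>" and q: "q \<in> pts C" shows "DD \<delta> (fibre E q) = \<delta> q"
proof -
 have "(\<Sum>p | \<delta> p ~= 0. \<delta> p * (if fibre E q = fibre E p then 1 else 0)) = (\<Sum>p | \<delta> p ~= 0. if p = q then \<delta> p else 0)"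
  by (rule sum.cong) (use fibre_inj[OF q] in auto)
 also have "\<dots> = \<delta> q" using \<delta> by (simp add: point_divisor_def)
 finally show ?thesis using C0_neq_fibre by (auto simp: DD_eq)
qed

lemma DD_C0: "DD \<delta> C0 = 1"
proof -
 have "(\<Sum>p | \<delta> p ~= 0. \<delta> p * (if C0 = fibre E p then 1 else 0)) = 0"
  by (rule sum.neutral) (use C0_neq_fibre in simp)
 then show ?thesis by (simp add: DD_eq)
qed

lemma DD_nz:
 assumes "DD \<delta> Z ~= 0" shows "Z = C0 \<or> (\<exists>q. \<delta> q ~= 0 & Z = fibre E q)"
proof (rule ccontr)
 assume n: "\<not> ?thesis"
 then have "(\<Sum>p | \<delta> p ~= 0. \<delta> p * (if Z = fibre E p then 1 else 0)) = 0" by (intro sum.neutral) auto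
 then show False using assms n by (simp add: DD_eq)
qed

lemma DD_finite: "point_divisor C \<delta> ==> finite {Z. DD \<delta> Z ~= 0}"
 by (rule finite_subset[of _ "insert C0 (fibre E ` {q. \<delta> q ~= 0})"])
  (use DD_nz in \<open>auto simp: point_divisor_def\<close>)

lemma in_support:
 assumes \<delta>: "point_divisor C \<delta>" and y: "y \<in> pts S"
 shows "y \<in> divisor_support (DD \<delta>) \<longleftrightarrow> y \<in> C0 \<or> \<delta> (\<pi> y) ~= 0"
proof
 assume "y \<in> divisor_support (DD \<delta>)"
 then obtain Z where "DD \<delta> Z ~= 0" "y \<in> Z" by (auto simp: divisor_support_def)
 then show "y \<in> C0 \<or> \<delta> (\<pi> y) ~= 0" using DD_nz[of \<delta> Z] by (auto simp: fibre_eq)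
next
 assume "y \<in> C0 \<or> \<delta> (\<pi> y) ~= 0"
 then show "y \<in> divisor_support (DD \<delta>)"
 proof
  assume "y \<in> C0" then show ?thesis unfolding divisor_support_def using DD_C0[of \<delta>] by (intro UnionI[of C0]) auto
 next
  assume n: "\<delta> (\<pi> y) ~= 0"
  then have "DD \<delta> (fibre E (\<pi> y)) ~= 0" using DD_fibre[OF \<delta> pi_pts[OF y]] by simp
  moreover have "y \<in> fibre E (\<pi> y)" using y by (simp add: fibre_eq)
  ultimately show ?thesis by (auto simp: divisor_support_def)
 qed
qed

lemma generic_pi: "eventually P (generic C) ==> \<forall>\<^sub>F y in generic S. P (\<pi> y)"
proof -
 assume "eventually P (generic C)"
 then obtain U where U: "openin (zar C) U" "U ~= {}" "\<forall>q\<in>U. P q" by (auto simp: eventually_generic)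
 then obtain q where q: "q \<in> U" "q \<in> pts C" using openin_subset by blast
 obtain w where "w \<in> NZ" "bproj E w = q" using fibre_nonempty[OF q(2)] by blast
 then have "line_of E w \<in> {y \<in> pts S. \<pi> y \<in> U}" using q by (auto simp: pts_S line_of_props(5))
 then show ?thesis by (intro S.eventually_genericI[OF open_pi[OF U(1)]]) (use U in auto)
qed

end

text \<open>Over \<open>U\<close> the point \<open>p\<close> is the only possible zero of the chosen
  uniformizer and the only possible point of the support of \<delta>, so the divisor there is C0
  plus \<delta>(p) times one fibre.\<close>

locale small_frame = scroll C E \<iota> \<rho> for C :: "'c fspace" and E :: "('c, 'e) vbundle" and \<iota> \<rho> +
 fixes p :: 'c and U :: "'c set" and X Y :: "'e => complex" and \<delta> :: "'c => int"
 assumes pU: "p \<in> U" and fr: "frame C E U X Y"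
  and zz_U: "q \<in> U ==> regat C q (zz p)" and zz_nz: "q \<in> U ==> zz p q = 0 ==> q = p"
  and \<delta>: "point_divisor C \<delta>" and \<delta>_U: "q \<in> U ==> q ~= p ==> \<delta> q = 0"
begin

sublocale F: frame C E U X Y by (rule fr)
sublocale sc: schart C S \<pi> U "vs U X" "us X Y" by (rule schart_of_frame[OF fr])

lemma swap: "small_frame C E \<iota> \<rho> p U Y X \<delta>"
 by (intro small_frame.intro scroll_axioms small_frame_axioms.intro frame_swap[OF swfT fr] pU zz_U zz_nz \<delta> \<delta>_U)

lemma pC: "p \<in> pts C"
 using openin_subset[OF F.openU] pU by auto

text \<open>The function RR / X in the coordinates of the chart; it will be the local equation of
  C0.\<close>

definition rr :: "'e set => complex" where
 "rr y = r0 U X Y (\<pi> y) + r1 U X Y (\<pi> y) * us X Y y"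

text \<open>The local equation of the whole divisor on the chart, with the fibre over
  \<open>p\<close> as the only possible component besides C0.\<close>

definition g0 :: "'e set => complex" where
 "g0 y = rr y * zz p (\<pi> y) powi \<delta> p"

lemma rr_line: "e \<in> NZ ==> e \<in> fib E U ==> X e ~= 0 ==> rr (line_of E e) = RR e / X e"
 using frame_RR[OF fr] us_line[OF fr] line_of_props(5) by (simp add: rr_def field_simps)

lemma rr_C0: "y \<in> vs U X ==> y \<in> C0 \<longleftrightarrow> rr y = 0"
proof -
 assume y: "y \<in> vs U X"
 obtain e where e: "e \<in> NZ" "e \<in> fib E U" "y = line_of E e" "X e = 1"
  by (rule frame_normalize[OF fr y]) (rule that)
 then show ?thesis using line_C0 rr_line by simp
qed

lemma rr_regat: "y \<in> vs U X ==> regat S y rr"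
 unfolding rr_def[abs_def]
 by (intro S.regat_add S.regat_mult sc.pi_regat sc.u_regat r_regat[OF fr] sc.piV)

lemma rr_generic: "\<forall>\<^sub>F y in generic S. rr y ~= 0"
proof -
 obtain c where c: "r0 U X Y p + r1 U X Y p * c ~= 0"
 proof (cases "r0 U X Y p = 0")
  case True
  then have "r1 U X Y p ~= 0" using r_nz[OF fr pU] by simp
  then show thesis using that[of 1] True by simp
 next
  case False then show thesis using that[of 0] by simp
 qed
 show ?thesis by (rule S.generic_nz[OF rr_regat[OF sc.pt(1)[OF pU, of c]]]) (use c sc.pt[OF pU] in \<open>simp add: rr_def\<close>)
qed

lemma zz_pi_generic: "\<forall>\<^sub>F y in generic S. zz p (\<pi> y) ~= 0"
 by (rule generic_pi[OF zz_generic[OF pC]])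

lemma generic_off_support: "\<forall>\<^sub>F y in generic S. y \<in> pts S & y \<in> vs U X & y \<notin> divisor_support (DD \<delta>)"
proof -
 have "\<forall>\<^sub>F y in generic S. y \<in> vs U X" by (rule S.eventually_genericI[OF sc.openV]) (use sc.pt(1)[OF pU] in auto)
 then show ?thesis using rr_generic generic_pi[OF generic_neq[of p]]
 proof eventually_elim
  case (elim y)
  then have "y \<in> pts S" "\<pi> y \<in> U" using sc.ptsV sc.piV by auto
  then show ?case using elim in_support[OF \<delta>] rr_C0 \<delta>_U by auto
 qed
qed

text \<open>Where \<open>rr\<close> is nonzero it is a unit. At a zero of \<open>rr\<close> the
  coefficient \<open>r1\<close> is invertible and C0 is the section u = -r0/r1, so
  \<open>divide_linear\<close> applies.\<close>

lemma C0_generates: "generates_ideal S C0 (vs U X) rr"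
 unfolding generates_ideal_def
proof (intro conjI ballI allI impI)
 show "rr \<in> reg S (vs U X)" unfolding S.reg_iff[OF sc.openV] using rr_regat by blast
 show "rr y = 0" if "y \<in> vs U X \<inter> C0" for y using that rr_C0 by auto
 fix V f assume "openin (zar S) V & V \<subseteq> vs U X & f \<in> reg S V & (\<forall>y\<in>V \<inter> C0. f y = 0)"
 then have V: "openin (zar S) V" "V \<subseteq> vs U X" "f \<in> reg S V" "\<And>y. y \<in> V ==> y \<in> C0 ==> f y = 0" by auto
 show "\<exists>a\<in>reg S V. \<forall>y\<in>V. f y = a y * rr y"
 proof (rule S.divides_local_global[OF V(1) rr_generic])
  fix y assume y: "y \<in> V"
  then have yV: "y \<in> vs U X" using V by auto
  have q: "\<pi> y \<in> U" by (rule sc.piV[OF yV])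
  have rf: "regat S y f" by (rule S.regatI[OF V(1) y V(3)])
  show "\<exists>a. regat S y a & (\<forall>\<^sub>F y' in nhd S y. f y' = a y' * rr y')"
  proof (cases "rr y = 0")
   case False
   have "\<forall>\<^sub>F y' in nhd S y. f y' = (f y' / rr y') * rr y'"
    using S.regat_nz[OF rr_regat[OF yV] False] by eventually_elim simp
   then show ?thesis using S.regat_divide[OF rf rr_regat[OF yV] False] by (intro exI[of _ "%y. f y / rr y"]) simp
  next
   case True
   define c where "c = (%q. - r0 U X Y q / r1 U X Y q)"
   have n1: "r1 U X Y (\<pi> y) ~= 0" using True r_nz[OF fr q] by (auto simp: rr_def)
   have rc: "regat C (\<pi> y) c" unfolding c_def by (intro regat_divide regat_uminus r_regat[OF fr] q n1)
   have uc: "us X Y y = c (\<pi> y)" using True n1 by (simp add: rr_def c_def field_simps eq_neg_iff_add_eq_0)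
   have r1r: "regat S y (%y. r1 U X Y (\<pi> y))" by (rule sc.pi_regat[OF yV r_regat(2)[OF fr q]])
   have "\<exists>c'. regat C (\<pi> y) c' & us X Y y = c' (\<pi> y) & (\<forall>q. c' q = (if r1 U X Y q = 0 then 0 else c q)) "
   proof (intro exI conjI allI)
    have "\<forall>\<^sub>F q in nhd C (\<pi> y). (if r1 U X Y q = 0 then 0 else c q) = c q"
     using regat_nz[OF r_regat(2)[OF fr q] n1] by eventually_elim simp
    from regat_cong[OF rc this] show "regat C (\<pi> y) (%q. if r1 U X Y q = 0 then 0 else c q)" .
   qed (use uc n1 in auto)
   have "\<exists>a. regat S y a & (\<forall>\<^sub>F y' in nhd S y. f y' = a y' * (us X Y y' - c (\<pi> y')))"
   proof -
    \<comment> \<open>Where \<open>r1\<close> vanishes the total quotient \<open>c\<close> is 0 and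
      does not describe C0; such points are removed from \<open>V\<close> first.\<close>
    let ?W = "{y' \<in> V. r1 U X Y (\<pi> y') ~= 0}"
    have r1V: "(%y. r1 U X Y (\<pi> y)) \<in> reg S V" unfolding S.reg_iff[OF V(1)]
     using V(2) sc.pi_regat r_regat(2)[OF fr] sc.piV by auto
    have oW: "openin (zar S) ?W" by (rule S.reg_open[OF V(1) r1V])
    have fW: "f \<in> reg S ?W" by (rule S.reg_restrict[OF V(3,1) oW]) auto
    show ?thesis
    proof (rule sc.divide_linear[OF oW fW _ yV rc uc])
     show "y \<in> ?W" using y n1 by simp
     fix q' assume q': "q' \<in> U" "sc.pt q' (c q') \<in> ?W"
     then have "r1 U X Y q' ~= 0" using sc.pt[OF q'(1)] by simp
     then have "rr (sc.pt q' (c q')) = 0" using sc.pt[OF q'(1)] by (simp add: rr_def c_def)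
     then have "sc.pt q' (c q') \<in> C0" using rr_C0[OF sc.pt(1)[OF q'(1)]] by simp
     then show "f (sc.pt q' (c q')) = 0" using V(4) q'(2) by simp
    qed
   qed
   then obtain a where a: "regat S y a" "\<forall>\<^sub>F y' in nhd S y. f y' = a y' * (us X Y y' - c (\<pi> y'))" by (elim exE conjE)
   have "\<forall>\<^sub>F y' in nhd S y. f y' = (a y' / r1 U X Y (\<pi> y')) * rr y'"
    using a(2) S.regat_nz[OF r1r n1]
    by eventually_elim (simp add: rr_def c_def field_simps)
   then show ?thesis using S.regat_divide[OF a(1) r1r n1]
    by (intro exI[of _ "%y'. a y' / r1 U X Y (\<pi> y')"]) simp
  qed
 qed
qed

lemma fibre_generates: "generates_ideal S (fibre E p) (vs U X) (%y. zz p (\<pi> y))"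
 unfolding generates_ideal_def
proof (intro conjI ballI allI impI)
 have zr: "regat S y (%y. zz p (\<pi> y))" if "y \<in> vs U X" for y
  by (rule sc.pi_regat[OF that zz_U[OF sc.piV[OF that]]])
 show "(%y. zz p (\<pi> y)) \<in> reg S (vs U X)" unfolding S.reg_iff[OF sc.openV] using zr by blast
 show "zz p (\<pi> y) = 0" if "y \<in> vs U X \<inter> fibre E p" for y using that zz_zero[OF pC] by (simp add: fibre_eq)
 fix V f assume "openin (zar S) V & V \<subseteq> vs U X & f \<in> reg S V & (\<forall>y\<in>V \<inter> fibre E p. f y = 0)"
 then have V: "openin (zar S) V" "V \<subseteq> vs U X" "f \<in> reg S V" "\<And>y. y \<in> V ==> y \<in> fibre E p ==> f y = 0" by auto
 show "\<exists>a\<in>reg S V. \<forall>y\<in>V. f y = a y * zz p (\<pi> y)"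
 proof (rule S.divides_local_global[OF V(1) zz_pi_generic])
  fix y assume y: "y \<in> V"
  then have yV: "y \<in> vs U X" using V by auto
  have rf: "regat S y f" by (rule S.regatI[OF V(1) y V(3)])
  show "\<exists>a. regat S y a & (\<forall>\<^sub>F y' in nhd S y. f y' = a y' * zz p (\<pi> y'))"
  proof (cases "\<pi> y = p")
   case False
   then have n: "zz p (\<pi> y) ~= 0" using zz_nz[OF sc.piV[OF yV]] by auto
   have "\<forall>\<^sub>F y' in nhd S y. f y' = (f y' / zz p (\<pi> y')) * zz p (\<pi> y')"
    using S.regat_nz[OF zr[OF yV] n] by eventually_elim simp
   then show ?thesis using S.regat_divide[OF rf zr[OF yV] n]
    by (intro exI[of _ "%y'. f y' / zz p (\<pi> y')"]) simp
  next
   case True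
   show ?thesis
   proof (rule sc.divide_fibre[OF V(1,3) y yV])
    show "uniformizer C (\<pi> y) (zz p)" using uniformizer_zz[OF pC] True by simp
    fix y' assume "y' \<in> V" "\<pi> y' = \<pi> y"
    then show "f y' = 0" using V(4)[of y'] openin_subset[OF V(1)] True by (auto simp: fibre_eq)
   qed
  qed
 qed
qed

text \<open>Local equations of all components of the divisor at once; those that miss the chart have
  equation 1.\<close>

definition hh :: "'e set set => 'e set => complex" where
 "hh Z = (if Z = C0 then rr else if Z = fibre E p then (%y. zz p (\<pi> y)) else (%_. 1))"

lemma hh_generates: "DD \<delta> Z ~= 0 ==> generates_ideal S Z (vs U X) (hh Z)"
proof (cases "Z = C0 \<or> Z = fibre E p")
 case True
 then show ?thesis using C0_generates fibre_generates C0_neq_fibre[of p] by (auto simp: hh_def)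
next
 case False
 assume "DD \<delta> Z ~= 0"
 with False obtain q where q: "\<delta> q ~= 0" "Z = fibre E q" "q ~= p" using DD_nz by blast
 then have "q \<notin> U" using \<delta>_U by auto
 then have e: "vs U X \<inter> Z = {}" using sc.piV q(2) by (auto simp: fibre_eq)
 have h: "hh Z = (%_. 1)" using False by (simp add: hh_def)
 have "\<exists>a\<in>reg S V. \<forall>y\<in>V. f y = a y * 1" if "f \<in> reg S V" for f V by (rule bexI[OF _ that]) simp
 then show ?thesis unfolding generates_ideal_def h using S.reg_const[OF sc.openV, of 1] e by auto
qed

lemma hh_generic: "\<forall>\<^sub>F y in generic S. hh Z y ~= 0"
 using rr_generic zz_pi_generic by (cases "Z = C0"; cases "Z = fibre E p") (simp_all add: hh_def)

lemma g0_prod: "(\<Prod>Z | DD \<delta> Z ~= 0. hh Z y powi DD \<delta> Z) = g0 y"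
proof -
 \<comment> \<open>The fibre over \<open>p\<close> may be absent from the support; its exponent is
   then 0. Other components contribute the factor 1. So the two index sets give the same
   product.\<close>
 have "(\<Prod>Z | DD \<delta> Z ~= 0. hh Z y powi DD \<delta> Z) = (\<Prod>Z\<in>{C0, fibre E p}. hh Z y powi DD \<delta> Z)"
  by (rule prod.mono_neutral_cong) (use DD_finite[OF \<delta>] in \<open>auto simp: hh_def\<close>)
 also have "\<dots> = rr y powi DD \<delta> C0 * zz p (\<pi> y) powi DD \<delta> (fibre E p)"
  using C0_neq_fibre[of p] by (simp add: hh_def)
 also have "\<dots> = g0 y" by (simp add: DD_C0 DD_fibre[OF \<delta> pC] g0_def)
 finally show ?thesis .
qed

lemma local_equation_g0:
 assumes "openin (zar S) W" "W \<subseteq> vs U X" shows "local_equation S (DD \<delta>) W g0"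
proof -
 have "generates_ideal S Z W (hh Z)" if "DD \<delta> Z ~= 0" for Z
  unfolding generates_ideal_def
 proof (intro conjI allI impI)
  note g = hh_generates[OF that, unfolded generates_ideal_def]
  show "hh Z \<in> reg S W" using S.reg_restrict[OF _ sc.openV assms] g by blast
  show "\<forall>y\<in>W \<inter> Z. hh Z y = 0" using g assms(2) by blast
  fix V f assume V: "openin (zar S) V & V \<subseteq> W & f \<in> reg S V & (\<forall>y\<in>V \<inter> Z. f y = 0)"
  then have "V \<subseteq> vs U X" using assms(2) by blast
  with V show "\<exists>a\<in>reg S V. \<forall>y\<in>V. f y = a y * hh Z y"
   using g[THEN conjunct2, THEN conjunct2, rule_format, of V f] by simp
 qed
 moreover have "g0 = (%y. \<Prod>Z | DD \<delta> Z ~= 0. hh Z y powi DD \<delta> Z)" by (simp add: g0_prod)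
 ultimately show ?thesis unfolding local_equation_def using assms(1) by (intro conjI exI[of _ hh]) auto
qed

text \<open>Corresponding factors of two local equations generate the same ideal and differ by
  units; powers of units, also negative ones, are again units.\<close>

lemma local_equation_unit:
 assumes le: "local_equation S (DD \<delta>) U' g" and y: "y \<in> U'" "y \<in> vs U X"
 shows "\<exists>a. regat S y a & a y ~= 0 & (\<forall>\<^sub>F y' in nhd S y. g y' = a y' * g0 y')"
proof -
 obtain h where o: "openin (zar S) U'" and h: "\<And>Z. DD \<delta> Z ~= 0 ==> generates_ideal S Z U' (h Z)"
  "g = (%y. \<Prod>Z | DD \<delta> Z ~= 0. h Z y powi DD \<delta> Z)"
  using le unfolding local_equation_def by blast
 have "\<forall>Z\<in>{Z. DD \<delta> Z ~= 0}. \<exists>a. regat S y a & a y ~= 0 & (\<forall>\<^sub>F y' in nhd S y. h Z y' = a y' * hh Z y')"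
 proof
  fix Z assume "Z \<in> {Z. DD \<delta> Z ~= 0}"
  then have Z: "DD \<delta> Z ~= 0" by simp
  obtain a where "regat S y a" "a y ~= 0" "\<forall>\<^sub>F y' in nhd S y. h Z y' = a y' * hh Z y'"
   by (rule S.generates_ideal_unit[OF hh_generates[OF Z] h(1)[OF Z] sc.openV o y(2,1) hh_generic]) (rule that)
  then show "\<exists>a. regat S y a & a y ~= 0 & (\<forall>\<^sub>F y' in nhd S y. h Z y' = a y' * hh Z y')"
   by (intro exI[of _ a]) simp
 qed
 from bchoice[OF this] obtain a where a: "\<forall>Z\<in>{Z. DD \<delta> Z ~= 0}. regat S y (a Z) & a Z y ~= 0 & (\<forall>\<^sub>F y' in nhd S y. h Z y' = a Z y' * hh Z y')"
  by (elim exE)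
 define b where "b = (%y. \<Prod>Z | DD \<delta> Z ~= 0. a Z y powi DD \<delta> Z)"
 have "regat S y b" unfolding b_def
  by (rule S.regat_prod[OF sc.ptsV[OF y(2)]], rule S.regat_powi) (use a in auto)
 moreover have "b y ~= 0" unfolding b_def using a DD_finite[OF \<delta>] by auto
 moreover have "\<forall>\<^sub>F y' in nhd S y. \<forall>Z\<in>{Z. DD \<delta> Z ~= 0}. h Z y' = a Z y' * hh Z y'"
  using a DD_finite[OF \<delta>] by (intro eventually_ball_finite) auto
 then have "\<forall>\<^sub>F y' in nhd S y. g y' = b y' * g0 y'"
 proof eventually_elim
  case (elim y')
  have "g y' = (\<Prod>Z | DD \<delta> Z ~= 0. a Z y' powi DD \<delta> Z * hh Z y' powi DD \<delta> Z)"
   unfolding h(2) using elim by (intro prod.cong) (auto simp: power_int_mult_distrib)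
  also have "\<dots> = b y' * g0 y'" unfolding prod.distrib b_def g0_prod ..
  finally show ?case .
 qed
 ultimately show ?thesis by (intro exI[of _ b]) simp
qed

text \<open>\<open>stalk_pow\<close> allows any local equation near \<open>y\<close>. Since these
  differ from \<open>g0\<close> by units, membership can be tested with \<open>g0\<close>
  alone.\<close>

lemma stalk_iff:
 assumes y: "y \<in> vs U X"
 shows "s \<in> stalk_pow S (DD \<delta>) y k \<longleftrightarrow> (\<exists>t\<in>max_ideal_pow S y k.
  \<forall>\<^sub>F y' in nhd S y. y' \<notin> divisor_support (DD \<delta>) --> t y' = s y' * g0 y')"
proof
 assume "s \<in> stalk_pow S (DD \<delta>) y k"
 then obtain U' g t where *: "y \<in> U'" "local_equation S (DD \<delta>) U' g" "t \<in> max_ideal_pow S y k"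
  "\<forall>y'\<in>U' - divisor_support (DD \<delta>). t y' = s y' * g y'" unfolding stalk_pow_def by blast
 from local_equation_unit[OF *(2,1) y] obtain a where a: "regat S y a" "a y ~= 0" "\<forall>\<^sub>F y' in nhd S y. g y' = a y' * g0 y'"
  by (elim exE conjE)
 have "openin (zar S) U'" using *(2) by (simp add: local_equation_def)
 then have "\<forall>\<^sub>F y' in nhd S y. y' \<in> U'" using *(1) by (rule eventually_nhdI)
 then have "\<forall>\<^sub>F y' in nhd S y. y' \<notin> divisor_support (DD \<delta>) --> (1 / a y') * t y' = s y' * g0 y'"
  using a(3) S.regat_nz[OF a(1,2)] by eventually_elim (use *(4) in auto)
 moreover have "(%y'. (1 / a y') * t y') \<in> max_ideal_pow S y k"
  by (rule S.max_ideal_pow_mult[OF *(3) sc.ptsV[OF y] S.regat_inverse[OF a(1,2)]])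
 ultimately show "\<exists>t\<in>max_ideal_pow S y k. \<forall>\<^sub>F y' in nhd S y. y' \<notin> divisor_support (DD \<delta>) --> t y' = s y' * g0 y'"
  by (intro bexI[of _ "%y'. (1 / a y') * t y'"]) simp_all
next
 assume "\<exists>t\<in>max_ideal_pow S y k. \<forall>\<^sub>F y' in nhd S y. y' \<notin> divisor_support (DD \<delta>) --> t y' = s y' * g0 y'"
 then obtain t where t: "t \<in> max_ideal_pow S y k"
  "\<forall>\<^sub>F y' in nhd S y. y' \<notin> divisor_support (DD \<delta>) --> t y' = s y' * g0 y'" by (elim bexE)
 have "\<forall>\<^sub>F y' in nhd S y. y' \<in> vs U X & (y' \<notin> divisor_support (DD \<delta>) --> t y' = s y' * g0 y')"
  using t(2) sc.eventually_V[OF y] by eventually_elim simp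
 then obtain W where W: "openin (zar S) W" "y \<in> W" "\<forall>y'\<in>W. y' \<in> vs U X & (y' \<notin> divisor_support (DD \<delta>) --> t y' = s y' * g0 y')"
  using sc.ptsV[OF y] by (auto simp: eventually_nhdsin)
 then have "local_equation S (DD \<delta>) W g0" by (intro local_equation_g0) auto
 then show "s \<in> stalk_pow S (DD \<delta>) y k" unfolding stalk_pow_def using W t(1)
  by (intro CollectI exI[of _ W] exI[of _ g0] exI[of _ t]) auto
qed

text \<open>The germs representing \<open>s\<close> times \<open>g0\<close> are determined off the
  support, hence generically, so their values are unique and they glue over the chart.\<close>

lemma section_chart:
 assumes s: "\<And>y. y \<in> vs U X ==> s \<in> stalk_pow S (DD \<delta>) y 0"
 obtains t where "t \<in> reg S (vs U X)" "\<And>y. y \<in> vs U X ==> y \<notin> divisor_support (DD \<delta>) ==> t y = s y * g0 y"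
proof -
 define G where "G = (%y t. regat S y t & (\<forall>\<^sub>F y' in nhd S y. y' \<notin> divisor_support (DD \<delta>) --> t y' = s y' * g0 y'))"
 have ex: "\<exists>t. G y t" if "y \<in> vs U X" for y
  using s[OF that] unfolding stalk_iff[OF that] G_def using S.max_ideal_pow_0_iff[OF sc.ptsV[OF that]] by auto
 obtain t where t: "t \<in> reg S (vs U X)" "\<And>y t'. y \<in> vs U X ==> G y t' ==> t y = t' y"
 proof (rule S.glue[OF sc.openV, of G])
  show "\<forall>\<^sub>F y' in nhd S y. G y' t" if g: "G y t" for y t
  proof -
   have "\<forall>\<^sub>F y' in nhd S y. regat S y' t" using g S.regat_ev by (simp add: G_def)
   moreover have "\<forall>\<^sub>F y' in nhd S y. \<forall>\<^sub>F y' in nhd S y'. y' \<notin> divisor_support (DD \<delta>) --> t y' = s y' * g0 y'"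
    by (rule eventually_nhd_nhd) (use g in \<open>simp add: G_def\<close>)
   ultimately show ?thesis by eventually_elim (simp add: G_def)
  qed
  show "t y = t' y" if y: "y \<in> vs U X" and g: "G y t" "G y t'" for y t t'
  proof (rule S.identity_at)
   have "\<forall>\<^sub>F y' in nhd S y. y' \<notin> divisor_support (DD \<delta>) --> t y' = s y' * g0 y'"
    "\<forall>\<^sub>F y' in nhd S y. y' \<notin> divisor_support (DD \<delta>) --> t' y' = s y' * g0 y'" using g by (simp_all add: G_def)
   then have "\<forall>\<^sub>F y' in nhd S y. y' \<notin> divisor_support (DD \<delta>) --> t y' = t' y'" by eventually_elim simp
   then have "\<forall>\<^sub>F y' in generic S. y' \<notin> divisor_support (DD \<delta>) --> t y' = t' y'"
    using sc.ptsV[OF y] by (rule S.eventually_nhd_generic)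
   then show "\<forall>\<^sub>F y' in generic S. t y' = t' y'" using generic_off_support by eventually_elim simp
  qed (use g in \<open>auto simp: G_def\<close>)
 qed (use ex in \<open>auto simp: G_def\<close>)
 have "t y = s y * g0 y" if y: "y \<in> vs U X" "y \<notin> divisor_support (DD \<delta>)" for y
 proof -
  obtain t' where t': "G y t'" using ex[OF y(1)] by blast
  then have "\<forall>\<^sub>F y' in nhd S y. y' \<notin> divisor_support (DD \<delta>) --> t' y' = s y' * g0 y'" by (simp add: G_def)
  from eventually_nhd_self[OF this sc.ptsV[OF y(1)]] show ?thesis using t(2)[OF y(1) t'] y(2) by simp
 qed
 with t(1) show thesis by (rule that)
qed

text \<open>The product of \<open>s\<close> with \<open>RR\<close> and the power of the uniformizer
  is homogeneous of degree one in the vector \<open>e\<close>; here it is a linear form with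
  coefficients \<alpha> and \<beta>. Vectors with RR = 0 or over the support of \<delta> are left
  out because sections are normalised to 0 there.\<close>

definition LS :: "('e set => complex) => ('c => complex) => ('c => complex) => bool" where
 "LS s \<alpha> \<beta> \<longleftrightarrow> (\<forall>q\<in>U. regat C q \<alpha> & regat C q \<beta>) &
  (\<forall>e\<in>fib E U. RR e ~= 0 & \<delta> (bproj E e) = 0 -->
    s (line_of E e) * RR e * zz p (bproj E e) powi \<delta> p = \<alpha> (bproj E e) * X e + \<beta> (bproj E e) * Y e)"

lemma RR_NZ: "e \<in> fib E U ==> RR e ~= 0 ==> e \<in> NZ"
 using frame_RR[OF fr] frame_NZ[OF fr] by auto

text \<open>On the charts where \<open>X\<close> and where \<open>Y\<close> is nonzero the section
  becomes a regular function \<open>t\<close> and \<open>t'\<close>, with t = u t' on the overlap.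
  On each fibre both are polynomials, and \<open>linear_of_reciprocal\<close> forces t = \<alpha> +
  \<beta> u.\<close>

lemma LS_exists:
 assumes s: "\<And>y. y \<in> pts S ==> s \<in> stalk_pow S (DD \<delta>) y 0"
 shows "\<exists>\<alpha> \<beta>. LS s \<alpha> \<beta>"
proof -
 interpret sw: small_frame C E \<iota> \<rho> p U Y X \<delta> by (rule swap)
 obtain t where t: "t \<in> reg S (vs U X)" "\<And>y. y \<in> vs U X ==> y \<notin> divisor_support (DD \<delta>) ==> t y = s y * g0 y"
  by (rule section_chart[of s]) (use s sc.ptsV in auto)
 obtain t' where t': "t' \<in> reg S (vs U Y)" "\<And>y. y \<in> vs U Y ==> y \<notin> divisor_support (DD \<delta>) ==> t' y = s y * sw.g0 y"
  by (rule sw.section_chart[of s]) (use s sw.sc.ptsV in auto)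
 have tr: "regat S y t" if "y \<in> vs U X" for y using t(1) that S.reg_iff[OF sc.openV] by blast
 have t'r: "regat S y t'" if "y \<in> vs U Y" for y using t'(1) that S.reg_iff[OF sw.sc.openV] by blast
 have us: "us X Y y ~= 0 & us Y X y = 1 / us X Y y & g0 y = us X Y y * sw.g0 y" if y: "y \<in> vs U X" "y \<in> vs U Y" for y
 proof -
  obtain e where e: "e \<in> NZ" "e \<in> fib E U" "y = line_of E e" "X e = 1" "Y e = us X Y y"
   by (rule frame_normalize[OF fr y(1)]) (rule that)
  have "Y e ~= 0" using vs_line[OF sw.fr e(1)] e(3) y(2) by simp
  moreover have "us Y X y = X e / Y e" using us_line[OF sw.fr e(1,2)] e(3) by simp
  moreover have "rr y = RR e / X e" "sw.rr y = RR e / Y e"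
   using rr_line[OF e(1,2)] sw.rr_line[OF e(1,2)] e \<open>Y e ~= 0\<close> by auto
  ultimately show ?thesis using e(4,5) by (simp add: g0_def sw.g0_def)
 qed
 have glue: "t y = us X Y y * t' y" if y: "y \<in> vs U X" "y \<in> vs U Y" for y
 proof (rule S.identity_at[OF tr[OF y(1)] S.regat_mult[OF sc.u_regat[OF y(1)] t'r[OF y(2)]]])
  show "\<forall>\<^sub>F y in generic S. t y = us X Y y * t' y"
   using generic_off_support sw.generic_off_support by eventually_elim (use t(2) t'(2) us in auto)
 qed
 define \<alpha> where "\<alpha> = (%q. t (sc.pt q 0))"
 define \<beta> where "\<beta> = (%q. t' (sw.sc.pt q 0))"
 have ab: "regat C q \<alpha> & regat C q \<beta>" if q: "q \<in> U" for q
  unfolding \<alpha>_def \<beta>_def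
  using sc.section_regat[OF q regat_const[OF sc.ptsU[OF q]] tr[OF sc.pt(1)[OF q]]]
   sw.sc.section_regat[OF q regat_const[OF sc.ptsU[OF q]] t'r[OF sw.sc.pt(1)[OF q]]] by simp
 have lin: "t (sc.pt q c) = \<alpha> q + \<beta> q * c & t' (sw.sc.pt q c) = \<beta> q + \<alpha> q * c" if q: "q \<in> U" for q c
 proof -
  obtain P where P: "\<forall>c. t (sc.pt q c) = poly P c" using sc.fibre_poly[OF t(1) q] by blast
  obtain Q where Q: "\<forall>c. t' (sw.sc.pt q c) = poly Q c" using sw.sc.fibre_poly[OF t'(1) q] by blast
  have rec: "poly P c = c * poly Q (1 / c)" if c: "c ~= 0" for c
  proof -
   let ?y = "sc.pt q c"
   have y: "?y \<in> vs U X" "us X Y ?y = c" "\<pi> ?y = q" using sc.pt[OF q] by auto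
   obtain e where e: "e \<in> NZ" "e \<in> fib E U" "?y = line_of E e" "X e = 1" "Y e = us X Y ?y"
    by (rule frame_normalize[OF fr y(1)]) (rule that)
   have yY: "?y \<in> vs U Y" using vs_line[OF sw.fr e(1)] e y(2) c by simp
   have "us Y X ?y = 1 / c" using us[OF y(1) yY] y(2) by simp
   then have "sw.sc.pt q (1 / c) = ?y" using sw.sc.pt_eq[OF yY] y(3) by simp
   then have "t' ?y = poly Q (1 / c)" using Q by metis
   moreover have "t ?y = poly P c" using P by simp
   ultimately show ?thesis using glue[OF y(1) yY] y(2) by simp
  qed
  have PQ0: "poly P 0 = \<alpha> q" "poly Q 0 = \<beta> q" using P Q by (simp_all add: \<alpha>_def \<beta>_def)
  have rec': "poly Q c = c * poly P (1 / c)" if "c ~= 0" for c using rec[of "1 / c"] that by simp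
  show ?thesis using linear_of_reciprocal[OF rec, of c] linear_of_reciprocal[OF rec', of c] P Q PQ0 by simp
 qed
 have "s (line_of E e) * RR e * zz p (bproj E e) powi \<delta> p = \<alpha> (bproj E e) * X e + \<beta> (bproj E e) * Y e"
  if e: "e \<in> fib E U" "RR e ~= 0" "\<delta> (bproj E e) = 0" for e
 proof -
  let ?y = "line_of E e" and ?q = "bproj E e"
  have eN: "e \<in> NZ" by (rule RR_NZ[OF e(1,2)])
  have yS: "?y \<in> pts S" using eN by (auto simp: pts_S)
  have q: "?q \<in> U" using e by (simp add: fib_def)
  have pi: "\<pi> ?y = ?q" by (rule line_of_props(5)[OF eN])
  have ns: "?y \<notin> divisor_support (DD \<delta>)" using in_support[OF \<delta> yS] line_C0[OF eN] e pi by simp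
  show ?thesis
  proof (cases "X e = 0")
   case False
   have yV: "?y \<in> vs U X" using vs_line[OF fr eN] e False by simp
   have "t ?y = \<alpha> ?q + \<beta> ?q * (Y e / X e)"
    using lin[OF q, of "us X Y ?y"] sc.pt_eq[OF yV] pi us_line[OF fr eN e(1)] by simp
   moreover have "t ?y = s ?y * (RR e / X e * zz p ?q powi \<delta> p)"
    using t(2)[OF yV ns] rr_line[OF eN e(1) False] pi by (simp add: g0_def)
   ultimately have "s ?y * (RR e / X e * zz p ?q powi \<delta> p) * X e = (\<alpha> ?q + \<beta> ?q * (Y e / X e)) * X e" by simp
   then show ?thesis using False by (simp add: distrib_right mult.assoc)
  next
   case True
   then have False': "Y e ~= 0" using frame_NZ[OF fr e(1)] eN by simp
   have yV: "?y \<in> vs U Y" using vs_line[OF sw.fr eN] e False' by simp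
   have "t' ?y = \<beta> ?q + \<alpha> ?q * (X e / Y e)"
    using lin[OF q, of "us Y X ?y"] sw.sc.pt_eq[OF yV] pi us_line[OF sw.fr eN e(1)] by simp
   moreover have "t' ?y = s ?y * (RR e / Y e * zz p ?q powi \<delta> p)"
    using t'(2)[OF yV ns] sw.rr_line[OF eN e(1) False'] pi by (simp add: sw.g0_def)
   ultimately have "s ?y * (RR e / Y e * zz p ?q powi \<delta> p) * Y e = (\<beta> ?q + \<alpha> ?q * (X e / Y e)) * Y e" by simp
   then show ?thesis using False' True by (simp add: mult.assoc)
  qed
 qed
 then show ?thesis using ab unfolding LS_def by blast
qed

lemma LS_chart:
 assumes "LS s \<alpha> \<beta>" "y \<in> vs U X" "y \<notin> divisor_support (DD \<delta>)"
 shows "s y * g0 y = \<alpha> (\<pi> y) + \<beta> (\<pi> y) * us X Y y"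
proof -
 obtain e where e: "e \<in> NZ" "e \<in> fib E U" "y = line_of E e" "X e = 1" "Y e = us X Y y" "bproj E e = \<pi> y"
  by (rule frame_normalize[OF fr assms(2)]) (rule that)
 have n: "RR e ~= 0" "\<delta> (\<pi> y) = 0"
  using in_support[OF \<delta> sc.ptsV[OF assms(2)]] assms(3) line_C0[OF e(1)] e(3) by auto
 have "g0 y = RR e * zz p (\<pi> y) powi \<delta> p" using rr_line[OF e(1,2)] e by (simp add: g0_def)
 moreover have "s (line_of E e) * RR e * zz p (bproj E e) powi \<delta> p = \<alpha> (bproj E e) * X e + \<beta> (bproj E e) * Y e"
  using assms(1)[unfolded LS_def, THEN conjunct2, THEN bspec, OF e(2)] n e(6) by simp
 ultimately show ?thesis using e(3-6) by (simp add: mult.assoc)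
qed

lemma LS_stalk:
 assumes LS: "LS s \<alpha> \<beta>" and y: "y \<in> vs U X" shows "s \<in> stalk_pow S (DD \<delta>) y 0"
 unfolding stalk_iff[OF y]
proof (rule bexI[of _ "%y. \<alpha> (\<pi> y) + \<beta> (\<pi> y) * us X Y y"])
 have "regat C (\<pi> y) \<alpha>" "regat C (\<pi> y) \<beta>" using LS sc.piV[OF y] by (auto simp: LS_def)
 then show "(%y. \<alpha> (\<pi> y) + \<beta> (\<pi> y) * us X Y y) \<in> max_ideal_pow S y 0"
  unfolding S.max_ideal_pow_0_iff[OF sc.ptsV[OF y]]
  by (intro S.regat_add S.regat_mult sc.pi_regat sc.u_regat y)
 show "\<forall>\<^sub>F y' in nhd S y. y' \<notin> divisor_support (DD \<delta>) --> \<alpha> (\<pi> y') + \<beta> (\<pi> y') * us X Y y' = s y' * g0 y'"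
  using sc.eventually_V[OF y] by eventually_elim (use LS_chart[OF LS] in auto)
qed

lemma LS_swap: "LS s \<alpha> \<beta> ==> small_frame.LS C E \<rho> p U Y X \<delta> s \<beta> \<alpha>"
proof -
 interpret sw: small_frame C E \<iota> \<rho> p U Y X \<delta> by (rule swap)
 assume "LS s \<alpha> \<beta>"
 then show "sw.LS s \<beta> \<alpha>" unfolding LS_def sw.LS_def by (simp add: add.commute)
qed

end

section \<open>Jets of sections of the hyperplane bundle\<close>

text \<open>Every germ vanishing at \<open>p\<close> is a multiple of the uniformizer, so a product
  of k of them is a multiple of its k-th power.\<close>

lemma (in curve) max_ideal_pow_zz:
 assumes p: "p \<in> pts C"
 shows "f \<in> max_ideal_pow C p k \<longleftrightarrow> (\<exists>h. regat C p h & (\<forall>\<^sub>F q in nhd C p. f q = h q * zz p q ^ k))"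
proof
 assume "f \<in> max_ideal_pow C p k"
 then obtain N :: nat and a h where ah: "\<forall>j<N. regat C p (a j) & (\<forall>i<k. regat C p (h j i) & h j i p = 0)"
  "\<forall>\<^sub>F q in nhd C p. f q = (\<Sum>j<N. a j q * (\<Prod>i<k. h j i q))"
  unfolding max_ideal_pow_iff[OF p] by (elim exE conjE) (rule that)
 define g where "g = (%j i. SOME g. regat C p g & (\<forall>\<^sub>F q in nhd C p. h j i q = g q * zz p q))"
 have g: "regat C p (g j i) & (\<forall>\<^sub>F q in nhd C p. h j i q = g j i q * zz p q)" if "j < N" "i < k" for j i
 proof -
  have "regat C p (h j i)" "h j i p = 0" using ah(1) that by auto
  then obtain g' where "regat C p g'" "\<forall>\<^sub>F q in nhd C p. h j i q = g' q * zz p q" by (rule zz_divides)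
  then have "\<exists>g. regat C p g & (\<forall>\<^sub>F q in nhd C p. h j i q = g q * zz p q)" by (intro exI[of _ g'] conjI)
  from someI_ex[OF this] show ?thesis by (simp only: g_def)
 qed
 have "\<forall>\<^sub>F q in nhd C p. \<forall>j\<in>{..<N}. \<forall>i\<in>{..<k}. h j i q = g j i q * zz p q"
  by (intro eventually_ball_finite finite_lessThan ballI) (use g in auto)
 then have "\<forall>\<^sub>F q in nhd C p. f q = (\<Sum>j<N. a j q * (\<Prod>i<k. g j i q)) * zz p q ^ k"
  using ah(2)
 proof eventually_elim
  case (elim q)
  then show ?case by (simp add: prod.distrib sum_distrib_right mult.assoc)
 qed
 moreover have "regat C p (%q. \<Sum>j<N. a j q * (\<Prod>i<k. g j i q))"
  by (intro regat_sum regat_mult regat_prod p) (use ah g in auto)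
 ultimately show "\<exists>h. regat C p h & (\<forall>\<^sub>F q in nhd C p. f q = h q * zz p q ^ k)"
  by (intro exI[of _ "%q. \<Sum>j<N. a j q * (\<Prod>i<k. g j i q)"]) simp
next
 assume "\<exists>h. regat C p h & (\<forall>\<^sub>F q in nhd C p. f q = h q * zz p q ^ k)"
 then obtain h where h: "regat C p h" "\<forall>\<^sub>F q in nhd C p. f q = h q * zz p q ^ k" by (elim exE conjE)
 show "f \<in> max_ideal_pow C p k"
  by (rule max_ideal_pow_cong[OF max_ideal_pow_power[OF h(1) zz_regat[OF p] zz_zero[OF p]] p h(2)])
qed

lemma (in curve) max_ideal_pow_Suc_mult_zz:
 assumes p: "p \<in> pts C" and b: "regat C p b"
  and f: "(%q. b q * zz p q) \<in> max_ideal_pow C p (Suc k)"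
 shows "b \<in> max_ideal_pow C p k"
proof -
 obtain h where h: "regat C p h" "\<forall>\<^sub>F q in nhd C p. b q * zz p q = h q * zz p q ^ Suc k"
  using f unfolding max_ideal_pow_zz[OF p] by (elim exE conjE)
 have "\<forall>\<^sub>F q in generic C. b q = h q * zz p q ^ k"
  using eventually_nhd_generic[OF h(2) p] zz_generic[OF p] by eventually_elim simp
 from identity_nhd[OF b regat_mult[OF h(1) regat_power[OF zz_regat[OF p]]] this]
 show ?thesis unfolding max_ideal_pow_zz[OF p] using h(1) by (intro exI[of _ h]) simp
qed

text \<open>Pulling back along a section sends germs vanishing at the point to germs vanishing at
  \<open>q\<close>, so sums of products keep their shape.\<close>

lemma (in schart) section_max_ideal_pow:
 assumes q: "q \<in> U" and c: "regat C q c" and f: "f \<in> max_ideal_pow S (pt q (c q)) k"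
 shows "(%q'. f (pt q' (c q'))) \<in> max_ideal_pow C q k"
proof -
 let ?y = "pt q (c q)"
 have y: "?y \<in> pts S" using pt(1)[OF q] ptsV by simp
 obtain N :: nat and a h where ah: "\<forall>j<N. regat S ?y (a j) & (\<forall>i<k. regat S ?y (h j i) & h j i ?y = 0)"
  "\<forall>\<^sub>F y in nhd S ?y. f y = (\<Sum>j<N. a j y * (\<Prod>i<k. h j i y))"
  using f unfolding S.max_ideal_pow_iff[OF y] by (elim exE conjE) (rule that)
 show ?thesis unfolding C.max_ideal_pow_iff[OF ptsU[OF q]]
 proof (rule exI[of _ N], rule exI[of _ "%j q. a j (pt q (c q))"], rule exI[of _ "%j i q. h j i (pt q (c q))"], intro conjI allI impI)
  show "\<forall>\<^sub>F q in nhd C q. f (pt q (c q)) = (\<Sum>j<N. a j (pt q (c q)) * (\<Prod>i<k. h j i (pt q (c q))))"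
   by (rule section_eventually[OF q c ah(2)])
 qed (use ah(1) section_regat[OF q c] in auto)
qed

context small_frame
begin

text \<open>At the origin of the chart z and u vanish, which gives one direction for \<alpha> +
  \<beta> u. For the other, restriction to the sections u = 0 and u = z preserves powers of the
  maximal ideal: the first yields \<alpha>, the difference yields \<beta> z, and one factor z is
  cancelled.\<close>

lemma stalk_pow_iff:
 assumes LS: "LS s \<alpha> \<beta>" and y: "y \<in> vs U X" "us X Y y = 0" "\<pi> y = p"
 shows "s \<in> stalk_pow S (DD \<delta>) y (Suc k) \<longleftrightarrow>
  \<alpha> \<in> max_ideal_pow C p (Suc k) & \<beta> \<in> max_ideal_pow C p k"
proof
 have yS: "y \<in> pts S" by (rule sc.ptsV[OF y(1)])
 have rab: "regat C p \<alpha>" "regat C p \<beta>" using LS pU by (auto simp: LS_def)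
 have zr: "regat S y (%y. zz p (\<pi> y))" by (rule sc.pi_regat[OF y(1)]) (use y zz_U pU in simp)
 have z0: "zz p (\<pi> y) = 0" using y zz_zero[OF pC] by simp
 let ?t = "%y. \<alpha> (\<pi> y) + \<beta> (\<pi> y) * us X Y y"
 {
  assume "\<alpha> \<in> max_ideal_pow C p (Suc k) & \<beta> \<in> max_ideal_pow C p k"
  then obtain h h' where h: "regat C p h" "\<forall>\<^sub>F q in nhd C p. \<alpha> q = h q * zz p q ^ Suc k"
   and h': "regat C p h'" "\<forall>\<^sub>F q in nhd C p. \<beta> q = h' q * zz p q ^ k"
   unfolding max_ideal_pow_zz[OF pC] by (elim exE conjE) (rule that)
  have hS: "regat S y (%y. h (\<pi> y))" "regat S y (%y. h' (\<pi> y))"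
   using sc.pi_regat[OF y(1), of h] sc.pi_regat[OF y(1), of h'] y(3) h(1) h'(1) by auto
  have 1: "(%y. h (\<pi> y) * zz p (\<pi> y) ^ Suc k) \<in> max_ideal_pow S y (Suc k)"
   by (rule S.max_ideal_pow_power[OF hS(1) zr z0])
  \<comment> \<open>There are k factors z and one factor u; the case distinction on the index writes
    them as one product of length \<open>Suc k\<close>.\<close>
  have 2: "(%y'. h' (\<pi> y') * (\<Prod>i<Suc k. (if i < k then (%y. zz p (\<pi> y)) else us X Y) y')) \<in> max_ideal_pow S y (Suc k)"
   by (rule S.max_ideal_pow_prod[OF hS(2)]) (use zr z0 y sc.u_regat in auto)
  have e: "(\<Prod>i<Suc k. (if i < k then (%y. zz p (\<pi> y)) else us X Y) y') = zz p (\<pi> y') ^ k * us X Y y'" for y'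
   by simp
  have "\<forall>\<^sub>F y' in nhd S y. \<alpha> (\<pi> y') = h (\<pi> y') * zz p (\<pi> y') ^ Suc k"
   "\<forall>\<^sub>F y' in nhd S y. \<beta> (\<pi> y') = h' (\<pi> y') * zz p (\<pi> y') ^ k"
   using sc.eventually_pi[OF y(1)] h(2) h'(2) y(3) by auto
  then have "\<forall>\<^sub>F y' in nhd S y. ?t y' = h (\<pi> y') * zz p (\<pi> y') ^ Suc k +
   h' (\<pi> y') * (\<Prod>i<Suc k. (if i < k then (%y. zz p (\<pi> y)) else us X Y) y')"
   unfolding e by eventually_elim simp
  from S.max_ideal_pow_cong[OF S.max_ideal_pow_add[OF 1 2 yS] yS this]
  have "?t \<in> max_ideal_pow S y (Suc k)" .
  then show "s \<in> stalk_pow S (DD \<delta>) y (Suc k)" unfolding stalk_iff[OF y(1)]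
  proof (rule bexI[rotated])
   show "\<forall>\<^sub>F y' in nhd S y. y' \<notin> divisor_support (DD \<delta>) --> ?t y' = s y' * g0 y'"
    using sc.eventually_V[OF y(1)] by eventually_elim (use LS_chart[OF LS] in auto)
  qed
 next
  assume "s \<in> stalk_pow S (DD \<delta>) y (Suc k)"
  then obtain t where t: "t \<in> max_ideal_pow S y (Suc k)"
   "\<forall>\<^sub>F y' in nhd S y. y' \<notin> divisor_support (DD \<delta>) --> t y' = s y' * g0 y'"
   unfolding stalk_iff[OF y(1)] by (elim bexE)
  have "\<forall>\<^sub>F y in generic S. t y = ?t y"
   using S.eventually_nhd_generic[OF t(2) yS] generic_off_support by eventually_elim (use LS_chart[OF LS] in auto)
  then have "\<forall>\<^sub>F y in nhd S y. t y = ?t y"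
   using S.identity_nhd[OF S.max_ideal_pow_regat[OF t(1) yS] S.regat_add[OF sc.pi_regat[OF y(1)] S.regat_mult[OF sc.pi_regat[OF y(1)] sc.u_regat[OF y(1)]]]]
    y(3) rab by simp
  then have "\<forall>\<^sub>F y in nhd S y. ?t y = t y" by eventually_elim simp
  from S.max_ideal_pow_cong[OF t(1) yS this] have T: "?t \<in> max_ideal_pow S y (Suc k)" .
  have pt: "sc.pt p 0 = y" using sc.pt_eq[OF y(1)] y by simp
  have val: "\<forall>\<^sub>F q in nhd C p. ?t (sc.pt q (c q)) = \<alpha> q + \<beta> q * c q" for c
   by (rule eventually_nhdI[OF F.openU pU]) (simp add: sc.pt)
  have ev: "(%q. \<alpha> q + \<beta> q * c q) \<in> max_ideal_pow C p (Suc k)" if c: "regat C p c" "c p = 0" for c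
  proof (rule max_ideal_pow_cong[OF _ pC])
   show "(%q. ?t (sc.pt q (c q))) \<in> max_ideal_pow C p (Suc k)"
    by (rule sc.section_max_ideal_pow[OF pU c(1)]) (use T pt c(2) in simp)
   show "\<forall>\<^sub>F q in nhd C p. \<alpha> q + \<beta> q * c q = ?t (sc.pt q (c q))"
    using val[of c] by eventually_elim simp
  qed
  have a: "\<alpha> \<in> max_ideal_pow C p (Suc k)" using ev[of "%_. 0"] regat_const[OF pC, of 0] by simp
  have "(%q. (\<alpha> q + \<beta> q * zz p q) + (- 1) * \<alpha> q) \<in> max_ideal_pow C p (Suc k)"
   by (rule max_ideal_pow_add[OF ev[OF zz_regat[OF pC] zz_zero[OF pC]]
     max_ideal_pow_mult[OF a pC regat_const[OF pC, of "- 1"]] pC])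
  then have "(%q. \<beta> q * zz p q) \<in> max_ideal_pow C p (Suc k)" by simp
  then show "\<alpha> \<in> max_ideal_pow C p (Suc k) & \<beta> \<in> max_ideal_pow C p k"
   using a max_ideal_pow_Suc_mult_zz[OF pC rab(2)] by simp
 }
qed

text \<open>The vectors with RR ~= 0 form the complement of a line in the fibre, and they span
  it.\<close>

lemma functional_zero:
 assumes q: "q \<in> U" and z: "\<And>e. e \<in> fib E U ==> bproj E e = q ==> RR e ~= 0 ==> a * X e + b * Y e = 0"
 shows "a = 0 & b = 0"
proof -
 have R: "RR (F.vec q c d) = r0 U X Y q * c + r1 U X Y q * d" for c d
  using frame_RR[OF fr F.vec(1)[OF q]] F.vec[OF q] by simp
 have Z: "a * c + b * d = 0" if "r0 U X Y q * c + r1 U X Y q * d ~= 0" for c d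
  using z[OF F.vec(1,2)[OF q], of c d] F.vec[OF q] that R by simp
 show ?thesis
 proof (cases "r0 U X Y q = 0")
  case True
  then have "r1 U X Y q ~= 0" using r_nz[OF fr q] by simp
  then have "b = 0" "a + b = 0" using Z[of 0 1] Z[of 1 1] True by auto
  then show ?thesis by simp
 next
  case False
  then have "a = 0" using Z[of 1 0] by simp
  moreover have "b = 0"
  proof (cases "r1 U X Y q = 0")
   case True then show ?thesis using Z[of 1 1] False \<open>a = 0\<close> by simp
  next
   case F: False then show ?thesis using Z[of 0 1] by simp
  qed
  ultimately show ?thesis by simp
 qed
qed

lemma LS_add: "LS s \<alpha> \<beta> ==> LS s' \<alpha>' \<beta>' ==> LS (%y. s y + s' y) (%q. \<alpha> q + \<alpha>' q) (%q. \<beta> q + \<beta>' q)"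
 unfolding LS_def by (auto intro: regat_add simp: algebra_simps)

lemma LS_mult:
 assumes "LS s \<alpha> \<beta>" "\<And>q. q \<in> U ==> regat C q f"
 shows "LS (%y. f (\<pi> y) * s y) (%q. f q * \<alpha> q) (%q. f q * \<beta> q)"
proof -
 have "f (\<pi> (line_of E e)) * s (line_of E e) * RR e * zz p (bproj E e) powi \<delta> p =
  f (bproj E e) * \<alpha> (bproj E e) * X e + f (bproj E e) * \<beta> (bproj E e) * Y e"
  if e: "e \<in> fib E U" "RR e ~= 0" "\<delta> (bproj E e) = 0" for e
 proof -
  have "s (line_of E e) * RR e * zz p (bproj E e) powi \<delta> p = \<alpha> (bproj E e) * X e + \<beta> (bproj E e) * Y e"
   using assms(1)[unfolded LS_def, THEN conjunct2, THEN bspec, OF e(1)] e by simp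
  then have "f (bproj E e) * (s (line_of E e) * RR e * zz p (bproj E e) powi \<delta> p) =
   f (bproj E e) * (\<alpha> (bproj E e) * X e + \<beta> (bproj E e) * Y e)" by simp
  then show ?thesis using line_of_props(5)[OF RR_NZ[OF e(1,2)]] by (simp add: algebra_simps)
 qed
 moreover have "regat C q (%q. f q * \<alpha> q) & regat C q (%q. f q * \<beta> q)" if "q \<in> U" for q
  using assms that by (auto simp: LS_def intro: regat_mult)
 ultimately show ?thesis unfolding LS_def by blast
qed

lemma LS_scale: "LS s \<alpha> \<beta> ==> LS (%y. c * s y) (%q. c * \<alpha> q) (%q. c * \<beta> q)"
 by (rule LS_mult[of s \<alpha> \<beta> "%_. c"]) (auto intro: regat_const sc.ptsU)

lemma LS_zero: "LS (%_. 0) (%_. 0) (%_. 0)"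
 unfolding LS_def by (auto intro: regat_const sc.ptsU)

text \<open>A filtration by the vanishing orders of the two coefficients at \<open>p\<close>. By
  \<open>stalk_pow_iff\<close> the step (m + 1, m) is the kernel of the m-jet map at the origin of
  the chart; the step (m, m) consists of the sections divisible by the m-th power of the equation of
  the fibre.\<close>

definition FF :: "('e set => complex) set => nat => nat => ('e set => complex) set" where
 "FF V k l = {s \<in> V. \<exists>\<alpha> \<beta>. LS s \<alpha> \<beta> & \<alpha> \<in> max_ideal_pow C p k & \<beta> \<in> max_ideal_pow C p l}"

lemma zero_max_ideal_pow: "(%_. 0) \<in> max_ideal_pow C p k"
 unfolding max_ideal_pow_zz[OF pC] using regat_const[OF pC, of 0] by (intro exI[of _ "%_. 0"]) simp

lemma fsubspace_FF:
 assumes V: "fsubspace V" shows "fsubspace (FF V k l)"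
proof (rule fsubspaceI)
 show "(%_. 0) \<in> FF V k l" unfolding FF_def
  using fsubspace_zero[OF V] LS_zero zero_max_ideal_pow by blast
next
 fix f g assume "f \<in> FF V k l" "g \<in> FF V k l"
 then obtain \<alpha> \<beta> \<alpha>' \<beta>' where *: "f \<in> V" "LS f \<alpha> \<beta>" "\<alpha> \<in> max_ideal_pow C p k" "\<beta> \<in> max_ideal_pow C p l"
  "g \<in> V" "LS g \<alpha>' \<beta>'" "\<alpha>' \<in> max_ideal_pow C p k" "\<beta>' \<in> max_ideal_pow C p l" unfolding FF_def by blast
 show "(%s. f s + g s) \<in> FF V k l" unfolding FF_def
  using fsubspace_add[OF V *(1,5)] LS_add[OF *(2,6)] max_ideal_pow_add[OF *(3,7) pC] max_ideal_pow_add[OF *(4,8) pC]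
  by (intro CollectI conjI exI[of _ "%q. \<alpha> q + \<alpha>' q"] exI[of _ "%q. \<beta> q + \<beta>' q"])
next
 fix f c assume "f \<in> FF V k l"
 then obtain \<alpha> \<beta> where *: "f \<in> V" "LS f \<alpha> \<beta>" "\<alpha> \<in> max_ideal_pow C p k" "\<beta> \<in> max_ideal_pow C p l" unfolding FF_def by blast
 show "(%s. c * f s) \<in> FF V k l" unfolding FF_def
  using fsubspace_scale[OF V *(1)] LS_scale[OF *(2)] max_ideal_pow_mult[OF *(3) pC regat_const[OF pC]] max_ideal_pow_mult[OF *(4) pC regat_const[OF pC]]
  by (intro CollectI conjI exI[of _ "%q. c * \<alpha> q"] exI[of _ "%q. c * \<beta> q"])
qed

text \<open>A combination of two sections can be chosen to kill the leading values
  \<open>h p\<close> and \<open>h' p\<close> of the first coefficients, and thereby gains one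
  order.\<close>

lemma dlt_FF:
 assumes V: "fsubspace V" shows "dlt (FF V k l) (FF V (Suc k) l) 2"
 unfolding dlt_def
proof (intro allI impI)
 fix v :: "nat => 'e set => complex" assume v: "\<forall>i<2. v i \<in> FF V k l"
 have ex: "\<exists>h \<alpha> \<beta>. s \<in> V & LS s \<alpha> \<beta> & regat C p h & (\<forall>\<^sub>F q in nhd C p. \<alpha> q = h q * zz p q ^ k) & \<beta> \<in> max_ideal_pow C p l"
  if sF: "s \<in> FF V k l" for s
 proof -
  obtain \<alpha> \<beta> where *: "s \<in> V" "LS s \<alpha> \<beta>" "\<alpha> \<in> max_ideal_pow C p k" "\<beta> \<in> max_ideal_pow C p l"
   using sF unfolding FF_def by blast
  obtain h where "regat C p h" "\<forall>\<^sub>F q in nhd C p. \<alpha> q = h q * zz p q ^ k"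
   using *(3) unfolding max_ideal_pow_zz[OF pC] by (elim exE conjE)
  with * show ?thesis by (intro exI[of _ h] exI[of _ \<alpha>] exI[of _ \<beta>]) simp
 qed
 have v01: "v 0 \<in> FF V k l" "v 1 \<in> FF V k l" using v by auto
 obtain h \<alpha> \<beta> where 0: "v 0 \<in> V" "LS (v 0) \<alpha> \<beta>" "regat C p h" "\<forall>\<^sub>F q in nhd C p. \<alpha> q = h q * zz p q ^ k" "\<beta> \<in> max_ideal_pow C p l"
  using ex[OF v01(1)] by (elim exE conjE)
 obtain h' \<alpha>' \<beta>' where 1: "v 1 \<in> V" "LS (v 1) \<alpha>' \<beta>'" "regat C p h'" "\<forall>\<^sub>F q in nhd C p. \<alpha>' q = h' q * zz p q ^ k" "\<beta>' \<in> max_ideal_pow C p l"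
  using ex[OF v01(2)] by (elim exE conjE)
 obtain a b :: complex where ab: "a ~= 0 \<or> b ~= 0" "a * h p + b * h' p = 0"
 proof (cases "h p = 0")
  case True then show thesis using that[of 1 0] by simp
 next
  case False then show thesis using that[of "- h' p" "h p"] by (simp add: mult.commute)
 qed
 let ?h = "%q. a * h q + b * h' q"
 have "regat C p ?h" using 0(3) 1(3) by (intro regat_add regat_scale)
 then obtain g where g: "regat C p g" "\<forall>\<^sub>F q in nhd C p. ?h q = g q * zz p q" using ab(2) by (rule zz_divides)
 have "(%q. a * \<alpha> q + b * \<alpha>' q) \<in> max_ideal_pow C p (Suc k)" unfolding max_ideal_pow_zz[OF pC]
 proof (intro exI[of _ g] conjI g(1))
  show "\<forall>\<^sub>F q in nhd C p. a * \<alpha> q + b * \<alpha>' q = g q * zz p q ^ Suc k"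
   using 0(4) 1(4) g(2)
  proof eventually_elim
   case (elim q)
   have "a * \<alpha> q + b * \<alpha>' q = (a * h q + b * h' q) * zz p q ^ k"
    unfolding elim(1,2) by (simp add: algebra_simps)
   also have "\<dots> = g q * zz p q ^ Suc k" unfolding elim(3) by simp
   finally show ?case .
  qed
 qed
 moreover have "(%q. a * \<beta> q + b * \<beta>' q) \<in> max_ideal_pow C p l"
  by (rule max_ideal_pow_add[OF max_ideal_pow_mult[OF 0(5) pC regat_const[OF pC]] max_ideal_pow_mult[OF 1(5) pC regat_const[OF pC]] pC])
 moreover have "LS (%y. a * v 0 y + b * v 1 y) (%q. a * \<alpha> q + b * \<alpha>' q) (%q. a * \<beta> q + b * \<beta>' q)"
  by (rule LS_add[OF LS_scale[OF 0(2)] LS_scale[OF 1(2)]])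
 moreover have "(%y. a * v 0 y + b * v 1 y) \<in> V"
  by (rule fsubspace_add[OF V fsubspace_scale[OF V 0(1)] fsubspace_scale[OF V 1(1)]])
 ultimately have F: "(%y. a * v 0 y + b * v 1 y) \<in> FF V (Suc k) l" unfolding FF_def
  by (intro CollectI conjI exI[of _ "%q. a * \<alpha> q + b * \<alpha>' q"] exI[of _ "%q. a * \<beta> q + b * \<beta>' q"])
 show "\<exists>c. (\<exists>i<2. c i ~= 0) & (%s. \<Sum>i<2. c i * v i s) \<in> FF V (Suc k) l"
 proof (rule exI[of _ "%i::nat. if i = 0 then a else b"], rule conjI)
  show "\<exists>i<2. (if i = (0::nat) then a else b) ~= 0"
  proof (cases "a = 0")
   case True
   with ab(1) show ?thesis by (intro exI[of _ 1]) simp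
  next
   case False
   then show ?thesis by (intro exI[of _ 0]) simp
  qed
  show "(%s. \<Sum>i<2. (if i = 0 then a else b) * v i s) \<in> FF V (Suc k) l"
   using F by (simp add: numeral_2_eq_2)
 qed
qed

lemma FF_swap: "small_frame.FF C E \<rho> p U Y X \<delta> V l k = FF V k l"
proof -
 interpret sw: small_frame C E \<iota> \<rho> p U Y X \<delta> by (rule swap)
 show ?thesis unfolding FF_def sw.FF_def using LS_swap sw.LS_swap by blast
qed

text \<open>From (k, k) to (k + 1, k + 1) there are two steps of codimension at most one: the first
  raises the order of \<alpha>, the second that of \<beta> in the frame with \<open>X\<close> and
  \<open>Y\<close> exchanged.\<close>

lemma dlt_FF_diag:
 assumes V: "fsubspace V" and ex: "\<And>s. s \<in> V ==> \<exists>\<alpha> \<beta>. LS s \<alpha> \<beta>"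
 shows "dlt V (FF V k k) (2 * k + 1)"
proof (induction k)
 case 0
 have "V \<subseteq> FF V 0 0"
 proof
  fix s assume s: "s \<in> V"
  then obtain \<alpha> \<beta> where "LS s \<alpha> \<beta>" using ex by blast
  moreover then have "regat C p \<alpha>" "regat C p \<beta>" using pU by (auto simp: LS_def)
  ultimately show "s \<in> FF V 0 0" unfolding FF_def using s max_ideal_pow_0_iff[OF pC] by blast
 qed
 then show ?case using dlt_1 by simp
next
 case (Suc k)
 interpret sw: small_frame C E \<iota> \<rho> p U Y X \<delta> by (rule swap)
 have i: "V \<inter> FF V k l = FF V k l" for k l by (auto simp: FF_def)
 have 1: "dlt V (FF V (Suc k) k) (Suc (2 * k + 1))"
  by (rule dlt_ext[OF V fsubspace_FF[OF V]]) (use Suc dlt_FF[OF V] in \<open>simp_all add: i numeral_2_eq_2\<close>)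
 have "dlt (FF V (Suc k) k) (FF V (Suc k) (Suc k)) 2"
  using sw.dlt_FF[OF V, of k "Suc k"] by (simp only: FF_swap)
 then have "dlt V (FF V (Suc k) (Suc k)) (Suc (2 * k + 1 + 1))"
  by (intro dlt_ext[OF V fsubspace_FF[OF V] 1]) (simp add: i numeral_2_eq_2)
 then show ?case by simp
qed

end

text \<open>Twisting down by fibres stays within the family \<open>DD\<close>, so the analysis of
  sections applies to L(-m f) as well.\<close>

lemma (in scroll) DD_diff:
 assumes \<delta>: "point_divisor C \<delta>" and p: "p \<in> pts C"
 shows "(%Z. DD \<delta> Z - m * prime_divisor (fibre E p) Z) = DD (%q. \<delta> q - m * pd p q)"
proof
 fix Z
 have \<delta>': "point_divisor C (%q. \<delta> q - m * pd p q)"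
  by (intro point_divisor_diff \<delta> point_divisor_mult point_divisor_pd p)
 consider "Z = C0" | q where "q \<in> pts C" "Z = fibre E q" | "Z ~= C0" "\<And>q. q \<in> pts C ==> Z ~= fibre E q" by blast
 then show "DD \<delta> Z - m * prime_divisor (fibre E p) Z = DD (%q. \<delta> q - m * pd p q) Z"
 proof cases
  case 1
  then show ?thesis using C0_neq_fibre by (simp add: DD_C0 prime_divisor_def)
 next
  case 2
  have "prime_divisor (fibre E p) Z = pd p q" using 2 fibre_inj[OF 2(1), of p] by (auto simp: prime_divisor_def pd_def)
  then show ?thesis using DD_fibre[OF \<delta> 2(1)] DD_fibre[OF \<delta>' 2(1)] 2 by simp
 next
  case 3
  have "DD \<delta> Z = 0" using DD_nz[of \<delta> Z] 3 \<delta> by (auto simp: point_divisor_def)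
  moreover have "DD (%q. \<delta> q - m * pd p q) Z = 0" using DD_nz[of "%q. \<delta> q - m * pd p q" Z] 3 \<delta>' by (fastforce simp: point_divisor_def)
  moreover have "Z ~= fibre E p" by (rule 3(2)[OF p])
  ultimately show ?thesis by (simp add: prime_divisor_def)
 qed
qed

text \<open>One neighbourhood serves every divisor supported in \<open>A\<close>: it avoids the
  other points of \<open>A\<close> and the other zeros of the uniformizer.\<close>

lemma (in scroll) small_frame_exists:
 assumes e: "e \<in> NZ" and A: "finite A"
 obtains U X Y where "\<And>\<delta>. point_divisor C \<delta> ==> {q. \<delta> q ~= 0} \<subseteq> A ==> small_frame C E \<iota> \<rho> (bproj E e) U X Y \<delta>"
  "X e = 1" "Y e = 0" "U \<inter> A \<subseteq> {bproj E e}"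
proof -
 let ?p = "bproj E e"
 have p: "?p \<in> pts C" by (rule bproj_pts[OF NZ_pts[OF e]])
 have "\<forall>\<^sub>F q in generic C. zz ?p q ~= 0 & q \<notin> A"
  using zz_generic[OF p] generic_iff_finite[of "%q. q \<notin> A"] A by (auto intro: eventually_conj)
 from generic_punctured[OF this p] regat_ev[OF zz_regat[OF p]]
 have "\<forall>\<^sub>F q in nhd C ?p. regat C q (zz ?p) & (q ~= ?p --> zz ?p q ~= 0 & q \<notin> A)" by eventually_elim simp
 then obtain U0 where U0: "openin (zar C) U0" "?p \<in> U0"
  "\<And>q. q \<in> U0 ==> regat C q (zz ?p) & (q ~= ?p --> zz ?p q ~= 0 & q \<notin> A)" by (rule eventually_nhdE[OF _ p]) (rule that)
 obtain U X Y where U: "?p \<in> U" "U \<subseteq> U0" "frame C E U X Y" "X e = 1" "Y e = 0"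
  by (rule good_frame[OF e U0(1,2)]) (rule that)
 show thesis
 proof (rule that[of U X Y])
  fix \<delta> assume \<delta>: "point_divisor C \<delta>" "{q. \<delta> q ~= 0} \<subseteq> A"
  show "small_frame C E \<iota> \<rho> ?p U X Y \<delta>"
  proof (intro small_frame.intro scroll_axioms small_frame_axioms.intro U(1,3) \<delta>(1))
   fix q assume "q \<in> U"
   then have q: "q \<in> U0" using U(2) by auto
   show "regat C q (zz ?p)" using U0(3)[OF q] by simp
   show "q = ?p" if "zz ?p q = 0" using U0(3)[OF q] that by auto
   show "\<delta> q = 0" if "q ~= ?p" using U0(3)[OF q] that \<delta>(2) by auto
  qed
 qed (use U U0(3) in auto)
qed

section \<open>Global sections in a fixed system of frames and the bound on their dimension\<close>

lemma dlt_linear: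
 assumes d: "dlt W Z n" and T: "\<And>s. s \<in> V ==> T s \<in> W"
  and lin: "\<And>c v. T (%s. \<Sum>i<n. c i * v i s) = (%q. \<Sum>i<n. c i * T (v i) q)"
 shows "dlt V {s. T s \<in> Z} n"
 unfolding dlt_def
proof (intro allI impI)
 fix v :: "nat => _" assume "\<forall>i<n. v i \<in> V"
 then have "\<forall>i<n. T (v i) \<in> W" using T by blast
 from d[unfolded dlt_def, THEN spec, of "%i. T (v i)", THEN mp, OF this]
 show "\<exists>c. (\<exists>i<n. c i ~= 0) & (%s. \<Sum>i<n. c i * v i s) \<in> {s. T s \<in> Z}"
  by (simp add: lin)
qed

lemma proportional_of_common_kernel:
 fixes a b :: complex
 assumes "a * X + b * Y = 0" "r * X + r' * Y = 0" "X ~= 0 \<or> Y ~= 0"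
 shows "a * r' = b * r"
proof -
 have "(a * r' - b * r) * X = r' * (a * X + b * Y) - b * (r * X + r' * Y)" by (simp add: algebra_simps)
 moreover have "(a * r' - b * r) * Y = a * (r * X + r' * Y) - r * (a * X + b * Y)" by (simp add: algebra_simps)
 ultimately show ?thesis using assms by auto
qed

text \<open>The frame at each point is fixed once and works for every divisor supported in
  \<open>A\<close>, so that the coefficients of sections of L and of L(-m f) refer to the same
  coordinates and can be compared.\<close>

locale framed_scroll = scroll C E \<iota> \<rho> for C :: "'c fspace" and E :: "('c, 'e) vbundle" and \<iota> \<rho> +
 fixes A :: "'c set" and FU :: "'c => 'c set" and FX FY :: "'c => 'e => complex"
 assumes small: "p \<in> pts C ==> point_divisor C \<delta> ==> {q. \<delta> q ~= 0} \<subseteq> A ==> small_frame C E \<iota> \<rho> p (FU p) (FX p) (FY p) \<delta>"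
  and FU_A: "p \<in> pts C ==> FU p \<inter> A \<subseteq> {p}"
begin

definition adm :: "('c => int) => bool" where
 "adm \<delta> \<longleftrightarrow> point_divisor C \<delta> & {q. \<delta> q ~= 0} \<subseteq> A"

abbreviation VV :: "('c => int) => ('e set => complex) set" where
 "VV \<delta> \<equiv> global_sections S (DD \<delta>)"

abbreviation LSp :: "('c => int) => 'c => ('e set => complex) => ('c => complex) => ('c => complex) => bool" where
 "LSp \<delta> p \<equiv> small_frame.LS C E \<rho> p (FU p) (FX p) (FY p) \<delta>"

lemma small_adm: "adm \<delta> ==> p \<in> pts C ==> small_frame C E \<iota> \<rho> p (FU p) (FX p) (FY p) \<delta>"
 using small by (simp add: adm_def)

lemmas LSp_def = small_frame.LS_def[OF small_adm]

lemma VV_LS: "adm \<delta> ==> s \<in> VV \<delta> ==> p \<in> pts C ==> \<exists>\<alpha> \<beta>. LSp \<delta> p s \<alpha> \<beta>"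
 by (rule small_frame.LS_exists[OF small_adm]) (simp_all add: global_sections_def)

lemma VV_zero: "s \<in> VV \<delta> ==> y \<notin> pts S - divisor_support (DD \<delta>) ==> s y = 0"
 unfolding global_sections_def by blast

text \<open>A nonzero vector has nonzero \<open>X\<close> or nonzero \<open>Y\<close>, so the linear
  form gives membership in the stalk on one of the two charts.\<close>

lemma VV_I:
 assumes \<delta>: "adm \<delta>" and 0: "\<And>y. y \<notin> pts S - divisor_support (DD \<delta>) ==> s y = 0"
  and LS: "\<And>p. p \<in> pts C ==> \<exists>\<alpha> \<beta>. LSp \<delta> p s \<alpha> \<beta>"
 shows "s \<in> VV \<delta>"
 unfolding global_sections_def
proof (intro CollectI conjI ballI allI impI 0)
 fix y assume y: "y \<in> pts S"
 let ?p = "\<pi> y"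
 have p: "?p \<in> pts C" by (rule pi_pts[OF y])
 interpret sf: small_frame C E \<iota> \<rho> ?p "FU ?p" "FX ?p" "FY ?p" \<delta> by (rule small_adm[OF \<delta> p])
 interpret sw: small_frame C E \<iota> \<rho> ?p "FU ?p" "FY ?p" "FX ?p" \<delta> by (rule sf.swap)
 obtain \<alpha> \<beta> where ab: "sf.LS s \<alpha> \<beta>" using LS[OF p] by (elim exE)
 obtain e where e: "e \<in> NZ" "y = line_of E e" by (rule pts_SE[OF y])
 have eU: "e \<in> fib E (FU ?p)" using sf.pU line_of_props(5)[OF e(1)] e NZ_pts by (simp add: fib_def)
 show "s \<in> stalk_pow S (DD \<delta>) y 0"
 proof (cases "FX ?p e = 0")
  case False
  then have "y \<in> vs (FU ?p) (FX ?p)" unfolding e(2) using vs_line[OF sf.fr e(1)] eU e(2) by simp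
  then show ?thesis by (rule sf.LS_stalk[OF ab])
 next
  case True
  then have "FY ?p e ~= 0" using frame_NZ[OF sf.fr eU] e(1) by simp
  then have "y \<in> vs (FU ?p) (FY ?p)" unfolding e(2) using vs_line[OF sw.fr e(1)] eU e(2) by simp
  then show ?thesis by (rule sw.LS_stalk[OF sf.LS_swap[OF ab]])
 qed
qed

lemma fsubspace_VV:
 assumes \<delta>: "adm \<delta>" shows "fsubspace (VV \<delta>)"
proof (rule fsubspaceI)
 show "(%_. 0) \<in> VV \<delta>"
  by (rule VV_I[OF \<delta>]) (use small_frame.LS_zero[OF small_adm[OF \<delta>]] in \<open>auto intro!: exI[of _ "%_. 0"]\<close>)
next
 fix f g assume f: "f \<in> VV \<delta>" and g: "g \<in> VV \<delta>"
 show "(%s. f s + g s) \<in> VV \<delta>"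
 proof (rule VV_I[OF \<delta>])
  show "f y + g y = 0" if "y \<notin> pts S - divisor_support (DD \<delta>)" for y using VV_zero[OF f that] VV_zero[OF g that] by simp
  fix p assume p: "p \<in> pts C"
  obtain \<alpha> \<beta> where 1: "LSp \<delta> p f \<alpha> \<beta>" using VV_LS[OF \<delta> f p] by (elim exE)
  obtain \<alpha>' \<beta>' where 2: "LSp \<delta> p g \<alpha>' \<beta>'" using VV_LS[OF \<delta> g p] by (elim exE)
  from small_frame.LS_add[OF small_adm[OF \<delta> p] 1 2] show "\<exists>\<alpha> \<beta>. LSp \<delta> p (%s. f s + g s) \<alpha> \<beta>" by (intro exI)
 qed
next
 fix f c assume f: "f \<in> VV \<delta>"
 show "(%s. c * f s) \<in> VV \<delta>"
 proof (rule VV_I[OF \<delta>])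
  show "c * f y = 0" if "y \<notin> pts S - divisor_support (DD \<delta>)" for y using VV_zero[OF f that] by simp
  fix p assume p: "p \<in> pts C"
  obtain \<alpha> \<beta> where 1: "LSp \<delta> p f \<alpha> \<beta>" using VV_LS[OF \<delta> f p] by (elim exE)
  from small_frame.LS_scale[OF small_adm[OF \<delta> p] 1] show "\<exists>\<alpha> \<beta>. LSp \<delta> p (%s. c * f s) \<alpha> \<beta>" by (intro exI)
 qed
qed

text \<open>A version of \<open>LSp\<close> that ignores finitely many fibres, so that it can compare sections of
 bundles whose divisors have different supports.\<close>

definition GR :: "('c => int) => 'c => ('e set => complex) => ('c => complex) => ('c => complex) => bool" where
 "GR \<delta> p s \<alpha> \<beta> \<longleftrightarrow> regat C p \<alpha> & regat C p \<beta> &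
  (\<forall>\<^sub>F q in generic C. \<forall>e\<in>NZ. bproj E e = q & RR e ~= 0 -->
    s (line_of E e) * RR e * zz p q powi \<delta> p = \<alpha> q * FX p e + \<beta> q * FY p e)"

definition MM :: "('c => int) => ('e set => complex) set" where
 "MM \<delta> = {s. \<forall>p\<in>pts C. \<exists>\<alpha> \<beta>. GR \<delta> p s \<alpha> \<beta>}"

text \<open>Representatives of the zero section, the analogue of \<open>ZZ\<close>: elements of
  \<open>MM\<close> are compared only modulo them, whereas normalised sections in \<open>NN\<close>
  are zero by \<open>VV_NN\<close>.\<close>

definition NN :: "('e set => complex) set" where
 "NN = {s. \<forall>\<^sub>F q in generic C. \<forall>e\<in>NZ. bproj E e = q & RR e ~= 0 --> s (line_of E e) = 0}"

lemma LS_GR: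
 assumes \<delta>: "adm \<delta>" and p: "p \<in> pts C" and LS: "LSp \<delta> p s \<alpha> \<beta>"
 shows "GR \<delta> p s \<alpha> \<beta>"
proof -
 interpret sf: small_frame C E \<iota> \<rho> p "FU p" "FX p" "FY p" \<delta> by (rule small_adm[OF \<delta> p])
 have "\<forall>\<^sub>F q in generic C. q \<in> FU p" by (rule eventually_genericI[OF sf.F.openU]) (use sf.pU in auto)
 moreover have "\<forall>\<^sub>F q in generic C. \<delta> q = 0"
  unfolding generic_iff_finite using sf.\<delta> by (auto simp: point_divisor_def elim: finite_subset[rotated])
 ultimately have "\<forall>\<^sub>F q in generic C. \<forall>e\<in>NZ. bproj E e = q & RR e ~= 0 -->
    s (line_of E e) * RR e * zz p q powi \<delta> p = \<alpha> q * FX p e + \<beta> q * FY p e"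
 proof eventually_elim
  case (elim q)
  show ?case
  proof (intro ballI impI)
   fix e assume e: "e \<in> NZ" "bproj E e = q & RR e ~= 0"
   then have "e \<in> fib E (FU p)" using elim NZ_pts by (simp add: fib_def)
   from LS[unfolded sf.LS_def, THEN conjunct2, THEN bspec, OF this] e elim
   show "s (line_of E e) * RR e * zz p q powi \<delta> p = \<alpha> q * FX p e + \<beta> q * FY p e" by simp
  qed
 qed
 moreover have "regat C p \<alpha>" "regat C p \<beta>" using LS sf.pU by (auto simp: sf.LS_def)
 ultimately show ?thesis by (simp add: GR_def)
qed

lemma GR_add:
 assumes "GR \<delta> p s \<alpha> \<beta>" "GR \<delta> p s' \<alpha>' \<beta>'"
 shows "GR \<delta> p (%y. s y + s' y) (%q. \<alpha> q + \<alpha>' q) (%q. \<beta> q + \<beta>' q)"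
proof -
 have "\<forall>\<^sub>F q in generic C. \<forall>e\<in>NZ. bproj E e = q & RR e ~= 0 -->
    (s (line_of E e) + s' (line_of E e)) * RR e * zz p q powi \<delta> p = (\<alpha> q + \<alpha>' q) * FX p e + (\<beta> q + \<beta>' q) * FY p e"
  using assms[unfolded GR_def, THEN conjunct2, THEN conjunct2]
  by eventually_elim (simp add: algebra_simps)
 then show ?thesis using assms unfolding GR_def by (auto intro: regat_add)
qed

lemma GR_scale:
 assumes "GR \<delta> p s \<alpha> \<beta>" shows "GR \<delta> p (%y. c * s y) (%q. c * \<alpha> q) (%q. c * \<beta> q)"
proof -
 have "\<forall>\<^sub>F q in generic C. \<forall>e\<in>NZ. bproj E e = q & RR e ~= 0 -->
    (c * s (line_of E e)) * RR e * zz p q powi \<delta> p = (c * \<alpha> q) * FX p e + (c * \<beta> q) * FY p e"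
  using assms[unfolded GR_def, THEN conjunct2, THEN conjunct2]
  by eventually_elim (simp add: mult.assoc flip: distrib_left)
 then show ?thesis using assms unfolding GR_def by (auto intro: regat_scale)
qed

lemma fsubspace_MM: "fsubspace (MM \<delta>)"
proof (rule fsubspaceI)
 have "GR \<delta> p (%_. 0) (%_. 0) (%_. 0)" if "p \<in> pts C" for p using regat_const[OF that, of 0] by (simp add: GR_def)
 then show "(%_. 0) \<in> MM \<delta>" unfolding MM_def by blast
next
 fix f g assume f: "f \<in> MM \<delta>" and g: "g \<in> MM \<delta>"
 show "(%s. f s + g s) \<in> MM \<delta>" unfolding MM_def
 proof (intro CollectI ballI)
  fix p assume p: "p \<in> pts C"
  obtain \<alpha> \<beta> where 1: "GR \<delta> p f \<alpha> \<beta>" using f p unfolding MM_def by blast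
  obtain \<alpha>' \<beta>' where 2: "GR \<delta> p g \<alpha>' \<beta>'" using g p unfolding MM_def by blast
  from GR_add[OF 1 2] show "\<exists>\<alpha> \<beta>. GR \<delta> p (%s. f s + g s) \<alpha> \<beta>" by (intro exI)
 qed
next
 fix f c assume f: "f \<in> MM \<delta>"
 show "(%s. c * f s) \<in> MM \<delta>" unfolding MM_def
 proof (intro CollectI ballI)
  fix p assume p: "p \<in> pts C"
  obtain \<alpha> \<beta> where 1: "GR \<delta> p f \<alpha> \<beta>" using f p unfolding MM_def by blast
  from GR_scale[OF 1] show "\<exists>\<alpha> \<beta>. GR \<delta> p (%s. c * f s) \<alpha> \<beta>" by (intro exI)
 qed
qed

text \<open>A linear form that vanishes off a line is zero, so both coefficients vanish generically
  and, being regular, at \<open>p\<close>.\<close>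

lemma GR_NN:
 assumes p: "p \<in> pts C" and GR: "GR \<delta> p s \<alpha> \<beta>" and s: "s \<in> NN"
 shows "\<alpha> p = 0 & \<beta> p = 0"
proof -
 interpret sf: small_frame C E \<iota> \<rho> p "FU p" "FX p" "FY p" "%_. 0" by (rule small[OF p]) (simp_all add: point_divisor_def)
 have "\<forall>\<^sub>F q in generic C. q \<in> FU p" by (rule eventually_genericI[OF sf.F.openU]) (use sf.pU in auto)
 then have z: "\<forall>\<^sub>F q in generic C. \<alpha> q = 0 & \<beta> q = 0"
  using GR[unfolded GR_def, THEN conjunct2, THEN conjunct2] s[unfolded NN_def, THEN CollectD]
 proof eventually_elim
  case (elim q)
  show ?case
  proof (rule sf.functional_zero[OF elim(1)])
   fix e assume e: "e \<in> fib E (FU p)" "bproj E e = q" "RR e ~= 0"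
   have "e \<in> NZ" by (rule sf.RR_NZ[OF e(1,3)])
   from elim(2)[THEN bspec, OF this] elim(3)[THEN bspec, OF this] e
   show "\<alpha> q * FX p e + \<beta> q * FY p e = 0" by simp
  qed
 qed
 have "\<forall>\<^sub>F q in generic C. \<alpha> q = 0" "\<forall>\<^sub>F q in generic C. \<beta> q = 0" using z by (auto elim: eventually_mono)
 then show ?thesis using identity_at[OF _ regat_const[OF p, of 0]] GR by (auto simp: GR_def)
qed

text \<open>The coefficients vanish at every point of C, which gives 0 off the support; on the
  support sections are normalised to 0.\<close>

lemma VV_NN:
 assumes \<delta>: "adm \<delta>" and s: "s \<in> VV \<delta>" "s \<in> NN" shows "s = (%_. 0)"
proof
 fix y
 show "s y = 0"
 proof (cases "y \<in> pts S - divisor_support (DD \<delta>)")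
  case False then show ?thesis by (rule VV_zero[OF s(1)])
 next
  case True
  let ?p = "\<pi> y"
  have p: "?p \<in> pts C" using pi_pts True by simp
  interpret sf: small_frame C E \<iota> \<rho> ?p "FU ?p" "FX ?p" "FY ?p" \<delta> by (rule small_adm[OF \<delta> p])
  obtain \<alpha> \<beta> where ab: "sf.LS s \<alpha> \<beta>" using VV_LS[OF \<delta> s(1) p] by (elim exE)
  have z: "\<alpha> ?p = 0 & \<beta> ?p = 0" by (rule GR_NN[OF p LS_GR[OF \<delta> p ab] s(2)])
  obtain e where e: "e \<in> NZ" "y = line_of E e" using True by (auto elim: pts_SE)
  have eU: "e \<in> fib E (FU ?p)" using sf.pU line_of_props(5)[OF e(1)] e NZ_pts by (simp add: fib_def)
  have n: "RR e ~= 0" "\<delta> ?p = 0" using True in_support[OF sf.\<delta>, of y] line_C0[OF e(1)] e(2) by auto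
  have be: "bproj E e = ?p" using line_of_props(5)[OF e(1)] e(2) by simp
  from ab[unfolded sf.LS_def, THEN conjunct2, THEN bspec, OF eU] have "s y * RR e = 0"
   using n z be e(2) by simp
  then show ?thesis using n by simp
 qed
qed

text \<open>Chosen separately over each point, without regularity in \<open>q\<close>. For elements
  of \<open>MM\<close> this is generically harmless: the slope does not depend on the choice, and
  the offset does not when the slope vanishes.\<close>

definition e1 :: "'c => 'e" where
 "e1 q = (SOME e. e \<in> NZ & bproj E e = q & RR e = 1)"

lemma e1: "q \<in> pts C ==> e1 q \<in> NZ" "q \<in> pts C ==> bproj E (e1 q) = q" "q \<in> pts C ==> RR (e1 q) = 1"
 unfolding e1_def using someI_ex[OF fibre_nonempty] by auto

text \<open>Both vectors, the chosen one and its sum with \<open>i1 q\<close>, have RR = 1, so up to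
  the power of the uniformizer the difference is the value of the linear form on
  \<open>i1 q\<close>: the restriction of the section to the trivial subbundle.\<close>

definition slope :: "('e set => complex) => 'c => complex" where
 "slope s q = s (line_of E (badd E (e1 q) (i1 q))) - s (line_of E (e1 q))"

definition offset :: "('e set => complex) => 'c => complex" where
 "offset s q = s (line_of E (e1 q))"

lemma GR_values:
 assumes p: "p \<in> pts C" and GR: "GR \<delta> p s \<alpha> \<beta>"
 shows "\<forall>\<^sub>F q in generic C. q \<in> pts C & q \<in> FU p & zz p q ~= 0 &
  slope s q * zz p q powi \<delta> p = \<alpha> q * FX p (i1 q) + \<beta> q * FY p (i1 q) &
  offset s q * zz p q powi \<delta> p = \<alpha> q * FX p (e1 q) + \<beta> q * FY p (e1 q) &
  r0 (FU p) (FX p) (FY p) q * FX p (i1 q) + r1 (FU p) (FX p) (FY p) q * FY p (i1 q) = 0 &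
  (FX p (i1 q) ~= 0 \<or> FY p (i1 q) ~= 0) &
  r0 (FU p) (FX p) (FY p) q * FX p (e1 q) + r1 (FU p) (FX p) (FY p) q * FY p (e1 q) = 1 &
  (\<forall>e\<in>NZ. bproj E e = q & RR e ~= 0 -->
    s (line_of E e) * RR e * zz p q powi \<delta> p = \<alpha> q * FX p e + \<beta> q * FY p e)"
proof -
 interpret sf: small_frame C E \<iota> \<rho> p "FU p" "FX p" "FY p" "%_. 0" by (rule small[OF p]) (simp_all add: point_divisor_def)
 have "\<forall>\<^sub>F q in generic C. q \<in> FU p" by (rule eventually_genericI[OF sf.F.openU]) (use sf.pU in auto)
 then show ?thesis using GR[unfolded GR_def, THEN conjunct2, THEN conjunct2] zz_generic[OF p]
 proof eventually_elim
  case (elim q)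
  have q: "q \<in> pts C" using sf.sc.ptsU[OF elim(1)] .
  have f: "e1 q \<in> fib E (FU p)" "i1 q \<in> fib E (FU p)" using e1[OF q] i1[OF q] NZ_pts elim(1) by (auto simp: fib_def)
  have eq: "bproj E (e1 q) = bproj E (i1 q)" using e1[OF q] i1[OF q] by simp
  let ?w = "badd E (e1 q) (i1 q)"
  have w: "?w \<in> fib E (FU p)" by (rule sf.F.badd_fib[OF f eq])
  have bw: "bproj E ?w = q" "FX p ?w = FX p (e1 q) + FX p (i1 q)" "FY p ?w = FY p (e1 q) + FY p (i1 q)"
   using sf.F.badd[OF f eq] e1(2)[OF q] i1(2)[OF q] by auto
  have Rw: "RR ?w = 1" using RR_add[of "e1 q" "i1 q"] f eq e1[OF q] i1[OF q] NZ_pts by simp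
  have wN: "?w \<in> NZ" by (rule sf.RR_NZ[OF w]) (simp add: Rw)
  have 1: "offset s q * zz p q powi \<delta> p = \<alpha> q * FX p (e1 q) + \<beta> q * FY p (e1 q)"
   using elim(2)[THEN bspec, OF e1(1)[OF q]] e1[OF q] by (simp add: offset_def)
  have 2: "s (line_of E ?w) * zz p q powi \<delta> p = \<alpha> q * FX p ?w + \<beta> q * FY p ?w"
   using elim(2)[THEN bspec, OF wN] Rw bw by simp
  have 3: "slope s q * zz p q powi \<delta> p = \<alpha> q * FX p (i1 q) + \<beta> q * FY p (i1 q)"
   using 1 2 bw by (simp add: slope_def offset_def algebra_simps)
  show ?case using q elim 1 3 frame_RR[OF sf.fr f(1)] frame_RR[OF sf.fr f(2)] e1[OF q] i1[OF q] frame_NZ[OF sf.fr f(2)]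
   by simp
 qed
qed

lemma slope_LL:
 assumes s: "s \<in> MM \<delta>" shows "slope s \<in> LL \<delta>"
 unfolding LL_def
proof (intro CollectI ballI)
 fix p assume p: "p \<in> pts C"
 interpret sf: small_frame C E \<iota> \<rho> p "FU p" "FX p" "FY p" "%_. 0" by (rule small[OF p]) (simp_all add: point_divisor_def)
 obtain \<alpha> \<beta> where GR: "GR \<delta> p s \<alpha> \<beta>" using s p unfolding MM_def by blast
 show "ordge p (- \<delta> p) (slope s)" unfolding ordge_def
 proof (intro exI[of _ "%q. \<alpha> q * FX p (i1 q) + \<beta> q * FY p (i1 q)"] conjI)
  show "regat C p (%q. \<alpha> q * FX p (i1 q) + \<beta> q * FY p (i1 q))"
   using GR i1_regat[OF sf.fr sf.pU] i1_regat[OF frame_swap[OF swfT sf.fr] sf.pU]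
   by (auto simp: GR_def intro: regat_add regat_mult)
  show "\<forall>\<^sub>F q in generic C. slope s q = (\<alpha> q * FX p (i1 q) + \<beta> q * FY p (i1 q)) * zz p q powi - \<delta> p"
   using GR_values[OF p GR]
  proof eventually_elim
   case (elim q)
   then have z: "zz p q powi \<delta> p ~= 0" by simp
   have sl: "slope s q * zz p q powi \<delta> p = \<alpha> q * FX p (i1 q) + \<beta> q * FY p (i1 q)" using elim by blast
   show ?case unfolding sl[symmetric] power_int_minus using z by simp
  qed
 qed
qed

text \<open>A linear form that kills \<open>i1 q\<close> is a multiple of \<open>RR\<close>, and the
  factor is its value on \<open>e1 q\<close>.\<close>

lemma offset_coefficients:
 assumes p: "p \<in> pts C" and GR: "GR \<delta> p s \<alpha> \<beta>" and z: "slope s \<in> ZZ"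
 shows "\<forall>\<^sub>F q in generic C. zz p q ~= 0 &
  \<alpha> q = r0 (FU p) (FX p) (FY p) q * (offset s q * zz p q powi \<delta> p) &
  \<beta> q = r1 (FU p) (FX p) (FY p) q * (offset s q * zz p q powi \<delta> p) &
  (\<forall>e\<in>NZ. bproj E e = q & RR e ~= 0 -->
    s (line_of E e) * RR e * zz p q powi \<delta> p = \<alpha> q * FX p e + \<beta> q * FY p e)"
 using GR_values[OF p GR] z[unfolded ZZ_def, THEN CollectD]
proof eventually_elim
 case (elim q)
 let ?r = "r0 (FU p) (FX p) (FY p) q" and ?r' = "r1 (FU p) (FX p) (FY p) q"
 have k: "\<alpha> q * ?r' = \<beta> q * ?r" using elim by (intro proportional_of_common_kernel[of _ "FX p (i1 q)" _ "FY p (i1 q)"]) auto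
 have R: "?r * FX p (e1 q) + ?r' * FY p (e1 q) = 1" using elim by blast
 have "?r * (\<alpha> q * FX p (e1 q) + \<beta> q * FY p (e1 q)) = \<alpha> q * (?r * FX p (e1 q)) + (\<beta> q * ?r) * FY p (e1 q)" by (simp add: algebra_simps)
 also have "\<dots> = \<alpha> q * (?r * FX p (e1 q) + ?r' * FY p (e1 q))" unfolding k[symmetric] by (simp add: algebra_simps)
 finally have 1: "?r * (\<alpha> q * FX p (e1 q) + \<beta> q * FY p (e1 q)) = \<alpha> q" using R by simp
 have "?r' * (\<alpha> q * FX p (e1 q) + \<beta> q * FY p (e1 q)) = (\<alpha> q * ?r') * FX p (e1 q) + \<beta> q * (?r' * FY p (e1 q))" by (simp add: algebra_simps)
 also have "\<dots> = \<beta> q * (?r * FX p (e1 q) + ?r' * FY p (e1 q))" unfolding k by (simp add: algebra_simps)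
 finally have 2: "?r' * (\<alpha> q * FX p (e1 q) + \<beta> q * FY p (e1 q)) = \<beta> q" using R by simp
 show ?case using elim 1 2 by simp
qed

text \<open>One of the coefficients of \<open>RR\<close> is a unit at \<open>p\<close>; dividing the
  matching coefficient of \<open>s\<close> by it bounds the order of the offset.\<close>

lemma offset_LL:
 assumes s: "s \<in> MM \<delta>" and z: "slope s \<in> ZZ" shows "offset s \<in> LL \<delta>"
 unfolding LL_def
proof (intro CollectI ballI)
 fix p assume p: "p \<in> pts C"
 interpret sf: small_frame C E \<iota> \<rho> p "FU p" "FX p" "FY p" "%_. 0" by (rule small[OF p]) (simp_all add: point_divisor_def)
 let ?r = "r0 (FU p) (FX p) (FY p)" and ?r' = "r1 (FU p) (FX p) (FY p)"
 obtain \<alpha> \<beta> where GR: "GR \<delta> p s \<alpha> \<beta>" using s p unfolding MM_def by blast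
 have ord: "ordge p (- \<delta> p) (offset s)" if h: "regat C p a" "regat C p r" "r p ~= 0"
  and e: "\<forall>\<^sub>F q in generic C. zz p q ~= 0 & a q = r q * (offset s q * zz p q powi \<delta> p)" for a r
  unfolding ordge_def
 proof (intro exI[of _ "%q. a q / r q"] conjI)
  show "regat C p (%q. a q / r q)" by (rule regat_divide[OF h])
  show "\<forall>\<^sub>F q in generic C. offset s q = a q / r q * zz p q powi - \<delta> p"
   using e generic_nz[OF h(2,3)] by eventually_elim (simp add: power_int_minus)
 qed
 note c = offset_coefficients[OF p GR z]
 show "ordge p (- \<delta> p) (offset s)"
 proof (cases "?r p = 0")
  case False
  show ?thesis by (rule ord[of \<alpha> ?r]) (use GR r_regat[OF sf.fr sf.pU] False c in \<open>auto simp: GR_def elim: eventually_mono\<close>)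
 next
  case True
  then have "?r' p ~= 0" using r_nz[OF sf.fr sf.pU] by simp
  then show ?thesis by (intro ord[of \<beta> ?r']) (use GR r_regat[OF sf.fr sf.pU] c in \<open>auto simp: GR_def elim: eventually_mono\<close>)
 qed
qed

lemma slope_offset_NN:
 assumes s: "s \<in> MM \<delta>" and z: "slope s \<in> ZZ" "offset s \<in> ZZ" shows "s \<in> NN"
proof -
 obtain p where p: "p \<in> pts C" using infinite_imp_nonempty[OF infinite_pts] by blast
 obtain \<alpha> \<beta> where GR: "GR \<delta> p s \<alpha> \<beta>" using s p unfolding MM_def by blast
 show ?thesis unfolding NN_def
 proof (rule CollectI)
  show "\<forall>\<^sub>F q in generic C. \<forall>e\<in>NZ. bproj E e = q & RR e ~= 0 --> s (line_of E e) = 0"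
   using offset_coefficients[OF p GR z(1)] z(2)[unfolded ZZ_def, THEN CollectD]
  proof eventually_elim
   case (elim q)
   then have "\<alpha> q = 0" "\<beta> q = 0" by auto
   with elim show ?case by auto
  qed
 qed
qed

text \<open>Left exactness for the extension: the slope maps sections to L(\<delta>), and on its
  kernel the offset maps to L(\<delta>) with kernel in \<open>NN\<close>. Each map contributes at
  most one dimension.\<close>

lemma dlt_MM:
 assumes d: "dlt (LL \<delta>) ZZ 2" shows "dlt (MM \<delta>) NN 3"
proof -
 let ?Z = "{s. slope s \<in> ZZ}"
 have lin: "slope (%s. \<Sum>i<n. c i * v i s) = (%q. \<Sum>i<n. c i * slope (v i) q)" for n :: nat and c v
  by (rule ext) (simp add: slope_def sum_subtractf right_diff_distrib)
 have lin': "offset (%s. \<Sum>i<n. c i * v i s) = (%q. \<Sum>i<n. c i * offset (v i) q)" for n :: nat and c v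
  by (rule ext) (simp add: offset_def)
 have Z: "fsubspace ?Z"
 proof (rule fsubspaceI)
  have "slope (%_. 0) = (%_. 0)" by (rule ext) (simp add: slope_def)
  then show "(%_. 0) \<in> ?Z" using fsubspace_zero[OF fsubspace_ZZ] by simp
 next
  fix f g assume fg: "f \<in> ?Z" "g \<in> ?Z"
  have "slope (%s. f s + g s) = (%q. slope f q + slope g q)" by (rule ext) (simp add: slope_def)
  then show "(%s. f s + g s) \<in> ?Z" using fsubspace_add[OF fsubspace_ZZ] fg by simp
 next
  fix f c assume f: "f \<in> ?Z"
  have "slope (%s. c * f s) = (%q. c * slope f q)" by (rule ext) (simp add: slope_def right_diff_distrib)
  then show "(%s. c * f s) \<in> ?Z" using fsubspace_scale[OF fsubspace_ZZ] f by simp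
 qed
 have 1: "dlt (MM \<delta>) ?Z (Suc 1)" using dlt_linear[where T = slope, OF d slope_LL lin] by (simp only: Suc_1)
 have I: "fsubspace (MM \<delta> \<inter> ?Z)" by (rule fsubspace_Int[OF fsubspace_MM Z])
 have "dlt (MM \<delta> \<inter> ?Z) {s. offset s \<in> ZZ} 2" by (rule dlt_linear[OF d]) (use offset_LL lin' in auto)
 then have "dlt (MM \<delta> \<inter> ?Z) NN 2" by (rule dlt_subset[OF _ subset_refl I]) (use slope_offset_NN in auto)
 then have 2: "dlt (MM \<delta> \<inter> ?Z) NN (Suc 1)" by (simp add: numeral_2_eq_2)
 from dlt_ext[OF fsubspace_MM Z 1 2] show ?thesis by (simp add: numeral_3_eq_3)
qed

end

section \<open>Jets of sections of L compared with sections of L(-m f)\<close>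

context framed_scroll
begin

text \<open>Division of a section by the equation of a multiple fibre. On the fibre itself the values of
 the quotient have to be read off from the local coefficients.\<close>

lemma divide_section:
 assumes \<delta>: "adm \<delta>" and \<delta>': "adm (%q. \<delta> q - int m * pd p q)" (is "adm ?\<delta>'") and p: "p \<in> pts C" "p \<in> A"
  and s: "s \<in> VV \<delta>" "LSp \<delta> p s \<alpha> \<beta>" and a: "\<alpha> \<in> max_ideal_pow C p m" and b: "\<beta> \<in> max_ideal_pow C p m"
 obtains s' \<alpha>' \<beta>' where "s' \<in> VV ?\<delta>'" "LSp ?\<delta>' p s' \<alpha>' \<beta>'" "\<forall>\<^sub>F q in nhd C p. \<alpha> q = \<alpha>' q * zz p q ^ m"
proof -
 interpret sf: small_frame C E \<iota> \<rho> p "FU p" "FX p" "FY p" \<delta> by (rule small_adm[OF \<delta> p(1)])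
 note LS' = LSp_def[OF \<delta>' p(1)]
 have quot: "\<exists>f'. (\<forall>q\<in>FU p. regat C q f') & (\<forall>q\<in>FU p. q ~= p --> f' q = f q / zz p q ^ m) & (\<forall>\<^sub>F q in nhd C p. f q = f' q * zz p q ^ m)"
  if f: "f \<in> max_ideal_pow C p m" "\<forall>q\<in>FU p. regat C q f" for f
 proof -
  obtain h where h: "regat C p h" "\<forall>\<^sub>F q in nhd C p. f q = h q * zz p q ^ m"
   using f(1) unfolding max_ideal_pow_zz[OF p(1)] by (elim exE conjE)
  \<comment> \<open>At \<open>p\<close> the total quotient is meaningless, so the value there is
    taken from the germ \<open>h\<close>.\<close>
  define f' where "f' = (%q. if q = p then h p else f q / zz p q ^ m)"
  have evU: "\<forall>\<^sub>F q in nhd C p. q \<in> FU p" by (rule eventually_nhdI[OF sf.F.openU sf.pU])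
  have ev: "\<forall>\<^sub>F q in nhd C p. f' q = h q" using h(2) evU
   by eventually_elim (use sf.zz_nz in \<open>auto simp: f'_def\<close>)
  have "regat C q f'" if q: "q \<in> FU p" for q
  proof (cases "q = p")
   case True
   then show ?thesis using regat_cong[OF h(1) ev] by simp
  next
   case False
   then have z: "zz p q ^ m ~= 0" using sf.zz_nz[OF q] by auto
   have "\<forall>\<^sub>F q' in nhd C q. q' ~= p"
    by (rule eventually_nhdI[OF cofinite_open[of "{p}"]]) (use sf.sc.ptsU[OF q] False in auto)
   then have "\<forall>\<^sub>F q' in nhd C q. f' q' = f q' / zz p q' ^ m" by eventually_elim (simp add: f'_def)
   from regat_cong[OF regat_divide[OF bspec[OF f(2) q] regat_power[OF sf.zz_U[OF q]] z] this] show ?thesis .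
  qed
  moreover have "\<forall>\<^sub>F q in nhd C p. f q = f' q * zz p q ^ m" using ev h(2) by eventually_elim simp
  ultimately show ?thesis by (intro exI[of _ f']) (auto simp: f'_def)
 qed
 have rab: "\<forall>q\<in>FU p. regat C q \<alpha>" "\<forall>q\<in>FU p. regat C q \<beta>" using s(2) by (auto simp: sf.LS_def)
 obtain \<alpha>' where a': "\<forall>q\<in>FU p. regat C q \<alpha>'" "\<forall>q\<in>FU p. q ~= p --> \<alpha>' q = \<alpha> q / zz p q ^ m"
  "\<forall>\<^sub>F q in nhd C p. \<alpha> q = \<alpha>' q * zz p q ^ m" using quot[OF a rab(1)] by (elim exE conjE)
 obtain \<beta>' where b': "\<forall>q\<in>FU p. regat C q \<beta>'" "\<forall>q\<in>FU p. q ~= p --> \<beta>' q = \<beta> q / zz p q ^ m"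
  using quot[OF b rab(2)] by (elim exE conjE)
 \<comment> \<open>If \<delta>(p) = m, the fibre over \<open>p\<close> does not belong to the new
   support, and the new section must take on it the values prescribed by \<alpha>' and \<beta>',
   which \<open>s\<close>, normalised to 0 where \<delta> is nonzero, need not show.\<close>
 define v where "v = (%e. (\<alpha>' p * FX p e + \<beta>' p * FY p e) / RR e)"
 \<comment> \<open>On C0, and on the whole fibre when it stays in the support, the normalisation of
   sections demands 0.\<close>
 define s' where "s' = (%y. if y \<in> fibre E p then (if y \<in> C0 \<or> ?\<delta>' p ~= 0 then 0 else v (SOME e. e \<in> y)) else s y)"
 have line_v: "v (SOME w. w \<in> line_of E e) = v e" if e: "e \<in> NZ" "e \<in> fib E (FU p)" for e
 proof -
  have "(SOME w. w \<in> line_of E e) \<in> line_of E e" by (rule someI[of "%w. w \<in> line_of E e", OF line_of_props(1)[OF e(1)]])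
  from line_of_props(2)[OF e(1) this] obtain c where c: "c ~= 0" "(SOME w. w \<in> line_of E e) = bscale E c e" by (elim exE conjE)
  have "FX p (bscale E c e) = c * FX p e" "FY p (bscale E c e) = c * FY p e" "RR (bscale E c e) = c * RR e"
   using sf.F.bscale[OF e(2), of c] RR_scale[OF NZ_pts[OF e(1)]] by auto
  then show ?thesis unfolding c(2) v_def using c(1)
   by (simp add: mult.left_commute[of _ c] flip: distrib_left)
 qed
 have off: "s' (line_of E e) = s (line_of E e)" if "e \<in> NZ" "bproj E e ~= p" for e
  using line_of_props(5)[OF that(1)] that(2) by (simp add: s'_def fibre_eq)
 have LSp': "LSp ?\<delta>' p s' \<alpha>' \<beta>'" unfolding LS'
 proof (intro conjI ballI impI)
  fix e assume e: "e \<in> fib E (FU p)" and n: "RR e ~= 0 & ?\<delta>' (bproj E e) = 0"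
  have eN: "e \<in> NZ" by (rule sf.RR_NZ) (use e n in auto)
  have qU: "bproj E e \<in> FU p" using e by (simp add: fib_def)
  show "s' (line_of E e) * RR e * zz p (bproj E e) powi ?\<delta>' p = \<alpha>' (bproj E e) * FX p e + \<beta>' (bproj E e) * FY p e"
  proof (cases "bproj E e = p")
   case True
   have "line_of E e \<in> fibre E p" using True line_of_props(5)[OF eN] eN by (auto simp: fibre_eq pts_S)
   moreover have "line_of E e \<notin> C0" using line_C0[OF eN] n by simp
   ultimately have "s' (line_of E e) = v e" using n True line_v[OF eN e] by (simp add: s'_def)
   moreover have d0: "?\<delta>' p = 0" using n True by simp
   ultimately show ?thesis unfolding d0 using n True by (simp add: v_def)
  next
   case False
   let ?q = "bproj E e"
   have z: "zz p ?q ~= 0" using sf.zz_nz[OF qU] False by auto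
   have "\<delta> ?q = 0" using n False by (simp add: pd_def)
   then have "s (line_of E e) * RR e * zz p ?q powi \<delta> p = \<alpha> ?q * FX p e + \<beta> ?q * FY p e"
    using s(2)[unfolded sf.LS_def, THEN conjunct2, THEN bspec, OF e] n by simp
   then have eq: "s (line_of E e) * RR e * zz p ?q powi \<delta> p / zz p ?q ^ m = (\<alpha> ?q * FX p e + \<beta> ?q * FY p e) / zz p ?q ^ m" by simp
   have pw: "zz p ?q powi ?\<delta>' p = zz p ?q powi \<delta> p / zz p ?q ^ m"
    using z by (simp add: pd_def power_int_diff)
   show ?thesis unfolding off[OF eN False] pw using eq a'(2) b'(2) qU False by (simp add: add_divide_distrib)
  qed
 qed (use a' b' in auto)
 have V': "s' \<in> VV ?\<delta>'"
 proof (rule VV_I[OF \<delta>'])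
  fix y assume y: "y \<notin> pts S - divisor_support (DD ?\<delta>')"
  show "s' y = 0"
  proof (cases "y \<in> fibre E p")
   case True
   then have "y \<in> pts S" "\<pi> y = p" by (auto simp: fibre_eq)
   then have "y \<in> C0 \<or> ?\<delta>' p ~= 0" using y in_support[of ?\<delta>' y] \<delta>' by (auto simp: adm_def)
   then show ?thesis unfolding s'_def using True by simp
  next
   case False
   have "y \<notin> pts S - divisor_support (DD \<delta>)"
   proof
    assume yS: "y \<in> pts S - divisor_support (DD \<delta>)"
    then have "\<pi> y ~= p" using False by (auto simp: fibre_eq)
    then have "\<delta> (\<pi> y) = ?\<delta>' (\<pi> y)" by (simp add: pd_def)
    then have "y \<notin> divisor_support (DD ?\<delta>')"
     using yS in_support[OF sf.\<delta>, of y] in_support[of ?\<delta>' y] \<delta>' by (auto simp: adm_def)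
    then show False using y yS by simp
   qed
   then show ?thesis using VV_zero[OF s(1)] False by (simp add: s'_def)
  qed
 next
  fix p' assume p': "p' \<in> pts C"
  show "\<exists>\<alpha> \<beta>. LSp ?\<delta>' p' s' \<alpha> \<beta>"
  proof (cases "p' = p")
   case True then show ?thesis using LSp' by (intro exI) simp
  next
   case False
   \<comment> \<open>Since \<open>p\<close> lies in \<open>A\<close>, the frame at any other point
     avoids it, and over that frame the section is unchanged.\<close>
   have nU: "p \<notin> FU p'" using FU_A[OF p'] p(2) False by auto
   interpret sf': small_frame C E \<iota> \<rho> p' "FU p'" "FX p'" "FY p'" \<delta> by (rule small_adm[OF \<delta> p'])
   obtain a b where ab: "sf'.LS s a b" using VV_LS[OF \<delta> s(1) p'] by (elim exE)
   have "LSp ?\<delta>' p' s' a b" unfolding LSp_def[OF \<delta>' p']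
   proof (intro conjI ballI impI)
    fix e assume e: "e \<in> fib E (FU p')" and n: "RR e ~= 0 & ?\<delta>' (bproj E e) = 0"
    have ne: "bproj E e ~= p" using e nU by (auto simp: fib_def)
    have eN: "e \<in> NZ" by (rule sf'.RR_NZ) (use e n in auto)
    have d: "\<delta> (bproj E e) = 0" "?\<delta>' p' = \<delta> p'" using n ne False by (simp_all add: pd_def)
    show "s' (line_of E e) * RR e * zz p' (bproj E e) powi ?\<delta>' p' = a (bproj E e) * FX p' e + b (bproj E e) * FY p' e"
     unfolding off[OF eN ne] d(2) using ab[unfolded sf'.LS_def, THEN conjunct2, THEN bspec, OF e] n d(1) by simp
   qed (use ab in \<open>auto simp: sf'.LS_def\<close>)
   then show ?thesis by (intro exI)
  qed
 qed
 show thesis by (rule that[OF V' LSp' a'(3)])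
qed

lemma stalk_pow_line:
 assumes \<delta>: "adm \<delta>" and e: "e \<in> NZ" "bproj E e = p" "FX p e = 1" "FY p e = 0" and LS: "LSp \<delta> p s \<alpha> \<beta>"
 shows "s \<in> stalk_pow S (DD \<delta>) (line_of E e) (Suc k) \<longleftrightarrow> \<alpha> \<in> max_ideal_pow C p (Suc k) & \<beta> \<in> max_ideal_pow C p k"
proof -
 have p: "p \<in> pts C" using bproj_pts[OF NZ_pts[OF e(1)]] e(2) by simp
 interpret sf: small_frame C E \<iota> \<rho> p "FU p" "FX p" "FY p" \<delta> by (rule small_adm[OF \<delta> p])
 have eU: "e \<in> fib E (FU p)" using e sf.pU NZ_pts by (simp add: fib_def)
 show ?thesis
 proof (rule sf.stalk_pow_iff[OF LS])
  show "line_of E e \<in> vs (FU p) (FX p)" using vs_line[OF sf.fr e(1)] eU e by simp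
  show "us (FX p) (FY p) (line_of E e) = 0" using us_line[OF sf.fr e(1) eU] e by simp
  show "\<pi> (line_of E e) = p" using line_of_props(5)[OF e(1)] e(2) by simp
 qed
qed

lemma VV_stalk_pow_FF:
 assumes \<delta>: "adm \<delta>" and e: "e \<in> NZ" "bproj E e = p" "FX p e = 1" "FY p e = 0"
 shows "VV \<delta> \<inter> stalk_pow S (DD \<delta>) (line_of E e) (Suc k) =
  small_frame.FF C E \<rho> p (FU p) (FX p) (FY p) \<delta> (VV \<delta>) (Suc k) k"
proof -
 have p: "p \<in> pts C" using bproj_pts[OF NZ_pts[OF e(1)]] e(2) by simp
 interpret sf: small_frame C E \<iota> \<rho> p "FU p" "FX p" "FY p" \<delta> by (rule small_adm[OF \<delta> p])
 show ?thesis unfolding sf.FF_def using stalk_pow_line[OF \<delta> e] VV_LS[OF \<delta> _ p] by blast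
qed

theorem dlt_jets_iff:
 assumes \<delta>: "adm \<delta>" and \<delta>': "adm (%q. \<delta> q - int m * pd p q)" (is "adm ?\<delta>'") and p: "p \<in> A"
  and e: "e \<in> NZ" "bproj E e = p" "FX p e = 1" "FY p e = 0"
  and nd: "\<not> dlt (VV \<delta>) {%_. 0} (2 * m + 2)" and d: "dlt (LL (%q. \<delta> q - int m * pd p q)) ZZ 2"
 shows "dlt (VV \<delta>) (VV \<delta> \<inter> stalk_pow S (DD \<delta>) (line_of E e) (Suc m)) (2 * m + 1) \<longleftrightarrow>
  \<not> spanned_at S (DD (%q. \<delta> q - int m * pd p q)) (line_of E e)"
proof
 have pC: "p \<in> pts C" using bproj_pts[OF NZ_pts[OF e(1)]] e(2) by simp
 interpret sf: small_frame C E \<iota> \<rho> p "FU p" "FX p" "FY p" \<delta> by (rule small_adm[OF \<delta> pC])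
 note V = fsubspace_VV[OF \<delta>]
 let ?x = "line_of E e"
 let ?T = "stalk_pow S (DD \<delta>) ?x (Suc m)"
 have VT: "VV \<delta> \<inter> ?T = sf.FF (VV \<delta>) (Suc m) m" by (rule VV_stalk_pow_FF[OF \<delta> e])
 {
  assume ns: "\<not> spanned_at S (DD ?\<delta>') ?x"
  have "sf.FF (VV \<delta>) m m \<subseteq> VV \<delta> \<inter> ?T"
  proof
   fix s assume "s \<in> sf.FF (VV \<delta>) m m"
   then obtain \<alpha> \<beta> where s: "s \<in> VV \<delta>" "sf.LS s \<alpha> \<beta>" "\<alpha> \<in> max_ideal_pow C p m" "\<beta> \<in> max_ideal_pow C p m"
    unfolding sf.FF_def by blast
   obtain s' \<alpha>' \<beta>' where s': "s' \<in> VV ?\<delta>'" "LSp ?\<delta>' p s' \<alpha>' \<beta>'" "\<forall>\<^sub>F q in nhd C p. \<alpha> q = \<alpha>' q * zz p q ^ m"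
    by (rule divide_section[OF \<delta> \<delta>' pC p s]) (rule that)
   have "s' \<in> stalk_pow S (DD ?\<delta>') ?x 1" using ns s'(1) unfolding spanned_at_def by blast
   then have "\<alpha>' \<in> max_ideal_pow C p (Suc 0)" using stalk_pow_line[OF \<delta>' e s'(2), of 0] by simp
   then obtain h where h: "regat C p h" "\<forall>\<^sub>F q in nhd C p. \<alpha>' q = h q * zz p q ^ Suc 0"
    unfolding max_ideal_pow_zz[OF pC] by (elim exE conjE)
   have "\<forall>\<^sub>F q in nhd C p. \<alpha> q = h q * zz p q ^ Suc m" using h(2) s'(3) by eventually_elim simp
   then have "\<alpha> \<in> max_ideal_pow C p (Suc m)" unfolding max_ideal_pow_zz[OF pC] using h(1) by (intro exI[of _ h] conjI)
   then show "s \<in> VV \<delta> \<inter> ?T" using stalk_pow_line[OF \<delta> e s(2), of m] s by simp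
  qed
  \<comment> \<open>The step (m, m) of the filtration has codimension at most 2 m, and it has just
    been placed inside the kernel of the jet map.\<close>
  then show "dlt (VV \<delta>) (VV \<delta> \<inter> ?T) (2 * m + 1)"
   using dlt_subset[OF sf.dlt_FF_diag[OF V VV_LS[OF \<delta> _ pC]] subset_refl V] by blast
 next
  assume dl: "dlt (VV \<delta>) (VV \<delta> \<inter> ?T) (2 * m + 1)"
  have W: "fsubspace (VV \<delta> \<inter> ?T)" unfolding VT by (rule sf.fsubspace_FF[OF V])
  \<comment> \<open>The kernel has dimension at least two: rank at most 2 m together with a kernel
    of dimension at most one would fall short of 2 m + 2.\<close>
  have "\<not> dlt (VV \<delta> \<inter> ?T) {%_. 0} 2"
  proof
   assume "dlt (VV \<delta> \<inter> ?T) {%_. 0} 2"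
   then have 2: "dlt (VV \<delta> \<inter> (VV \<delta> \<inter> ?T)) {%_. 0} (Suc 1)" by (simp only: Suc_1 Int_left_absorb)
   have "dlt (VV \<delta>) (VV \<delta> \<inter> ?T) (Suc (2 * m))" using dl by simp
   from dlt_ext[OF V W this 2] show False using nd by simp
  qed
  then have "\<exists>v :: nat => _. (\<forall>i<2. v i \<in> VV \<delta> \<inter> ?T) & (\<forall>c. (\<exists>i<2. c i ~= 0) --> (%s. \<Sum>i<2. c i * v i s) \<notin> {%_. 0})"
   unfolding dlt_def not_all not_imp
  proof (elim exE, intro exI conjI)
   fix v :: "nat => _"
   assume v: "(\<forall>i<2. v i \<in> VV \<delta> \<inter> ?T) & \<not> (\<exists>c. (\<exists>i<2. c i ~= 0) & (%s. \<Sum>i<2. c i * v i s) \<in> {%_. 0})"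
   show "\<forall>i<2. v i \<in> VV \<delta> \<inter> ?T" by (rule conjunct1[OF v])
   show "\<forall>c. (\<exists>i<2. c i ~= 0) --> (%s. \<Sum>i<2. c i * v i s) \<notin> {%_. 0}"
   proof (intro allI impI notI)
    fix c :: "nat => complex" assume "\<exists>i<2. c i ~= 0" "(%s. \<Sum>i<2. c i * v i s) \<in> {%_. 0}"
    then have "\<exists>c. (\<exists>i<2. c i ~= 0) & (%s. \<Sum>i<2. c i * v i s) \<in> {%_. 0}" by (intro exI[of _ c] conjI)
    then show False by (rule notE[OF conjunct2[OF v]])
   qed
  qed
  then obtain v :: "nat => _" where v: "\<forall>i<2. v i \<in> VV \<delta> \<inter> ?T"
   "\<forall>c. (\<exists>i<2. c i ~= 0) --> (%s. \<Sum>i<2. c i * v i s) \<notin> {%_. 0}" by (elim exE) (erule conjE, rule that)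
  have k: "s \<in> MM ?\<delta>' & (\<exists>\<alpha> \<beta>. GR ?\<delta>' p s \<alpha> \<beta> & \<alpha> p = 0)" if s: "s \<in> VV \<delta> \<inter> ?T" for s
  proof -
   obtain \<alpha> \<beta> where ab: "sf.LS s \<alpha> \<beta>" using VV_LS[OF \<delta> _ pC] s by blast
   then have "\<alpha> \<in> max_ideal_pow C p (Suc m)" "\<beta> \<in> max_ideal_pow C p m"
    using stalk_pow_line[OF \<delta> e ab, of m] s by auto
   then obtain h h' where h: "regat C p h" "\<forall>\<^sub>F q in nhd C p. \<alpha> q = h q * zz p q ^ Suc m"
    and h': "regat C p h'" "\<forall>\<^sub>F q in nhd C p. \<beta> q = h' q * zz p q ^ m"
    unfolding max_ideal_pow_zz[OF pC] by (elim exE conjE) (rule that)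
   \<comment> \<open>Dividing the coefficients by the m-th power of the uniformizer exhibits a
     kernel section generically as a section of L(-m f) whose first coefficient keeps a factor z, so
     that it vanishes at x. No section has to be constructed, because \<open>GR\<close> ignores the
     values on the fibre over \<open>p\<close>.\<close>
   have G: "GR ?\<delta>' p s (%q. h q * zz p q) h'" unfolding GR_def
   proof (intro conjI h' regat_mult h zz_regat pC)
    show "\<forall>\<^sub>F q in generic C. \<forall>e\<in>NZ. bproj E e = q & RR e ~= 0 -->
     s (line_of E e) * RR e * zz p q powi ?\<delta>' p = h q * zz p q * FX p e + h' q * FY p e"
     using LS_GR[OF \<delta> pC ab, unfolded GR_def, THEN conjunct2, THEN conjunct2] zz_generic[OF pC]
      eventually_nhd_generic[OF h(2) pC] eventually_nhd_generic[OF h'(2) pC]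
    proof eventually_elim
     case (elim q)
     have pw: "zz p q powi ?\<delta>' p = zz p q powi \<delta> p / zz p q ^ m"
      using elim(2) by (simp add: pd_def power_int_diff)
     show ?case
     proof (intro ballI impI)
      fix w assume w: "w \<in> NZ" "bproj E w = q & RR w ~= 0"
      have "s (line_of E w) * RR w * zz p q powi \<delta> p = (h q * zz p q * FX p w + h' q * FY p w) * zz p q ^ m"
       using elim(1)[THEN bspec, OF w(1)] w(2) elim(3,4) by (simp add: algebra_simps)
      then show "s (line_of E w) * RR w * zz p q powi ?\<delta>' p = h q * zz p q * FX p w + h' q * FY p w"
       unfolding pw using elim(2) by simp
     qed
    qed
   qed
   have "\<exists>\<alpha> \<beta>. GR ?\<delta>' p' s \<alpha> \<beta>" if p': "p' \<in> pts C" for p'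
   proof (cases "p' = p")
    case True then show ?thesis using G by (intro exI) simp
   next
    case False
    obtain a b where "LSp \<delta> p' s a b" using VV_LS[OF \<delta> _ p'] s by blast
    from LS_GR[OF \<delta> p' this] have "GR ?\<delta>' p' s a b" using False by (simp add: GR_def pd_def)
    then show ?thesis by (intro exI)
   qed
   then have "s \<in> MM ?\<delta>'" unfolding MM_def by blast
   then show ?thesis using G zz_zero[OF pC] by (intro conjI exI[of _ "%q. h q * zz p q"] exI[of _ h']) simp_all
  qed
  show "\<not> spanned_at S (DD ?\<delta>') ?x"
  proof
   assume "spanned_at S (DD ?\<delta>') ?x"
   then obtain s where s: "s \<in> VV ?\<delta>'" "s \<notin> stalk_pow S (DD ?\<delta>') ?x 1" unfolding spanned_at_def by blast
   obtain \<alpha> \<beta> where ab: "LSp ?\<delta>' p s \<alpha> \<beta>" using VV_LS[OF \<delta>' s(1) pC] by (elim exE)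
   have G: "GR ?\<delta>' p s \<alpha> \<beta>" by (rule LS_GR[OF \<delta>' pC ab])
   have sM: "s \<in> MM ?\<delta>'" unfolding MM_def using VV_LS[OF \<delta>' s(1)] LS_GR[OF \<delta>'] by blast
   have v01: "v 0 \<in> VV \<delta> \<inter> ?T" "v 1 \<in> VV \<delta> \<inter> ?T" using v(1) by auto
   obtain a b where 0: "GR ?\<delta>' p (v 0) a b" "a p = 0" using k[OF v01(1)] by blast
   obtain a' b' where 1: "GR ?\<delta>' p (v 1) a' b'" "a' p = 0" using k[OF v01(2)] by blast
   \<comment> \<open>Three sections of L(-m f) satisfy a relation. Evaluating first coefficients at
     \<open>p\<close> leaves only the term of \<open>s\<close>, so either \<open>s\<close> vanishes
     at x or the relation is one between \<open>v 0\<close> and \<open>v 1\<close>, which are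
     independent.\<close>
   define w where "w = (%i::nat. if i = 0 then v 0 else if i = 1 then v 1 else s)"
   have "\<forall>i<3. w i \<in> MM ?\<delta>'" using k[OF v01(1)] k[OF v01(2)] sM by (simp add: w_def)
   then have "\<exists>c. (\<exists>i<3. c i ~= 0) & (%y. \<Sum>i<3. c i * w i y) \<in> NN"
    using dlt_MM[OF d] unfolding dlt_def by simp
   then obtain c where c: "\<exists>i<3. c i ~= 0" "(%y. \<Sum>i<3. c i * w i y) \<in> NN" by (elim exE) (erule conjE, rule that)
   have cN: "(%y. c 0 * v 0 y + c 1 * v 1 y + c 2 * s y) \<in> NN"
    using c(2) by (simp add: w_def numeral_3_eq_3 numeral_2_eq_2)
   have "GR ?\<delta>' p (%y. c 0 * v 0 y + c 1 * v 1 y + c 2 * s y) (%q. c 0 * a q + c 1 * a' q + c 2 * \<alpha> q)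
     (%q. c 0 * b q + c 1 * b' q + c 2 * \<beta> q)"
    by (rule GR_add[OF GR_add[OF GR_scale[OF 0(1)] GR_scale[OF 1(1)]] GR_scale[OF G]])
   from GR_NN[OF pC this cN] have z: "c 2 * \<alpha> p = 0" using 0(2) 1(2) by simp
   show False
   proof (cases "c 2 = 0")
    case False
    then have "\<alpha> p = 0" using z by simp
    then have "\<alpha> \<in> max_ideal_pow C p (Suc 0)" "\<beta> \<in> max_ideal_pow C p 0"
     using G max_ideal_pow_1_iff[OF pC] max_ideal_pow_0_iff[OF pC] by (auto simp: GR_def)
    then show False using stalk_pow_line[OF \<delta>' e ab, of 0] s(2) by simp
   next
    case True
    have "(%y. c 0 * v 0 y + c 1 * v 1 y) \<in> VV \<delta>"
     using v01 by (intro fsubspace_add[OF V] fsubspace_scale[OF V]) auto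
    moreover have "(%y. c 0 * v 0 y + c 1 * v 1 y) \<in> NN" using cN True by simp
    ultimately have "(%y. c 0 * v 0 y + c 1 * v 1 y) = (%_. 0)" by (rule VV_NN[OF \<delta>])
    then have "(%y. \<Sum>i<2. c i * v i y) \<in> {%_. 0}" by (simp add: numeral_2_eq_2)
    moreover have "\<exists>i<2. c i ~= 0"
    proof -
     from c(1) obtain i where i: "i < 3" "c i ~= 0" by (elim exE conjE)
     then have "i ~= 2" using True by auto
     then have "i < 2" using i(1) by simp
     then show ?thesis using i(2) by (intro exI[of _ i] conjI)
    qed
    ultimately show False using v(2)[THEN spec, of c, THEN mp] by simp
   qed
  qed
 }
qed

text \<open>All powers of \<open>f\<close> times \<open>s\<close> lie in one finite-dimensional
  space, so \<open>f\<close> satisfies a polynomial equation at the infinitely many points over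
  which \<open>s\<close> is not identically zero. Then \<open>f\<close> takes some value infinitely
  often and is constant.\<close>

lemma constants:
 assumes \<delta>: "adm \<delta>" and d: "dlt (VV \<delta>) {%_. 0} N" and s: "s \<in> VV \<delta>" "s ~= (%_. 0)" and f: "f \<in> reg C (pts C)"
 shows "\<exists>c. \<forall>y\<in>pts C. f y = c"
proof -
 have fr: "regat C q f" if "q \<in> pts C" for q by (rule regatI[OF openin_topspace that f])
 have V: "(%y. f (\<pi> y) ^ i * s y) \<in> VV \<delta>" for i
 proof (rule VV_I[OF \<delta>])
  show "f (\<pi> y) ^ i * s y = 0" if "y \<notin> pts S - divisor_support (DD \<delta>)" for y using VV_zero[OF s(1) that] by simp
  fix p assume p: "p \<in> pts C"
  interpret sf: small_frame C E \<iota> \<rho> p "FU p" "FX p" "FY p" \<delta> by (rule small_adm[OF \<delta> p])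
  obtain \<alpha> \<beta> where ab: "sf.LS s \<alpha> \<beta>" using VV_LS[OF \<delta> s(1) p] by (elim exE)
  have "sf.LS (%y. f (\<pi> y) ^ i * s y) (%q. f q ^ i * \<alpha> q) (%q. f q ^ i * \<beta> q)"
   by (rule sf.LS_mult[OF ab, of "%q. f q ^ i"]) (use fr sf.sc.ptsU in \<open>auto intro: regat_power\<close>)
  then show "\<exists>\<alpha> \<beta>. sf.LS (%y. f (\<pi> y) ^ i * s y) \<alpha> \<beta>" by (intro exI)
 qed
 then have "\<exists>c. (\<exists>i<N. c i ~= 0) & (%y. \<Sum>i<N. c i * (f (\<pi> y) ^ i * s y)) \<in> {%_. 0}"
  using d[unfolded dlt_def, THEN spec, of "%i y. f (\<pi> y) ^ i * s y"] by simp
 then obtain c where c: "\<exists>i<N. c i ~= 0" "(%y. \<Sum>i<N. c i * (f (\<pi> y) ^ i * s y)) = (%_. 0)"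
  by (elim exE) (erule conjE, simp add: that)
 define P where "P = Poly (map c [0..<N])"
 have cf: "coeff P i = (if i < N then c i else 0)" for i by (simp add: P_def nth_default_def)
 have P0: "P ~= 0"
 proof -
  obtain i where "i < N" "c i ~= 0" using c(1) by blast
  then have "coeff P i ~= 0" by (simp add: cf)
  then show ?thesis by auto
 qed
 have Pp: "poly P z = (\<Sum>i<N. c i * z ^ i)" for z
 proof -
  have "degree P < N \<or> P = 0" using P0 cf by (metis leading_coeff_neq_0)
  then have "degree P < N" using P0 by simp
  have "poly P z = (\<Sum>i\<le>degree P. coeff P i * z ^ i)" by (rule poly_altdef)
  also have "\<dots> = (\<Sum>i<N. coeff P i * z ^ i)"
   by (rule sum.mono_neutral_left) (use \<open>degree P < N\<close> in \<open>auto simp: coeff_eq_0\<close>)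
  also have "\<dots> = (\<Sum>i<N. c i * z ^ i)" by (rule sum.cong) (simp_all add: cf)
  finally show ?thesis .
 qed
 let ?B = "{q \<in> pts C. \<not> (\<forall>e\<in>NZ. bproj E e = q & RR e ~= 0 --> s (line_of E e) = 0)}"
 have inf: "infinite ?B"
 proof
  assume "finite ?B"
  then have "s \<in> NN" unfolding NN_def generic_iff_finite by simp
  then show False using VV_NN[OF \<delta> s(1)] s(2) by simp
 qed
 have "f ` ?B \<subseteq> {z. poly P z = 0}"
 proof (rule image_subsetI)
  fix q assume "q \<in> ?B"
  then obtain e where e: "e \<in> NZ" "bproj E e = q" "s (line_of E e) ~= 0" by blast
  have "(\<Sum>i<N. c i * (f q ^ i * s (line_of E e))) = 0"
   using fun_cong[OF c(2), of "line_of E e"] line_of_props(5)[OF e(1)] e(2) by simp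
  then have "poly P (f q) * s (line_of E e) = 0" unfolding Pp by (simp add: sum_distrib_right mult.assoc)
  then show "f q \<in> {z. poly P z = 0}" using e(3) by simp
 qed
 then have "finite (f ` ?B)" by (rule finite_subset) (rule poly_roots_finite[OF P0])
 from pigeonhole_infinite[OF inf this] obtain q0 where q0: "infinite {q \<in> ?B. f q = f q0}" by blast
 have inf0: "infinite {q \<in> pts C. \<not> (f q - f q0 ~= 0)}"
  by (rule infinite_super[OF _ q0]) auto
 have "f y = f q0" if y: "y \<in> pts C" for y
 proof -
  have "regat C y (%q. f q - f q0)" by (intro regat_diff fr y regat_const)
  from generic_dichotomy[OF this] have "\<forall>\<^sub>F y' in nhd C y. f y' - f q0 = 0"
   using inf0 unfolding generic_iff_finite by blast
  from eventually_nhd_self[OF this y] show ?thesis by simp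
 qed
 then show ?thesis by blast
qed

end

theorem proposition5p1:
  fixes C :: "'c fspace" and E :: "('c, 'e) vbundle"
    and \<iota> :: "'c \<times> (nat \<Rightarrow> complex) \<Rightarrow> 'e" and \<rho> :: "'e \<Rightarrow> 'c \<times> (nat \<Rightarrow> complex)"
    and \<delta> :: "'c \<Rightarrow> int" and m :: nat
    and S :: "'e set fspace" and L :: "'e set set \<Rightarrow> int"
  assumes "smooth_projective_curve C" and "genus C = 1"
    and "vector_bundle C 2 E"
    and "short_exact (trivial_bundle C 1) E (trivial_bundle C 1) \<iota> \<rho>"
    and "\<not> splits E (trivial_bundle C 1) \<rho>"
    and "m \<ge> 2"
    and "S = ruled_surface E"
    and "point_divisor C \<delta>" and "divisor_degree \<delta> = int m + 1"
    and "L = scroll_divisor E (trivial_bundle C 1) \<rho> \<delta>"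
    and "embedded_by_complete_system S L (2 * m + 1)"
    and "x \<in> pts S"
  shows "x \<in> inflectional_locus S L m \<longleftrightarrow>
    \<not> spanned_at S (\<lambda>Z. L Z - int m * prime_divisor (fibre E (ruling E x)) Z) x"
proof -
 interpret curve C by (rule smooth_projective_curve_imp_curve[OF assms(1)])
 interpret scroll C E \<iota> \<rho> by (intro scroll.intro curve_axioms scroll_axioms.intro assms(3,4))
 have L: "L = DD \<delta>" by (simp add: DD_def assms(10))
 have xS: "x \<in> pts (ruled_surface E)" using assms(7,12) by simp
 obtain e where e: "e \<in> NZ" "x = line_of E e" by (rule pts_SE[OF xS])
 define p where "p = bproj E e"
 have p: "p \<in> pts C" unfolding p_def by (rule bproj_pts[OF NZ_pts[OF e(1)]])
 have px: "ruling E x = p" using line_of_props(5)[OF e(1)] e(2) by (simp add: p_def)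
 \<comment> \<open>The point \<open>p\<close> is included so that subtracting m p keeps the support
   inside \<open>A\<close>.\<close>
 define A where "A = insert p {q. \<delta> q ~= 0}"
 have A: "finite A" using assms(8) by (simp add: A_def point_divisor_def)
 \<comment> \<open>Every point gets a frame for divisors supported in \<open>A\<close>; the one at
   \<open>p\<close> is adapted to \<open>e\<close>, so that \<open>x\<close> is the origin of its
   chart.\<close>
 have frames: "\<exists>F. (\<forall>\<delta>. point_divisor C \<delta> --> {q. \<delta> q ~= 0} \<subseteq> A -->
   small_frame C E \<iota> \<rho> q (fst F) (fst (snd F)) (snd (snd F)) \<delta>) & fst F \<inter> A \<subseteq> {q} &
   (q = p --> fst (snd F) e = 1 & snd (snd F) e = 0)" if q: "q \<in> pts C" for q
 proof -
  obtain w where w: "w \<in> NZ" "bproj E w = q" "q = p --> w = e"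
  proof (cases "q = p")
   case True then show thesis using that[of e] e(1) by (simp add: p_def)
  next
   case False
   obtain w where "w \<in> NZ" "bproj E w = q" using fibre_nonempty[OF q] by blast
   then show thesis using that[of w] False by simp
  qed
  obtain U X Y where "\<And>\<delta>. point_divisor C \<delta> ==> {q. \<delta> q ~= 0} \<subseteq> A ==> small_frame C E \<iota> \<rho> (bproj E w) U X Y \<delta>"
   "X w = 1" "Y w = 0" "U \<inter> A \<subseteq> {bproj E w}" by (rule small_frame_exists[OF w(1) A]) (rule that)
  then show ?thesis using w(2,3) by (intro exI[of _ "(U, X, Y)"]) auto
 qed
 then have "\<forall>q\<in>pts C. \<exists>F. (\<forall>\<delta>. point_divisor C \<delta> --> {q. \<delta> q ~= 0} \<subseteq> A -->
   small_frame C E \<iota> \<rho> q (fst F) (fst (snd F)) (snd (snd F)) \<delta>) & fst F \<inter> A \<subseteq> {q} &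
   (q = p --> fst (snd F) e = 1 & snd (snd F) e = 0)" by (rule ballI)
 from bchoice[OF this] obtain F where F: "\<forall>q\<in>pts C. (\<forall>\<delta>. point_divisor C \<delta> --> {q. \<delta> q ~= 0} \<subseteq> A -->
   small_frame C E \<iota> \<rho> q (fst (F q)) (fst (snd (F q))) (snd (snd (F q))) \<delta>) & fst (F q) \<inter> A \<subseteq> {q} &
   (q = p --> fst (snd (F q)) e = 1 & snd (snd (F q)) e = 0)" by (elim exE)
 interpret framed_scroll C E \<iota> \<rho> A "%q. fst (F q)" "%q. fst (snd (F q))" "%q. snd (snd (F q))"
 proof (intro framed_scroll.intro scroll_axioms framed_scroll_axioms.intro)
  show "small_frame C E \<iota> \<rho> q (fst (F q)) (fst (snd (F q))) (snd (snd (F q))) \<delta>"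
   if "q \<in> pts C" "point_divisor C \<delta>" "{q. \<delta> q ~= 0} \<subseteq> A" for q \<delta>
   using F[THEN bspec, OF that(1), THEN conjunct1, THEN spec, THEN mp, OF that(2), THEN mp, OF that(3)] .
  show "fst (F q) \<inter> A \<subseteq> {q}" if "q \<in> pts C" for q
   using F[THEN bspec, OF that, THEN conjunct2, THEN conjunct1] .
 qed
 have e01: "fst (snd (F p)) e = 1" "snd (snd (F p)) e = 0" using F[THEN bspec, OF p] by auto
 let ?\<delta>' = "%q. \<delta> q - int m * pd p q"
 have \<delta>: "adm \<delta>" unfolding adm_def using assms(8) by (auto simp: A_def)
 have pd': "point_divisor C ?\<delta>'" by (intro point_divisor_diff assms(8) point_divisor_mult point_divisor_pd p)
 have \<delta>': "adm ?\<delta>'" unfolding adm_def using pd' by (auto simp: A_def pd_def)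
 note V = fsubspace_VV[OF \<delta>]
 obtain \<sigma> where \<sigma>: "inj_on \<sigma> {..2 * m + 1}" "quot_basis (VV \<delta>) {%_. 0} (\<sigma> ` {..2 * m + 1})"
  using assms(11) unfolding embedded_by_complete_system_def L assms(7) by (elim exE conjE) (rule that)
 have z: "fsubspace {%_::'e set. 0::complex}" by (rule fsubspaceI) auto
 have card: "card (\<sigma> ` {..2 * m + 1}) = 2 * m + 2" using card_image[OF \<sigma>(1)] by simp
 \<comment> \<open>The basis of sections that defines the embedding has 2 m + 2 members, which fixes
   h^0(L).\<close>
 have dV: "dlt (VV \<delta>) {%_. 0} (2 * m + 3)" "\<not> dlt (VV \<delta>) {%_. 0} (2 * m + 2)"
  using quot_basis_dlt[OF V z \<sigma>(2)] unfolding card by (simp_all add: numeral_3_eq_3)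
 have "\<not> VV \<delta> \<subseteq> {%_. 0}"
 proof
  assume "VV \<delta> \<subseteq> {%_. 0}"
  from dlt_mono[OF dlt_1[OF this], of "2 * m + 2"] dV(2) show False by simp
 qed
 then obtain s where s: "s \<in> VV \<delta>" "s ~= (%_. 0)" by auto
 interpret g: genus_one_curve C
  by (intro genus_one_curve.intro curve_axioms genus_one_curve_axioms.intro assms(2) constants[OF \<delta> dV(1) s])
 \<comment> \<open>The degree m + 1 of \<delta> is what makes the twisted divisor have degree
   one.\<close>
 have "divisor_degree ?\<delta>' = divisor_degree \<delta> + divisor_degree (%q. - int m * pd p q)"
  using degree_add[OF assms(8) point_divisor_mult[OF point_divisor_pd[OF p], of "- int m"]] by simp
 also have "\<dots> = 1" using degree_mult[of "- int m" "pd p"] degree_pd[of p] assms(9) by simp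
 finally have d: "dlt (LL ?\<delta>') ZZ 2" by (rule g.dlt_LL_degree_one[OF pd'])
 have iff: "dlt (VV \<delta>) (VV \<delta> \<inter> stalk_pow (ruled_surface E) (DD \<delta>) x (Suc m)) (2 * m + 1) \<longleftrightarrow> \<not> spanned_at (ruled_surface E) (DD ?\<delta>') x"
  unfolding e(2) by (rule dlt_jets_iff[OF \<delta> \<delta>' _ e(1) p_def[symmetric] e01 dV(2) d]) (simp add: A_def)
 have W: "fsubspace (VV \<delta> \<inter> stalk_pow (ruled_surface E) (DD \<delta>) x (Suc m))"
  unfolding e(2) VV_stalk_pow_FF[OF \<delta> e(1) p_def[symmetric] e01]
  by (rule small_frame.fsubspace_FF[OF small_adm[OF \<delta> p] V])
 have N: "dlt (VV \<delta>) (VV \<delta> \<inter> stalk_pow (ruled_surface E) (DD \<delta>) x (Suc m)) (2 * m + 3)"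
  by (rule dlt_subset[OF dV(1) subset_refl V]) (use fsubspace_zero[OF W] in auto)
 \<comment> \<open>\<open>osc_dim\<close> is the rank minus one, so being below 2 m means rank at
   most 2 m, the bound that appears in \<open>dlt_jets_iff\<close>.\<close>
 have "x \<in> inflectional_locus S L m \<longleftrightarrow> jet_rank (ruled_surface E) (DD \<delta>) m x < 2 * m + 1"
  using xS unfolding inflectional_locus_def osc_dim_def assms(7) L by auto
 also have "\<dots> \<longleftrightarrow> \<not> spanned_at (ruled_surface E) (DD ?\<delta>') x"
  unfolding jet_rank_def quot_dim_less_iff[OF V W N] by (rule iff)
 finally show ?thesis unfolding px assms(7) L DD_diff[OF assms(8) p] .
qed

end
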